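(* Let $Y$ be a Haar system Hardy space of the form $Y=X_0(\mathbf r)$. Suppose that the sequence of Rademacher functions $(r_n)_{n=0}^\infty$ is weakly null in $Y$, and let $E$ denote one of the following Banach spaces: (i) $E=Y$; (ii) $E=\ell^p(Y)$ for some $1\le p<\infty$; (iii) $E=\ell^\infty(Y)$, if $Y$ is asymptotically curved with respect to $(h_I)_{I\in\mathcal D}$. Then $E$ has the $4$-primary factorization property, and hence $\mathcal M_E=\{T\in\mathcal B(E): I_E\neq ATB\text{ for all }A,B\in\mathcal B(E)\}$ is the unique maximal ideal of the algebra $\mathcal B(E)$. In particular, the spaces in (ii) and (iii) are primary.
   Context: All Banach spaces are real; $\mathcal B(E)$ is the algebra of bounded linear operators on $E$ and $I_E$ the identity. Haar system: $\mathcal D$ is the set of dyadic intervals $[\frac{i-1}{2^j},\frac{i}{2^j})$, $j\ge0$, $1\le i\le 2^j$; $\mathcal D_n=\{I\in\mathcal D:|I|=2^{-n}\}$. $I^+$, $I^-$ are the left and right halves of $I$. $h_I=\chi_{I^+}-\chi_{I^-}$ for $I\in\mathcal D$, $h_\varnothing=\chi_{[0,1)}$, $\mathcal D^+=\mathcal D\cup\{\varnothing\}$. The bijection $\iota:\mathcal D\to\mathbb N$, $[\frac{i}{2^j},\frac{i+1}{2^j})\mapsto 2^j+i$, together with $\iota(\varnothing)=0$, defines the linear order on $\mathcal D^+$ used for all sequences and series indexed by $\mathcal D$ or $\mathcal D^+$. $H=\operatorname{span}\{h_I:I\in\mathcal D^+\}$, $H_0=\operatorname{span}\{h_I:I\in\mathcal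 D\}$. Rademacher functions: $r_n=\sum_{I\in\mathcal D_n}h_I$, $n\ge0$. Haar system space: the completion $X$ of $H$ under a norm $\|\cdot\|_X$ such that $\|x\|_X=\|y\|_X$ whenever $x,y\in H$ and $|x|,|y|$ have the same distribution, and $\|\chi_{[0,1)}\|_X=1$. Haar system Hardy space: let $\mathcal R=\{(r_{\iota(I)})_{I\in\mathcal D^+},(r_0)_{I\in\mathcal D^+}\}$ (an independent sequence and a constant sequence). For a Haar system space $X$ and $\mathbf r=(r_I)_{I\in\mathcal D^+}\in\mathcal R$, $X(\mathbf r)$ is the completion of $H$ under $\|\sum_{I\in\mathcal D^+}a_Ih_I\|_{X(\mathbf r)}=\big\|s\mapsto\int_0^1|\sum_{I\in\mathcal D^+}r_I(u)a_Ih_I(s)|\,du\big\|_X$, and $X_0(\mathbf r)$ is the closure of $H_0$ in $X(\mathbf r)$. The Haar system $(h_I)_{I\in\mathcal D}$ is a monotone Schauder basis of $X_0(\mathbf r)$. Factorization: for $S,T\in\mathcal B(E)$ and $C\ge0$, $S$ factors through $T$ with constant $C$ if there are $A,B\in\mathcal B(E)$ with $S=ATB$ and $\|A\|\|B\|\le C$; it factors with constant $C^+$ if it factors with constant $C+\gamma$ for every $\gamma>0$. $E$ has the $C$-primary factorization property if for every $T\in\mathcal B(E)$, $I_E$ factors through $T$ or through $I_E-T$ with constant $C^+$. $E$ is primary if whenever $E=F\oplus G$, then $F$ or $G$ is isomorphic to $E$. Asymptotically curved: a Banach space $E$ is asymptotically curved with respect to a Schauder basis $(e_j)_{j=1}^\infty$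 if for every bounded block basis $(x_j)_{j=1}^\infty$ of $(e_j)$ one has $\lim_{n\to\infty}\frac1n\|\sum_{j=1}^nx_j\|_E=0$. *)

theory Defs
  imports "HOL-Analysis.Analysis" "HOL-Algebra.Ideal"
begin

section \<open>The Haar system\<close>

text \<open>
  Members of the index set \<open>\<D>\<^sup>+\<close> are sets of reals, and its extra element is literally the empty
  set. All functions on \<open>[0,1)\<close> are represented by functions on the reals that vanish outside
  \<open>[0,1)\<close>.
\<close>

definition dyadic_level :: "nat \<Rightarrow> real set set" where
  "dyadic_level j = {{real i / 2 ^ j ..< real (i + 1) / 2 ^ j} | i. i < 2 ^ j}"

definition dyadic :: "real set set" where
  "dyadic = (\<Union>j. dyadic_level j)"

definition dyadic_plus :: "real set set" where
  "dyadic_plus = insert {} dyadic"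

definition left_half :: "real set \<Rightarrow> real set" where
  "left_half I = {s \<in> I. s < (Inf I + Sup I) / 2}"

definition right_half :: "real set \<Rightarrow> real set" where
  "right_half I = {s \<in> I. (Inf I + Sup I) / 2 \<le> s}"

definition haar :: "real set \<Rightarrow> real \<Rightarrow> real" where
  "haar I s = (if I = {} then indicat_real {0..<1} s
               else indicat_real (left_half I) s - indicat_real (right_half I) s)"

definition iota :: "real set \<Rightarrow> nat" where
  "iota I = (if I = {} then 0
             else (THE k. \<exists>j i. i < 2 ^ j \<and> I = {real i / 2 ^ j ..< real (i + 1) / 2 ^ j} \<and> k = 2 ^ j + i))"

definition rademacher :: "nat \<Rightarrow> real \<Rightarrow> real" where
  "rademacher n s = (\<Sum>I\<in>dyadic_level n. haar I s)"

definition haar_sum :: "real set set \<Rightarrow> (real set \<Rightarrow> real) \<Rightarrow> real \<Rightarrow> real" where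
  "haar_sum F a s = (\<Sum>I\<in>F. a I * haar I s)"

text \<open>
  The linear spans \<open>H\<close> (for \<open>A = \<D>\<^sup>+\<close>) and \<open>H\<^sub>0\<close> (for \<open>A = \<D>\<close>), written out because the function
  type is not an instance of \<open>real_vector\<close>.
\<close>

definition haar_span :: "real set set \<Rightarrow> (real \<Rightarrow> real) set" where
  "haar_span A = {haar_sum F a | F a. finite F \<and> F \<subseteq> A}"

abbreviation "H_plus \<equiv> haar_span dyadic_plus"
abbreviation "H_zero \<equiv> haar_span dyadic"

section \<open>Haar system Hardy spaces\<close>

text \<open>
  A Haar system space is determined by its norm \<open>N\<close> on \<open>H\<close>; values of \<open>N\<close> outside \<open>H\<close> are irrelevant.
\<close>

definition haar_system_norm :: "((real \<Rightarrow> real) \<Rightarrow> real) \<Rightarrow> bool" where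
  "haar_system_norm N \<longleftrightarrow>
     (\<forall>x\<in>H_plus. 0 \<le> N x \<and> (N x = 0 \<longleftrightarrow> x = (\<lambda>s. 0))) \<and>
     (\<forall>c. \<forall>x\<in>H_plus. N (\<lambda>s. c * x s) = \<bar>c\<bar> * N x) \<and>
     (\<forall>x\<in>H_plus. \<forall>y\<in>H_plus. N (\<lambda>s. x s + y s) \<le> N x + N y) \<and>
     (\<forall>x\<in>H_plus. \<forall>y\<in>H_plus.
        distr (restrict_space lborel {0..<1}) borel (\<lambda>s. \<bar>x s\<bar>) =
        distr (restrict_space lborel {0..<1}) borel (\<lambda>s. \<bar>y s\<bar>) \<longrightarrow> N x = N y) \<and>
     N (indicat_real {0..<1}) = 1"

definition rademacher_choices :: "(real set \<Rightarrow> real \<Rightarrow> real) set" where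
  "rademacher_choices = {\<lambda>I. rademacher (iota I), \<lambda>I. rademacher 0}"

text \<open>
  A completion is given by a Banach space together with a linear isometry \<open>J\<close> of \<open>H\<close> onto a dense
  subspace. The type \<open>'x\<close> below is the space \<open>X(\<^bold>r)\<close>.
\<close>

definition hardy_completion ::
    "((real \<Rightarrow> real) \<Rightarrow> real) \<Rightarrow> (real set \<Rightarrow> real \<Rightarrow> real) \<Rightarrow> ((real \<Rightarrow> real) \<Rightarrow> 'x::banach) \<Rightarrow> bool" where
  "hardy_completion N r J \<longleftrightarrow>
     (\<forall>x\<in>H_plus. \<forall>y\<in>H_plus. J (\<lambda>s. x s + y s) = J x + J y) \<and>
     (\<forall>c. \<forall>x\<in>H_plus. J (\<lambda>s. c * x s) = c *\<^sub>R J x) \<and>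
     (\<forall>F a. finite F \<and> F \<subseteq> dyadic_plus \<longrightarrow>
        norm (J (haar_sum F a)) =
        N (\<lambda>s. LINT u:{0..<1}|lborel. \<bar>\<Sum>I\<in>F. r I u * a I * haar I s\<bar>)) \<and>
     closure (J ` H_plus) = UNIV"

text \<open>
  The closed subspace \<open>X\<^sub>0(\<^bold>r)\<close> of \<open>X(\<^bold>r)\<close>, as a Banach space \<open>'y\<close> of its own with inclusion map
  \<open>inc\<close>.
\<close>

definition hardy_zero :: "((real \<Rightarrow> real) \<Rightarrow> 'x::banach) \<Rightarrow> ('y::banach \<Rightarrow> 'x) \<Rightarrow> bool" where
  "hardy_zero J inc \<longleftrightarrow>
     linear inc \<and> (\<forall>y. norm (inc y) = norm y) \<and> range inc = closure (J ` H_zero)"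

text \<open>The element of \<open>X\<^sub>0(\<^bold>r)\<close> given by a function in \<open>H\<^sub>0\<close>.\<close>

definition in_zero :: "((real \<Rightarrow> real) \<Rightarrow> 'x) \<Rightarrow> ('y \<Rightarrow> 'x) \<Rightarrow> (real \<Rightarrow> real) \<Rightarrow> 'y" where
  "in_zero J inc x = inv_into UNIV inc (J x)"

text \<open>
  The sequence \<open>(h\<^sub>I)\<close>, \<open>I \<in> \<D>\<close>, in the order given by \<open>\<iota>\<close>. As \<open>\<iota>\<close> maps \<open>\<D>\<close> onto the positive
  integers, the index is shifted by one.
\<close>

definition haar_basis :: "((real \<Rightarrow> real) \<Rightarrow> 'x) \<Rightarrow> ('y \<Rightarrow> 'x) \<Rightarrow> nat \<Rightarrow> 'y" where
  "haar_basis J inc k = in_zero J inc (haar (inv_into dyadic_plus iota (Suc k)))"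

section \<open>Banach space notions\<close>

definition weakly_null :: "(nat \<Rightarrow> 'a::real_normed_vector) \<Rightarrow> bool" where
  "weakly_null x \<longleftrightarrow> (\<forall>f :: 'a \<Rightarrow>\<^sub>L real. (\<lambda>n. blinfun_apply f (x n)) \<longlonglongrightarrow> 0)"

definition block_basis :: "(nat \<Rightarrow> 'a::real_vector) \<Rightarrow> (nat \<Rightarrow> 'a) \<Rightarrow> bool" where
  "block_basis e x \<longleftrightarrow>
     (\<exists>m :: nat \<Rightarrow> nat. \<exists>a :: nat \<Rightarrow> real. strict_mono m \<and>
        (\<forall>j. x j = (\<Sum>i = m j..<m (Suc j). a i *\<^sub>R e i) \<and> x j \<noteq> 0))"

definition asymptotically_curved :: "(nat \<Rightarrow> 'a::real_normed_vector) \<Rightarrow> bool" where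
  "asymptotically_curved e \<longleftrightarrow>
     (\<forall>x. block_basis e x \<and> bounded (range x) \<longrightarrow>
        (\<lambda>n. norm (\<Sum>j<n. x j) / real n) \<longlonglongrightarrow> 0)"

text \<open>
  The predicates below say that \<open>'e\<close> is (an isometric copy of) the space \<open>'y\<close>, \<open>\<ell>\<^sup>p('y)\<close> or
  \<open>\<ell>\<^sup>\<infinity>('y)\<close>; in the last two cases \<open>\<Phi> v\<close> is the sequence of coordinates of the vector \<open>v\<close>. A type
  cannot depend on the real number \<open>p\<close>, hence this formulation.
\<close>

definition is_space :: "'e::banach itself \<Rightarrow> 'y::banach itself \<Rightarrow> bool" where
  "is_space E Y \<longleftrightarrow>
     (\<exists>\<Phi> :: 'e \<Rightarrow> 'y. linear \<Phi> \<and> (\<forall>v. norm (\<Phi> v) = norm v) \<and> range \<Phi> = UNIV)"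

definition is_lp_space :: "real \<Rightarrow> 'e::banach itself \<Rightarrow> 'y::banach itself \<Rightarrow> bool" where
  "is_lp_space p E Y \<longleftrightarrow>
     (\<exists>\<Phi> :: 'e \<Rightarrow> nat \<Rightarrow> 'y.
        (\<forall>n. linear (\<lambda>v. \<Phi> v n)) \<and>
        range \<Phi> = {y. summable (\<lambda>n. norm (y n) powr p)} \<and>
        (\<forall>v. norm v = (\<Sum>n. norm (\<Phi> v n) powr p) powr (1 / p)))"

definition is_linf_space :: "'e::banach itself \<Rightarrow> 'y::banach itself \<Rightarrow> bool" where
  "is_linf_space E Y \<longleftrightarrow>
     (\<exists>\<Phi> :: 'e \<Rightarrow> nat \<Rightarrow> 'y.
        (\<forall>n. linear (\<lambda>v. \<Phi> v n)) \<and>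
        range \<Phi> = {y. bounded (range y)} \<and>
        (\<forall>v. norm v = (SUP n. norm (\<Phi> v n))))"

definition factors_through ::
    "('e::real_normed_vector \<Rightarrow>\<^sub>L 'e) \<Rightarrow> ('e \<Rightarrow>\<^sub>L 'e) \<Rightarrow> real \<Rightarrow> bool" where
  "factors_through S T C \<longleftrightarrow>
     (\<exists>A B :: 'e \<Rightarrow>\<^sub>L 'e. S = A o\<^sub>L T o\<^sub>L B \<and> norm A * norm B \<le> C)"

definition factors_through_plus ::
    "('e::real_normed_vector \<Rightarrow>\<^sub>L 'e) \<Rightarrow> ('e \<Rightarrow>\<^sub>L 'e) \<Rightarrow> real \<Rightarrow> bool" where
  "factors_through_plus S T C \<longleftrightarrow> (\<forall>\<gamma>>0. factors_through S T (C + \<gamma>))"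

definition primary_factorization_property :: "real \<Rightarrow> 'e::real_normed_vector itself \<Rightarrow> bool" where
  "primary_factorization_property C E \<longleftrightarrow>
     (\<forall>T :: 'e \<Rightarrow>\<^sub>L 'e. factors_through_plus id_blinfun T C \<or>
                      factors_through_plus id_blinfun (id_blinfun - T) C)"

text \<open>
  Two-sided ring ideals of this ring are automatically linear subspaces, since a scalar multiple of
  \<open>T\<close> is the product of \<open>T\<close> with a scalar multiple of the identity.
\<close>

definition operator_ring :: "'e::real_normed_vector itself \<Rightarrow> ('e \<Rightarrow>\<^sub>L 'e) ring" where
  "operator_ring E = \<lparr>carrier = UNIV, monoid.mult = (o\<^sub>L), one = id_blinfun, zero = 0, add = (+)\<rparr>"

definition M_set :: "'e::real_normed_vector itself \<Rightarrow> ('e \<Rightarrow>\<^sub>L 'e) set" where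
  "M_set E = {T. \<forall>A B :: 'e \<Rightarrow>\<^sub>L 'e. id_blinfun \<noteq> A o\<^sub>L T o\<^sub>L B}"

definition isomorphic_to_subspace :: "'e::real_normed_vector itself \<Rightarrow> 'e set \<Rightarrow> bool" where
  "isomorphic_to_subspace E F \<longleftrightarrow>
     (\<exists>f g :: 'e \<Rightarrow> 'e. linear f \<and> homeomorphism UNIV F f g)"

definition primary :: "'e::real_normed_vector itself \<Rightarrow> bool" where
  "primary E \<longleftrightarrow>
     (\<forall>F G :: 'e set.
        subspace F \<and> closed F \<and> subspace G \<and> closed G \<and>
        F \<inter> G = {0} \<and> {u + v | u v. u \<in> F \<and> v \<in> G} = UNIV \<longrightarrow>
        isomorphic_to_subspace E F \<or> isomorphic_to_subspace E G)"

end

theory Submission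
  imports Defs "HOL-Complex_Analysis.Great_Picard"
begin

text \<open>
  A faithful copy of the Haar system, whose \<open>k\<close>-th member is a sum of \<open>\<plusminus>h\<^sub>L\<close> over intervals \<open>L\<close> of a
  single level \<open>l k\<close>, spans an isometric copy of \<open>Y\<close> that is the range of a contractive conditional
  expectation. Let \<open>T\<close> be an operator on \<open>Y\<close>. Along a subsequence of levels, the sums of
  \<open>\<langle>h\<^sub>L, T h\<^sub>L\<rangle>\<close> over the \<open>L\<close> of a level contained in a given interval converge. If the signs are chosen
  at random, then on a deep level of this subsequence the off-diagonal terms of \<open>T\<close> cancel, as the squares
  of all matrix entries \<open>2\<^sup>-\<^sup>n \<langle>h\<^sub>K, T h\<^sub>L\<rangle>\<close> have a small sum, and the diagonal of \<open>T\<close> is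
  distributed evenly over the two halves of each block. The interaction with the finitely many earlier
  blocks is small because the Rademacher functions are weakly null. Hence \<open>T\<close> compressed to the copy is a
  small perturbation of a Haar multiplier whose entries vary little and are close to a number \<open>c\<close>, the
  limit for the whole interval, that is, of \<open>c\<close> times the identity. The limits for \<open>T\<close> and \<open>I - T\<close> add up to
  \<open>1\<close>, so one of them is at least \<open>1/2\<close> in absolute value.

  For sequence spaces the same is done for all coordinates simultaneously, after a selection of infinitely
  many coordinates on which the same one of \<open>T\<close> and \<open>I - T\<close> has a large limit. In \<open>\<ell>\<^sup>\<infinity>(Y)\<close> the coordinates
  are selected further so that the relevant countably many functionals are determined by finitely supported
  vectors: this is possible since a functional is small on all but finitely many of disjoint sets of
  coordinates. Primariness follows by the decomposition method, and by the factorization property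
  the operators that do not factor the identity form an ideal.
\<close>

section \<open>The dyadic tree\<close>

text \<open>The Haar system may be conditional, so a Haar multiplier whose entries are merely close
  to \<open>c\<close> need not be close to \<open>c\<close> times the identity. The diagonal entries
  are therefore arranged as a martingale with summable increments: multiplication by one Haar
  function is bounded where it is needed, and summability does the rest. All other entries are
  summed absolutely. Coefficient functionals grow at most like the index, and the tolerance at stage
  \<open>q\<close> of the selection is a multiple of \<open>1 / 8 ^ q\<close>. The pairs
  (coordinate, block) of a sequence space share one enumeration, so that interactions between
  coordinates are treated like those within one. The random signs have to control the off-diagonal
  form and the imbalance between the halves at once, which is achieved by one second-moment bound
  for both. The constant 4 is 2 times 2: division by a limit of absolute value at least 1/2, and a
  left inverse of an operator at distance at most 1/2 from the identity.\<close>

text \<open>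
  Dyadic intervals are numbered as in a binary heap: the root is 1 and the halves of \<open>k\<close> are \<open>2k\<close> and
  \<open>2k+1\<close>, so that \<open>k\<close> is the value of \<open>\<iota>\<close>. A function that is constant on the intervals of length
  \<open>2\<^sup>-\<^sup>m\<close> is a function on \<open>nodes m\<close>, and \<open>hs k p\<close> is the value of \<open>h\<^sub>k\<close> on the interval \<open>p\<close>.
\<close>

definition nodes :: "nat \<Rightarrow> nat set" where
  "nodes n = {2 ^ n..<2 ^ Suc n}"

fun depth :: "nat \<Rightarrow> nat" where
  "depth k = (if k \<le> 1 then 0 else Suc (depth (k div 2)))"

fun hs :: "nat \<Rightarrow> nat \<Rightarrow> real" where
  "hs k p = (if p \<le> 1 then 0 else if p div 2 = k then (if even p then 1 else -1) else hs k (p div 2))"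

declare depth.simps [simp del] hs.simps [simp del]

lemma finite_nodes [simp]: "finite (nodes n)"
  by (simp add: nodes_def)

lemma card_nodes [simp]: "card (nodes n) = 2 ^ n"
  by (simp add: nodes_def)

lemma nodes_0 [simp]: "nodes 0 = {1}"
  by (auto simp: nodes_def)

lemma nodes_ge1: "p \<in> nodes n \<Longrightarrow> 1 \<le> p"
  using one_le_power[of "2::nat" n] by (auto simp: nodes_def)

lemma nodes_Suc_0_le: "p \<in> nodes n \<Longrightarrow> Suc 0 \<le> p"
  using nodes_ge1 by simp

lemma nodes_Suc: "nodes (Suc m) = (\<lambda>q. 2 * q) ` nodes m \<union> (\<lambda>q. 2 * q + 1) ` nodes m"
proof (intro equalityI subsetI)
  fix p assume p: "p \<in> nodes (Suc m)"
  then have "p div 2 \<in> nodes m" by (auto simp: nodes_def)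
  moreover have "p = 2 * (p div 2) \<or> p = 2 * (p div 2) + 1" by presburger
  ultimately show "p \<in> (\<lambda>q. 2 * q) ` nodes m \<union> (\<lambda>q. 2 * q + 1) ` nodes m" by blast
qed (auto simp: nodes_def)

lemma nodes_Suc_div: "p \<in> nodes (Suc m) \<Longrightarrow> p div 2 \<in> nodes m"
  by (auto simp: nodes_def)

lemma nodes_children: "q \<in> nodes m \<Longrightarrow> 2 * q \<in> nodes (Suc m)" "q \<in> nodes m \<Longrightarrow> Suc (2 * q) \<in> nodes (Suc m)"
  by (auto simp: nodes_def)

lemma sum_nodes_Suc:
  fixes F :: "nat \<Rightarrow> 'a::comm_monoid_add"
  shows "(\<Sum>p\<in>nodes (Suc m). F p) = (\<Sum>q\<in>nodes m. F (2 * q) + F (2 * q + 1))"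
proof -
  have "(\<lambda>q. 2 * q) ` nodes m \<inter> (\<lambda>q. 2 * q + 1) ` nodes m = {}"
    by auto presburger
  then have "(\<Sum>p\<in>nodes (Suc m). F p)
      = (\<Sum>p\<in>(\<lambda>q. 2 * q) ` nodes m. F p) + (\<Sum>p\<in>(\<lambda>q. 2 * q + 1) ` nodes m. F p)"
    unfolding nodes_Suc by (intro sum.union_disjoint) auto
  also have "\<dots> = (\<Sum>q\<in>nodes m. F (2 * q)) + (\<Sum>q\<in>nodes m. F (2 * q + 1))"
    by (simp add: sum.reindex inj_on_def)
  finally show ?thesis by (simp add: sum.distrib)
qed

lemma depth_child [simp]:
  "1 \<le> q \<Longrightarrow> depth (2 * q) = Suc (depth q)" "1 \<le> q \<Longrightarrow> depth (Suc (2 * q)) = Suc (depth q)"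
  by (subst depth.simps; simp)+

lemma depth_1 [simp]: "depth (Suc 0) = 0"
  by (simp add: depth.simps)

lemma depth_nodes: "k \<in> nodes n \<Longrightarrow> depth k = n"
proof (induction n arbitrary: k)
  case (Suc n)
  then have "k div 2 \<in> nodes n" using nodes_Suc_div by blast
  moreover from this have "2 \<le> k" using nodes_ge1[of "k div 2" n] by auto
  ultimately show ?case using Suc.IH by (subst depth.simps) auto
qed auto

lemma in_nodes_depth: "1 \<le> k \<Longrightarrow> k \<in> nodes (depth k)"
proof (induction k rule: depth.induct)
  case (1 k)
  show ?case
  proof (cases "k \<le> 1")
    case False
    with 1 have "k div 2 \<in> nodes (depth (k div 2))" by auto
    moreover have "k = 2 * (k div 2) \<or> k = Suc (2 * (k div 2))" by presburger
    ultimately have "k \<in> nodes (Suc (depth (k div 2)))" using nodes_children by metis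
    with False show ?thesis by (simp add: depth.simps)
  qed (use 1 in auto)
qed

lemma nodes_iff_depth: "k \<in> nodes n \<longleftrightarrow> 1 \<le> k \<and> depth k = n"
  using depth_nodes in_nodes_depth nodes_ge1 by blast

lemma less_pow_iff: "1 \<le> k \<Longrightarrow> k < 2 ^ n \<longleftrightarrow> depth k < n"
proof -
  assume "1 \<le> k"
  then have k: "2 ^ depth k \<le> k" "k < 2 ^ Suc (depth k)"
    using in_nodes_depth[of k] by (auto simp: nodes_def)
  show ?thesis
  proof (cases "depth k < n")
    case True
    then show ?thesis using k(2) power_increasing[of "Suc (depth k)" n "2::nat"] by simp
  next
    case False
    then have "(2::nat) ^ n \<le> 2 ^ depth k" by (intro power_increasing) auto
    then have "2 ^ n \<le> k" using k(1) by (rule order_trans)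
    then show ?thesis using False by simp
  qed
qed

lemma nodes_div: "p \<in> nodes m \<Longrightarrow> l \<le> m \<Longrightarrow> p div 2 ^ (m - l) \<in> nodes l"
proof (induction "m - l" arbitrary: m p)
  case (Suc d)
  then obtain m' where m': "m = Suc m'" by (cases m) auto
  with Suc have "p div 2 \<in> nodes m'" "d = m' - l" "l \<le> m'" by (auto dest: nodes_Suc_div)
  with Suc.hyps(1) have "p div 2 div 2 ^ (m' - l) \<in> nodes l" by blast
  then show ?case using m' \<open>l \<le> m'\<close> by (simp add: div_mult2_eq Suc_diff_le)
qed auto

section \<open>Values of Haar functions on dyadic intervals\<close>

lemma hs_1 [simp]: "hs k (Suc 0) = 0"
  by (simp add: hs.simps)

lemma hs_child:
  "1 \<le> q \<Longrightarrow> hs k (2 * q) = (if q = k then 1 else hs k q)"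
  "1 \<le> q \<Longrightarrow> hs k (Suc (2 * q)) = (if q = k then -1 else hs k q)"
  by (subst hs.simps; simp)+

lemma hs_nonzero_le: "hs k p \<noteq> 0 \<Longrightarrow> 2 * k \<le> p"
proof (induction k p rule: hs.induct)
  case (1 k p)
  show ?case
  proof (cases "p \<le> 1 \<or> p div 2 = k")
    case False
    with 1(2) have "hs k (p div 2) \<noteq> 0" by (subst (asm) hs.simps) auto
    with 1(1) False have "2 * k \<le> p div 2" by auto
    then show ?thesis by linarith
  qed (use 1(2) in \<open>auto simp: hs.simps\<close>)
qed

text \<open>An interval that is not deeper than \<open>k\<close> need not carry a constant value of
  h_k; \<open>hs\<close> then returns the default 0. Later this makes \<open>hs j K\<close> vanish
  unless \<open>K\<close> is strictly deeper than \<open>j\<close>.\<close>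

lemma hs_eq_0: "k \<in> nodes n \<Longrightarrow> p \<in> nodes m \<Longrightarrow> m \<le> n \<Longrightarrow> hs k p = 0"
proof (rule ccontr)
  assume "k \<in> nodes n" "p \<in> nodes m" "m \<le> n" "hs k p \<noteq> 0"
  then have "2 * k \<le> p" "2 ^ n \<le> k" "p < 2 ^ Suc m" "(2::nat) ^ m \<le> 2 ^ n"
    using hs_nonzero_le by (auto simp: nodes_def)
  then show False by simp
qed

lemma hs_self [simp]: "1 \<le> k \<Longrightarrow> hs k k = 0"
  using hs_nonzero_le[of k k] by fastforce

lemma hs_values: "hs k p \<in> {0, 1, -1}"
  by (induction k p rule: hs.induct) (subst hs.simps, auto)

lemma hs_abs_le: "\<bar>hs k p\<bar> \<le> 1"
  using hs_values[of k p] by auto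

text \<open>\<open>p div 2 ^ (m - l)\<close> is the ancestor of \<open>p\<close> at level
  \<open>l\<close>, and Haar functions of a level below \<open>l\<close> are constant on it.\<close>

lemma hs_div:
  assumes "k \<in> nodes n" "p \<in> nodes m" "n < l" "l \<le> m"
  shows "hs k p = hs k (p div 2 ^ (m - l))"
  using assms(2,4)
proof (induction "m - l" arbitrary: m p)
  case (Suc d)
  then obtain m' where m': "m = Suc m'" by (cases m) auto
  with Suc have q: "p div 2 \<in> nodes m'" "d = m' - l" "l \<le> m'" by (auto dest: nodes_Suc_div)
  with Suc.hyps(1) have "hs k (p div 2) = hs k (p div 2 div 2 ^ (m' - l))" by blast
  moreover have "hs k p = hs k (p div 2)"
  proof -
    have "p div 2 \<noteq> k" using depth_nodes[OF q(1)] depth_nodes[OF assms(1)] q(3) assms(3) by auto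
    moreover have "\<not> p \<le> 1" using depth_nodes[OF Suc.prems(1)] m' by (auto simp: depth.simps)
    ultimately show ?thesis by (subst hs.simps) auto
  qed
  ultimately show ?case using m' q(3) by (simp add: div_mult2_eq Suc_diff_le)
qed auto

lemma hs_ancestor: "p \<in> nodes m \<Longrightarrow> l < m \<Longrightarrow> hs (p div 2 ^ (m - l)) p \<in> {1, -1}"
proof -
  assume p: "p \<in> nodes m" and l: "l < m"
  let ?k = "p div 2 ^ (m - l)" and ?q = "p div 2 ^ (m - Suc l)"
  have k: "?k \<in> nodes l" "?q \<in> nodes (Suc l)" using nodes_div[OF p] l by auto
  have "?q div 2 = ?k" using l by (simp add: div_mult2_eq[symmetric] Suc_diff_Suc flip: power_Suc2)
  moreover have "\<not> ?q \<le> 1" using k(2) depth_nodes by (fastforce simp: nodes_iff_depth depth.simps)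
  ultimately have "hs ?k ?q \<in> {1, -1}" by (subst hs.simps) auto
  then show ?thesis using hs_div[OF k(1) p, of "Suc l"] l by simp
qed

lemma hs_nonzero_ancestor:
  assumes "hs k p \<noteq> 0" "k \<in> nodes l" "p \<in> nodes m"
  shows "l < m \<and> k = p div 2 ^ (m - l)"
proof
  show l: "l < m" using hs_eq_0[OF assms(2,3)] assms(1) by fastforce
  let ?q = "p div 2 ^ (m - Suc l)"
  have q: "?q \<in> nodes (Suc l)" using nodes_div[OF assms(3)] l by auto
  have "hs k ?q \<noteq> 0" using hs_div[OF assms(2,3), of "Suc l"] l assms(1) by simp
  moreover have "hs k (?q div 2) = 0" using hs_eq_0[OF assms(2) nodes_Suc_div[OF q]] by simp
  ultimately have "?q div 2 = k" by (subst (asm) hs.simps) (auto split: if_splits)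
  then show "k = p div 2 ^ (m - l)"
    using l by (simp add: div_mult2_eq[symmetric] Suc_diff_Suc flip: power_Suc2)
qed

text \<open>Intervals of one level are disjoint, so only the ancestor of \<open>p\<close>
  contributes.\<close>

lemma sum_nodes_hs:
  assumes "p \<in> nodes m" "l < m"
  shows "(\<Sum>L\<in>nodes l. F L * hs L p) = F (p div 2 ^ (m - l)) * hs (p div 2 ^ (m - l)) p"
proof -
  have "(\<Sum>L\<in>nodes l. F L * hs L p) = (\<Sum>L\<in>{p div 2 ^ (m - l)}. F L * hs L p)"
    by (rule sum.mono_neutral_right) (use assms nodes_div[of p m l] hs_nonzero_ancestor in force)+
  then show ?thesis by simp
qed

text \<open>An additive \<open>g\<close> is a finitely additive measure on dyadic intervals, and the
  sum is the integral of h_L against it. It is computed at level \<open>l + 1\<close>; further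
  subdivision changes nothing, as h_L is constant there.\<close>

lemma sum_hs_additive:
  fixes g :: "nat \<Rightarrow> real"
  assumes g: "\<And>k. 1 \<le> k \<Longrightarrow> g k = g (2 * k) + g (2 * k + 1)" and L: "L \<in> nodes l" and "l < m"
  shows "(\<Sum>p\<in>nodes m. hs L p * g p) = g (2 * L) - g (2 * L + 1)"
proof -
  have "(\<Sum>p\<in>nodes (Suc (l + d)). hs L p * g p) = g (2 * L) - g (2 * L + 1)" for d
  proof (induction d)
    case 0
    have "(\<Sum>p\<in>nodes (Suc l). hs L p * g p)
        = (\<Sum>q\<in>nodes l. if q = L then g (2 * L) - g (2 * L + 1) else 0)"
      unfolding sum_nodes_Suc
      by (rule sum.cong) (auto simp: hs_child nodes_Suc_0_le hs_eq_0[OF L])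
    then show ?case using L by simp
  next
    case (Suc d)
    have "(\<Sum>p\<in>nodes (Suc (l + Suc d)). hs L p * g p) = (\<Sum>q\<in>nodes (l + Suc d). hs L q * g q)"
      unfolding sum_nodes_Suc
    proof (rule sum.cong)
      fix q assume q: "q \<in> nodes (l + Suc d)"
      then have "q \<noteq> L" "Suc 0 \<le> q" using depth_nodes[OF q] depth_nodes[OF L] nodes_ge1[OF q] by auto
      then show "hs L (2 * q) * g (2 * q) + hs L (2 * q + 1) * g (2 * q + 1) = hs L q * g q"
        using g[of q] by (simp add: hs_child distrib_left)
    qed simp
    then show ?case using Suc by simp
  qed
  from this[of "m - Suc l"] show ?thesis using \<open>l < m\<close> by simp
qed

text \<open>From level \<open>l\<close> on, \<open>D\<close> passes to both halves, so it describes
  a union of intervals of level \<open>l\<close>; its measure can be computed on any finer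
  level.\<close>

lemma sum_nodes_additive:
  fixes g :: "nat \<Rightarrow> real"
  assumes g: "\<And>k. 1 \<le> k \<Longrightarrow> g k = g (2 * k) + g (2 * k + 1)" and "l \<le> m"
    and D: "\<And>j q. l \<le> j \<Longrightarrow> q \<in> nodes j \<Longrightarrow> D (2 * q) = D q \<and> D (2 * q + 1) = D q"
  shows "(\<Sum>p\<in>nodes m. if D p then g p else 0) = (\<Sum>p\<in>nodes l. if D p then g p else 0)"
  using \<open>l \<le> m\<close>
proof (induction m rule: dec_induct)
  case (step m)
  have "(\<Sum>p\<in>nodes (Suc m). if D p then g p else 0) = (\<Sum>q\<in>nodes m. if D q then g q else 0)"
    unfolding sum_nodes_Suc
  proof (rule sum.cong)
    fix q assume q: "q \<in> nodes m"
    show "(if D (2 * q) then g (2 * q) else 0) + (if D (2 * q + 1) then g (2 * q + 1) else 0)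
        = (if D q then g q else 0)"
      unfolding D[OF step.hyps(1) q, THEN conjunct1] D[OF step.hyps(1) q, THEN conjunct2]
      using g[OF nodes_ge1[OF q]] by (cases "D q") simp_all
  qed simp
  then show ?case using step.IH by simp
qed simp

lemma sum_hs: 
  assumes "L \<in> nodes l"
  shows "(\<Sum>p\<in>nodes m. hs L p) = 0"
proof (cases "l < m")
  case True
  have "(\<Sum>p\<in>nodes m. hs L p * (1 / 2 ^ depth p)) = 1 / 2 ^ depth (2 * L) - 1 / 2 ^ depth (2 * L + 1)"
    by (rule sum_hs_additive[OF _ assms True]) auto
  also have "\<dots> = 0" using nodes_ge1[OF assms] by simp
  also have "(\<Sum>p\<in>nodes m. hs L p * (1 / 2 ^ depth p)) = (\<Sum>p\<in>nodes m. hs L p) / 2 ^ m"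
    by (simp add: sum_divide_distrib depth_nodes)
  finally show ?thesis by simp
qed (use assms hs_eq_0 in \<open>auto intro!: sum.neutral\<close>)

text \<open>Passing to the next level doubles every product of values. The interval \<open>K\<close>
  itself first contributes when its halves appear; for \<open>L\<close> different from
  \<open>K\<close> the two contributions cancel.\<close>

lemma hs_orthogonal:
  assumes "1 \<le> K" "K < 2 ^ m" "1 \<le> L" "L < 2 ^ m"
  shows "(\<Sum>p\<in>nodes m. hs K p * hs L p) = (if K = L then 2 ^ (m - depth K) else 0)"
  using assms
proof (induction m)
  case (Suc m)
  have eq: "(\<Sum>p\<in>nodes (Suc m). hs K p * hs L p)
      = (\<Sum>q\<in>nodes m. 2 * (hs K q * hs L q) + (if q = K \<and> K = L then 2 else 0))"
    unfolding sum_nodes_Suc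
    by (rule sum.cong) (use Suc.prems in \<open>auto simp: hs_child nodes_Suc_0_le\<close>)
  have disj: "K < 2 ^ m \<or> K \<in> nodes m" "L < 2 ^ m \<or> L \<in> nodes m"
    using Suc.prems by (auto simp: nodes_def)
  show ?case
  proof (cases "K < 2 ^ m \<and> L < 2 ^ m")
    case True
    then have "K \<notin> nodes m" by (auto simp: nodes_def)
    then have "(\<Sum>q\<in>nodes m. if q = K \<and> K = L then 2 else 0 :: real) = 0"
      by (intro sum.neutral) auto
    then have "(\<Sum>p\<in>nodes (Suc m). hs K p * hs L p) = 2 * (\<Sum>q\<in>nodes m. hs K q * hs L q)"
      unfolding eq sum.distrib by (simp add: sum_distrib_left)
    then show ?thesis using Suc.IH True Suc.prems less_pow_iff[of K m] by (auto simp: Suc_diff_le)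
  next
    case False
    then have nz: "hs K q * hs L q = 0" if "q \<in> nodes m" for q
      using disj hs_eq_0[OF _ that] by auto
    have "(\<Sum>p\<in>nodes (Suc m). hs K p * hs L p) = (\<Sum>q\<in>nodes m. if q = K \<and> K = L then 2 else 0)"
      unfolding eq by (rule sum.cong) (auto simp: nz)
    also have "\<dots> = (if K = L then 2 else 0)"
    proof (cases "K = L")
      case True
      then show ?thesis using False disj by simp
    qed simp
    finally show ?thesis using False disj by (auto simp: depth_nodes)
  qed
qed simp

section \<open>Faithful Haar systems\<close>

text \<open>
  The \<open>k\<close>-th block is \<open>b\<^sub>k = \<Sum>\<^sub>L \<beta>\<^sub>k(L) h\<^sub>L\<close>, the sum ranging over the intervals \<open>L\<close> of depth \<open>l k\<close>, and
  \<open>tau n p\<close> is the unique interval \<open>i\<close> of depth \<open>n\<close> such that \<open>p\<close> is contained in the support of \<open>b\<^sub>i\<close>.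
\<close>

definition bval :: "(nat \<Rightarrow> nat) \<Rightarrow> (nat \<Rightarrow> nat \<Rightarrow> real) \<Rightarrow> nat \<Rightarrow> nat \<Rightarrow> real" where
  "bval l \<beta> k p = (\<Sum>L\<in>nodes (l k). \<beta> k L * hs L p)"

fun tau :: "(nat \<Rightarrow> nat) \<Rightarrow> (nat \<Rightarrow> nat \<Rightarrow> real) \<Rightarrow> nat \<Rightarrow> nat \<Rightarrow> nat" where
  "tau l \<beta> 0 p = 1"
| "tau l \<beta> (Suc n) p =
     (if bval l \<beta> (tau l \<beta> n p) p = 1 then 2 * tau l \<beta> n p else 2 * tau l \<beta> n p + 1)"

text \<open>The second assumption is recursive but well founded, since
  \<open>tau l \<beta> n\<close> involves only blocks of index below \<open>2 ^ n\<close>. It says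
  that block \<open>k\<close> has a sign on exactly those intervals of its level on which the parent
  block takes the value prescribed by the parity of \<open>k\<close>. Levels have to increase only
  from one generation to the next.\<close>

locale faithful =
  fixes l :: "nat \<Rightarrow> nat" and \<beta> :: "nat \<Rightarrow> nat \<Rightarrow> real"
  assumes level_less: "\<And>n j k. 1 \<le> j \<Longrightarrow> j < 2 ^ n \<Longrightarrow> k \<in> nodes n \<Longrightarrow> l j < l k"
    and beta: "\<And>n k K. k \<in> nodes n \<Longrightarrow>
      \<beta> k K \<in> (if K \<in> nodes (l k) \<and> tau l \<beta> n K = k then {1, -1} else {0})"
begin

abbreviation "bv \<equiv> bval l \<beta>"
abbreviation "\<tau> \<equiv> tau l \<beta>"

text \<open>The condition under which all blocks of index below \<open>2 ^ n\<close> are constant on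
  intervals of level \<open>m\<close>.\<close>

definition deep :: "nat \<Rightarrow> nat \<Rightarrow> bool" where
  "deep n m \<longleftrightarrow> (\<forall>k. 1 \<le> k \<and> k < 2 ^ n \<longrightarrow> l k < m)"

lemma deep_Suc: "deep (Suc n) m \<Longrightarrow> deep n m"
  by (auto simp: deep_def)

lemma deep_mono: "deep n m \<Longrightarrow> m \<le> m' \<Longrightarrow> deep n m'"
  by (auto simp: deep_def intro: less_le_trans)

lemma deep_exists: "\<exists>m. deep n m"
proof -
  have "l k \<le> (\<Sum>k<2 ^ n. l k)" if "k < 2 ^ n" for k
    using that by (intro member_le_sum) auto
  then have "deep n (Suc (\<Sum>k<2 ^ n. l k))" by (simp add: deep_def less_Suc_eq_le)
  then show ?thesis ..
qed

lemma deep_level: "k \<in> nodes n \<Longrightarrow> deep n (l k)"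
  using level_less by (auto simp: deep_def)

lemma tau_nodes [simp]: "\<tau> n p \<in> nodes n"
  by (induction n) (auto simp: nodes_children)

lemma bv_div:
  assumes "p \<in> nodes m" "l k < j" "j \<le> m"
  shows "bv k p = bv k (p div 2 ^ (m - j))"
  unfolding bval_def by (rule sum.cong) (use hs_div[OF _ assms(1) _ assms(3)] assms(2) in auto)

lemma tau_div:
  assumes "p \<in> nodes m" "deep n j" "j \<le> m"
  shows "\<tau> n p = \<tau> n (p div 2 ^ (m - j))"
  using assms(2)
proof (induction n)
  case (Suc n)
  let ?i = "\<tau> n (p div 2 ^ (m - j))"
  have eq: "\<tau> n p = ?i" using Suc deep_Suc by blast
  have "?i \<in> nodes n" by simp
  then have "l ?i < j" using Suc.prems nodes_ge1[OF \<open>?i \<in> nodes n\<close>]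
    unfolding deep_def by (auto simp: nodes_def)
  then show ?case using bv_div[OF assms(1) _ assms(3)] eq by simp
qed simp

lemma tau_child:
  assumes "deep n m" "m \<le> j" "q \<in> nodes j"
  shows "\<tau> n (2 * q) = \<tau> n q \<and> \<tau> n (2 * q + 1) = \<tau> n q"
  using tau_div[OF nodes_children(1)[OF assms(3)] deep_mono[OF assms(1,2)]]
    tau_div[OF nodes_children(2)[OF assms(3)] deep_mono[OF assms(1,2)]] by simp

lemma bv_eq:
  assumes "p \<in> nodes m" "l k < m"
  shows "bv k p = \<beta> k (p div 2 ^ (m - l k)) * hs (p div 2 ^ (m - l k)) p"
  unfolding bval_def by (rule sum_nodes_hs[OF assms])

lemma bv_values:
  assumes "k \<in> nodes n" "p \<in> nodes m" "l k < m"
  shows "bv k p \<in> (if \<tau> n p = k then {1, -1} else {0})"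
proof -
  let ?K = "p div 2 ^ (m - l k)"
  have "\<tau> n p = \<tau> n ?K" by (rule tau_div[OF assms(2) deep_level[OF assms(1)]]) (use assms(3) in simp)
  moreover have "?K \<in> nodes (l k)" using nodes_div[OF assms(2)] assms(3) by simp
  moreover have "hs ?K p \<in> {1, -1}" by (rule hs_ancestor[OF assms(2,3)])
  ultimately show ?thesis using bv_eq[OF assms(2,3)] beta[OF assms(1), of ?K] by auto
qed

text \<open>\<open>\<tau> n\<close> is the point map that carries the blocks to the Haar system. In
  the inductive step the index is either old or of depth \<open>n\<close>, and in the latter case
  \<open>\<tau> (Suc n)\<close> was defined by the value of that very block.\<close>

lemma hs_tau:
  assumes "p \<in> nodes m" "deep n m" "1 \<le> k" "k < 2 ^ n"
  shows "hs k (\<tau> n p) = bv k p"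
  using assms(2,4)
proof (induction n)
  case (Suc n)
  let ?i = "\<tau> n p"
  have i: "?i \<in> nodes n" "1 \<le> ?i" using nodes_ge1[OF tau_nodes] by auto
  have li: "l k < m" using Suc.prems assms(3) unfolding deep_def by auto
  consider "k < 2 ^ n" | "k \<in> nodes n" using Suc.prems by (force simp: nodes_def)
  then show ?case
  proof cases
    case 1
    then have "?i \<noteq> k" using i by (auto simp: nodes_def)
    then show ?thesis using Suc.IH[OF deep_Suc[OF Suc.prems(1)] 1] i by (simp add: hs_child)
  next
    case 2
    show ?thesis
    proof (cases "?i = k")
      case True
      then show ?thesis using bv_values[OF 2 assms(1) li] i by (auto simp: hs_child)
    next
      case False
      then show ?thesis using bv_values[OF 2 assms(1) li] i hs_eq_0[OF 2 i(1)]
        by (auto simp: hs_child)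
    qed
  qed
qed (use assms(3) in simp)

lemma beta_nonzero:
  assumes "k \<in> nodes n" "\<beta> k K \<noteq> 0"
  shows "K \<in> nodes (l k)" "\<tau> n K = k"
proof -
  have "K \<in> nodes (l k) \<and> \<tau> n K = k"
  proof (rule ccontr)
    assume "\<not> (K \<in> nodes (l k) \<and> \<tau> n K = k)"
    then have "\<beta> k K \<in> {0}" using beta[OF assms(1), of K] by (simp only: if_False)
    then show False using assms(2) by simp
  qed
  then show "K \<in> nodes (l k)" "\<tau> n K = k" by blast+
qed

text \<open>Blocks of different generations live on different levels; within a generation,
  \<open>\<tau>\<close> recovers the block from the interval.\<close>

lemma beta_disjoint:
  assumes "1 \<le> k" "1 \<le> k'" "\<beta> k K \<noteq> 0" "\<beta> k' K \<noteq> 0"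
  shows "k = k'"
proof -
  have k: "k \<in> nodes (depth k)" "k' \<in> nodes (depth k')" using assms in_nodes_depth by auto
  have K: "K \<in> nodes (l k)" "K \<in> nodes (l k')"
    using beta_nonzero(1)[OF k(1) assms(3)] beta_nonzero(1)[OF k(2) assms(4)] .
  have leq: "l k = l k'" using depth_nodes[OF K(1)] depth_nodes[OF K(2)] by (rule trans[OF sym])
  show ?thesis
  proof (cases "depth k" "depth k'" rule: linorder_cases)
    case less
    then have "k < 2 ^ depth k'" using less_pow_iff[OF assms(1)] by (rule iffD2[rotated])
    from level_less[OF assms(1) this k(2)] show ?thesis unfolding leq by (rule less_irrefl[THEN notE])
  next
    case greater
    then have "k' < 2 ^ depth k" using less_pow_iff[OF assms(2)] by (rule iffD2[rotated])
    from level_less[OF assms(2) this k(1)] show ?thesis unfolding leq by (rule less_irrefl[THEN notE])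
  next
    case equal
    from beta_nonzero(2)[OF k(1) assms(3)] show ?thesis
      unfolding equal beta_nonzero(2)[OF k(2) assms(4)] by (rule sym)
  qed
qed

text \<open>On the fiber of \<open>i\<close> the block takes the values 1 and -1, and it vanishes
  elsewhere. So the indicator of each half is half of the indicator of the fiber plus or minus the
  block.\<close>

lemma fiber_sum_split:
  assumes "deep (Suc n) m" "i \<in> nodes n"
  shows "2 * (\<Sum>p | p \<in> nodes m \<and> \<tau> (Suc n) p = 2 * i. f p)
      = (\<Sum>p | p \<in> nodes m \<and> \<tau> n p = i. f p) + (\<Sum>p\<in>nodes m. bv i p * f p)"
    and "2 * (\<Sum>p | p \<in> nodes m \<and> \<tau> (Suc n) p = 2 * i + 1. f p)
      = (\<Sum>p | p \<in> nodes m \<and> \<tau> n p = i. f p) - (\<Sum>p\<in>nodes m. bv i p * f p)"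
proof -
  have li: "l i < m" using assms nodes_ge1[OF assms(2)] unfolding deep_def nodes_def by auto
  note bvv = bv_values[OF assms(2) _ li]
  have conv: "(\<Sum>p | p \<in> nodes m \<and> Q p. f p) = (\<Sum>p\<in>nodes m. if Q p then f p else 0)" for Q
    by (simp add: sum.If_cases Int_def)
  have par: "2 * a \<noteq> Suc (2 * b)" "Suc (2 * b) \<noteq> 2 * a" for a b :: nat by presburger+
  have pt: "2 * (if \<tau> (Suc n) p = 2 * i then f p else 0) = (if \<tau> n p = i then f p else 0) + bv i p * f p"
    "2 * (if \<tau> (Suc n) p = 2 * i + 1 then f p else 0) = (if \<tau> n p = i then f p else 0) - bv i p * f p"
    if p: "p \<in> nodes m" for p
  proof -
    have "bv i p = 1 \<or> bv i p = -1" if "\<tau> n p = i" using bvv[OF p] that by auto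
    moreover have "bv i p = 0" if "\<tau> n p \<noteq> i" using bvv[OF p] that by auto
    ultimately show "2 * (if \<tau> (Suc n) p = 2 * i then f p else 0)
        = (if \<tau> n p = i then f p else 0) + bv i p * f p"
      "2 * (if \<tau> (Suc n) p = 2 * i + 1 then f p else 0)
        = (if \<tau> n p = i then f p else 0) - bv i p * f p"
      by (cases "\<tau> n p = i"; auto simp: par)+
  qed
  show "2 * (\<Sum>p | p \<in> nodes m \<and> \<tau> (Suc n) p = 2 * i. f p)
      = (\<Sum>p | p \<in> nodes m \<and> \<tau> n p = i. f p) + (\<Sum>p\<in>nodes m. bv i p * f p)"
    unfolding conv sum_distrib_left sum.distrib[symmetric] using pt(1) by (intro sum.cong) auto
  show "2 * (\<Sum>p | p \<in> nodes m \<and> \<tau> (Suc n) p = 2 * i + 1. f p)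
      = (\<Sum>p | p \<in> nodes m \<and> \<tau> n p = i. f p) - (\<Sum>p\<in>nodes m. bv i p * f p)"
    unfolding conv sum_distrib_left sum_subtractf[symmetric] using pt(2) by (intro sum.cong) auto
qed

lemma sum_bv_mult: "(\<Sum>p\<in>nodes m. bv i p * f p) = (\<Sum>L\<in>nodes (l i). \<beta> i L * (\<Sum>p\<in>nodes m. hs L p * f p))"
  unfolding bval_def sum_distrib_right sum_distrib_left
  by (subst sum.swap) (simp add: mult.assoc)

text \<open>Blocks have mean zero, so each splits its fiber into two parts of equal size. Thus
  \<open>\<tau> n\<close> preserves measure.\<close>

lemma card_fiber:
  assumes "deep n m" "i \<in> nodes n"
  shows "2 ^ n * card {p \<in> nodes m. \<tau> n p = i} = 2 ^ m"
  using assms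
proof (induction n arbitrary: i)
  case (Suc n)
  have "i div 2 \<in> nodes n" "i = 2 * (i div 2) \<or> i = 2 * (i div 2) + 1"
    using Suc.prems nodes_Suc_div by (auto) 
  moreover have "(\<Sum>p\<in>nodes m. bv j p) = 0" for j
    using sum_bv_mult[where f = "\<lambda>_. 1"] by (simp add: sum_hs)
  ultimately have "2 * (\<Sum>p | p \<in> nodes m \<and> \<tau> (Suc n) p = i. 1::real)
      = (\<Sum>p | p \<in> nodes m \<and> \<tau> n p = i div 2. 1)"
    using fiber_sum_split[OF Suc.prems(1), of "i div 2" "\<lambda>_. 1"]
    by (elim disjE) (simp_all del: tau.simps)
  then have "2 * card {p \<in> nodes m. \<tau> (Suc n) p = i} = card {p \<in> nodes m. \<tau> n p = i div 2}"
    by (simp del: tau.simps)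
  then show ?case using Suc.IH[OF deep_Suc[OF Suc.prems(1)] \<open>i div 2 \<in> nodes n\<close>]
    by (simp del: tau.simps add: mult.assoc mult.left_commute[of 2])
qed simp

text \<open>The integral of b_k x divided by that of the square of b_k, where x is the sum of the
  c_L h_L: the support of h_L has measure \<open>1 / 2 ^ l k\<close> and that of b_k has measure
  \<open>1 / 2 ^ depth k\<close>. These are the coefficients of the conditional expectation of
  x.\<close>

definition bcoef :: "(nat \<Rightarrow> real) \<Rightarrow> nat \<Rightarrow> real" where
  "bcoef c k = (\<Sum>L\<in>nodes (l k). \<beta> k L * c L) * 2 ^ depth k / 2 ^ l k"

text \<open>Up to normalization the left side is a conditional expectation read through
  \<open>\<tau> n\<close>. Splitting a fiber changes its average by plus or minus the coefficient of
  the block that splits it; orthogonality isolates this coefficient.\<close>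

lemma fiber_average:
  assumes "deep n m" "i \<in> nodes n"
  shows "2 ^ n * (\<Sum>p | p \<in> nodes m \<and> \<tau> n p = i. \<Sum>K\<in>{1..<2 ^ m}. c K * hs K p)
    = 2 ^ m * (\<Sum>k\<in>{1..<2 ^ n}. bcoef c k * hs k i)"
  using assms
proof (induction n arbitrary: i)
  case 0
  have "(\<Sum>p\<in>nodes m. \<Sum>K\<in>{1..<2 ^ m}. c K * hs K p) = (\<Sum>K\<in>{1..<2 ^ m}. c K * (\<Sum>p\<in>nodes m. hs K p))"
    by (subst sum.swap) (simp add: sum_distrib_left)
  also have "\<dots> = 0" by (rule sum.neutral) (use sum_hs[OF in_nodes_depth] in auto)
  finally show ?case using 0 by simp
next
  case (Suc n)
  let ?f = "\<lambda>p. \<Sum>K\<in>{1..<2 ^ m}. c K * hs K p"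
  let ?j = "i div 2"
  have j: "?j \<in> nodes n" "i = 2 * ?j \<or> i = 2 * ?j + 1" using Suc.prems nodes_Suc_div by auto
  have j1: "1 \<le> ?j" by (rule nodes_ge1[OF j(1)])
  have lj: "l ?j < m" using Suc.prems(1) j1 j(1) unfolding deep_def nodes_def by auto
  have "(\<Sum>p\<in>nodes m. hs L p * ?f p) = c L * 2 ^ (m - l ?j)" if L: "L \<in> nodes (l ?j)" for L
  proof -
    have L1: "1 \<le> L" "depth L = l ?j" using L nodes_ge1 depth_nodes by auto
    then have L2: "L < 2 ^ m" using less_pow_iff lj by auto
    have "(\<Sum>p\<in>nodes m. hs L p * ?f p) = (\<Sum>K\<in>{1..<2 ^ m}. c K * (\<Sum>p\<in>nodes m. hs K p * hs L p))"
      unfolding sum_distrib_left by (subst sum.swap) (simp add: mult_ac)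
    also have "\<dots> = (\<Sum>K\<in>{1..<2 ^ m}. if K = L then c L * 2 ^ (m - l ?j) else 0)"
      by (rule sum.cong) (use L1 L2 hs_orthogonal in auto)
    finally show ?thesis using L1 L2 by simp
  qed
  then have "(\<Sum>p\<in>nodes m. bv ?j p * ?f p) = (\<Sum>L\<in>nodes (l ?j). \<beta> ?j L * (c L * 2 ^ (m - l ?j)))"
    unfolding sum_bv_mult by simp
  also have "\<dots> = 2 ^ m / 2 ^ n * bcoef c ?j"
    using lj by (simp add: bcoef_def depth_nodes[OF j(1)] power_diff sum_distrib_left sum_divide_distrib mult_ac)
  finally have S: "2 ^ n * (\<Sum>p\<in>nodes m. bv ?j p * ?f p) = 2 ^ m * bcoef c ?j" by simp
  have IH: "2 ^ n * (\<Sum>p | p \<in> nodes m \<and> \<tau> n p = ?j. ?f p)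
      = 2 ^ m * (\<Sum>k\<in>{1..<2 ^ n}. bcoef c k * hs k ?j)"
    by (rule Suc.IH[OF deep_Suc[OF Suc.prems(1)] j(1)])
  have hk: "(\<Sum>k\<in>{1..<2 ^ Suc n}. bcoef c k * hs k i)
      = (\<Sum>k\<in>{1..<2 ^ n}. bcoef c k * hs k ?j) + bcoef c ?j * (if even i then 1 else -1)"
  proof -
    have "{1..<2 ^ Suc n} = {1..<2 ^ n} \<union> nodes n" by (auto simp: nodes_def)
    moreover have "{1..<2 ^ n} \<inter> nodes n = {}" by (auto simp: nodes_def)
    ultimately have "(\<Sum>k\<in>{1..<2 ^ Suc n}. bcoef c k * hs k i)
        = (\<Sum>k\<in>{1..<2 ^ n}. bcoef c k * hs k i) + (\<Sum>k\<in>nodes n. bcoef c k * hs k i)"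
      by (simp add: sum.union_disjoint)
    moreover have hsi: "hs k i = (if ?j = k then (if even i then 1 else -1) else hs k ?j)" for k
      using nodes_ge1[OF Suc.prems(2)] j1 by (subst hs.simps) auto
    have "(\<Sum>k\<in>{1..<2 ^ n}. bcoef c k * hs k i) = (\<Sum>k\<in>{1..<2 ^ n}. bcoef c k * hs k ?j)"
      by (rule sum.cong) (use j(1) in \<open>auto simp: hsi nodes_def\<close>)
    moreover have "(\<Sum>k\<in>nodes n. bcoef c k * hs k i)
        = (\<Sum>k\<in>nodes n. if k = ?j then bcoef c ?j * (if even i then 1 else -1) else 0)"
      by (rule sum.cong) (auto simp: hsi hs_eq_0[OF _ j(1)])
    ultimately show ?thesis using j(1) by simp
  qed
  define sg :: real where "sg = (if even i then 1 else -1)"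
  have split: "2 * (\<Sum>p | p \<in> nodes m \<and> \<tau> (Suc n) p = i. g p)
      = (\<Sum>p | p \<in> nodes m \<and> \<tau> n p = ?j. g p) + sg * (\<Sum>p\<in>nodes m. bv ?j p * g p)" for g
  proof (cases "even i")
    case True
    then have "2 * ?j = i" by simp
    then show ?thesis using fiber_sum_split(1)[OF Suc.prems(1) j(1), of g] True
      by (simp del: tau.simps add: sg_def)
  next
    case False
    then have "2 * ?j + 1 = i" using j(2) by (metis dvd_triv_left)
    then show ?thesis using fiber_sum_split(2)[OF Suc.prems(1) j(1), of g] False
      by (simp del: tau.simps add: sg_def)
  qed
  have "2 ^ Suc n * (\<Sum>p | p \<in> nodes m \<and> \<tau> (Suc n) p = i. ?f p)
      = 2 ^ n * (2 * (\<Sum>p | p \<in> nodes m \<and> \<tau> (Suc n) p = i. ?f p))"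
    by (simp only: power_Suc mult_ac)
  also have "\<dots> = 2 ^ n * (\<Sum>p | p \<in> nodes m \<and> \<tau> n p = ?j. ?f p)
      + sg * (2 ^ n * (\<Sum>p\<in>nodes m. bv ?j p * ?f p))"
    unfolding split by (simp only: distrib_left mult.left_commute)
  also have "\<dots> = 2 ^ m * (\<Sum>k\<in>{1..<2 ^ Suc n}. bcoef c k * hs k i)"
    unfolding S IH hk sg_def[symmetric] by (simp only: distrib_left mult_ac)
  finally show ?case .
qed

end

section \<open>Rearrangement invariant norms on step functions\<close>

lemma bij_betw_add_mod:
  fixes a q :: nat
  shows "bij_betw (\<lambda>t. (a + t) mod q) {0..<q} {0..<q}"
proof -
  have inj: "s = t" if "(a + s) mod q = (a + t) mod q" "s < q" "t < q" "s \<le> t" for s t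
  proof -
    have "q dvd (a + t) - (a + s)" using that mod_eq_dvd_iff_nat[of "a + s" "a + t" q] by simp
    then have "q dvd t - s" by simp
    then show ?thesis using that nat_dvd_not_less[of "t - s" q] by (cases "t = s") auto
  qed
  have "inj_on (\<lambda>t. (a + t) mod q) {0..<q}"
  proof (rule inj_onI)
    fix s t assume "s \<in> {0..<q}" "t \<in> {0..<q}" "(a + s) mod q = (a + t) mod q"
    then show "s = t" using inj[of s t] inj[of t s] by (cases "s \<le> t") auto
  qed
  moreover have "(\<lambda>t. (a + t) mod q) ` {0..<q} \<subseteq> {0..<q}" by auto
  ultimately show ?thesis using endo_inj_surj[of "{0..<q}"] by (auto simp: bij_betw_def)
qed

text \<open>\<open>Nn m v\<close> is the norm of the function with value \<open>v p\<close> on the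
  interval \<open>p\<close> of level \<open>m\<close>. \<open>N_dist\<close> compares distributions
  of functions that may live on different levels, with denominators cleared.\<close>

locale step_norm =
  fixes Nn :: "nat \<Rightarrow> (nat \<Rightarrow> real) \<Rightarrow> real"
  assumes N_add: "\<And>m v w. Nn m (\<lambda>p. v p + w p) \<le> Nn m v + Nn m w"
    and N_scale: "\<And>m c v. Nn m (\<lambda>p. c * v p) = \<bar>c\<bar> * Nn m v"
    and N_dist: "\<And>m n v w. (\<And>S. 2 ^ n * card {p \<in> nodes m. \<bar>v p\<bar> \<in> S} = 2 ^ m * card {p \<in> nodes n. \<bar>w p\<bar> \<in> S})
      \<Longrightarrow> Nn m v = Nn n w"
    and N_nonneg: "\<And>m v. 0 \<le> Nn m v"
    and N_0: "\<And>m v p. Nn m v = 0 \<Longrightarrow> p \<in> nodes m \<Longrightarrow> v p = 0"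
    and N_one: "Nn 0 (\<lambda>_. 1) = 1"
begin

lemma N_abs_cong: "(\<And>p. p \<in> nodes m \<Longrightarrow> \<bar>v p\<bar> = \<bar>w p\<bar>) \<Longrightarrow> Nn m v = Nn m w"
proof (rule N_dist)
  fix S assume *: "\<And>p. p \<in> nodes m \<Longrightarrow> \<bar>v p\<bar> = \<bar>w p\<bar>"
  have "{p \<in> nodes m. \<bar>v p\<bar> \<in> S} = {p \<in> nodes m. \<bar>w p\<bar> \<in> S}" using * by auto
  then show "2 ^ m * card {p \<in> nodes m. \<bar>v p\<bar> \<in> S} = 2 ^ m * card {p \<in> nodes m. \<bar>w p\<bar> \<in> S}" by simp
qed

lemma N_cong: "(\<And>p. p \<in> nodes m \<Longrightarrow> v p = w p) \<Longrightarrow> Nn m v = Nn m w"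
  by (rule N_abs_cong) simp

text \<open>Values are replaced one at a time. Changing the sign at one place preserves the norm,
  and \<open>t * w x\<close> with \<open>t\<close> between -1 and 1 is a convex combination of
  \<open>w x\<close> and \<open>- w x\<close>.\<close>

lemma N_mono:
  assumes "\<And>p. p \<in> nodes m \<Longrightarrow> \<bar>v p\<bar> \<le> \<bar>w p\<bar>"
  shows "Nn m v \<le> Nn m w"
proof -
  have "Nn m (\<lambda>p. if p \<in> X then v p else w p) \<le> Nn m w" if "finite X" "X \<subseteq> nodes m" for X
    using that
  proof (induction X)
    case (insert x X)
    define u where "u p = (if p \<in> X then v p else w p)" for p
    define u' where "u' p = (if p = x then - w x else u p)" for p
    have ux: "u x = w x" using insert by (simp add: u_def)
    have u': "Nn m u' = Nn m u" by (rule N_abs_cong) (use ux in \<open>auto simp: u'_def\<close>)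
    obtain t where t: "\<bar>t\<bar> \<le> 1" "v x = t * w x"
    proof (cases "w x = 0")
      case True
      then show ?thesis using assms[of x] insert.prems that[of 0] by auto
    next
      case False
      then show ?thesis using assms[of x] insert.prems that[of "v x / w x"] by auto
    qed
    have "Nn m (\<lambda>p. if p \<in> insert x X then v p else w p)
        = Nn m (\<lambda>p. (1 + t) / 2 * u p + (1 - t) / 2 * u' p)"
      by (rule N_cong) (use insert.hyps in \<open>auto simp: u_def u'_def t(2) field_simps\<close>)
    also have "\<dots> \<le> Nn m (\<lambda>p. (1 + t) / 2 * u p) + Nn m (\<lambda>p. (1 - t) / 2 * u' p)" by (rule N_add)
    also have "\<dots> = Nn m u" unfolding N_scale u' using t(1) by (simp add: field_simps)
    also have "\<dots> \<le> Nn m w" unfolding u_def using insert by auto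
    finally show ?case .
  qed simp
  from this[of "nodes m"] have "Nn m (\<lambda>p. if p \<in> nodes m then v p else w p) \<le> Nn m w" by simp
  then show ?thesis using N_cong[of m v "\<lambda>p. if p \<in> nodes m then v p else w p"] by simp
qed

lemma N_sum: "finite A \<Longrightarrow> Nn m (\<lambda>p. \<Sum>a\<in>A. f a p) \<le> (\<Sum>a\<in>A. Nn m (f a))"
proof (induction A rule: finite_induct)
  case empty
  show ?case using N_scale[of m 0 "\<lambda>_. 0"] by simp
next
  case (insert a A)
  then show ?case using N_add[of m "f a" "\<lambda>p. \<Sum>a\<in>A. f a p"] by simp
qed

text \<open>Composition with a map whose fibers have equal size preserves the distribution.\<close>

lemma N_fiber:
  assumes "\<And>p. p \<in> nodes m \<Longrightarrow> t p \<in> nodes n"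
    and c: "\<And>i. i \<in> nodes n \<Longrightarrow> 2 ^ n * card {p \<in> nodes m. t p = i} = 2 ^ m"
  shows "Nn m (\<lambda>p. v (t p)) = Nn n v"
proof (rule N_dist)
  fix S
  have "card {p \<in> nodes m. \<bar>v (t p)\<bar> \<in> S} = (\<Sum>p\<in>nodes m. if \<bar>v (t p)\<bar> \<in> S then 1 else 0)"
    by (simp add: sum.If_cases Int_def)
  also have "\<dots> = (\<Sum>i\<in>nodes n. \<Sum>p | p \<in> nodes m \<and> t p = i. if \<bar>v (t p)\<bar> \<in> S then 1 else 0)"
    by (rule sum.group[symmetric]) (use assms(1) in auto)
  also have "\<dots> = (\<Sum>i\<in>nodes n. if \<bar>v i\<bar> \<in> S then card {p \<in> nodes m. t p = i} else 0)"
    by (rule sum.cong) auto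
  finally have "2 ^ n * card {p \<in> nodes m. \<bar>v (t p)\<bar> \<in> S}
      = (\<Sum>i\<in>nodes n. 2 ^ n * (if \<bar>v i\<bar> \<in> S then card {p \<in> nodes m. t p = i} else 0))"
    by (simp only: sum_distrib_left)
  also have "\<dots> = (\<Sum>i\<in>nodes n. if \<bar>v i\<bar> \<in> S then 2 ^ m else 0)"
    by (rule sum.cong) (use c in auto)
  also have "\<dots> = 2 ^ m * card {p \<in> nodes n. \<bar>v p\<bar> \<in> S}" by (simp add: sum.If_cases Int_def)
  finally show "2 ^ n * card {p \<in> nodes m. \<bar>v (t p)\<bar> \<in> S} = 2 ^ m * card {p \<in> nodes n. \<bar>v p\<bar> \<in> S}" .
qed

text \<open>
  Conditional expectation onto fibers of equal size is an average of rearrangements: rotate all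
  fibers simultaneously.
\<close>

lemma N_average:
  assumes t: "\<And>p. p \<in> nodes m \<Longrightarrow> t p \<in> nodes n"
    and c: "\<And>i. i \<in> nodes n \<Longrightarrow> 2 ^ n * card {p \<in> nodes m. t p = i} = 2 ^ m"
  shows "Nn n (\<lambda>i. 2 ^ n / 2 ^ m * (\<Sum>p | p \<in> nodes m \<and> t p = i. v p)) \<le> Nn m v"
proof -
  define fib where "fib i = {p \<in> nodes m. t p = i}" for i
  have root: "2 ^ n \<in> nodes n" by (simp add: nodes_def)
  obtain q where q: "2 ^ n * q = (2::nat) ^ m" "\<And>i. i \<in> nodes n \<Longrightarrow> card (fib i) = q"
  proof
    fix i assume "i \<in> nodes n"
    then show "card (fib i) = card (fib (2 ^ n))"
      using c[of i] c[OF root] unfolding fib_def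
      by (metis mult_cancel1 power_not_zero zero_neq_numeral)
  qed (use c[OF root] in \<open>simp add: fib_def\<close>)
  have q0: "q > 0" using q(1) by (metis gr0I mult_0_right power_not_zero zero_neq_numeral)
  have "\<exists>e. bij_betw e {0..<q} (fib i)" if "i \<in> nodes n" for i
    using ex_bij_betw_nat_finite[of "fib i"] q(2)[OF that] by (auto simp: fib_def)
  then obtain e where e: "\<And>i. i \<in> nodes n \<Longrightarrow> bij_betw (e i) {0..<q} (fib i)" by metis
  define idx where "idx p = inv_into {0..<q} (e (t p)) p" for p
  have idx: "idx p \<in> {0..<q}" "e (t p) (idx p) = p" if "p \<in> nodes m" for p
  proof -
    have "p \<in> e (t p) ` {0..<q}" using e[OF t[OF that]] that by (auto simp: bij_betw_def fib_def)
    then show "idx p \<in> {0..<q}" "e (t p) (idx p) = p"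
      unfolding idx_def by (rule inv_into_into, rule f_inv_into_f)
  qed
  define pi where "pi s p = e (t p) ((s + idx p) mod q)" for s p
  have pi_fib: "pi s p \<in> fib (t p)" if "p \<in> nodes m" for s p
    using e[OF t[OF that]] q0 unfolding pi_def bij_betw_def by auto
  have pi_inj: "inj_on (pi s) (nodes m)" for s
  proof (rule inj_onI)
    fix p p' assume p: "p \<in> nodes m" "p' \<in> nodes m" "pi s p = pi s p'"
    then have tt: "t p = t p'" using pi_fib[of p s] pi_fib[of p' s] by (auto simp: fib_def)
    have "inj_on (e (t p)) {0..<q}" using e[OF t[OF p(1)]] by (simp add: bij_betw_def)
    then have "(s + idx p) mod q = (s + idx p') mod q"
      using p(3) q0 unfolding pi_def tt by (auto dest: inj_onD)
    moreover have "inj_on (\<lambda>t. (s + t) mod q) {0..<q}" using bij_betw_add_mod by (auto simp: bij_betw_def)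
    ultimately have "idx p = idx p'" using idx(1)[OF p(1)] idx(1)[OF p(2)] by (auto dest: inj_onD)
    then show "p = p'" using idx(2)[OF p(1)] idx(2)[OF p(2)] tt by metis
  qed
  have pi_nodes: "pi s p \<in> nodes m" if "p \<in> nodes m" for s p
    using pi_fib[OF that] by (simp add: fib_def)
  have Npi: "Nn m (\<lambda>p. v (pi s p)) = Nn m v" for s
  proof (rule N_fiber[OF pi_nodes])
    fix i assume i: "i \<in> nodes m"
    have "pi s ` nodes m = nodes m" using pi_nodes pi_inj by (intro endo_inj_surj) auto
    then obtain p where p: "p \<in> nodes m" "pi s p = i" using i by (metis imageE)
    then have "{p \<in> nodes m. pi s p = i} = {p}" using pi_inj[of s] by (auto dest: inj_onD)
    then show "2 ^ m * card {p \<in> nodes m. pi s p = i} = 2 ^ m" by simp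
  qed
  have sum_pi: "(\<Sum>s\<in>{0..<q}. v (pi s p)) = (\<Sum>p' | p' \<in> nodes m \<and> t p' = t p. v p')" if "p \<in> nodes m" for p
  proof -
    have "bij_betw (\<lambda>s. (s + idx p) mod q) {0..<q} {0..<q}"
      using bij_betw_add_mod[of "idx p" q] by (simp add: add.commute)
    from bij_betw_trans[OF this e[OF t[OF that]]]
    have "bij_betw (\<lambda>s. pi s p) {0..<q} (fib (t p))" by (simp add: pi_def comp_def)
    then show ?thesis unfolding fib_def by (rule sum.reindex_bij_betw)
  qed
  have qr: "2 ^ n / 2 ^ m = 1 / real q"
    using q0 q(1) by (simp add: field_simps) (metis of_nat_mult of_nat_numeral of_nat_power mult.commute)
  have "Nn n (\<lambda>i. 2 ^ n / 2 ^ m * (\<Sum>p | p \<in> nodes m \<and> t p = i. v p))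
      = Nn m (\<lambda>p. 2 ^ n / 2 ^ m * (\<Sum>p' | p' \<in> nodes m \<and> t p' = t p. v p'))"
    by (rule N_fiber[OF t c, symmetric])
  also have "\<dots> = Nn m (\<lambda>p. 1 / real q * (\<Sum>s\<in>{0..<q}. v (pi s p)))"
    unfolding qr by (rule N_cong) (simp add: sum_pi)
  also have "\<dots> = 1 / real q * Nn m (\<lambda>p. \<Sum>s\<in>{0..<q}. v (pi s p))" unfolding N_scale by simp
  also have "\<dots> \<le> 1 / real q * (\<Sum>s\<in>{0..<q}. Nn m (\<lambda>p. v (pi s p)))"
    by (intro mult_left_mono N_sum) auto
  also have "\<dots> = Nn m v" using q0 by (simp add: Npi)
  finally show ?thesis .
qed

text \<open>Averaging over a single fiber, all of [0,1), contracts the norm, and the constant 1 has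
  norm 1. Applied to absolute values this says that the norm dominates that of L1.\<close>

lemma N_mean: "(\<Sum>p\<in>nodes m. v p) / 2 ^ m \<le> Nn m v"
proof -
  have "(\<Sum>p\<in>nodes m. v p) / 2 ^ m \<le> \<bar>(\<Sum>p\<in>nodes m. v p) / 2 ^ m\<bar> * Nn 0 (\<lambda>_. 1)"
    by (simp add: N_one divide_right_mono)
  also have "\<dots> = Nn 0 (\<lambda>_. (\<Sum>p\<in>nodes m. v p) / 2 ^ m * 1)" by (rule N_scale[symmetric])
  also have "\<dots> = Nn 0 (\<lambda>i. 2 ^ 0 / 2 ^ m * (\<Sum>p | p \<in> nodes m \<and> 1 = i. v p))" by (rule N_cong) auto
  also have "\<dots> \<le> Nn m v" by (rule N_average) auto
  finally show ?thesis .
qed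

end

section \<open>Sign averages\<close>

text \<open>
  \<open>W ind F x\<close> is \<open>\<integral>\<bar>\<Sum>\<^sub>k r\<^sub>k(u) x\<^sub>k\<bar> du\<close>, for independent signs \<open>r\<^sub>k\<close> if \<open>ind\<close> and for a constant
  sequence of signs otherwise.
\<close>

definition sgn_of :: "nat set \<Rightarrow> nat \<Rightarrow> real" where
  "sgn_of Z k = (if k \<in> Z then -1 else 1)"

definition sign_sets :: "bool \<Rightarrow> nat set \<Rightarrow> nat set set" where
  "sign_sets ind F = (if ind then Pow F else {{}})"

definition W :: "bool \<Rightarrow> nat set \<Rightarrow> (nat \<Rightarrow> real) \<Rightarrow> real" where
  "W ind F x = (\<Sum>Z\<in>sign_sets ind F. \<bar>\<Sum>k\<in>F. sgn_of Z k * x k\<bar>) / real (card (sign_sets ind F))"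

lemma sgn_of_abs [simp]: "\<bar>sgn_of Z k\<bar> = 1" "sgn_of Z k * sgn_of Z k = 1" "sgn_of {} k = 1"
  by (auto simp: sgn_of_def)

lemma card_sign_sets: "finite F \<Longrightarrow> 0 < card (sign_sets ind F)"
  by (auto simp: sign_sets_def card_gt_0_iff)

lemma W_False: "W False F x = \<bar>\<Sum>k\<in>F. x k\<bar>"
  by (simp add: W_def sign_sets_def)

lemma W_True: "finite F \<Longrightarrow> W True F x = (\<Sum>Z\<in>Pow F. \<bar>\<Sum>k\<in>F. sgn_of Z k * x k\<bar>) / 2 ^ card F"
  by (simp add: W_def sign_sets_def card_Pow)

lemma W_nonneg: "0 \<le> W ind F x"
  by (auto simp: W_def intro!: sum_nonneg divide_nonneg_nonneg)

lemma W_cong: "(\<And>k. k \<in> F \<Longrightarrow> x k = y k) \<Longrightarrow> W ind F x = W ind F y"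
  by (simp add: W_def)

lemma W_scale: "W ind F (\<lambda>k. c * x k) = \<bar>c\<bar> * W ind F x"
  by (simp add: W_def mult.left_commute[of _ c] sum_distrib_left[symmetric] abs_mult)

lemma sum_Pow_insert:
  fixes F :: "'a set \<Rightarrow> 'b::comm_monoid_add"
  assumes "finite X" "k \<notin> X"
  shows "(\<Sum>Z\<in>Pow (insert k X). F Z) = (\<Sum>Z\<in>Pow X. F Z + F (insert k Z))"
proof -
  have "Pow X \<inter> insert k ` Pow X = {}" using assms by auto
  moreover have "inj_on (insert k) (Pow X)" using assms(2) by (intro inj_on_inverseI[where g = "\<lambda>A. A - {k}"]) auto
  ultimately show ?thesis
    using assms(1) by (simp add: Pow_insert sum.union_disjoint sum.reindex sum.distrib)
qed

lemma sgn_of_insert: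
  "k \<notin> X \<Longrightarrow> Z \<subseteq> X \<Longrightarrow> (\<Sum>j\<in>X. sgn_of (insert k Z) j * x j) = (\<Sum>j\<in>X. sgn_of Z j * x j)"
  by (rule sum.cong) (auto simp: sgn_of_def)

lemma W_insert:
  assumes "finite F" "k \<notin> F"
  shows "W True (insert k F) x = (\<Sum>Z\<in>Pow F. \<bar>(\<Sum>j\<in>F. sgn_of Z j * x j) + x k\<bar>
      + \<bar>(\<Sum>j\<in>F. sgn_of Z j * x j) - x k\<bar>) / 2 / 2 ^ card F"
proof -
  have "(\<Sum>Z\<in>Pow F. \<bar>\<Sum>j\<in>insert k F. sgn_of Z j * x j\<bar> + \<bar>\<Sum>j\<in>insert k F. sgn_of (insert k Z) j * x j\<bar>)
      = (\<Sum>Z\<in>Pow F. \<bar>(\<Sum>j\<in>F. sgn_of Z j * x j) + x k\<bar> + \<bar>(\<Sum>j\<in>F. sgn_of Z j * x j) - x k\<bar>)"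
  proof (rule sum.cong)
    fix Z assume Z: "Z \<in> Pow F"
    then have "k \<notin> Z" using assms(2) by auto
    then show "\<bar>\<Sum>j\<in>insert k F. sgn_of Z j * x j\<bar> + \<bar>\<Sum>j\<in>insert k F. sgn_of (insert k Z) j * x j\<bar>
        = \<bar>(\<Sum>j\<in>F. sgn_of Z j * x j) + x k\<bar> + \<bar>(\<Sum>j\<in>F. sgn_of Z j * x j) - x k\<bar>"
      using assms Z by (simp add: sgn_of_insert) (simp add: sgn_of_def add.commute)
  qed simp
  then show ?thesis using assms by (simp add: W_True sum_Pow_insert)
qed

lemma W_insert_mono:
  assumes "finite F" "k \<notin> F"
  shows "W True F x \<le> W True (insert k F) x"
proof -
  have "(\<Sum>Z\<in>Pow F. \<bar>\<Sum>j\<in>F. sgn_of Z j * x j\<bar>)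
      \<le> (\<Sum>Z\<in>Pow F. (\<bar>(\<Sum>j\<in>F. sgn_of Z j * x j) + x k\<bar> + \<bar>(\<Sum>j\<in>F. sgn_of Z j * x j) - x k\<bar>) / 2)"
  proof (rule sum_mono)
    fix Z
    show "\<bar>\<Sum>j\<in>F. sgn_of Z j * x j\<bar>
        \<le> (\<bar>(\<Sum>j\<in>F. sgn_of Z j * x j) + x k\<bar> + \<bar>(\<Sum>j\<in>F. sgn_of Z j * x j) - x k\<bar>) / 2"
      by (simp add: abs_if)
  qed
  from divide_right_mono[OF this, of "2 ^ card F"] show ?thesis
    unfolding W_insert[OF assms] W_True[OF assms(1)] sum_divide_distrib[symmetric] by simp
qed

text \<open>Averaging over the independent sign of a further term does not decrease the mean, as |a|
  is at most (|a + x| + |a - x|) / 2. With one constant sign a further term could cancel the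
  others.\<close>

lemma W_mono:
  assumes "finite G" "F \<subseteq> G"
  shows "W True F x \<le> W True G x"
proof -
  have "finite F" using assms finite_subset by blast
  have "W True F x \<le> W True (F \<union> D) x" if "finite D" for D
    using that
  proof (induction D rule: finite_induct)
    case (insert d D)
    show ?case
    proof (cases "d \<in> F")
      case True
      then show ?thesis using insert by (simp add: insert_absorb)
    next
      case False
      then show ?thesis using insert W_insert_mono[of "F \<union> D" d x] \<open>finite F\<close> by auto
    qed
  qed simp
  from this[of "G - F"] show ?thesis using assms by (simp add: Un_absorb1)
qed

lemma W_superset:
  assumes "finite G" "F \<subseteq> G" "\<And>k. k \<in> G - F \<Longrightarrow> x k = 0"
  shows "W ind G x = W ind F x"
proof (cases ind)
  case True
  have "finite F" using assms finite_subset by blast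
  have "W True (F \<union> D) x = W True F x" if "finite D" "D \<subseteq> G - F" for D
    using that
  proof (induction D rule: finite_induct)
    case (insert d D)
    have "W True (insert d (F \<union> D)) x = W True (F \<union> D) x"
      by (subst W_insert) (use insert assms(3)[of d] \<open>finite F\<close> in \<open>auto simp: W_True sum_divide_distrib\<close>)
    then show ?case using insert by simp
  qed simp
  from this[of "G - F"] show ?thesis using assms True by (simp add: Un_absorb1)
next
  case False
  have "sum x G = sum x F" by (rule sum.mono_neutral_right) (use assms in auto)
  then show ?thesis using False by (simp add: W_False)
qed

lemma W_reindex:
  assumes "finite F" "inj_on s F"
  shows "W ind (s ` F) x = W ind F (\<lambda>k. x (s k))"
proof (cases ind)
  case False
  then show ?thesis using assms by (simp add: W_False sum.reindex)
next
  case True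
  have "inj_on (image s) (Pow F)" using assms(2) by (rule inj_on_image_Pow)
  then have "(\<Sum>Z\<in>Pow (s ` F). \<bar>\<Sum>k\<in>s ` F. sgn_of Z k * x k\<bar>)
      = (\<Sum>Z\<in>Pow F. \<bar>\<Sum>k\<in>s ` F. sgn_of (s ` Z) k * x k\<bar>)"
    by (simp add: image_Pow_surj[symmetric, OF refl] sum.reindex)
  also have "\<dots> = (\<Sum>Z\<in>Pow F. \<bar>\<Sum>k\<in>F. sgn_of Z k * x (s k)\<bar>)"
  proof (rule sum.cong)
    fix Z assume "Z \<in> Pow F"
    then have "sgn_of (s ` Z) (s k) = sgn_of Z k" if "k \<in> F" for k
      using assms(2) that by (auto simp: sgn_of_def inj_on_image_mem_iff dest: inj_onD)
    then show "\<bar>\<Sum>k\<in>s ` F. sgn_of (s ` Z) k * x k\<bar> = \<bar>\<Sum>k\<in>F. sgn_of Z k * x (s k)\<bar>"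
      using assms(2) by (simp add: sum.reindex)
  qed simp
  finally show ?thesis using True assms by (simp add: W_True card_image)
qed

section \<open>Sign averages of embedded and of projected functions\<close>

context faithful
begin

definition anc :: "nat \<Rightarrow> nat \<Rightarrow> nat \<Rightarrow> nat" where
  "anc m p k = p div 2 ^ (m - l k)"

text \<open>The indices of blocks whose support contains \<open>p\<close>. Different ones use
  different ancestors of \<open>p\<close>, so sums over them can be reindexed by Haar functions
  without identifying two signs.\<close>

definition act :: "nat \<Rightarrow> nat \<Rightarrow> nat \<Rightarrow> nat set" where
  "act n m p = {k \<in> {1..<2 ^ n}. \<beta> k (anc m p k) \<noteq> 0}"

lemma act_subset: "act n m p \<subseteq> {1..<2 ^ n}"
  by (auto simp: act_def)

lemma finite_act: "finite (act n m p)"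
  by (rule finite_subset[OF act_subset]) simp

lemma deepD: "deep n m \<Longrightarrow> k \<in> {1..<2 ^ n} \<Longrightarrow> l k < m"
  by (simp add: deep_def)

lemma beta_abs: "1 \<le> k \<Longrightarrow> \<beta> k K \<noteq> 0 \<Longrightarrow> \<bar>\<beta> k K\<bar> = 1"
  using beta[OF in_nodes_depth, of k K] by (auto split: if_splits)

lemma beta_level: "1 \<le> k \<Longrightarrow> \<beta> k K \<noteq> 0 \<Longrightarrow> K \<in> nodes (l k)"
  using beta_nonzero(1)[OF in_nodes_depth] .

lemma inj_on_anc: "inj_on (anc m p) (act n m p)"
proof (rule inj_onI)
  fix k k' assume a: "k \<in> act n m p" "k' \<in> act n m p" "anc m p k = anc m p k'"
  then have "1 \<le> k" "1 \<le> k'" "\<beta> k (anc m p k) \<noteq> 0" "\<beta> k' (anc m p k) \<noteq> 0" by (auto simp: act_def)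
  then show "k = k'" by (rule beta_disjoint)
qed

lemma anc_act_subset:
  assumes "deep n m" 
  shows "anc m p ` act n m p \<subseteq> {1..<2 ^ m}"
proof
  fix K assume "K \<in> anc m p ` act n m p"
  then obtain k where k: "k \<in> {1..<2 ^ n}" "\<beta> k K \<noteq> 0" by (auto simp: act_def)
  then have "K \<in> nodes (l k)" using beta_level[of k K] by simp
  then have "1 \<le> K" "depth K < m" using deepD[OF assms k(1)] by (auto simp: nodes_iff_depth)
  then show "K \<in> {1..<2 ^ m}" using less_pow_iff[of K m] by simp
qed

lemma hs_tau_anc:
  assumes "deep n m" "p \<in> nodes m" "k \<in> {1..<2 ^ n}"
  shows "hs k (\<tau> n p) = \<beta> k (anc m p k) * hs (anc m p k) p"
  using hs_tau[OF assms(2,1), of k] bv_eq[OF assms(2) deepD[OF assms(1,3)]] assms(3)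
  by (simp add: anc_def)

lemma sum_beta_hs:
  assumes "deep n m" "p \<in> nodes m" "k \<in> {1..<2 ^ n}"
  shows "(\<Sum>K\<in>{1..<2 ^ m}. \<bar>\<beta> k K\<bar> * c K * hs K p)
    = \<bar>\<beta> k (anc m p k)\<bar> * c (anc m p k) * hs (anc m p k) p"
proof -
  have lk: "l k < m" using deepD[OF assms(1,3)] .
  have "(\<Sum>K\<in>{1..<2 ^ m}. \<bar>\<beta> k K\<bar> * c K * hs K p) = (\<Sum>K\<in>nodes (l k). \<bar>\<beta> k K\<bar> * c K * hs K p)"
  proof (rule sum.mono_neutral_right)
    show "nodes (l k) \<subseteq> {1..<2 ^ m}" using lk less_pow_iff by (auto simp: nodes_iff_depth)
    show "\<forall>K\<in>{1..<2 ^ m} - nodes (l k). \<bar>\<beta> k K\<bar> * c K * hs K p = 0"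
    proof
      fix K assume "K \<in> {1..<2 ^ m} - nodes (l k)"
      then have "\<beta> k K = 0" using beta_level[of k K] assms(3) by auto
      then show "\<bar>\<beta> k K\<bar> * c K * hs K p = 0" by simp
    qed
  qed simp
  also have "\<dots> = \<bar>\<beta> k (anc m p k)\<bar> * c (anc m p k) * hs (anc m p k) p"
    unfolding anc_def by (rule sum_nodes_hs[OF assms(2) lk])
  finally show ?thesis .
qed

lemma beta_sum_act:
  assumes "k \<in> {1..<2 ^ n}" "\<beta> k K \<noteq> 0"
  shows "(\<Sum>j\<in>{1..<2 ^ n}. a j * \<beta> j K) = a k * \<beta> k K"
    and "(\<Sum>j\<in>{1..<2 ^ n}. a j * \<bar>\<beta> j K\<bar>) = a k"
proof -
  have z: "\<beta> j K = 0" if "j \<in> {1..<2 ^ n} - {k}" for j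
    using beta_disjoint[of k j K] assms that by auto
  have "(\<Sum>j\<in>{1..<2 ^ n}. a j * \<beta> j K) = (\<Sum>j\<in>{k}. a j * \<beta> j K)"
    by (rule sum.mono_neutral_right) (use assms z in auto)
  then show "(\<Sum>j\<in>{1..<2 ^ n}. a j * \<beta> j K) = a k * \<beta> k K" by simp
  have "(\<Sum>j\<in>{1..<2 ^ n}. a j * \<bar>\<beta> j K\<bar>) = (\<Sum>j\<in>{k}. a j * \<bar>\<beta> j K\<bar>)"
    by (rule sum.mono_neutral_right) (use assms z in auto)
  then show "(\<Sum>j\<in>{1..<2 ^ n}. a j * \<bar>\<beta> j K\<bar>) = a k" using beta_abs[of k K] assms by simp
qed

text \<open>At \<open>p\<close> each active block contributes the single Haar function of its
  ancestor interval, whose value is given by \<open>hs_tau\<close>. All other terms vanish, and the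
  signs are renumbered injectively.\<close>

lemma W_embedding:
  assumes "deep n m" "p \<in> nodes m"
  shows "W ind {1..<2 ^ m} (\<lambda>K. (\<Sum>k\<in>{1..<2 ^ n}. a k * \<beta> k K) * hs K p)
    = W ind {1..<2 ^ n} (\<lambda>k. a k * hs k (\<tau> n p))"
proof -
  let ?X = "\<lambda>K. (\<Sum>k\<in>{1..<2 ^ n}. a k * \<beta> k K) * hs K p"
  have "W ind {1..<2 ^ m} ?X = W ind (anc m p ` act n m p) ?X"
  proof (rule W_superset)
    fix K assume K: "K \<in> {1..<2 ^ m} - anc m p ` act n m p"
    show "?X K = 0"
    proof (rule ccontr)
      assume nz: "?X K \<noteq> 0"
      then have "\<exists>k\<in>{1..<2 ^ n}. \<beta> k K \<noteq> 0" by (metis (no_types, lifting) mult_eq_0_iff sum.neutral)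
      then obtain k where k: "k \<in> {1..<2 ^ n}" "\<beta> k K \<noteq> 0" ..
      then have "K \<in> nodes (l k)" using beta_level[of k K] by simp
      then have "K = anc m p k" using hs_nonzero_ancestor[OF _ _ assms(2)] nz unfolding anc_def by force
      then have "K \<in> anc m p ` act n m p" using k by (auto simp: act_def)
      then show False using K by simp
    qed
  qed (use anc_act_subset[OF assms(1)] in auto)
  also have "\<dots> = W ind (act n m p) (\<lambda>k. ?X (anc m p k))" by (rule W_reindex[OF finite_act inj_on_anc])
  also have "\<dots> = W ind (act n m p) (\<lambda>k. a k * hs k (\<tau> n p))"
  proof (rule W_cong)
    fix k assume "k \<in> act n m p"
    then have k: "k \<in> {1..<2 ^ n}" "\<beta> k (anc m p k) \<noteq> 0" by (auto simp: act_def)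
    show "?X (anc m p k) = a k * hs k (\<tau> n p)"
      unfolding beta_sum_act(1)[OF k] hs_tau_anc[OF assms k(1)] by simp
  qed
  also have "\<dots> = W ind {1..<2 ^ n} (\<lambda>k. a k * hs k (\<tau> n p))"
  proof (rule W_superset[symmetric])
    fix k assume "k \<in> {1..<2 ^ n} - act n m p"
    then have "k \<in> {1..<2 ^ n}" "\<beta> k (anc m p k) = 0" by (auto simp: act_def)
    then show "a k * hs k (\<tau> n p) = 0" using hs_tau_anc[OF assms] by simp
  qed (use act_subset in auto)
  finally show ?thesis .
qed

text \<open>\<open>\<bar>\<beta> k K\<bar>\<close> is the indicator of membership in block
  \<open>k\<close>. For fixed \<open>p\<close> the left side keeps at most one Haar function per
  block and drops the rest, which is harmless for independent signs.\<close>

lemma W_restrict: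
  assumes "deep n m" "p \<in> nodes m"
  shows "W True {1..<2 ^ n} (\<lambda>k. \<Sum>K\<in>{1..<2 ^ m}. \<bar>\<beta> k K\<bar> * c K * hs K p)
    \<le> W True {1..<2 ^ m} (\<lambda>K. c K * hs K p)"
proof -
  let ?x = "\<lambda>k. \<Sum>K\<in>{1..<2 ^ m}. \<bar>\<beta> k K\<bar> * c K * hs K p"
  have x: "?x k = \<bar>\<beta> k (anc m p k)\<bar> * c (anc m p k) * hs (anc m p k) p" if "k \<in> {1..<2 ^ n}" for k
    by (rule sum_beta_hs[OF assms that])
  have "W True {1..<2 ^ n} ?x = W True (act n m p) ?x"
    by (rule W_superset) (use act_subset x in \<open>auto simp: act_def\<close>)
  also have "\<dots> = W True (act n m p) (\<lambda>k. c (anc m p k) * hs (anc m p k) p)"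
    by (rule W_cong) (use x beta_abs in \<open>auto simp: act_def\<close>)
  also have "\<dots> = W True (anc m p ` act n m p) (\<lambda>K. c K * hs K p)"
    by (rule W_reindex[OF finite_act inj_on_anc, symmetric])
  also have "\<dots> \<le> W True {1..<2 ^ m} (\<lambda>K. c K * hs K p)"
    by (rule W_mono) (use anc_act_subset[OF assms(1)] in auto)
  finally show ?thesis .
qed

lemma fiber_average':
  assumes "deep n m" "i \<in> nodes n"
  shows "(\<Sum>k\<in>{1..<2 ^ n}. bcoef c k * hs k i)
    = 2 ^ n / 2 ^ m * (\<Sum>p | p \<in> nodes m \<and> \<tau> n p = i. \<Sum>K\<in>{1..<2 ^ m}. c K * hs K p)"
  using fiber_average[OF assms, of c] by (simp add: field_simps)

text \<open>
  In the independent case Jensen's inequality is applied for every fixed choice of signs on the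
  blocks; coefficients outside the blocks are discarded by monotonicity.
\<close>

lemma W_projection:
  assumes "deep n m" "i \<in> nodes n"
  shows "W ind {1..<2 ^ n} (\<lambda>k. bcoef c k * hs k i)
    \<le> 2 ^ n / 2 ^ m * (\<Sum>p | p \<in> nodes m \<and> \<tau> n p = i. W ind {1..<2 ^ m} (\<lambda>K. c K * hs K p))"
proof (cases ind)
  case False
  have "\<bar>\<Sum>k\<in>{1..<2 ^ n}. bcoef c k * hs k i\<bar>
      \<le> 2 ^ n / 2 ^ m * (\<Sum>p | p \<in> nodes m \<and> \<tau> n p = i. \<bar>\<Sum>K\<in>{1..<2 ^ m}. c K * hs K p\<bar>)"
    unfolding fiber_average'[OF assms] abs_mult by (intro mult_mono sum_abs) auto
  then show ?thesis using False by (simp add: W_False)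
next
  case True
  let ?D = "{1..<2 ^ n} :: nat set"
  let ?x = "\<lambda>p k. \<Sum>K\<in>{1..<2 ^ m}. \<bar>\<beta> k K\<bar> * c K * hs K p"
  let ?P = "{p. p \<in> nodes m \<and> \<tau> n p = i}"
  have Z: "(\<Sum>k\<in>?D. sgn_of Z k * (bcoef c k * hs k i)) = 2 ^ n / 2 ^ m * (\<Sum>p\<in>?P. \<Sum>k\<in>?D. sgn_of Z k * ?x p k)" for Z
  proof -
    \<comment> \<open>The signs \<open>Z\<close> on blocks, pulled back to coefficients: every
      \<open>K\<close> in block \<open>k\<close> gets the sign of \<open>k\<close>, and every
      \<open>K\<close> in no block gets 0. The projection carries these signs along.\<close>
    define cZ where "cZ K = (\<Sum>k\<in>?D. sgn_of Z k * \<bar>\<beta> k K\<bar>) * c K" for K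
    have "bcoef cZ k = sgn_of Z k * bcoef c k" if k: "k \<in> ?D" for k
    proof -
      have *: "\<beta> k L * cZ L = sgn_of Z k * (\<beta> k L * c L)" for L
      proof (cases "\<beta> k L = 0")
        case False
        show ?thesis unfolding cZ_def beta_sum_act(2)[OF k False] by simp
      qed simp
      show ?thesis by (simp only: bcoef_def * sum_distrib_left[symmetric] times_divide_eq_right mult.assoc)
    qed
    then have "(\<Sum>k\<in>?D. sgn_of Z k * (bcoef c k * hs k i)) = (\<Sum>k\<in>?D. bcoef cZ k * hs k i)"
      by (intro sum.cong) simp_all
    also have "\<dots> = 2 ^ n / 2 ^ m * (\<Sum>p\<in>?P. \<Sum>K\<in>{1..<2 ^ m}. cZ K * hs K p)"
      by (rule fiber_average'[OF assms])
    moreover have "(\<Sum>K\<in>{1..<2 ^ m}. cZ K * hs K p) = (\<Sum>k\<in>?D. sgn_of Z k * ?x p k)" for p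
      unfolding cZ_def sum_distrib_right sum_distrib_left
      by (subst sum.swap) (simp add: mult_ac)
    ultimately show ?thesis by simp
  qed
  have "W True ?D (\<lambda>k. bcoef c k * hs k i)
      \<le> (\<Sum>Z\<in>Pow ?D. 2 ^ n / 2 ^ m * (\<Sum>p\<in>?P. \<bar>\<Sum>k\<in>?D. sgn_of Z k * ?x p k\<bar>)) / 2 ^ card ?D"
    unfolding W_True[OF finite_atLeastLessThan] Z abs_mult
    by (intro divide_right_mono sum_mono mult_mono sum_abs) auto
  also have "\<dots> = 2 ^ n / 2 ^ m * (\<Sum>p\<in>?P. W True ?D (?x p))"
    unfolding W_True[OF finite_atLeastLessThan] sum_distrib_left[symmetric] sum_divide_distrib[symmetric]
    by (subst sum.swap) simp
  also have "\<dots> \<le> 2 ^ n / 2 ^ m * (\<Sum>p\<in>?P. W True {1..<2 ^ m} (\<lambda>K. c K * hs K p))"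
  proof (intro mult_left_mono sum_mono)
    fix p assume "p \<in> ?P"
    then show "W True ?D (?x p) \<le> W True {1..<2 ^ m} (\<lambda>K. c K * hs K p)"
      by (intro W_restrict[OF assms(1)]) blast
  qed auto
  finally show ?thesis using True by simp
qed

end

section \<open>The identity system\<close>

text \<open>The Haar system as a faithful copy of itself. Its \<open>tau\<close> is the ancestor
  map, so statements about truncation and about subintervals become special cases of those about
  blocks.\<close>

definition id_beta :: "nat \<Rightarrow> nat \<Rightarrow> real" where
  "id_beta k K = (if K = k then 1 else 0)"

lemma bval_id: "1 \<le> k \<Longrightarrow> bval depth id_beta k p = hs k p"
  using in_nodes_depth[of k] by (simp add: bval_def id_beta_def if_distrib[of "\<lambda>x. x * _"] cong: if_cong)

lemma tau_id: "p \<in> nodes m \<Longrightarrow> n \<le> m \<Longrightarrow> tau depth id_beta n p = p div 2 ^ (m - n)"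
proof (induction n)
  case 0
  then have "p div 2 ^ (m - 0) \<in> nodes 0" by (intro nodes_div) auto
  then show ?case by simp
next
  case (Suc n)
  let ?i = "p div 2 ^ (m - n)" and ?q = "p div 2 ^ (m - Suc n)"
  have i: "?i \<in> nodes n" "?q \<in> nodes (Suc n)" using nodes_div[OF Suc.prems(1)] Suc.prems(2) by auto
  have qi: "?q div 2 = ?i" using Suc.prems by (simp add: div_mult2_eq[symmetric] Suc_diff_Suc flip: power_Suc2)
  have q1: "\<not> ?q \<le> 1" using i(2) depth_nodes[OF i(2)] by (auto simp: depth.simps)
  have "hs ?i p = hs ?i ?q" using hs_div[OF i(1) Suc.prems(1), of "Suc n"] Suc.prems(2) by simp
  also have "\<dots> = (if even ?q then 1 else -1)" using q1 qi by (subst hs.simps) auto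
  finally have "bval depth id_beta ?i p = (if even ?q then 1 else -1)"
    using bval_id[OF nodes_ge1[OF i(1)]] by simp
  moreover have "?q = 2 * ?i + (if even ?q then 0 else 1)" unfolding qi[symmetric] by (auto) 
  ultimately show ?case using Suc by (auto split: if_splits)
qed

interpretation id_sys: faithful depth id_beta
proof
  fix n j k :: nat assume "1 \<le> j" "j < 2 ^ n" "k \<in> nodes n"
  then show "depth j < depth k" using less_pow_iff depth_nodes by metis
next
  fix n k K :: nat assume k: "k \<in> nodes n"
  have "tau depth id_beta n K = K" if "K \<in> nodes n" using tau_id[OF that, of n] by simp
  then show "id_beta k K \<in> (if K \<in> nodes (depth k) \<and> tau depth id_beta n K = k then {1, -1} else {0})"
    using k depth_nodes[OF k] by (auto simp: id_beta_def)
qed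

lemma deep_id: "id_sys.deep n n"
  unfolding id_sys.deep_def using less_pow_iff by blast

lemma bcoef_id: "1 \<le> k \<Longrightarrow> id_sys.bcoef c k = c k"
  using in_nodes_depth[of k]
  by (simp add: id_sys.bcoef_def id_beta_def if_distrib[of "\<lambda>x. x * _"] cong: if_cong)

lemma hs_nonzero_iff:
  assumes "k \<in> nodes n" "p \<in> nodes m" "n < m"
  shows "\<bar>hs k p\<bar> = (if tau depth id_beta n p = k then 1 else 0)"
  using hs_nonzero_ancestor[OF _ assms(1,2)] hs_ancestor[OF assms(2,3)] tau_id[OF assms(2), of n] assms(3)
  by auto

section \<open>Spaces with a Haar basis\<close>

text \<open>Index 0 would belong to the constant function, which is not in the space; hence only
  positive indices are constrained. Norms are prescribed for full initial segments, other finite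
  sums being obtained by zero coefficients.\<close>

locale haar_space = step_norm Nn for Nn :: "nat \<Rightarrow> (nat \<Rightarrow> real) \<Rightarrow> real" +
  fixes ind :: bool and h :: "nat \<Rightarrow> 'y::banach"
  assumes norm_comb: "\<And>m c. norm (\<Sum>k\<in>{1..<2 ^ m}. c k *\<^sub>R h k)
      = Nn m (\<lambda>p. W ind {1..<2 ^ m} (\<lambda>k. c k * hs k p))"
    and dense: "closure (span (h ` {1..})) = UNIV"
begin

definition comb :: "nat \<Rightarrow> (nat \<Rightarrow> real) \<Rightarrow> 'y" where
  "comb m c = (\<Sum>k\<in>{1..<2 ^ m}. c k *\<^sub>R h k)"

definition V :: "nat \<Rightarrow> (nat \<Rightarrow> real) \<Rightarrow> nat \<Rightarrow> real" where
  "V m c p = W ind {1..<2 ^ m} (\<lambda>k. c k * hs k p)"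

lemma norm_comb_V: "norm (comb m c) = Nn m (V m c)"
  unfolding comb_def V_def[abs_def] by (rule norm_comb)

lemma V_nonneg: "0 \<le> V m c p"
  by (simp add: V_def W_nonneg)

lemma comb_superset:
  assumes "finite F" "F \<subseteq> {1..<2 ^ m}"
  shows "(\<Sum>k\<in>F. c k *\<^sub>R h k) = comb m (\<lambda>k. if k \<in> F then c k else 0)"
  unfolding comb_def by (rule sum.mono_neutral_cong_left) (use assms in auto)

lemma comb_extend: "m \<le> m' \<Longrightarrow> comb m c = comb m' (\<lambda>k. if k < 2 ^ m then c k else 0)"
proof -
  assume "m \<le> m'"
  then have "(2::nat) ^ m \<le> 2 ^ m'" by simp
  then show ?thesis
    unfolding comb_def by (intro sum.mono_neutral_cong_left) auto
qed

text \<open>Pointwise, \<open>W_projection\<close> bounds the sign average of the projected function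
  by the fiber average of the original one; averaging over fibers then contracts
  \<open>Nn\<close>.\<close>

lemma norm_projection:
  assumes "faithful l \<beta>" "faithful.deep l n m"
  shows "norm (comb n (faithful.bcoef l \<beta> c)) \<le> norm (comb m c)"
proof -
  interpret faithful l \<beta> by fact
  have "norm (comb n (bcoef c)) = Nn n (V n (bcoef c))" by (rule norm_comb_V)
  also have "\<dots> \<le> Nn n (\<lambda>i. 2 ^ n / 2 ^ m * (\<Sum>p | p \<in> nodes m \<and> \<tau> n p = i. V m c p))"
  proof (rule N_mono)
    fix i assume i: "i \<in> nodes n"
    have nn: "0 \<le> 2 ^ n / 2 ^ m * (\<Sum>p | p \<in> nodes m \<and> \<tau> n p = i. V m c p)"
      by (intro mult_nonneg_nonneg sum_nonneg V_nonneg) auto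
    show "\<bar>V n (bcoef c) i\<bar> \<le> \<bar>2 ^ n / 2 ^ m * (\<Sum>p | p \<in> nodes m \<and> \<tau> n p = i. V m c p)\<bar>"
      unfolding abs_of_nonneg[OF nn] abs_of_nonneg[OF V_nonneg]
      unfolding V_def by (rule W_projection[OF assms(2) i])
  qed
  also have "\<dots> \<le> Nn m (V m c)" by (rule N_average) (use card_fiber[OF assms(2)] in auto)
  finally show ?thesis by (simp add: norm_comb_V)
qed

lemma norm_embedding:
  assumes "faithful l \<beta>" "faithful.deep l n m"
  shows "norm (comb m (\<lambda>K. \<Sum>k\<in>{1..<2 ^ n}. a k * \<beta> k K)) = norm (comb n a)"
proof -
  interpret faithful l \<beta> by fact
  have "Nn m (V m (\<lambda>K. \<Sum>k\<in>{1..<2 ^ n}. a k * \<beta> k K)) = Nn m (\<lambda>p. V n a (\<tau> n p))"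
    unfolding V_def by (rule N_cong) (rule W_embedding[OF assms(2)])
  also have "\<dots> = Nn n (V n a)" by (rule N_fiber) (use card_fiber[OF assms(2)] in auto)
  finally show ?thesis by (simp add: norm_comb_V)
qed

text \<open>For every choice of signs, pairing with h_k recovers \<open>c k\<close> up to sign by
  orthogonality; then the signs are averaged.\<close>

lemma V_coef:
  assumes "1 \<le> k" "k < 2 ^ m"
  shows "\<bar>c k\<bar> * 2 ^ (m - depth k) \<le> (\<Sum>p\<in>nodes m. \<bar>hs k p\<bar> * V m c p)"
proof -
  let ?D = "{1..<2 ^ m} :: nat set"
  let ?Q = "sign_sets ind ?D"
  have *: "\<bar>c k\<bar> * 2 ^ (m - depth k) \<le> (\<Sum>p\<in>nodes m. \<bar>hs k p\<bar> * \<bar>\<Sum>K\<in>?D. sgn_of Z K * (c K * hs K p)\<bar>)" for Z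
  proof -
    have "(\<Sum>p\<in>nodes m. hs k p * (\<Sum>K\<in>?D. sgn_of Z K * (c K * hs K p)))
        = (\<Sum>K\<in>?D. sgn_of Z K * c K * (\<Sum>p\<in>nodes m. hs k p * hs K p))"
      unfolding sum_distrib_left by (subst sum.swap) (simp add: mult_ac)
    also have "\<dots> = (\<Sum>K\<in>?D. if k = K then sgn_of Z k * c k * 2 ^ (m - depth k) else 0)"
      by (rule sum.cong) (use assms hs_orthogonal in auto)
    also have "\<dots> = sgn_of Z k * c k * 2 ^ (m - depth k)" using assms by simp
    finally have "\<bar>c k\<bar> * 2 ^ (m - depth k)
        = \<bar>\<Sum>p\<in>nodes m. hs k p * (\<Sum>K\<in>?D. sgn_of Z K * (c K * hs K p))\<bar>"
      by (simp add: abs_mult)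
    also have "\<dots> \<le> (\<Sum>p\<in>nodes m. \<bar>hs k p * (\<Sum>K\<in>?D. sgn_of Z K * (c K * hs K p))\<bar>)" by (rule sum_abs)
    finally show ?thesis by (simp add: abs_mult)
  qed
  have "\<bar>c k\<bar> * 2 ^ (m - depth k) * real (card ?Q)
      \<le> (\<Sum>Z\<in>?Q. \<Sum>p\<in>nodes m. \<bar>hs k p\<bar> * \<bar>\<Sum>K\<in>?D. sgn_of Z K * (c K * hs K p)\<bar>)"
    using sum_bounded_below[of ?Q "\<bar>c k\<bar> * 2 ^ (m - depth k)", OF *] by (simp add: mult_ac)
  also have "\<dots> = (\<Sum>p\<in>nodes m. \<bar>hs k p\<bar> * (\<Sum>Z\<in>?Q. \<bar>\<Sum>K\<in>?D. sgn_of Z K * (c K * hs K p)\<bar>))"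
    unfolding sum_distrib_left by (rule sum.swap)
  finally have "\<bar>c k\<bar> * 2 ^ (m - depth k)
      \<le> (\<Sum>p\<in>nodes m. \<bar>hs k p\<bar> * (\<Sum>Z\<in>?Q. \<bar>\<Sum>K\<in>?D. sgn_of Z K * (c K * hs K p)\<bar>)) / real (card ?Q)"
    using card_sign_sets[of ?D ind] by (simp add: le_divide_eq)
  then show ?thesis
    unfolding V_def W_def by (simp only: times_divide_eq_right sum_divide_distrib[symmetric])
qed

lemma V_mean: "(\<Sum>p\<in>nodes m. V m c p) / 2 ^ m \<le> norm (comb m c)"
  unfolding norm_comb_V by (rule N_mean)

text \<open>Adding \<open>V_coef\<close> over a level costs nothing, because the supports partition
  [0,1). What results is the mean of \<open>V\<close>, which the norm dominates.\<close>

lemma sum_abs_coef_le: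
  assumes "n < m"
  shows "(\<Sum>K\<in>nodes n. \<bar>c K\<bar>) / 2 ^ n \<le> norm (comb m c)"
proof -
  have one: "(\<Sum>K\<in>nodes n. \<bar>hs K p\<bar>) = 1" if "p \<in> nodes m" for p
  proof -
    have "(\<Sum>K\<in>nodes n. \<bar>hs K p\<bar>) = (\<Sum>K\<in>nodes n. if tau depth id_beta n p = K then 1 else 0)"
      by (rule sum.cong) (use hs_nonzero_iff[OF _ that assms] in auto)
    then show ?thesis by simp
  qed
  have "(\<Sum>K\<in>nodes n. \<bar>c K\<bar>) * 2 ^ (m - n) \<le> (\<Sum>K\<in>nodes n. \<Sum>p\<in>nodes m. \<bar>hs K p\<bar> * V m c p)"
    unfolding sum_distrib_right
  proof (rule sum_mono)
    fix K assume "K \<in> nodes n"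
    then have "1 \<le> K" "depth K = n" by (auto simp: nodes_iff_depth)
    then show "\<bar>c K\<bar> * 2 ^ (m - n) \<le> (\<Sum>p\<in>nodes m. \<bar>hs K p\<bar> * V m c p)"
      using V_coef[of K m c] less_pow_iff[of K m] assms by simp
  qed
  also have "\<dots> = (\<Sum>p\<in>nodes m. (\<Sum>K\<in>nodes n. \<bar>hs K p\<bar>) * V m c p)"
    unfolding sum_distrib_right by (rule sum.swap)
  also have "\<dots> = (\<Sum>p\<in>nodes m. V m c p)" by (simp add: one)
  finally have "(\<Sum>K\<in>nodes n. \<bar>c K\<bar>) / 2 ^ n \<le> (\<Sum>p\<in>nodes m. V m c p) / 2 ^ m"
    using assms by (simp add: field_simps power_diff)
  then show ?thesis using V_mean order_trans by blast
qed

lemma norm_h_eq: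
  assumes "k \<in> nodes n"
  shows "norm (h k) = Nn n (\<lambda>i. if i = k then 1 else 0)"
proof -
  have k: "1 \<le> k" "k < 2 ^ Suc n" using assms by (auto simp: nodes_def nodes_ge1)
  have "h k = comb (Suc n) (\<lambda>j. if j \<in> {k} then 1 else 0)"
    using comb_superset[of "{k}" "Suc n" "\<lambda>_. 1"] k by simp
  then have "norm (h k) = Nn (Suc n) (V (Suc n) (\<lambda>j. if j \<in> {k} then 1 else 0))" by (simp add: norm_comb_V)
  also have "\<dots> = Nn (Suc n) (\<lambda>p. if tau depth id_beta n p = k then 1 else 0)"
  proof (rule N_cong)
    fix p assume p: "p \<in> nodes (Suc n)"
    have "V (Suc n) (\<lambda>j. if j \<in> {k} then 1 else 0) p = W ind {k} (\<lambda>j. (if j \<in> {k} then 1 else 0) * hs j p)"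
      unfolding V_def by (rule W_superset) (use k in auto)
    also have "\<dots> = \<bar>hs k p\<bar>"
      by (cases ind) (auto simp: W_False W_True Pow_insert sgn_of_def)
    finally show "V (Suc n) (\<lambda>j. if j \<in> {k} then 1 else 0) p = (if tau depth id_beta n p = k then 1 else 0)"
      using hs_nonzero_iff[OF assms p] by simp
  qed
  also have "\<dots> = Nn n (\<lambda>i. if i = k then 1 else 0)"
    by (rule N_fiber) (use id_sys.card_fiber[OF id_sys.deep_mono[OF deep_id]] in auto)
  finally show ?thesis .
qed

lemma norm_h_pos: "1 \<le> k \<Longrightarrow> 0 < norm (h k)"
  using norm_h_eq[OF in_nodes_depth[of k]] N_nonneg N_0[of "depth k" "\<lambda>i. if i = k then 1 else 0" k] in_nodes_depth[of k]
  by (metis less_eq_real_def zero_neq_one)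

lemma norm_h_level:
  assumes "k \<in> nodes n" "k' \<in> nodes n"
  shows "norm (h k) = norm (h k')"
  unfolding norm_h_eq[OF assms(1)] norm_h_eq[OF assms(2)]
proof (rule N_dist)
  fix S
  have *: "card {p \<in> nodes n. \<bar>if p = k then 1 else 0 :: real\<bar> \<in> S}
     = (if 1 \<in> S then 1 else 0) + (if 0 \<in> S then 2 ^ n - 1 else 0)" if "k \<in> nodes n" for k
  proof -
    have "{p \<in> nodes n. \<bar>if p = k then 1 else 0 :: real\<bar> \<in> S}
       = (if 1 \<in> S then {k} else {}) \<union> (if 0 \<in> S then nodes n - {k} else {})" using that by auto
    then show ?thesis using that by (auto simp: card_Diff_singleton card_insert_if)
  qed
  show "2 ^ n * card {p \<in> nodes n. \<bar>if p = k then 1 else 0 :: real\<bar> \<in> S}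
    = 2 ^ n * card {p \<in> nodes n. \<bar>if p = k' then 1 else 0 :: real\<bar> \<in> S}"
    unfolding *[OF assms(1)] *[OF assms(2)] ..
qed

text \<open>The average of \<open>V\<close> over the interval \<open>k\<close> is at least
  \<open>\<bar>c k\<bar>\<close>, so the conditional expectation of \<open>V\<close> to level
  \<open>depth k\<close> dominates \<open>\<bar>c k\<bar>\<close> times the indicator of
  \<open>k\<close>.\<close>

lemma coef_norm_h_le:
  assumes "1 \<le> k" "k < 2 ^ m"
  shows "\<bar>c k\<bar> * norm (h k) \<le> norm (comb m c)"
proof -
  define n where "n = depth k"
  have k: "k \<in> nodes n" "n < m" using assms in_nodes_depth less_pow_iff by (auto simp: n_def)
  let ?t = "tau depth id_beta n"
  have deep: "id_sys.deep n m" using id_sys.deep_mono[OF deep_id] k(2) by simp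
  have "\<bar>c k\<bar> * norm (h k) = Nn n (\<lambda>i. c k * (if i = k then 1 else 0))"
    unfolding norm_h_eq[OF k(1)] N_scale ..
  also have "\<dots> \<le> Nn n (\<lambda>i. 2 ^ n / 2 ^ m * (\<Sum>p | p \<in> nodes m \<and> ?t p = i. V m c p))"
  proof (rule N_mono)
    fix i
    have nn: "0 \<le> 2 ^ n / 2 ^ m * (\<Sum>p | p \<in> nodes m \<and> ?t p = i. V m c p)" for i
      by (intro mult_nonneg_nonneg sum_nonneg V_nonneg) auto
    have "(\<Sum>p\<in>nodes m. \<bar>hs k p\<bar> * V m c p) = (\<Sum>p\<in>nodes m. if ?t p = k then V m c p else 0)"
      by (rule sum.cong) (use hs_nonzero_iff[OF k(1) _ k(2)] in auto)
    then have "\<bar>c k\<bar> * 2 ^ (m - n) \<le> (\<Sum>p | p \<in> nodes m \<and> ?t p = k. V m c p)"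
      using V_coef[OF assms, of c] by (simp add: sum.If_cases Int_def n_def)
    then have "\<bar>c k\<bar> \<le> 2 ^ n / 2 ^ m * (\<Sum>p | p \<in> nodes m \<and> ?t p = k. V m c p)"
      using k(2) by (simp add: field_simps power_diff)
    then show "\<bar>c k * (if i = k then 1 else 0)\<bar> \<le> \<bar>2 ^ n / 2 ^ m * (\<Sum>p | p \<in> nodes m \<and> ?t p = i. V m c p)\<bar>"
      unfolding abs_of_nonneg[OF nn] using nn[of i] by (auto simp: abs_mult)
  qed
  also have "\<dots> \<le> Nn m (V m c)"
    by (rule N_average) (use id_sys.card_fiber[OF deep] in auto)
  finally show ?thesis by (simp add: norm_comb_V)
qed

text \<open>At every point exactly one term is nonzero, with absolute value 1, so the sign average
  is the constant 1.\<close>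

lemma norm_signed_level:
  assumes "\<And>k. k \<in> nodes n \<Longrightarrow> \<bar>s k\<bar> = 1"
  shows "norm (\<Sum>k\<in>nodes n. s k *\<^sub>R h k) = 1"
proof -
  have sub: "nodes n \<subseteq> {1..<2 ^ Suc n}" using nodes_ge1 by (auto simp: nodes_def)
  let ?c = "\<lambda>k. if k \<in> nodes n then s k else 0"
  have "V (Suc n) ?c p = 1" if p: "p \<in> nodes (Suc n)" for p
  proof -
    let ?k = "tau depth id_beta n p"
    have k: "?k \<in> nodes n" by (rule id_sys.tau_nodes)
    have "V (Suc n) ?c p = W ind {?k} (\<lambda>k. ?c k * hs k p)"
      unfolding V_def
    proof (rule W_superset)
      fix k assume "k \<in> {1..<2 ^ Suc n} - {?k}"
      then show "?c k * hs k p = 0" using hs_nonzero_iff[OF _ p, of k n] by auto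
    next
      show "{?k} \<subseteq> {1..<2 ^ Suc n}" using sub k by blast
    qed simp
    also have "\<dots> = \<bar>?c ?k * hs ?k p\<bar>"
      by (cases ind) (auto simp: W_False W_True Pow_insert sgn_of_def)
    also have "\<dots> = 1" using assms[of ?k] hs_nonzero_iff[OF id_sys.tau_nodes p, of n] by (simp add: abs_mult)
    finally show ?thesis .
  qed
  then have "norm (comb (Suc n) ?c) = Nn (Suc n) (\<lambda>p. 1)"
    unfolding norm_comb_V by (intro N_cong) auto
  also have "\<dots> = Nn 0 (\<lambda>p. 1)"
    using N_fiber[of "Suc n" "\<lambda>_. 1" 0 "\<lambda>_. 1"] by simp
  finally show ?thesis using comb_superset[OF finite_nodes sub, of s] N_one by simp
qed

end

section \<open>Operators on spaces with a Haar basis\<close>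

lemma blinfun_extension:
  fixes S :: "'a::real_normed_vector set" and f :: "'a \<Rightarrow> 'b::banach"
  assumes S: "subspace S" "closure S = UNIV"
    and add: "\<And>x y. x \<in> S \<Longrightarrow> y \<in> S \<Longrightarrow> f (x + y) = f x + f y"
    and scale: "\<And>c x. x \<in> S \<Longrightarrow> f (c *\<^sub>R x) = c *\<^sub>R f x"
    and bound: "\<And>x. x \<in> S \<Longrightarrow> norm (f x) \<le> C * norm x" and "0 \<le> C"
  obtains L :: "'a \<Rightarrow>\<^sub>L 'b" where "\<And>x. x \<in> S \<Longrightarrow> blinfun_apply L x = f x" "norm L \<le> C"
proof -
  have diff: "norm (f x - f y) \<le> C * norm (x - y)" if "x \<in> S" "y \<in> S" for x y
  proof -
    have "x - y \<in> S" using S(1) that by (rule subspace_diff)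
    then have "f ((x - y) + y) = f (x - y) + f y" using that by (intro add)
    then show ?thesis using bound[OF \<open>x - y \<in> S\<close>] by simp
  qed
  have "uniformly_continuous_on S f"
    unfolding uniformly_continuous_on_def
  proof (intro allI impI)
    fix e :: real assume e: "e > 0"
    show "\<exists>d>0. \<forall>x\<in>S. \<forall>x'\<in>S. dist x' x < d \<longrightarrow> dist (f x') (f x) < e"
    proof (intro exI[of _ "e / (C + 1)"] conjI ballI impI)
      fix x x' assume x: "x \<in> S" "x' \<in> S" "dist x' x < e / (C + 1)"
      have "dist (f x') (f x) \<le> C * dist x' x" using diff[OF x(2,1)] by (simp add: dist_norm)
      also have "\<dots> \<le> (C + 1) * dist x' x" by (simp add: algebra_simps)
      also have "\<dots> < e" using x(3) \<open>0 \<le> C\<close> by (simp add: field_simps)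
      finally show "dist (f x') (f x) < e" .
    qed (use e \<open>0 \<le> C\<close> in simp)
  qed
  then obtain g where g: "uniformly_continuous_on (closure S) g" "\<And>x. x \<in> S \<Longrightarrow> f x = g x"
    by (rule uniformly_continuous_on_extension_on_closure) blast
  have cont: "isCont g x" for x
    using uniformly_continuous_imp_continuous[OF g(1)] S(2) by (simp add: continuous_on_eq_continuous_at)
  have seq: "\<exists>s. (\<forall>n. s n \<in> S) \<and> s \<longlonglongrightarrow> x" for x
    using S(2) closure_sequential[of x S] by auto
  have gadd: "g (x + y) = g x + g y" for x y
  proof -
    obtain s t where s: "\<And>n. s n \<in> S" "s \<longlonglongrightarrow> x" and t: "\<And>n. t n \<in> S" "t \<longlonglongrightarrow> y" using seq by metis
    have "(\<lambda>n. g (s n + t n)) \<longlonglongrightarrow> g (x + y)"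
      by (rule isCont_tendsto_compose[OF cont tendsto_add[OF s(2) t(2)]])
    moreover have "g (s n + t n) = g (s n) + g (t n)" for n
      using add[OF s(1) t(1)] g(2) s(1) t(1) subspace_add[OF S(1)] by metis
    moreover have "(\<lambda>n. g (s n) + g (t n)) \<longlonglongrightarrow> g x + g y"
      by (intro tendsto_add isCont_tendsto_compose[OF cont] s t)
    ultimately show ?thesis using LIMSEQ_unique by simp blast
  qed
  have gscale: "g (c *\<^sub>R x) = c *\<^sub>R g x" for c x
  proof -
    obtain s where s: "\<And>n. s n \<in> S" "s \<longlonglongrightarrow> x" using seq by metis
    have "(\<lambda>n. g (c *\<^sub>R s n)) \<longlonglongrightarrow> g (c *\<^sub>R x)"
      by (rule isCont_tendsto_compose[OF cont tendsto_scaleR[OF tendsto_const s(2)]])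
    moreover have "g (c *\<^sub>R s n) = c *\<^sub>R g (s n)" for n
      using scale[OF s(1)] g(2) s(1) subspace_scale[OF S(1)] by metis
    moreover have "(\<lambda>n. c *\<^sub>R g (s n)) \<longlonglongrightarrow> c *\<^sub>R g x"
      by (intro tendsto_intros isCont_tendsto_compose[OF cont] s)
    ultimately show ?thesis using LIMSEQ_unique by simp blast
  qed
  have gbound: "norm (g x) \<le> norm x * C" for x
  proof -
    obtain s where s: "\<And>n. s n \<in> S" "s \<longlonglongrightarrow> x" using seq by metis
    have "(\<lambda>n. norm (g (s n))) \<longlonglongrightarrow> norm (g x)"
      by (intro tendsto_norm isCont_tendsto_compose[OF cont] s)
    moreover have "(\<lambda>n. norm (s n) * C) \<longlonglongrightarrow> norm x * C" by (intro tendsto_intros s)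
    moreover have "norm (g (s n)) \<le> norm (s n) * C" for n
      using bound[OF s(1)] g(2)[OF s(1)] by (simp add: mult.commute)
    ultimately show ?thesis using LIMSEQ_le by blast
  qed
  have bl: "bounded_linear g" by (rule bounded_linear_intro[OF gadd gscale gbound])
  show ?thesis
  proof
    show "blinfun_apply (Blinfun g) x = f x" if "x \<in> S" for x
      using g(2)[OF that] bl by (simp add: bounded_linear_Blinfun_apply)
    show "norm (Blinfun g) \<le> C"
      by (rule norm_blinfun_bound[OF \<open>0 \<le> C\<close>]) (use gbound bl in \<open>simp add: bounded_linear_Blinfun_apply mult.commute\<close>)
  qed
qed

context haar_space
begin

lemma h_comb: "1 \<le> k \<Longrightarrow> k < 2 ^ m \<Longrightarrow> h k = comb m (\<lambda>j. if j = k then 1 else 0)"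
  using comb_superset[of "{k}" m "\<lambda>_. 1"] by simp

lemma comb_add: "comb m c + comb m d = comb m (\<lambda>k. c k + d k)"
  by (simp add: comb_def scaleR_left_distrib sum.distrib)

lemma comb_scale: "a *\<^sub>R comb m c = comb m (\<lambda>k. a * c k)"
  by (simp add: comb_def scaleR_sum_right)

lemma comb_cong: "(\<And>k. 1 \<le> k \<Longrightarrow> k < 2 ^ m \<Longrightarrow> c k = d k) \<Longrightarrow> comb m c = comb m d"
  by (simp add: comb_def)

lemma span_comb: "span (h ` {1..}) = {comb m c | m c. True}"
proof
  have "subspace {comb m c | m c. True}"
  proof (rule subspaceI)
    have "0 = comb 0 (\<lambda>_. 0)" by (simp add: comb_def)
    then show "0 \<in> {comb m c | m c. True}" by blast
    fix x y assume "x \<in> {comb m c | m c. True}" "y \<in> {comb m c | m c. True}"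
    then obtain m c m' c' where xy: "x = comb m c" "y = comb m' c'" by auto
    have "x = comb (max m m') (\<lambda>k. if k < 2 ^ m then c k else 0)"
      "y = comb (max m m') (\<lambda>k. if k < 2 ^ m' then c' k else 0)"
      unfolding xy by (rule comb_extend; simp)+
    then show "x + y \<in> {comb m c | m c. True}" using comb_add by blast
  next
    fix a x assume "x \<in> {comb m c | m c. True}"
    then show "a *\<^sub>R x \<in> {comb m c | m c. True}" using comb_scale by blast
  qed
  moreover have "h ` {1..} \<subseteq> {comb m c | m c. True}"
  proof
    fix x assume "x \<in> h ` {1..}"
    then obtain k where "1 \<le> k" "x = h k" by auto
    then show "x \<in> {comb m c | m c. True}" using h_comb[of k k] by auto
  qed
  ultimately show "span (h ` {1..}) \<subseteq> {comb m c | m c. True}" by (rule span_minimal[rotated])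
  show "{comb m c | m c. True} \<subseteq> span (h ` {1..})"
  proof clarify
    fix m c show "comb m c \<in> span (h ` {1..})"
      unfolding comb_def by (intro span_sum span_scale span_base imageI) auto
  qed
qed

lemma comb_approx: "0 < e \<Longrightarrow> \<exists>m c. norm (y - comb m c) < e"
proof -
  assume "0 < e"
  have "y \<in> closure {comb m c | m c. True}" using dense unfolding span_comb by simp
  then obtain z where "z \<in> {comb m c | m c. True}" "dist z y < e"
    using \<open>0 < e\<close> closure_approachable by blast
  then show ?thesis by (auto simp: dist_norm norm_minus_commute)
qed

lemma blinfun_eq_dense:
  fixes L M :: "'y \<Rightarrow>\<^sub>L 'z::real_normed_vector"
  assumes "\<And>k. 1 \<le> k \<Longrightarrow> blinfun_apply L (h k) = blinfun_apply M (h k)"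
  shows "L = M"
proof (rule blinfun_eqI)
  fix y
  have "closed {x. blinfun_apply L x = blinfun_apply M x}"
    by (intro closed_Collect_eq continuous_intros)
  moreover have "span (h ` {1..}) \<subseteq> {x. blinfun_apply L x = blinfun_apply M x}"
    unfolding span_comb by (auto simp: comb_def blinfun.sum_right blinfun.scaleR_right assms)
  ultimately show "blinfun_apply L y = blinfun_apply M y" using closure_minimal dense by blast
qed

lemma le_dense:
  fixes f g :: "'y \<Rightarrow> real"
  assumes "\<And>m c. f (comb m c) \<le> g (comb m c)" "continuous_on UNIV f" "continuous_on UNIV g"
  shows "f y \<le> g y"
proof -
  have "closed {x. f x \<le> g x}" using assms(2,3) by (rule closed_Collect_le)
  moreover have "span (h ` {1..}) \<subseteq> {x. f x \<le> g x}" unfolding span_comb using assms(1) by auto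
  ultimately show ?thesis using closure_minimal dense by blast
qed

text \<open>The bound also shows that the assignment is well defined: two representations of a
  vector differ by a combination of norm 0, which must be sent to 0.\<close>

lemma basis_extension:
  fixes g :: "nat \<Rightarrow> 'z::banach"
  assumes bound: "\<And>m c. norm (\<Sum>k\<in>{1..<2 ^ m}. c k *\<^sub>R g k) \<le> C * norm (comb m c)" and "0 \<le> C"
  obtains L where "\<And>k. 1 \<le> k \<Longrightarrow> blinfun_apply L (h k) = g k" "norm L \<le> C"
proof -
  let ?g = "\<lambda>m c. \<Sum>k\<in>{1..<2 ^ m}. c k *\<^sub>R g k"
  define S where "S = span (h ` {1..})"
  have ext: "?g m c = ?g m' (\<lambda>k. if k < 2 ^ m then c k else 0)" if "m \<le> m'" for m m' c
  proof -
    have "(2::nat) ^ m \<le> 2 ^ m'" using that by simp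
    then show ?thesis by (intro sum.mono_neutral_cong_left) auto
  qed
  have welldef: "?g m c = ?g m' c'" if "comb m c = comb m' c'" for m c m' c'
  proof -
    let ?M = "max m m'"
    let ?d = "\<lambda>k. (if k < 2 ^ m then c k else 0) + - 1 * (if k < 2 ^ m' then c' k else 0)"
    have "comb ?M ?d = comb m c + (- 1) *\<^sub>R comb m' c'"
      using comb_extend[of m ?M c] comb_extend[of m' ?M c'] by (simp only: comb_add comb_scale max.cobounded1 max.cobounded2)
    also have "\<dots> = 0" using that by simp
    finally have "?g ?M ?d = 0" using bound[of ?d ?M] by (simp del: max_def)
    moreover have "?g ?M ?d = ?g ?M (\<lambda>k. if k < 2 ^ m then c k else 0) - ?g ?M (\<lambda>k. if k < 2 ^ m' then c' k else 0)"
      unfolding sum_subtractf[symmetric] by (rule sum.cong) (simp_all add: scaleR_left_diff_distrib)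
    ultimately show ?thesis using ext[of m ?M c] ext[of m' ?M c'] by simp
  qed
  define f where "f x = (SOME z. \<exists>m c. x = comb m c \<and> z = ?g m c)" for x
  have f: "f (comb m c) = ?g m c" for m c
  proof -
    have "\<exists>m' c'. comb m c = comb m' c' \<and> f (comb m c) = ?g m' c'"
      unfolding f_def by (rule someI_ex) blast
    then show ?thesis using welldef by metis
  qed
  have fadd: "f (x + y) = f x + f y" if xy: "x \<in> S" "y \<in> S" for x y
  proof -
    obtain m c m' c' where e: "x = comb m c" "y = comb m' c'" using xy unfolding S_def span_comb by auto
    have x: "x = comb (max m m') (\<lambda>k. if k < 2 ^ m then c k else 0)"
      and y: "y = comb (max m m') (\<lambda>k. if k < 2 ^ m' then c' k else 0)"
      unfolding e by (rule comb_extend; simp)+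
    show ?thesis unfolding x y comb_add f by (simp add: scaleR_left_distrib sum.distrib)
  qed
  have fscale: "f (a *\<^sub>R x) = a *\<^sub>R f x" if x: "x \<in> S" for a x
  proof -
    obtain m c where e: "x = comb m c" using x unfolding S_def span_comb by auto
    show ?thesis unfolding e comb_scale f by (simp add: scaleR_sum_right)
  qed
  have fbound: "norm (f x) \<le> C * norm x" if x: "x \<in> S" for x
    using x bound unfolding S_def span_comb by (auto simp: f)
  obtain L where L: "\<And>x. x \<in> S \<Longrightarrow> blinfun_apply L x = f x" "norm L \<le> C"
    using blinfun_extension[of S f C] dense fadd fscale fbound \<open>0 \<le> C\<close> unfolding S_def by blast
  show ?thesis
  proof
    fix k :: nat assume k: "1 \<le> k"
    have "h k \<in> S" unfolding S_def using k by (intro span_base) auto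
    then have "blinfun_apply L (h k) = f (comb k (\<lambda>j. if j = k then 1 else 0))"
      using L(1) h_comb[of k k] k by simp
    also have "\<dots> = (\<Sum>j\<in>{1..<2 ^ k}. if j = k then g k else 0)"
      unfolding f by (rule sum.cong) auto
    also have "\<dots> = g k" using k by simp
    finally show "blinfun_apply L (h k) = g k" .
  qed (rule L(2))
qed

text \<open>The coefficient functionals. On the span, \<open>phi k\<close> is integration against
  h_k times \<open>2 ^ depth k\<close>; boundedness comes from
  \<open>coef_norm_h_le\<close>.\<close>

definition phi :: "nat \<Rightarrow> 'y \<Rightarrow>\<^sub>L real" where
  "phi k = (SOME L. \<forall>j\<ge>1. blinfun_apply L (h j) = (if j = k then 1 else 0))"

lemma phi_h: "1 \<le> k \<Longrightarrow> 1 \<le> j \<Longrightarrow> blinfun_apply (phi k) (h j) = (if j = k then 1 else 0)"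
proof -
  assume k: "1 \<le> k" and j: "1 \<le> j"
  obtain L :: "'y \<Rightarrow>\<^sub>L real" where "\<And>j. 1 \<le> j \<Longrightarrow> blinfun_apply L (h j) = (if j = k then 1 else 0)"
  proof (rule basis_extension[of "\<lambda>j. if j = k then 1 else 0 :: real" "1 / norm (h k)"])
    fix m c
    have "(\<Sum>j\<in>{1..<2 ^ m}. c j *\<^sub>R (if j = k then 1 else 0 :: real)) = (if k < 2 ^ m then c k else 0)"
      using k by (simp add: if_distrib[of "\<lambda>x. _ * x"] cong: if_cong)
    then show "norm (\<Sum>j\<in>{1..<2 ^ m}. c j *\<^sub>R (if j = k then 1 else 0 :: real)) \<le> 1 / norm (h k) * norm (comb m c)"
      using coef_norm_h_le[OF k, of m c] norm_h_pos[OF k] by (simp add: field_simps)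
  qed auto
  then have "\<exists>L. \<forall>j\<ge>1. blinfun_apply L (h j) = (if j = k then 1 else 0 :: real)" by blast
  then have "\<forall>j\<ge>1. blinfun_apply (phi k) (h j) = (if j = k then 1 else 0)"
    unfolding phi_def by (rule someI_ex)
  then show ?thesis using j by blast
qed

lemma phi_comb: "1 \<le> k \<Longrightarrow> blinfun_apply (phi k) (comb m c) = (if k < 2 ^ m then c k else 0)"
proof -
  assume k: "1 \<le> k"
  have "blinfun_apply (phi k) (comb m c) = (\<Sum>j\<in>{1..<2 ^ m}. c j * blinfun_apply (phi k) (h j))"
    by (simp add: comb_def blinfun.sum_right blinfun.scaleR_right)
  also have "\<dots> = (\<Sum>j\<in>{1..<2 ^ m}. if j = k then c k else 0)"
    by (rule sum.cong) (use phi_h[OF k] in auto)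
  finally show ?thesis using k by simp
qed

lemma phi_norm_h: "1 \<le> k \<Longrightarrow> \<bar>blinfun_apply (phi k) y\<bar> * norm (h k) \<le> norm y"
  by (rule le_dense[of "\<lambda>y. \<bar>blinfun_apply (phi k) y\<bar> * norm (h k)" norm])
     (auto simp: phi_comb coef_norm_h_le intro!: continuous_intros)

lemma phi_level: "(\<Sum>K\<in>nodes n. \<bar>blinfun_apply (phi K) y\<bar>) / 2 ^ n \<le> norm y"
proof (rule le_dense[of "\<lambda>y. (\<Sum>K\<in>nodes n. \<bar>blinfun_apply (phi K) y\<bar>) / 2 ^ n" norm])
  fix m and c :: "nat \<Rightarrow> real"
  let ?c = "\<lambda>k. if k < 2 ^ m then c k else 0"
  have "(\<Sum>K\<in>nodes n. \<bar>blinfun_apply (phi K) (comb m c)\<bar>) = (\<Sum>K\<in>nodes n. \<bar>?c K\<bar>)"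
    by (rule sum.cong) (use nodes_ge1 in \<open>auto simp: phi_comb\<close>)
  then show "(\<Sum>K\<in>nodes n. \<bar>blinfun_apply (phi K) (comb m c)\<bar>) / 2 ^ n \<le> norm (comb m c)"
    using sum_abs_coef_le[of n "max m (Suc n)" ?c] comb_extend[of m "max m (Suc n)" c] by simp
qed (auto intro!: continuous_intros)

text \<open>Finite combinations have no coefficients on deep levels, and the uniform bound
  \<open>phi_level\<close> carries this over to limits.\<close>

lemma phi_level_tendsto: "(\<lambda>n. (\<Sum>K\<in>nodes n. \<bar>blinfun_apply (phi K) y\<bar>) / 2 ^ n) \<longlonglongrightarrow> 0"
proof (rule LIMSEQ_I)
  fix e :: real assume "0 < e"
  then obtain m c where mc: "norm (y - comb m c) < e" using comb_approx by blast
  have "norm ((\<Sum>K\<in>nodes n. \<bar>blinfun_apply (phi K) y\<bar>) / 2 ^ n - 0) < e" if "m \<le> n" for n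
  proof -
    have "(\<Sum>K\<in>nodes n. \<bar>blinfun_apply (phi K) y\<bar>) = (\<Sum>K\<in>nodes n. \<bar>blinfun_apply (phi K) (y - comb m c)\<bar>)"
    proof (rule sum.cong)
      fix K assume K: "K \<in> nodes n"
      have "(2::nat) ^ m \<le> 2 ^ n" using that by simp
      also have "\<dots> \<le> K" using K by (simp add: nodes_def)
      finally have "\<not> K < 2 ^ m" by simp
      then show "\<bar>blinfun_apply (phi K) y\<bar> = \<bar>blinfun_apply (phi K) (y - comb m c)\<bar>"
        using phi_comb[OF nodes_ge1[OF K]] by (simp add: blinfun.diff_right)
    qed simp
    then show ?thesis using phi_level[where n = n and y = "y - comb m c"] mc by (simp add: sum_nonneg)
  qed
  then show "\<exists>N. \<forall>n\<ge>N. norm ((\<Sum>K\<in>nodes n. \<bar>blinfun_apply (phi K) y\<bar>) / 2 ^ n - 0) < e" by blast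
qed

lemma phi_abs_le: "k \<in> nodes n \<Longrightarrow> \<bar>blinfun_apply (phi k) y\<bar> \<le> 2 ^ n * norm y"
  using phi_level[where n = n and y = y] member_le_sum[of k "nodes n" "\<lambda>K. \<bar>blinfun_apply (phi K) y\<bar>"]
  by (simp add: field_simps)

text \<open>A crude bound, sufficient because all tolerances will decay exponentially in the
  index.\<close>

lemma phi_abs_le': "1 \<le> k \<Longrightarrow> \<bar>blinfun_apply (phi k) y\<bar> \<le> k * norm y"
proof -
  assume k: "1 \<le> k"
  have "2 ^ depth k \<le> k" using in_nodes_depth[OF k] by (simp add: nodes_def)
  then have "(2::real) ^ depth k \<le> real k" by (metis of_nat_le_iff of_nat_numeral of_nat_power)
  then have "2 ^ depth k * norm y \<le> real k * norm y" by (intro mult_right_mono) auto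
  then show ?thesis using phi_abs_le[OF in_nodes_depth[OF k], of y] by linarith
qed

lemma norm_comb_truncate: "n \<le> m \<Longrightarrow> norm (comb n c) \<le> norm (comb m c)"
proof -
  assume "n \<le> m"
  then have "id_sys.deep n m" using id_sys.deep_mono[OF deep_id] by simp
  from norm_projection[OF id_sys.faithful_axioms this, of c]
  show ?thesis using comb_cong[of n "id_sys.bcoef c" c] bcoef_id by simp
qed

text \<open>Partial sums are contractive on the whole space. The partial sum of order
  \<open>m\<close> of \<open>y - comb m c\<close> is \<open>- comb m c\<close>, so
  \<open>comb m c\<close> is bounded by the error of approximating \<open>y\<close>, and
  \<open>y\<close> by twice this error.\<close>

lemma phi_total:
  assumes "\<And>k. 1 \<le> k \<Longrightarrow> blinfun_apply (phi k) y = 0"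
  shows "y = 0"
proof (rule ccontr)
  assume "y \<noteq> 0"
  then obtain m c where mc: "norm (y - comb m c) < norm y / 2" using comb_approx[of "norm y / 2" y] by auto
  have "norm (comb m (\<lambda>k. blinfun_apply (phi k) x)) \<le> norm x" for x
  proof (rule le_dense[of "\<lambda>x. norm (comb m (\<lambda>k. blinfun_apply (phi k) x))" norm])
    fix m' and c' :: "nat \<Rightarrow> real"
    let ?c = "\<lambda>k. if k < 2 ^ m' then c' k else 0"
    have "comb m (\<lambda>k. blinfun_apply (phi k) (comb m' c')) = comb m ?c"
      by (rule comb_cong) (simp add: phi_comb)
    then show "norm (comb m (\<lambda>k. blinfun_apply (phi k) (comb m' c'))) \<le> norm (comb m' c')"
      using norm_comb_truncate[of m "max m m'" ?c] comb_extend[of m' "max m m'" c'] by simp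
  qed (auto simp: comb_def intro!: continuous_intros)
  from this[of "y - comb m c"] have "norm (comb m (\<lambda>k. - c k)) \<le> norm (y - comb m c)"
    using comb_cong[of m "\<lambda>k. blinfun_apply (phi k) (y - comb m c)" "\<lambda>k. - c k"] assms
    by (simp add: blinfun.diff_right phi_comb)
  moreover have "comb m (\<lambda>k. - c k) = - comb m c" by (simp add: comb_def sum_negf)
  ultimately have "norm y \<le> norm (y - comb m c) + norm (y - comb m c)"
    using norm_triangle_ineq[of "y - comb m c" "comb m c"] by simp
  then show False using mc by simp
qed

lemma norm_h_le_1: "1 \<le> k \<Longrightarrow> norm (h k) \<le> 1"
proof -
  assume "1 \<le> k"
  then have k: "k \<in> nodes (depth k)" by (rule in_nodes_depth)
  have "norm (h k) \<le> Nn (depth k) (\<lambda>_. 1)" unfolding norm_h_eq[OF k] by (rule N_mono) auto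
  also have "\<dots> = Nn 0 (\<lambda>_. 1)" using N_fiber[of "depth k" "\<lambda>_. 1" 0 "\<lambda>_. 1"] by simp
  finally show ?thesis by (simp add: N_one)
qed

text \<open>As \<open>h k\<close> has norm at most 1, the Haar series of \<open>y\<close> converges
  absolutely; its sum has the same coefficients as \<open>y\<close> and equals \<open>y\<close> by
  \<open>phi_total\<close>.\<close>

lemma norm_le_suminf_phi:
  assumes r: "\<And>k. 1 \<le> k \<Longrightarrow> \<bar>blinfun_apply (phi k) y\<bar> \<le> r k" and s: "summable r" and nn: "\<And>k. 0 \<le> r k"
  shows "norm y \<le> suminf r"
proof -
  define t where "t k = (if k = 0 then 0 else blinfun_apply (phi k) y *\<^sub>R h k)" for k
  have nt: "norm (t k) \<le> r k" for k
    using mult_mono[OF r[of k] norm_h_le_1[of k]] nn by (auto simp: t_def)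
  have sn: "summable (\<lambda>k. norm (t k))" by (rule summable_comparison_test'[OF s, of 0]) (use nt in simp)
  then have st: "summable t" by (rule summable_norm_cancel)
  have "blinfun_apply (phi j) (suminf t) = blinfun_apply (phi j) y" if j: "1 \<le> j" for j
  proof -
    have "blinfun_apply (phi j) (suminf t) = (\<Sum>k. blinfun_apply (phi j) (t k))"
      by (rule bounded_linear.suminf[OF blinfun.bounded_linear_right st])
    also have "(\<lambda>k. blinfun_apply (phi j) (t k)) = (\<lambda>k. if k = j then blinfun_apply (phi j) y else 0)"
      using j by (auto simp: t_def blinfun.scaleR_right phi_h)
    also have "suminf \<dots> = blinfun_apply (phi j) y" by (rule sums_unique[symmetric]) (rule sums_If_finite_set'[of "\<lambda>_. 0" 0 "{j}", simplified], auto)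
    finally show ?thesis .
  qed
  then have "y - suminf t = 0" by (intro phi_total) (simp add: blinfun.diff_right)
  then have "norm y = norm (suminf t)" by simp
  also have "\<dots> \<le> (\<Sum>k. norm (t k))" by (rule summable_norm[OF sn])
  also have "\<dots> \<le> suminf r" by (rule suminf_le[OF nt sn s])
  finally show ?thesis .
qed

end

section \<open>Operators attached to a faithful copy, and Haar multipliers\<close>

context haar_space
begin

definition blk :: "(nat \<Rightarrow> nat) \<Rightarrow> (nat \<Rightarrow> nat \<Rightarrow> real) \<Rightarrow> nat \<Rightarrow> 'y" where
  "blk l \<beta> k = (\<Sum>L\<in>nodes (l k). \<beta> k L *\<^sub>R h L)"

text \<open>\<open>bcoef\<close> as a functional. The factor normalizes it to the value 1 on block
  \<open>k\<close>, which consists of \<open>2 ^ l k / 2 ^ depth k\<close> intervals.\<close>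

definition psi :: "(nat \<Rightarrow> nat) \<Rightarrow> (nat \<Rightarrow> nat \<Rightarrow> real) \<Rightarrow> nat \<Rightarrow> 'y \<Rightarrow>\<^sub>L real" where
  "psi l \<beta> k = (2 ^ depth k / 2 ^ l k) *\<^sub>R (\<Sum>L\<in>nodes (l k). \<beta> k L *\<^sub>R phi L)"

lemma psi_apply: "blinfun_apply (psi l \<beta> k) y
    = 2 ^ depth k / 2 ^ l k * (\<Sum>L\<in>nodes (l k). \<beta> k L * blinfun_apply (phi L) y)"
  by (simp add: psi_def blinfun.scaleR_left blinfun.sum_left)

lemma nodes_subset: "n < m \<Longrightarrow> nodes n \<subseteq> {1..<2 ^ m}"
  using less_pow_iff by (auto simp: nodes_iff_depth)

lemma blk_comb:
  assumes "faithful l \<beta>" "1 \<le> k" "l k < m"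
  shows "blk l \<beta> k = comb m (\<beta> k)"
  unfolding blk_def comb_def
proof (rule sum.mono_neutral_left)
  show "\<forall>i\<in>{1..<2 ^ m} - nodes (l k). \<beta> k i *\<^sub>R h i = 0"
    using faithful.beta_level[OF assms(1,2)] by auto
qed (use nodes_subset[OF assms(3)] in auto)

lemma embedding_operator:
  assumes "faithful l \<beta>"
  obtains B where "\<And>k. 1 \<le> k \<Longrightarrow> blinfun_apply B (h k) = blk l \<beta> k" "norm B \<le> 1"
proof (rule basis_extension[of "blk l \<beta>" 1])
  interpret faithful l \<beta> by fact
  fix n and a :: "nat \<Rightarrow> real"
  obtain m where m: "deep n m" using deep_exists by blast
  have "(\<Sum>k\<in>{1..<2 ^ n}. a k *\<^sub>R blk l \<beta> k) = (\<Sum>k\<in>{1..<2 ^ n}. a k *\<^sub>R comb m (\<beta> k))"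
    by (rule sum.cong) (use blk_comb[OF assms] deepD[OF m] in auto)
  also have "\<dots> = comb m (\<lambda>K. \<Sum>k\<in>{1..<2 ^ n}. a k * \<beta> k K)"
    unfolding comb_def scaleR_sum_right scaleR_sum_left by (subst sum.swap) simp
  finally show "norm (\<Sum>k\<in>{1..<2 ^ n}. a k *\<^sub>R blk l \<beta> k) \<le> 1 * norm (comb n a)"
    using norm_embedding[OF assms m, of a] by simp
qed auto

text \<open>Conditional expectation onto the blocks, followed by the inverse of the embedding. On
  the basis, \<open>h K\<close> goes to a multiple of \<open>h k\<close> if \<open>K\<close> belongs
  to block \<open>k\<close>, and to 0 if it belongs to no block.\<close>

lemma projection_operator:
  assumes "faithful l \<beta>"
  obtains A where "\<And>k y. 1 \<le> k \<Longrightarrow> blinfun_apply (phi k) (blinfun_apply A y) = blinfun_apply (psi l \<beta> k) y"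
    "norm A \<le> 1"
proof -
  interpret faithful l \<beta> by fact
  define S where "S K = {k. 1 \<le> k \<and> \<beta> k K \<noteq> 0}" for K
  have finS: "finite (S K)" for K
  proof -
    have "is_singleton (S K) \<or> S K = {}"
      using beta_disjoint unfolding is_singleton_def S_def by blast
    then show ?thesis by (auto simp: is_singleton_def)
  qed
  define w where "w k = (2::real) ^ depth k / 2 ^ l k" for k
  define g where "g K = (\<Sum>k\<in>S K. (\<beta> k K * w k) *\<^sub>R h k)" for K
  obtain A where A: "\<And>k. 1 \<le> k \<Longrightarrow> blinfun_apply A (h k) = g k" "norm A \<le> 1"
  proof (rule basis_extension[of g 1])
    fix m and c :: "nat \<Rightarrow> real"
    \<comment> \<open>Only finitely many blocks meet the given combination; they have index below
      \<open>n\<close>, hence below \<open>2 ^ n\<close>, and the level is then taken deep enough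
      for all of these.\<close>
    have "finite (\<Union>K\<in>{1..<2 ^ m}. S K)" using finS by auto
    then obtain n where n: "(\<Union>K\<in>{1..<2 ^ m}. S K) \<subseteq> {..<n}" using finite_nat_bounded by blast
    obtain m0 where "deep n m0" using deep_exists by blast
    then have deep: "deep n (max m m0)" using deep_mono by (meson max.cobounded2)
    let ?M = "max m m0"
    let ?c = "\<lambda>k. if k < 2 ^ m then c k else 0"
    have SK: "S K \<subseteq> {1..<2 ^ n}" if "K \<in> {1..<2 ^ m}" for K
    proof
      fix k assume "k \<in> S K"
      then have "1 \<le> k" "k \<in> (\<Union>K\<in>{1..<2 ^ m}. S K)" using that unfolding S_def by blast+
      then have "1 \<le> k" "k < n" using subsetD[OF n] by auto
      moreover have "n < 2 ^ n" by (rule less_exp)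
      ultimately have "1 \<le> k" "k < 2 ^ n" by (simp, meson less_trans)
      then show "k \<in> {1..<2 ^ n}" by simp
    qed
    have gK: "g K = (\<Sum>k\<in>{1..<2 ^ n}. (\<beta> k K * w k) *\<^sub>R h k)" if "K \<in> {1..<2 ^ m}" for K
      unfolding g_def by (rule sum.mono_neutral_left) (use SK[OF that] in \<open>auto simp: S_def\<close>)
    have bc: "bcoef ?c k = (\<Sum>K\<in>{1..<2 ^ m}. c K * (\<beta> k K * w k))" if k: "k \<in> {1..<2 ^ n}" for k
    proof -
      have "(\<Sum>L\<in>nodes (l k). \<beta> k L * ?c L) = (\<Sum>L\<in>nodes (l k) \<inter> {1..<2 ^ m}. \<beta> k L * c L)"
        by (rule sum.mono_neutral_cong_right) (use nodes_ge1 in auto)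
      also have "\<dots> = (\<Sum>L\<in>{1..<2 ^ m}. \<beta> k L * c L)"
        by (rule sum.mono_neutral_left) (use beta_level[of k] k in auto)
      finally show ?thesis by (simp add: bcoef_def w_def sum_distrib_left sum_divide_distrib mult_ac)
    qed
    have "(\<Sum>K\<in>{1..<2 ^ m}. c K *\<^sub>R g K) = (\<Sum>K\<in>{1..<2 ^ m}. \<Sum>k\<in>{1..<2 ^ n}. (c K * (\<beta> k K * w k)) *\<^sub>R h k)"
      by (rule sum.cong) (simp_all add: gK scaleR_sum_right)
    also have "\<dots> = (\<Sum>k\<in>{1..<2 ^ n}. \<Sum>K\<in>{1..<2 ^ m}. (c K * (\<beta> k K * w k)) *\<^sub>R h k)" by (rule sum.swap)
    also have "\<dots> = comb n (bcoef ?c)"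
      unfolding comb_def by (rule sum.cong) (simp_all add: bc scaleR_sum_left)
    finally show "norm (\<Sum>K\<in>{1..<2 ^ m}. c K *\<^sub>R g K) \<le> 1 * norm (comb m c)"
      using norm_projection[OF assms deep, of ?c] comb_extend[of m ?M c] by simp
  qed auto
  show ?thesis
  proof
    fix k :: nat and y assume k: "1 \<le> k"
    have "phi k o\<^sub>L A = psi l \<beta> k"
    proof (rule blinfun_eq_dense)
      fix K :: nat assume K: "1 \<le> K"
      have "blinfun_apply (phi k o\<^sub>L A) (h K) = (\<Sum>j\<in>S K. \<beta> j K * w j * (if j = k then 1 else 0))"
      proof -
        have "blinfun_apply (phi k o\<^sub>L A) (h K) = (\<Sum>j\<in>S K. \<beta> j K * w j * blinfun_apply (phi k) (h j))"
          using A(1)[OF K] by (simp add: g_def blinfun.sum_right blinfun.scaleR_right)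
        also have "\<dots> = (\<Sum>j\<in>S K. \<beta> j K * w j * (if j = k then 1 else 0))"
          by (rule sum.cong[OF refl], subst phi_h[OF k]) (auto simp: S_def)
        finally show ?thesis .
      qed
      also have "\<dots> = (\<Sum>j\<in>S K. if j = k then \<beta> k K * w k else 0)" by (rule sum.cong) auto
      also have "\<dots> = \<beta> k K * w k" using finS[of K] k by (auto simp: S_def)
      also have "\<dots> = w k * (\<Sum>L\<in>nodes (l k). if L = K then \<beta> k K else 0)"
        using beta_level[OF k, of K] by auto
      also have "(\<Sum>L\<in>nodes (l k). if L = K then \<beta> k K else 0) = (\<Sum>L\<in>nodes (l k). \<beta> k L * blinfun_apply (phi L) (h K))"
        by (rule sum.cong) (use phi_h[OF nodes_ge1 K] in auto)
      finally show "blinfun_apply (phi k o\<^sub>L A) (h K) = blinfun_apply (psi l \<beta> k) (h K)"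
        by (simp add: psi_apply w_def)
    qed
    then show "blinfun_apply (phi k) (blinfun_apply A y) = blinfun_apply (psi l \<beta> k) y"
      by (metis blinfun_apply_blinfun_compose)
  qed (rule A(2))
qed

text \<open>For \<open>K\<close> strictly deeper than \<open>j\<close>, the number
  \<open>hs j K\<close> is the constant value of h_j on the support of h_K. Termwise this is
  multiplication by the value of h_j at \<open>p\<close>; the other terms vanish.\<close>

lemma V_hs_mult:
  assumes "1 \<le> j" "p \<in> nodes m"
  shows "V m (\<lambda>K. hs j K * c K) p \<le> V m (\<lambda>K. if depth j < depth K then c K else 0) p"
proof -
  let ?d = "\<lambda>K. if depth j < depth K then c K else 0"
  have eq: "hs j K * hs K p = hs j p * (if depth j < depth K then 1 else 0) * hs K p" if "1 \<le> K" for K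
  proof (cases "hs K p = 0")
    case False
    have K: "K \<in> nodes (depth K)" and j: "j \<in> nodes (depth j)" using that assms(1) in_nodes_depth by auto
    have anc: "depth K < m" "K = p div 2 ^ (m - depth K)" using hs_nonzero_ancestor[OF False K assms(2)] by auto
    show ?thesis
    proof (cases "depth j < depth K")
      case True
      then have "hs j p = hs j K" using hs_div[OF j assms(2) True] anc by simp
      then show ?thesis using True by simp
    next
      case False
      then have "hs j K = 0" using hs_eq_0[OF j K] by simp
      then show ?thesis using False by simp
    qed
  qed simp
  have "V m (\<lambda>K. hs j K * c K) p = W ind {1..<2 ^ m} (\<lambda>K. hs j p * (?d K * hs K p))"
    unfolding V_def
  proof (rule W_cong)
    fix K :: nat assume "K \<in> {1..<2 ^ m}"
    then have "hs j K * hs K p = hs j p * (if depth j < depth K then 1 else 0) * hs K p" by (intro eq) simp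
    then have "c K * (hs j K * hs K p) = c K * (hs j p * (if depth j < depth K then 1 else 0) * hs K p)" by (rule arg_cong)
    then show "hs j K * c K * hs K p = hs j p * (?d K * hs K p)" by (auto simp: mult_ac split: if_splits)
  qed
  also have "\<dots> = \<bar>hs j p\<bar> * V m ?d p" unfolding V_def by (rule W_scale)
  also have "\<dots> \<le> V m ?d p" using mult_right_mono[OF hs_abs_le V_nonneg] by simp
  finally show ?thesis .
qed

text \<open>The factor 2 pays for removing the levels up to \<open>depth j\<close>, that is, for
  subtracting a contractive partial sum.\<close>

lemma norm_hs_mult:
  assumes "1 \<le> j"
  shows "norm (comb m (\<lambda>K. hs j K * c K)) \<le> 2 * norm (comb m c)"
proof (cases "depth j < m")
  case True
  let ?d = "\<lambda>K. if depth j < depth K then c K else 0"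
  have "norm (comb m (\<lambda>K. hs j K * c K)) \<le> norm (comb m ?d)"
    unfolding norm_comb_V by (rule N_mono) (use V_hs_mult[OF assms] V_nonneg in \<open>auto simp: abs_of_nonneg\<close>)
  also have "comb m ?d = comb m c + (-1) *\<^sub>R comb (Suc (depth j)) c"
  proof -
    have "comb (Suc (depth j)) c = comb m (\<lambda>k. if k < 2 ^ Suc (depth j) then c k else 0)"
      by (rule comb_extend) (use True in simp)
    then have "comb m c + (-1) *\<^sub>R comb (Suc (depth j)) c
        = comb m (\<lambda>k. c k + (-1) * (if k < 2 ^ Suc (depth j) then c k else 0))"
      by (simp only: comb_add comb_scale)
    also have "\<dots> = comb m ?d"
      by (rule comb_cong) (use less_pow_iff[of _ "Suc (depth j)"] in \<open>auto simp del: power_Suc\<close>)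
    finally show ?thesis by (rule sym)
  qed
  also have "norm \<dots> \<le> norm (comb m c) + norm (comb (Suc (depth j)) c)"
    using norm_triangle_ineq4[of "comb m c" "comb (Suc (depth j)) c"] by simp
  also have "\<dots> \<le> 2 * norm (comb m c)" using norm_comb_truncate[of "Suc (depth j)" m c] True by simp
  finally show ?thesis .
next
  case False
  have "comb m (\<lambda>K. hs j K * c K) = 0"
    unfolding comb_def
  proof (rule sum.neutral, rule ballI)
    fix K :: nat assume "K \<in> {1..<2 ^ m}"
    then have "1 \<le> K" "depth K < m" using less_pow_iff by auto
    then have "hs j K = 0" using hs_eq_0[OF in_nodes_depth[OF assms] in_nodes_depth, of K] False by simp
    then show "(hs j K * c K) *\<^sub>R h K = 0" by simp
  qed
  then show ?thesis by simp
qed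

text \<open>On a conditional basis bounded entries would not give a bounded operator. Here the
  multiplier is an absolutely convergent sum of the operators of
  \<open>norm_hs_mult\<close>.\<close>

lemma multiplier_operator:
  assumes "summable d" "\<And>j. 0 \<le> d j" "\<And>j. \<bar>\<delta> j\<bar> \<le> d j"
  obtains D where "\<And>k. 1 \<le> k \<Longrightarrow> blinfun_apply D (h k) = (\<Sum>j\<in>{1..<k}. \<delta> j * hs j k) *\<^sub>R h k"
    "norm D \<le> 2 * suminf d"
proof (rule basis_extension[of "\<lambda>k. (\<Sum>j\<in>{1..<k}. \<delta> j * hs j k) *\<^sub>R h k" "2 * suminf d"])
  fix m and c :: "nat \<Rightarrow> real"
  have "(\<Sum>k\<in>{1..<2 ^ m}. c k *\<^sub>R ((\<Sum>j\<in>{1..<k}. \<delta> j * hs j k) *\<^sub>R h k))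
      = (\<Sum>k\<in>{1..<2 ^ m}. \<Sum>j\<in>{1..<2 ^ m}. (\<delta> j * (hs j k * c k)) *\<^sub>R h k)"
  proof (rule sum.cong)
    fix k :: nat assume k: "k \<in> {1..<2 ^ m}"
    have "(\<Sum>j\<in>{1..<k}. \<delta> j * hs j k) = (\<Sum>j\<in>{1..<2 ^ m}. \<delta> j * hs j k)"
    proof (rule sum.mono_neutral_left)
      show "\<forall>i\<in>{1..<2 ^ m} - {1..<k}. \<delta> i * hs i k = 0"
      proof
        fix i assume "i \<in> {1..<2 ^ m} - {1..<k}"
        then have "\<not> 2 * i \<le> k" by auto
        then show "\<delta> i * hs i k = 0" using hs_nonzero_le by (metis mult_zero_right)
      qed
    qed (use k in auto)
    then show "c k *\<^sub>R ((\<Sum>j\<in>{1..<k}. \<delta> j * hs j k) *\<^sub>R h k)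
        = (\<Sum>j\<in>{1..<2 ^ m}. (\<delta> j * (hs j k * c k)) *\<^sub>R h k)"
      by (simp add: scaleR_sum_left[symmetric] sum_distrib_left mult_ac)
  qed simp
  also have "\<dots> = (\<Sum>j\<in>{1..<2 ^ m}. \<delta> j *\<^sub>R comb m (\<lambda>k. hs j k * c k))"
    unfolding comb_def scaleR_sum_right by (subst sum.swap) simp
  finally have "norm (\<Sum>k\<in>{1..<2 ^ m}. c k *\<^sub>R ((\<Sum>j\<in>{1..<k}. \<delta> j * hs j k) *\<^sub>R h k))
      \<le> (\<Sum>j\<in>{1..<2 ^ m}. norm (\<delta> j *\<^sub>R comb m (\<lambda>k. hs j k * c k)))"
    by (simp only: norm_sum)
  also have "\<dots> \<le> (\<Sum>j\<in>{1..<2 ^ m}. d j * (2 * norm (comb m c)))"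
    unfolding norm_scaleR by (intro sum_mono mult_mono assms norm_hs_mult) auto
  also have "\<dots> = (\<Sum>j\<in>{1..<2 ^ m}. d j) * (2 * norm (comb m c))" by (simp add: sum_distrib_right)
  also have "\<dots> \<le> suminf d * (2 * norm (comb m c))"
    by (intro mult_right_mono sum_le_suminf assms) (auto simp: assms)
  finally show "norm (\<Sum>k\<in>{1..<2 ^ m}. c k *\<^sub>R ((\<Sum>j\<in>{1..<k}. \<delta> j * hs j k) *\<^sub>R h k))
      \<le> 2 * suminf d * norm (comb m c)" by (simp add: mult_ac)
qed (auto intro!: suminf_nonneg assms)

end

section \<open>Weakly null Rademacher functions\<close>

text \<open>A tree automorphism: it exchanges the halves of \<open>q\<close> exactly if
  \<open>s q\<close> is not 1. For signs \<open>s\<close> this turns the function \<open>s K\<close>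
  times h_K into the Haar function of the image interval.\<close>

fun flip :: "(nat \<Rightarrow> real) \<Rightarrow> nat \<Rightarrow> nat" where
  "flip s p = (if p \<le> 1 then 1 else
     2 * flip s (p div 2) + (if even p \<longleftrightarrow> s (p div 2) = 1 then 0 else 1))"

declare flip.simps [simp del]

definition flip_beta :: "(nat \<Rightarrow> real) \<Rightarrow> nat \<Rightarrow> nat \<Rightarrow> real" where
  "flip_beta s k K = (if K \<in> nodes (depth k) \<and> flip s K = k then s K else 0)"

lemma flip_nodes: "p \<in> nodes n \<Longrightarrow> flip s p \<in> nodes n"
proof (induction n arbitrary: p)
  case 0
  then show ?case by (simp add: flip.simps)
next
  case (Suc n)
  have "\<not> p \<le> 1" using depth_nodes[OF Suc.prems] by (auto simp: depth.simps)
  moreover have "flip s (p div 2) \<in> nodes n" using Suc nodes_Suc_div by blast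
  ultimately show ?case using nodes_children by (subst flip.simps) auto
qed

lemma tau_flip:
  assumes s: "\<And>k. s k = 1 \<or> s k = -1" and "p \<in> nodes m" "n \<le> m"
  shows "tau depth (flip_beta s) n p = flip s (p div 2 ^ (m - n))"
  using assms(3)
proof (induction n)
  case 0
  have "p div 2 ^ (m - 0) \<in> nodes 0" by (rule nodes_div[OF assms(2)]) simp
  then have "p div 2 ^ (m - 0) = 1" by simp
  then show ?case by (simp only: tau.simps flip.simps[of s 1]) simp
next
  case (Suc n)
  let ?r = "p div 2 ^ (m - n)" and ?q = "p div 2 ^ (m - Suc n)"
  have i: "?r \<in> nodes n" "?q \<in> nodes (Suc n)" using nodes_div[OF assms(2)] Suc.prems by auto
  have qi: "?q div 2 = ?r" using Suc.prems by (simp add: div_mult2_eq[symmetric] Suc_diff_Suc flip: power_Suc2)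
  have q1: "\<not> ?q \<le> 1" using depth_nodes[OF i(2)] by (auto simp: depth.simps)
  have fl: "depth (flip s ?r) = n" by (rule depth_nodes[OF flip_nodes[OF i(1)]])
  have "bval depth (flip_beta s) (flip s ?r) p = flip_beta s (flip s ?r) ?r * hs ?r p"
    unfolding bval_def fl by (rule sum_nodes_hs[OF assms(2)]) (use Suc.prems in simp)
  also have "\<dots> = s ?r * hs ?r ?q"
    using i(1) hs_div[OF i(1) assms(2), of "Suc n"] Suc.prems by (simp add: flip_beta_def fl)
  also have "hs ?r ?q = (if even ?q then 1 else -1)" using q1 qi by (subst hs.simps) auto
  finally have "bval depth (flip_beta s) (flip s ?r) p = 1 \<longleftrightarrow> (even ?q \<longleftrightarrow> s ?r = 1)"
    using s[of ?r] by auto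
  moreover have "flip s ?q = 2 * flip s ?r + (if even ?q \<longleftrightarrow> s ?r = 1 then 0 else 1)"
    using q1 qi by (subst flip.simps) simp
  ultimately show ?case using Suc by simp
qed

lemma faithful_flip:
  assumes s: "\<And>k. s k = 1 \<or> s k = -1"
  shows "faithful depth (flip_beta s)"
proof
  fix n j k :: nat assume "1 \<le> j" "j < 2 ^ n" "k \<in> nodes n"
  then show "depth j < depth k" using less_pow_iff depth_nodes by metis
next
  fix n k K :: nat assume k: "k \<in> nodes n"
  have "tau depth (flip_beta s) n K = flip s K" if "K \<in> nodes n" using tau_flip[OF s that, of n] by simp
  then show "flip_beta s k K \<in> (if K \<in> nodes (depth k) \<and> tau depth (flip_beta s) n K = k then {1, -1} else {0})"
    using s[of K] depth_nodes[OF k] by (auto simp: flip_beta_def)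
qed

locale haar_space_wn = haar_space Nn ind h for Nn ind and h :: "nat \<Rightarrow> 'y::banach" +
  assumes weak_null: "\<And>f :: 'y \<Rightarrow>\<^sub>L real. (\<lambda>n. blinfun_apply f (\<Sum>k\<in>nodes n. h k)) \<longlonglongrightarrow> 0"
begin

text \<open>
  A tree automorphism adapted to the signs of \<open>f h\<^sub>K\<close> turns the Rademacher functions into functions on
  which \<open>f\<close> attains the sum of the absolute values.
\<close>

lemma weak_null_abs:
  fixes f :: "'y \<Rightarrow>\<^sub>L real"
  shows "(\<lambda>n. \<Sum>K\<in>nodes n. \<bar>blinfun_apply f (h K)\<bar>) \<longlonglongrightarrow> 0"
proof -
  define s where "s K = (if 0 \<le> blinfun_apply f (h K) then 1 else -1 :: real)" for K
  have s: "s k = 1 \<or> s k = -1" for k by (simp add: s_def)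
  interpret faithful depth "flip_beta s" by (rule faithful_flip[OF s])
  obtain B where B: "\<And>k. 1 \<le> k \<Longrightarrow> blinfun_apply B (h k) = blk depth (flip_beta s) k"
    by (rule embedding_operator[OF faithful_axioms]) blast
  have "blinfun_apply (f o\<^sub>L B) (\<Sum>k\<in>nodes n. h k) = (\<Sum>K\<in>nodes n. \<bar>blinfun_apply f (h K)\<bar>)" for n
  proof -
    have "(\<Sum>k\<in>nodes n. blk depth (flip_beta s) k) = (\<Sum>k\<in>nodes n. \<Sum>K\<in>nodes n. if flip s K = k then s K *\<^sub>R h K else 0)"
      unfolding blk_def by (intro sum.cong) (auto simp: flip_beta_def depth_nodes)
    also have "\<dots> = (\<Sum>K\<in>nodes n. \<Sum>k\<in>nodes n. if flip s K = k then s K *\<^sub>R h K else 0)" by (rule sum.swap)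
    also have "\<dots> = (\<Sum>K\<in>nodes n. s K *\<^sub>R h K)" by (intro sum.cong) (use flip_nodes in auto)
    finally have "blinfun_apply f (\<Sum>k\<in>nodes n. blk depth (flip_beta s) k) = (\<Sum>K\<in>nodes n. s K * blinfun_apply f (h K))"
      by (simp add: blinfun.sum_right blinfun.scaleR_right)
    also have "\<dots> = (\<Sum>K\<in>nodes n. \<bar>blinfun_apply f (h K)\<bar>)" by (rule sum.cong) (auto simp: s_def)
    finally show ?thesis using B nodes_ge1 by (simp add: blinfun.sum_right)
  qed
  then show ?thesis using weak_null[of "f o\<^sub>L B"] by simp
qed

end

section \<open>Random signs\<close>

lemma sum_sgn_square:
  fixes u :: "nat \<Rightarrow> real"
  assumes "finite X"
  shows "(\<Sum>Z\<in>Pow X. (\<Sum>K\<in>X. sgn_of Z K * u K)\<^sup>2) = 2 ^ card X * (\<Sum>K\<in>X. (u K)\<^sup>2)"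
  using assms
proof (induction X rule: finite_induct)
  case (insert k X)
  have "(\<Sum>K\<in>insert k X. sgn_of Z K * u K)\<^sup>2 + (\<Sum>K\<in>insert k X. sgn_of (insert k Z) K * u K)\<^sup>2
      = 2 * (\<Sum>K\<in>X. sgn_of Z K * u K)\<^sup>2 + 2 * (u k)\<^sup>2" if Z: "Z \<in> Pow X" for Z
  proof -
    have "k \<notin> Z" "Z \<subseteq> X" using Z insert.hyps by auto
    then have "(\<Sum>K\<in>insert k X. sgn_of Z K * u K) = (\<Sum>K\<in>X. sgn_of Z K * u K) + u k"
      "(\<Sum>K\<in>insert k X. sgn_of (insert k Z) K * u K) = (\<Sum>K\<in>X. sgn_of Z K * u K) - u k"
      using insert.hyps by (simp_all add: sgn_of_insert) (simp_all add: sgn_of_def)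
    then show ?thesis by (simp only: power2_sum power2_diff)
  qed
  then have "(\<Sum>Z\<in>Pow (insert k X). (\<Sum>K\<in>insert k X. sgn_of Z K * u K)\<^sup>2)
      = (\<Sum>Z\<in>Pow X. 2 * (\<Sum>K\<in>X. sgn_of Z K * u K)\<^sup>2 + 2 * (u k)\<^sup>2)"
    unfolding sum_Pow_insert[OF insert.hyps] by (rule sum.cong[OF refl])
  also have "\<dots> = 2 * (2 ^ card X * (\<Sum>K\<in>X. (u K)\<^sup>2)) + 2 ^ card X * (2 * (u k)\<^sup>2)"
    using insert.hyps by (simp add: sum.distrib sum_distrib_left[symmetric] insert.IH card_Pow)
  finally show ?case using insert.hyps by (simp add: algebra_simps)
qed simp

definition offdiag :: "nat set \<Rightarrow> (nat \<Rightarrow> nat \<Rightarrow> real) \<Rightarrow> nat set \<Rightarrow> real" where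
  "offdiag X t Z = (\<Sum>K\<in>X. \<Sum>L\<in>X. if K = L then 0 else sgn_of Z K * sgn_of Z L * t K L)"

lemma offdiag_insert:
  assumes "finite X" "k \<notin> X" "Z \<subseteq> X"
  shows "offdiag (insert k X) t Z = offdiag X t Z + (\<Sum>L\<in>X. sgn_of Z L * (t k L + t L k))"
    and "offdiag (insert k X) t (insert k Z) = offdiag X t Z - (\<Sum>L\<in>X. sgn_of Z L * (t k L + t L k))"
proof -
  have ex: "offdiag (insert k X) t Y = offdiag X t Y + sgn_of Y k * (\<Sum>L\<in>X. sgn_of Y L * (t k L + t L k))" for Y
  proof -
    have "(\<Sum>L\<in>insert k X. if k = L then 0 else sgn_of Y k * sgn_of Y L * t k L)
        = (\<Sum>L\<in>X. sgn_of Y k * sgn_of Y L * t k L)"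
    proof -
      have "(\<Sum>L\<in>X. if k = L then 0 else sgn_of Y k * sgn_of Y L * t k L) = (\<Sum>L\<in>X. sgn_of Y k * sgn_of Y L * t k L)"
        by (rule sum.cong) (use assms(2) in auto)
      then show ?thesis using assms by simp
    qed
    moreover have "(\<Sum>K\<in>X. \<Sum>L\<in>insert k X. if K = L then 0 else sgn_of Y K * sgn_of Y L * t K L)
        = (\<Sum>K\<in>X. sgn_of Y K * sgn_of Y k * t K k) + offdiag X t Y"
      unfolding offdiag_def sum.distrib[symmetric]
      by (rule sum.cong) (use assms in auto)
    ultimately show ?thesis
      unfolding offdiag_def[of "insert k X"] using assms
      by (simp add: sum_distrib_left distrib_left sum.distrib mult_ac)
  qed
  have "k \<notin> Z" using assms by auto
  then show "offdiag (insert k X) t Z = offdiag X t Z + (\<Sum>L\<in>X. sgn_of Z L * (t k L + t L k))"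
    unfolding ex by (simp add: sgn_of_def)
  have *: "sgn_of (insert k Z) K = sgn_of Z K" if "K \<in> X" for K using that assms(2) by (auto simp: sgn_of_def)
  have "offdiag X t (insert k Z) = offdiag X t Z"
    unfolding offdiag_def by (intro sum.cong) (auto simp: *)
  moreover have "(\<Sum>L\<in>X. sgn_of (insert k Z) L * (t k L + t L k)) = (\<Sum>L\<in>X. sgn_of Z L * (t k L + t L k))"
    by (rule sum.cong) (auto simp: *)
  ultimately show "offdiag (insert k X) t (insert k Z) = offdiag X t Z - (\<Sum>L\<in>X. sgn_of Z L * (t k L + t L k))"
    unfolding ex by (simp add: sgn_of_def)
qed

text \<open>The second moment of a quadratic form in independent signs. A new sign multiplies a
  linear form in the others, the mixed term cancels between its two values, and the square of a sum
  is at most twice the sum of the squares.\<close>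

lemma sum_offdiag_square:
  assumes "finite X"
  shows "(\<Sum>Z\<in>Pow X. (offdiag X t Z)\<^sup>2) \<le> 2 ^ card X * (2 * (\<Sum>K\<in>X. \<Sum>L\<in>X. (t K L)\<^sup>2))"
  using assms
proof (induction X rule: finite_induct)
  case (insert k X)
  let ?l = "\<lambda>Z. \<Sum>L\<in>X. sgn_of Z L * (t k L + t L k)"
  have "(\<Sum>Z\<in>Pow (insert k X). (offdiag (insert k X) t Z)\<^sup>2)
      = (\<Sum>Z\<in>Pow X. 2 * (offdiag X t Z)\<^sup>2 + 2 * (?l Z)\<^sup>2)"
    unfolding sum_Pow_insert[OF insert.hyps]
  proof (rule sum.cong)
    fix Z assume "Z \<in> Pow X"
    then have Z: "Z \<subseteq> X" by simp
    show "(offdiag (insert k X) t Z)\<^sup>2 + (offdiag (insert k X) t (insert k Z))\<^sup>2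
        = 2 * (offdiag X t Z)\<^sup>2 + 2 * (?l Z)\<^sup>2"
      unfolding offdiag_insert[OF insert.hyps Z] by (simp add: power2_eq_square algebra_simps)
  qed simp
  also have "\<dots> = 2 * (\<Sum>Z\<in>Pow X. (offdiag X t Z)\<^sup>2) + 2 * (2 ^ card X * (\<Sum>L\<in>X. (t k L + t L k)\<^sup>2))"
    unfolding sum.distrib sum_distrib_left[symmetric] sum_sgn_square[OF insert.hyps(1)] ..
  also have "\<dots> \<le> 2 * (2 ^ card X * (2 * (\<Sum>K\<in>X. \<Sum>L\<in>X. (t K L)\<^sup>2)))
      + 2 * (2 ^ card X * (\<Sum>L\<in>X. 2 * (t k L)\<^sup>2 + 2 * (t L k)\<^sup>2))"
  proof (intro add_mono mult_left_mono sum_mono)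
    fix L show "(t k L + t L k)\<^sup>2 \<le> 2 * (t k L)\<^sup>2 + 2 * (t L k)\<^sup>2"
      using zero_le_power2[of "t k L - t L k"] by (simp add: power2_eq_square algebra_simps)
  qed (use insert.IH in auto)
  also have "\<dots> = 2 ^ card (insert k X) * (2 * ((\<Sum>K\<in>X. \<Sum>L\<in>X. (t K L)\<^sup>2) + (\<Sum>L\<in>X. (t k L)\<^sup>2) + (\<Sum>L\<in>X. (t L k)\<^sup>2)))"
    using insert.hyps by (simp add: sum.distrib sum_distrib_left[symmetric] algebra_simps)
  also have "\<dots> \<le> 2 ^ card (insert k X) * (2 * (\<Sum>K\<in>insert k X. \<Sum>L\<in>insert k X. (t K L)\<^sup>2))"
    using insert.hyps by (intro mult_left_mono) (simp_all add: sum.distrib)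
  finally show ?case .
qed (simp add: offdiag_def)

text \<open>Averaging the sum of the two squares yields one choice of signs that serves both
  expressions.\<close>

lemma exists_signs:
  fixes u :: "nat \<Rightarrow> real"
  assumes "finite X"
  obtains Z where "Z \<subseteq> X"
    "(offdiag X t Z)\<^sup>2 + (\<Sum>K\<in>X. sgn_of Z K * u K)\<^sup>2
      \<le> 2 * (\<Sum>K\<in>X. \<Sum>L\<in>X. (t K L)\<^sup>2) + (\<Sum>K\<in>X. (u K)\<^sup>2)"
proof -
  let ?F = "\<lambda>Z. (offdiag X t Z)\<^sup>2 + (\<Sum>K\<in>X. sgn_of Z K * u K)\<^sup>2"
  let ?R = "2 * (\<Sum>K\<in>X. \<Sum>L\<in>X. (t K L)\<^sup>2) + (\<Sum>K\<in>X. (u K)\<^sup>2)"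
  have "\<exists>Z\<in>Pow X. ?F Z \<le> ?R"
  proof (rule ccontr)
    assume "\<not> (\<exists>Z\<in>Pow X. ?F Z \<le> ?R)"
    then have "(\<Sum>Z\<in>Pow X. ?R) < (\<Sum>Z\<in>Pow X. ?F Z)"
      using assms by (intro sum_strict_mono) (auto simp: not_le)
    then have "2 ^ card X * ?R < (\<Sum>Z\<in>Pow X. ?F Z)" using assms by (simp add: card_Pow)
    also have "\<dots> \<le> 2 ^ card X * ?R"
      unfolding sum.distrib sum_sgn_square[OF assms] using sum_offdiag_square[OF assms, of t]
      by (simp add: distrib_left)
    finally show False by simp
  qed
  then show ?thesis using that by blast
qed

section \<open>Choosing a block\<close>

context haar_space
begin

text \<open>Division by \<open>2 ^ n\<close> turns \<open>phi K\<close> into integration against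
  h_K. For \<open>n\<close> at least \<open>depth k\<close>, the condition on \<open>tau\<close>
  says that \<open>K\<close> lies in the interval \<open>k\<close>.\<close>

definition diag_sum :: "('y \<Rightarrow>\<^sub>L 'y) \<Rightarrow> nat \<Rightarrow> nat \<Rightarrow> real" where
  "diag_sum S n k = (\<Sum>K\<in>nodes n. if tau depth id_beta (depth k) K = k then blinfun_apply (phi K) (blinfun_apply S (h K)) else 0) / 2 ^ n"

text \<open>
  \<open>g k\<close> is a limit, along a subsequence of levels, of \<open>\<Sum> \<langle>h\<^sub>K, S h\<^sub>K\<rangle>\<close> over the intervals \<open>K\<close> of a
  level that are contained in the \<open>k\<close>-th interval.
\<close>

definition diag_lim :: "('y \<Rightarrow>\<^sub>L 'y) \<Rightarrow> (nat \<Rightarrow> real) \<Rightarrow> bool" where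
  "diag_lim S g \<longleftrightarrow> (\<exists>s. strict_mono s \<and> (\<forall>k\<ge>1. (\<lambda>n. diag_sum S (s n) k) \<longlonglongrightarrow> g k))"

text \<open>Haar functions of one level have equal norms, so the norm of \<open>h L\<close> cancels
  against the one in the bound for \<open>phi K\<close>.\<close>

lemma phi_S_h:
  assumes "K \<in> nodes n" "L \<in> nodes n"
  shows "\<bar>blinfun_apply (phi K) (blinfun_apply S (h L))\<bar> \<le> norm S"
proof -
  have K: "1 \<le> K" by (rule nodes_ge1[OF assms(1)])
  have "\<bar>blinfun_apply (phi K) (blinfun_apply S (h L))\<bar> * norm (h K) \<le> norm S * norm (h K)"
    using phi_norm_h[OF K, of "blinfun_apply S (h L)"] norm_blinfun[of S "h L"] norm_h_level[OF assms] by simp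
  then show ?thesis using norm_h_pos[OF K] by simp
qed

lemma diag_sum_bound: "1 \<le> k \<Longrightarrow> depth k \<le> n \<Longrightarrow> \<bar>diag_sum S n k\<bar> \<le> norm S / 2 ^ depth k"
proof -
  assume k: "1 \<le> k" "depth k \<le> n"
  let ?P = "\<lambda>K. tau depth id_beta (depth k) K = k"
  have deep: "id_sys.deep (depth k) n" using id_sys.deep_mono[OF deep_id k(2)] .
  have card: "2 ^ depth k * card {K \<in> nodes n. ?P K} = 2 ^ n"
    by (rule id_sys.card_fiber[OF deep in_nodes_depth[OF k(1)]])
  have "\<bar>\<Sum>K\<in>nodes n. if ?P K then blinfun_apply (phi K) (blinfun_apply S (h K)) else 0\<bar>
      \<le> (\<Sum>K\<in>nodes n. if ?P K then norm S else 0)"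
    by (rule order_trans[OF sum_abs sum_mono]) (use phi_S_h in auto)
  also have "\<dots> = norm S * card {K \<in> nodes n. ?P K}" by (simp add: sum.If_cases Int_def mult.commute)
  also have "real (card {K \<in> nodes n. ?P K}) = 2 ^ n / 2 ^ depth k"
    using arg_cong[OF card, of real] by (simp add: field_simps)
  finally show ?thesis by (simp add: diag_sum_def field_simps)
qed

lemma diag_sum_additive:
  assumes "1 \<le> k" "depth k < n"
  shows "diag_sum S n k = diag_sum S n (2 * k) + diag_sum S n (2 * k + 1)"
  unfolding diag_sum_def add_divide_distrib[symmetric] sum.distrib[symmetric]
proof (intro arg_cong2[where f = "(/)"] sum.cong refl)
  fix K assume K: "K \<in> nodes n"
  let ?i = "tau depth id_beta (depth k) K"
  have "2 * a \<noteq> Suc (2 * b)" for a b :: nat by presburger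
  moreover have "Suc (2 * b) \<noteq> 2 * a" for a b :: nat by presburger
  ultimately show "(if tau depth id_beta (depth k) K = k then blinfun_apply (phi K) (blinfun_apply S (h K)) else 0)
    = (if tau depth id_beta (depth (2 * k)) K = 2 * k then blinfun_apply (phi K) (blinfun_apply S (h K)) else 0)
      + (if tau depth id_beta (depth (2 * k + 1)) K = 2 * k + 1 then blinfun_apply (phi K) (blinfun_apply S (h K)) else 0)"
    using assms(1) by simp
qed

text \<open>A diagonal sequence argument for countably many bounded sequences, one for each
  \<open>k\<close>.\<close>

lemma diag_lim_exists: "\<exists>g. diag_lim S g"
proof -
  have b: "\<bar>diag_sum S n k\<bar> \<le> norm S" if "k \<in> {1..}" for n k
  proof (cases "depth k \<le> n")
    case True
    then have "\<bar>diag_sum S n k\<bar> \<le> norm S / 2 ^ depth k" using diag_sum_bound[of k n S] that by simp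
    also have "\<dots> \<le> norm S" using mult_left_mono[of 1 "2 ^ depth k" "norm S"] by (simp add: divide_le_eq)
    finally show ?thesis .
  next
    case False
    have "\<bar>\<Sum>K\<in>nodes n. if tau depth id_beta (depth k) K = k then blinfun_apply (phi K) (blinfun_apply S (h K)) else 0\<bar>
        \<le> (\<Sum>K\<in>nodes n. norm S)"
      by (rule order_trans[OF sum_abs sum_mono]) (use phi_S_h in auto)
    then show ?thesis by (simp add: diag_sum_def field_simps)
  qed
  obtain s where s: "strict_mono (s :: nat \<Rightarrow> nat)" "\<And>k. k \<in> {1..} \<Longrightarrow> \<exists>l. (\<lambda>n. diag_sum S (s n) k) \<longlonglongrightarrow> l"
  proof (rule function_convergent_subsequence[of "{1..} :: nat set" "diag_sum S" "norm S"])
    show "norm (diag_sum S n k) \<le> norm S" if "k \<in> {1..}" for n k using b[OF that] by simp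
  qed auto
  then obtain g where "\<And>k. k \<in> {1..} \<Longrightarrow> (\<lambda>n. diag_sum S (s n) k) \<longlonglongrightarrow> g k" by metis
  then show ?thesis using s(1) unfolding diag_lim_def by auto
qed

lemma diag_lim_additive:
  assumes "diag_lim S g" "1 \<le> k"
  shows "g k = g (2 * k) + g (2 * k + 1)"
proof -
  obtain s where s: "strict_mono s" "\<And>k. 1 \<le> k \<Longrightarrow> (\<lambda>n. diag_sum S (s n) k) \<longlonglongrightarrow> g k"
    using assms(1) unfolding diag_lim_def by auto
  have "(\<lambda>n. diag_sum S (s n) (2 * k) + diag_sum S (s n) (2 * k + 1)) \<longlonglongrightarrow> g (2 * k) + g (2 * k + 1)"
    by (intro tendsto_add s(2)) (use assms in auto)
  moreover have "\<forall>\<^sub>F n in sequentially. diag_sum S (s n) (2 * k) + diag_sum S (s n) (2 * k + 1) = diag_sum S (s n) k"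
    unfolding eventually_sequentially
  proof (intro exI[of _ "Suc (depth k)"] allI impI)
    fix n assume "Suc (depth k) \<le> n"
    then have "depth k < s n" using seq_suble[OF s(1), of n] by simp
    then show "diag_sum S (s n) (2 * k) + diag_sum S (s n) (2 * k + 1) = diag_sum S (s n) k"
      using diag_sum_additive[OF assms(2)] by simp
  qed
  ultimately have "(\<lambda>n. diag_sum S (s n) k) \<longlonglongrightarrow> g (2 * k) + g (2 * k + 1)"
    using tendsto_cong by fast
  then show ?thesis using s(2)[OF assms(2)] LIMSEQ_unique by blast
qed

lemma diag_lim_bound:
  assumes "diag_lim S g" "1 \<le> k"
  shows "\<bar>g k\<bar> \<le> norm S / 2 ^ depth k"
proof -
  obtain s where s: "strict_mono s" "\<And>k. 1 \<le> k \<Longrightarrow> (\<lambda>n. diag_sum S (s n) k) \<longlonglongrightarrow> g k"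
    using assms(1) unfolding diag_lim_def by auto
  have "(\<lambda>n. \<bar>diag_sum S (s n) k\<bar>) \<longlonglongrightarrow> \<bar>g k\<bar>" by (intro tendsto_rabs s assms)
  moreover have "\<exists>N. \<forall>n\<ge>N. \<bar>diag_sum S (s n) k\<bar> \<le> norm S / 2 ^ depth k"
    using diag_sum_bound[OF assms(2)] seq_suble[OF s(1)] order_trans by blast
  ultimately show ?thesis by (rule LIMSEQ_le_const2)
qed

text \<open>The same subsequence works: from level \<open>depth k\<close> on, the diagonal sums of
  the identity equal the length of the interval \<open>k\<close>.\<close>

lemma diag_lim_complement:
  assumes "diag_lim S g"
  shows "diag_lim (id_blinfun - S) (\<lambda>k. 1 / 2 ^ depth k - g k)"
proof -
  obtain s where s: "strict_mono s" "\<And>k. 1 \<le> k \<Longrightarrow> (\<lambda>n. diag_sum S (s n) k) \<longlonglongrightarrow> g k"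
    using assms(1) unfolding diag_lim_def by auto
  have "(\<lambda>n. diag_sum (id_blinfun - S) (s n) k) \<longlonglongrightarrow> 1 / 2 ^ depth k - g k" if k: "1 \<le> k" for k
  proof -
    have "\<forall>\<^sub>F n in sequentially. 1 / 2 ^ depth k - diag_sum S (s n) k = diag_sum (id_blinfun - S) (s n) k"
      unfolding eventually_sequentially
    proof (intro exI[of _ "depth k"] allI impI)
      fix n assume "depth k \<le> n"
      then have n: "depth k \<le> s n" using seq_suble[OF s(1), of n] by simp
      let ?P = "\<lambda>K. tau depth id_beta (depth k) K = k"
      have card: "2 ^ depth k * card {K \<in> nodes (s n). ?P K} = 2 ^ s n"
        by (rule id_sys.card_fiber[OF id_sys.deep_mono[OF deep_id n] in_nodes_depth[OF k]])
      have "real (card {K \<in> nodes (s n). ?P K}) = 2 ^ s n / 2 ^ depth k"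
        using arg_cong[OF card, of real] by (simp add: field_simps)
      moreover have "(\<Sum>K\<in>nodes (s n). if ?P K then blinfun_apply (phi K) (blinfun_apply (id_blinfun - S) (h K)) else 0)
        = (\<Sum>K\<in>nodes (s n). (if ?P K then 1 else 0) - (if ?P K then blinfun_apply (phi K) (blinfun_apply S (h K)) else 0))"
        by (rule sum.cong) (auto simp: blinfun.diff_left blinfun.diff_right phi_h nodes_Suc_0_le)
      ultimately show "1 / 2 ^ depth k - diag_sum S (s n) k = diag_sum (id_blinfun - S) (s n) k"
        by (simp add: diag_sum_def sum_subtractf diff_divide_distrib sum.If_cases Int_def)
    qed
    moreover have "(\<lambda>n. 1 / 2 ^ depth k - diag_sum S (s n) k) \<longlonglongrightarrow> 1 / 2 ^ depth k - g k"
      by (intro tendsto_intros s k)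
    ultimately show ?thesis using tendsto_cong by fast
  qed
  then show ?thesis using s(1) unfolding diag_lim_def by blast
qed

text \<open>
  With \<open>e = \<parallel>h\<^sub>K\<parallel>\<close> for \<open>K\<close> of level \<open>n\<close>, the sum is at most \<open>\<parallel>S\<parallel>\<^sup>2 min(e, 1/(2\<^sup>n e))\<close>, by summation over
  columns and over rows respectively.
\<close>

lemma sum_matrix_square:
  fixes S :: "'y \<Rightarrow>\<^sub>L 'y"
  shows "(\<Sum>K\<in>nodes n. \<Sum>L\<in>nodes n. (blinfun_apply (phi K) (blinfun_apply S (h L)) / 2 ^ n)\<^sup>2)
    \<le> (norm S)\<^sup>2 * sqrt (1 / 2 ^ n)"
proof -
  let ?t = "\<lambda>K L. blinfun_apply (phi K) (blinfun_apply S (h L))"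
  define e where "e = norm (h (2 ^ n))"
  have root: "2 ^ n \<in> nodes n" by (simp add: nodes_def)
  have e: "norm (h K) = e" if "K \<in> nodes n" for K using norm_h_level[OF that root] by (simp add: e_def)
  have e0: "0 < e" using norm_h_pos[OF nodes_ge1[OF root]] by (simp add: e_def)
  have col: "(\<Sum>K\<in>nodes n. \<bar>?t K L\<bar>) \<le> 2 ^ n * (norm S * e)" if L: "L \<in> nodes n" for L
  proof -
    have "(\<Sum>K\<in>nodes n. \<bar>?t K L\<bar>) \<le> 2 ^ n * norm (blinfun_apply S (h L))"
      using phi_level[where n = n and y = "blinfun_apply S (h L)"] by (simp add: field_simps)
    also have "\<dots> \<le> 2 ^ n * (norm S * e)"
      using norm_blinfun[of S "h L"] e[OF L] by (intro mult_left_mono) auto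
    finally show ?thesis .
  qed
  \<comment> \<open>With the signs of the entries of row \<open>K\<close> as coefficients of
    \<open>?y\<close>, the value of \<open>phi K\<close> at the image of \<open>?y\<close> is the
    sum of absolute values, and \<open>?y\<close> has norm 1 by
    \<open>norm_signed_level\<close>.\<close>
  have row: "(\<Sum>L\<in>nodes n. \<bar>?t K L\<bar>) \<le> norm S / e" if K: "K \<in> nodes n" for K
  proof -
    define s where "s L = (if 0 \<le> ?t K L then 1 else -1 :: real)" for L
    let ?y = "\<Sum>L\<in>nodes n. s L *\<^sub>R h L"
    have "(\<Sum>L\<in>nodes n. \<bar>?t K L\<bar>) = (\<Sum>L\<in>nodes n. s L * ?t K L)" by (rule sum.cong) (auto simp: s_def)
    also have "\<dots> = blinfun_apply (phi K) (blinfun_apply S ?y)"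
      by (simp add: blinfun.sum_right blinfun.scaleR_right)
    also have "\<dots> \<le> norm (blinfun_apply S ?y) / e"
      using phi_norm_h[OF nodes_ge1[OF K], of "blinfun_apply S ?y"] e[OF K] e0 by (simp add: field_simps abs_le_iff) (metis abs_le_iff abs_mult abs_of_pos)
    also have "\<dots> \<le> norm S * norm ?y / e" using norm_blinfun e0 by (intro divide_right_mono) auto
    also have "norm ?y = 1" by (rule norm_signed_level) (simp add: s_def)
    finally show ?thesis by simp
  qed
  have sq: "(\<Sum>K\<in>nodes n. \<Sum>L\<in>nodes n. (?t K L / 2 ^ n)\<^sup>2) \<le> norm S / 4 ^ n * R"
    if R: "(\<Sum>K\<in>nodes n. \<Sum>L\<in>nodes n. \<bar>?t K L\<bar>) \<le> R" for R
  proof -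
    have "(\<Sum>K\<in>nodes n. \<Sum>L\<in>nodes n. (?t K L / 2 ^ n)\<^sup>2) \<le> (\<Sum>K\<in>nodes n. \<Sum>L\<in>nodes n. norm S / 4 ^ n * \<bar>?t K L\<bar>)"
    proof (intro sum_mono)
      fix K L assume "K \<in> nodes n" "L \<in> nodes n"
      then have "\<bar>?t K L\<bar> * \<bar>?t K L\<bar> \<le> norm S * \<bar>?t K L\<bar>" using phi_S_h by (intro mult_right_mono) auto
      then have "\<bar>?t K L\<bar> * \<bar>?t K L\<bar> / 4 ^ n \<le> norm S * \<bar>?t K L\<bar> / 4 ^ n" by (rule divide_right_mono) simp
      moreover have "(4::real) ^ n = 2 ^ n * 2 ^ n" by (simp flip: power_mult_distrib)
      ultimately show "(?t K L / 2 ^ n)\<^sup>2 \<le> norm S / 4 ^ n * \<bar>?t K L\<bar>" by (simp add: power2_eq_square)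
    qed
    also have "\<dots> = norm S / 4 ^ n * (\<Sum>K\<in>nodes n. \<Sum>L\<in>nodes n. \<bar>?t K L\<bar>)" by (simp add: sum_distrib_left)
    also have "\<dots> \<le> norm S / 4 ^ n * R" by (intro mult_left_mono R) auto
    finally show ?thesis .
  qed
  have four: "(4::real) ^ n = 2 ^ n * 2 ^ n" by (simp flip: power_mult_distrib)
  \<comment> \<open>The balance point of the two bounds: either \<open>e \<le> q\<close> or
    \<open>q * q / e \<le> q\<close>.\<close>
  define q where "q = sqrt (1 / 2 ^ n)"
  have q: "0 < q" "q * q = 1 / 2 ^ n" by (simp_all add: q_def)
  show ?thesis
  proof (cases "e \<le> q")
    case True
    have "(\<Sum>K\<in>nodes n. \<Sum>L\<in>nodes n. \<bar>?t K L\<bar>) \<le> (\<Sum>L\<in>nodes n. 2 ^ n * (norm S * e))"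
      by (subst sum.swap) (intro sum_mono col)
    then have "(\<Sum>K\<in>nodes n. \<Sum>L\<in>nodes n. (?t K L / 2 ^ n)\<^sup>2) \<le> norm S / 4 ^ n * (4 ^ n * (norm S * e))"
      by (intro sq) (simp add: four mult.assoc)
    also have "\<dots> = (norm S)\<^sup>2 * e" by (simp add: power2_eq_square)
    also have "\<dots> \<le> (norm S)\<^sup>2 * q" by (intro mult_left_mono True) auto
    finally show ?thesis by (simp add: q_def)
  next
    case False
    have "(\<Sum>K\<in>nodes n. \<Sum>L\<in>nodes n. \<bar>?t K L\<bar>) \<le> (\<Sum>K\<in>nodes n. norm S / e)" by (intro sum_mono row)
    then have "(\<Sum>K\<in>nodes n. \<Sum>L\<in>nodes n. (?t K L / 2 ^ n)\<^sup>2) \<le> norm S / 4 ^ n * (2 ^ n * (norm S / e))"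
      by (intro sq) simp
    also have "\<dots> = (norm S)\<^sup>2 * (q * q / e)" unfolding q(2) four by (simp add: power2_eq_square)
    also have "\<dots> \<le> (norm S)\<^sup>2 * q"
      using False q(1) e0 by (intro mult_left_mono) (simp_all add: divide_le_eq mult_left_mono)
    finally show ?thesis by (simp add: q_def)
  qed
qed

end

context haar_space_wn
begin

text \<open>\<open>D\<close> marks the prescribed support, a union of intervals of level
  \<open>l0\<close>. \<open>Fs\<close> and \<open>Ys\<close> encode the interaction with earlier
  blocks: their functionals composed with an entry of the operator, and the images of their vectors.
  The last two conclusions concern the diagonal entry and the balance of \<open>g\<close> between
  the halves of the block.\<close>

lemma block_exists:
  fixes S :: "'y \<Rightarrow>\<^sub>L 'y" and Fs :: "('y \<Rightarrow>\<^sub>L real) set" and Ys :: "'y set"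
  assumes g: "diag_lim S g" and fin: "finite Fs" "finite Ys" and "0 < \<eta>"
    and D: "\<And>j q. l0 \<le> j \<Longrightarrow> q \<in> nodes j \<Longrightarrow> D (2 * q) = D q \<and> D (2 * q + 1) = D q"
  obtains l b where "l0 < l" "\<And>K. b K \<in> (if K \<in> nodes l \<and> D K then {1, -1} else {0})"
    "\<And>f. f \<in> Fs \<Longrightarrow> \<bar>blinfun_apply f (\<Sum>L\<in>nodes l. b L *\<^sub>R h L)\<bar> < \<eta>"
    "\<And>y. y \<in> Ys \<Longrightarrow> \<bar>(\<Sum>L\<in>nodes l. b L * blinfun_apply (phi L) y) / 2 ^ l\<bar> < \<eta>"
    "\<bar>(\<Sum>L\<in>nodes l. b L * blinfun_apply (phi L) (blinfun_apply S (\<Sum>L\<in>nodes l. b L *\<^sub>R h L))) / 2 ^ l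
      - (\<Sum>L\<in>nodes l. if D L then g L else 0)\<bar> < \<eta>"
    "\<bar>\<Sum>L\<in>nodes l. b L * (g (2 * L) - g (2 * L + 1))\<bar> < \<eta>"
proof -
  obtain s where s: "strict_mono s" "\<And>k. 1 \<le> k \<Longrightarrow> (\<lambda>n. diag_sum S (s n) k) \<longlonglongrightarrow> g k"
    using g unfolding diag_lim_def by auto
  have s_top: "filterlim s sequentially sequentially" by (rule filterlim_subseq[OF s(1)])
  let ?t = "\<lambda>n K L. blinfun_apply (phi K) (blinfun_apply S (h L)) / 2 ^ n"
  \<comment> \<open>The bound of \<open>exists_signs\<close>: twice the sum of the squared matrix
    entries, plus the sum of squared differences of \<open>g\<close> between the two halves of each
    interval.\<close>
  let ?E = "\<lambda>n. 2 * ((norm S)\<^sup>2 * sqrt (1 / 2 ^ n)) + (norm S)\<^sup>2 / 2 ^ n"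
  define G where "G = (\<Sum>L\<in>nodes l0. if D L then g L else 0)"
  have "\<forall>\<^sub>F n in sequentially. \<forall>f\<in>Fs. (\<Sum>K\<in>nodes n. \<bar>blinfun_apply f (h K)\<bar>) < \<eta>"
    using fin(1) order_tendstoD(2)[OF weak_null_abs \<open>0 < \<eta>\<close>] by (intro eventually_ball_finite) auto
  then have e1: "\<forall>\<^sub>F n in sequentially. \<forall>f\<in>Fs. (\<Sum>K\<in>nodes (s n). \<bar>blinfun_apply f (h K)\<bar>) < \<eta>"
    using s_top by (rule eventually_compose_filterlim)
  have "\<forall>\<^sub>F n in sequentially. \<forall>y\<in>Ys. (\<Sum>K\<in>nodes n. \<bar>blinfun_apply (phi K) y\<bar>) / 2 ^ n < \<eta>"
    using fin(2) order_tendstoD(2)[OF phi_level_tendsto \<open>0 < \<eta>\<close>] by (intro eventually_ball_finite) auto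
  then have e2: "\<forall>\<^sub>F n in sequentially. \<forall>y\<in>Ys. (\<Sum>K\<in>nodes (s n). \<bar>blinfun_apply (phi K) y\<bar>) / 2 ^ s n < \<eta>"
    using s_top by (rule eventually_compose_filterlim)
  have "(\<lambda>n. (1 / 2 :: real) ^ n) \<longlonglongrightarrow> 0" by (rule LIMSEQ_power_zero) simp
  then have p0: "(\<lambda>n. 1 / 2 ^ n :: real) \<longlonglongrightarrow> 0" by (simp add: power_one_over)
  have "(\<lambda>n. 2 * ((norm S)\<^sup>2 * sqrt (1 / 2 ^ n)) + (norm S)\<^sup>2 * (1 / 2 ^ n)) \<longlonglongrightarrow> 2 * ((norm S)\<^sup>2 * sqrt 0) + (norm S)\<^sup>2 * 0"
    by (intro tendsto_intros p0)
  then have "?E \<longlonglongrightarrow> 0" by simp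
  then have "\<forall>\<^sub>F n in sequentially. ?E n < (\<eta> / 2)\<^sup>2" using \<open>0 < \<eta>\<close> by (intro order_tendstoD(2)) auto
  then have e3: "\<forall>\<^sub>F n in sequentially. ?E (s n) < (\<eta> / 2)\<^sup>2" using s_top by (rule eventually_compose_filterlim)
  \<comment> \<open>The diagonal terms contain each sign twice and so do not depend on the choice of
    signs. They form a finite sum of \<open>diag_sum\<close> over the intervals of level
    \<open>l0\<close> that make up \<open>D\<close>, and hence converge along
    \<open>s\<close>.\<close>
  have diag: "(\<Sum>K\<in>nodes n. if D K then ?t n K K else 0) = (\<Sum>L\<in>nodes l0. if D L then diag_sum S n L else 0)"
    if n: "l0 \<le> n" for n
  proof -
    have DK: "D K = D (tau depth id_beta l0 K)" if K: "K \<in> nodes n" for K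
      using n K
    proof (induction n arbitrary: K rule: dec_induct)
      case base
      then show ?case using tau_id[OF base, of l0] by simp
    next
      case (step n)
      have q: "K div 2 \<in> nodes n" by (rule nodes_Suc_div[OF step.prems])
      have "K = 2 * (K div 2) \<or> K = 2 * (K div 2) + 1" by presburger
      then have "D K = D (K div 2)" using D[OF step.hyps(1) q] by metis
      also have "\<dots> = D (tau depth id_beta l0 (K div 2))" by (rule step.IH[OF q])
      also have "tau depth id_beta l0 (K div 2) = tau depth id_beta l0 K"
        using tau_id[OF q step.hyps(1)] tau_id[OF step.prems, of l0] step.hyps(1)
        by (simp add: Suc_diff_le div_mult2_eq)
      finally show ?case .
    qed
    have "(\<Sum>L\<in>nodes l0. if D L then diag_sum S n L else 0)
        = (\<Sum>L\<in>nodes l0. \<Sum>K\<in>nodes n. if tau depth id_beta l0 K = L then (if D L then ?t n K K else 0) else 0)"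
    proof (rule sum.cong)
      fix L assume L: "L \<in> nodes l0"
      show "(if D L then diag_sum S n L else 0)
          = (\<Sum>K\<in>nodes n. if tau depth id_beta l0 K = L then (if D L then ?t n K K else 0) else 0)"
      proof (cases "D L")
        case True
        then show ?thesis by (auto simp: diag_sum_def depth_nodes[OF L] sum_divide_distrib intro!: sum.cong)
      next
        case False
        have "(if tau depth id_beta l0 K = L then (if D L then ?t n K K else 0) else 0) = 0" for K
          using False by simp
        then show ?thesis using False by (simp only: if_False sum.neutral_const)
      qed
    qed simp
    also have "\<dots> = (\<Sum>K\<in>nodes n. \<Sum>L\<in>nodes l0. if tau depth id_beta l0 K = L then (if D L then ?t n K K else 0) else 0)"
      by (rule sum.swap)
    also have "\<dots> = (\<Sum>K\<in>nodes n. if D K then ?t n K K else 0)"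
      by (rule sum.cong) (use DK in auto)
    finally show ?thesis by simp
  qed
  have "(\<lambda>n. \<Sum>L\<in>nodes l0. if D L then diag_sum S (s n) L else 0) \<longlonglongrightarrow> G"
    unfolding G_def
  proof (rule tendsto_sum)
    fix L assume "L \<in> nodes l0"
    then show "(\<lambda>n. if D L then diag_sum S (s n) L else 0) \<longlonglongrightarrow> (if D L then g L else 0)"
      using s(2)[OF nodes_ge1] by auto
  qed
  then have e4: "\<forall>\<^sub>F n in sequentially. dist (\<Sum>L\<in>nodes l0. if D L then diag_sum S (s n) L else 0) G < \<eta> / 2"
    using \<open>0 < \<eta>\<close> by (intro tendstoD) auto
  have e5: "\<forall>\<^sub>F n in sequentially. l0 < n" by (rule eventually_gt_at_top)
  obtain n where n: "\<And>f. f \<in> Fs \<Longrightarrow> (\<Sum>K\<in>nodes (s n). \<bar>blinfun_apply f (h K)\<bar>) < \<eta>"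
    "\<And>y. y \<in> Ys \<Longrightarrow> (\<Sum>K\<in>nodes (s n). \<bar>blinfun_apply (phi K) y\<bar>) / 2 ^ s n < \<eta>"
    "?E (s n) < (\<eta> / 2)\<^sup>2"
    "dist (\<Sum>L\<in>nodes l0. if D L then diag_sum S (s n) L else 0) G < \<eta> / 2" "l0 < n"
    using eventually_happens[OF eventually_conj[OF e1 eventually_conj[OF e2 eventually_conj[OF e3 eventually_conj[OF e4 e5]]]]]
    by auto
  define l where "l = s n"
  have l: "l0 < l" using n(5) seq_suble[OF s(1), of n] by (simp add: l_def)
  define X where "X = {K \<in> nodes l. D K}"
  define u where "u L = g (2 * L) - g (2 * L + 1)" for L
  have fX: "finite X" by (simp add: X_def)
  obtain Z where Z: "(offdiag X (?t l) Z)\<^sup>2 + (\<Sum>K\<in>X. sgn_of Z K * u K)\<^sup>2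
      \<le> 2 * (\<Sum>K\<in>X. \<Sum>L\<in>X. (?t l K L)\<^sup>2) + (\<Sum>K\<in>X. (u K)\<^sup>2)"
    by (rule exists_signs[OF fX, of "?t l" u])
  have t2: "(\<Sum>K\<in>X. \<Sum>L\<in>X. (?t l K L)\<^sup>2) \<le> (norm S)\<^sup>2 * sqrt (1 / 2 ^ l)"
  proof -
    have "(\<Sum>K\<in>X. \<Sum>L\<in>X. (?t l K L)\<^sup>2) \<le> (\<Sum>K\<in>X. \<Sum>L\<in>nodes l. (?t l K L)\<^sup>2)"
      by (intro sum_mono sum_mono2) (auto simp: X_def)
    also have "\<dots> \<le> (\<Sum>K\<in>nodes l. \<Sum>L\<in>nodes l. (?t l K L)\<^sup>2)"
      by (intro sum_mono2) (auto simp: X_def intro!: sum_nonneg)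
    finally show ?thesis using sum_matrix_square order_trans by blast
  qed
  have u2: "(\<Sum>K\<in>X. (u K)\<^sup>2) \<le> (norm S)\<^sup>2 / 2 ^ l"
  proof -
    have "(u K)\<^sup>2 \<le> (norm S / 2 ^ l)\<^sup>2" if "K \<in> X" for K
    proof -
      have K: "1 \<le> K" "depth K = l" using that by (auto simp: X_def nodes_Suc_0_le depth_nodes)
      have "\<bar>g (2 * K)\<bar> \<le> norm S / 2 ^ Suc l" "\<bar>g (2 * K + 1)\<bar> \<le> norm S / 2 ^ Suc l"
        using diag_lim_bound[OF g, of "2 * K"] diag_lim_bound[OF g, of "2 * K + 1"] K by auto
      then have "\<bar>u K\<bar> \<le> norm S / 2 ^ l" unfolding u_def by (simp add: abs_le_iff)
      then have "\<bar>u K\<bar>\<^sup>2 \<le> (norm S / 2 ^ l)\<^sup>2" by (rule power_mono) simp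
      then show ?thesis by simp
    qed
    then have "(\<Sum>K\<in>X. (u K)\<^sup>2) \<le> (\<Sum>K\<in>X. (norm S / 2 ^ l)\<^sup>2)" by (rule sum_mono)
    also have "\<dots> \<le> (\<Sum>K\<in>nodes l. (norm S / 2 ^ l)\<^sup>2)" by (rule sum_mono2) (auto simp: X_def)
    also have "\<dots> = (norm S)\<^sup>2 / 2 ^ l" by (simp add: power2_eq_square)
    finally show ?thesis .
  qed
  have "(offdiag X (?t l) Z)\<^sup>2 + (\<Sum>K\<in>X. sgn_of Z K * u K)\<^sup>2 < (\<eta> / 2)\<^sup>2"
    using Z t2 u2 n(3) unfolding l_def[symmetric] by linarith
  then have "(offdiag X (?t l) Z)\<^sup>2 < (\<eta> / 2)\<^sup>2" "(\<Sum>K\<in>X. sgn_of Z K * u K)\<^sup>2 < (\<eta> / 2)\<^sup>2"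
    using zero_le_power2[of "offdiag X (?t l) Z"] zero_le_power2[of "\<Sum>K\<in>X. sgn_of Z K * u K"] by linarith+
  then have small: "\<bar>offdiag X (?t l) Z\<bar> < \<eta> / 2" "\<bar>\<Sum>K\<in>X. sgn_of Z K * u K\<bar> < \<eta> / 2"
    using \<open>0 < \<eta>\<close> power2_less_imp_less[of "\<bar>offdiag X (?t l) Z\<bar>" "\<eta> / 2"]
      power2_less_imp_less[of "\<bar>\<Sum>K\<in>X. sgn_of Z K * u K\<bar>" "\<eta> / 2"] by auto
  define b where "b K = (if K \<in> X then sgn_of Z K else 0)" for K
  have babs: "\<bar>b K\<bar> \<le> 1" for K by (simp add: b_def)
  have bsum: "(\<Sum>L\<in>nodes l. b L * F L) = (\<Sum>L\<in>X. sgn_of Z L * F L)" for F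
    by (rule sum.mono_neutral_cong_right) (auto simp: b_def X_def)
  have bsumh: "(\<Sum>L\<in>nodes l. b L *\<^sub>R h L) = (\<Sum>L\<in>X. sgn_of Z L *\<^sub>R h L)"
    by (rule sum.mono_neutral_cong_right) (auto simp: b_def X_def)
  have bF: "\<bar>\<Sum>L\<in>nodes l. b L * F L\<bar> \<le> (\<Sum>L\<in>nodes l. \<bar>F L\<bar>)" for F
    by (rule order_trans[OF sum_abs sum_mono]) (use babs in \<open>auto simp: abs_mult intro: mult_left_le_one_le\<close>)
  show ?thesis
  proof
    show "l0 < l" by (rule l)
    show "b K \<in> (if K \<in> nodes l \<and> D K then {1, -1} else {0})" for K
      by (auto simp: b_def X_def sgn_of_def)
    show "\<bar>blinfun_apply f (\<Sum>L\<in>nodes l. b L *\<^sub>R h L)\<bar> < \<eta>" if "f \<in> Fs" for f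
      using le_less_trans[OF bF n(1)[OF that, folded l_def]]
      by (simp add: blinfun.sum_right blinfun.scaleR_right)
    show "\<bar>(\<Sum>L\<in>nodes l. b L * blinfun_apply (phi L) y) / 2 ^ l\<bar> < \<eta>" if "y \<in> Ys" for y
      using le_less_trans[OF divide_right_mono[OF bF] n(2)[OF that, folded l_def]] by (simp add: abs_divide)
    have "(\<Sum>L\<in>nodes l. b L * blinfun_apply (phi L) (blinfun_apply S (\<Sum>L\<in>nodes l. b L *\<^sub>R h L))) / 2 ^ l
        = (\<Sum>K\<in>X. \<Sum>L\<in>X. sgn_of Z K * sgn_of Z L * ?t l K L)"
      unfolding bsum bsumh
      by (simp add: blinfun.sum_right blinfun.scaleR_right sum_distrib_left sum_divide_distrib mult.assoc)
    also have "\<dots> = (\<Sum>K\<in>X. ?t l K K) + offdiag X (?t l) Z"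
      unfolding offdiag_def sum.distrib[symmetric]
    proof (rule sum.cong)
      fix K assume K: "K \<in> X"
      have "(\<Sum>L\<in>X. sgn_of Z K * sgn_of Z L * ?t l K L)
          = (\<Sum>L\<in>X. (if L = K then ?t l K K else 0) + (if K = L then 0 else sgn_of Z K * sgn_of Z L * ?t l K L))"
        by (rule sum.cong) auto
      then show "(\<Sum>L\<in>X. sgn_of Z K * sgn_of Z L * ?t l K L)
          = ?t l K K + (\<Sum>L\<in>X. if K = L then 0 else sgn_of Z K * sgn_of Z L * ?t l K L)"
        using K fX by (simp add: sum.distrib)
    qed simp
    also have "(\<Sum>K\<in>X. ?t l K K) = (\<Sum>L\<in>nodes l0. if D L then diag_sum S l L else 0)"
      using diag[of l] l by (simp add: X_def sum.If_cases Int_def)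
    finally have "\<bar>(\<Sum>L\<in>nodes l. b L * blinfun_apply (phi L) (blinfun_apply S (\<Sum>L\<in>nodes l. b L *\<^sub>R h L))) / 2 ^ l - G\<bar>
        < \<eta> / 2 + \<eta> / 2"
      using n(4) small(1) unfolding l_def[symmetric] dist_real_def by (simp add: abs_if split: if_splits)
    moreover have "(\<Sum>L\<in>nodes l. if D L then g L else 0) = G"
      unfolding G_def by (rule sum_nodes_additive[OF diag_lim_additive[OF g] _ D]) (use l in auto)
    ultimately show "\<bar>(\<Sum>L\<in>nodes l. b L * blinfun_apply (phi L) (blinfun_apply S (\<Sum>L\<in>nodes l. b L *\<^sub>R h L))) / 2 ^ l
        - (\<Sum>L\<in>nodes l. if D L then g L else 0)\<bar> < \<eta>" by simp
    show "\<bar>\<Sum>L\<in>nodes l. b L * (g (2 * L) - g (2 * L + 1))\<bar> < \<eta>"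
      unfolding bsum using small(2) \<open>0 < \<eta>\<close> by (simp add: u_def)
  qed
qed

end

section \<open>Choosing all blocks\<close>

lemma tau_in_nodes: "tau l \<beta> n p \<in> nodes n"
  by (induction n) (auto simp: nodes_children)

text \<open>Only earlier blocks enter \<open>tau\<close>, which makes a recursive choice of the
  blocks possible.\<close>

lemma tau_cong:
  assumes "\<And>k. 1 \<le> k \<Longrightarrow> k < 2 ^ n \<Longrightarrow> l k = l' k \<and> \<beta> k = \<beta>' k"
  shows "tau l \<beta> n p = tau l' \<beta>' n p"
  using assms
proof (induction n)
  case (Suc n)
  let ?i = "tau l \<beta> n p"
  have eq: "?i = tau l' \<beta>' n p" using Suc by simp
  have "1 \<le> ?i" "?i < 2 ^ Suc n" using tau_in_nodes[of l \<beta> n p] nodes_ge1 by (auto simp: nodes_def)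
  then have "bval l \<beta> ?i p = bval l' \<beta>' ?i p" using Suc.prems by (simp add: bval_def)
  then show ?case using eq by simp
qed simp

text \<open>Proved outside \<open>faithful\<close>, because it is applied while later blocks have
  not been chosen.\<close>

lemma tau_children:
  assumes "\<And>k. 1 \<le> k \<Longrightarrow> k < 2 ^ n \<Longrightarrow> l k < m" "m \<le> j" "q \<in> nodes j"
  shows "tau l \<beta> n (2 * q) = tau l \<beta> n q" "tau l \<beta> n (Suc (2 * q)) = tau l \<beta> n q"
proof -
  have "tau l \<beta> n (2 * q) = tau l \<beta> n q \<and> tau l \<beta> n (Suc (2 * q)) = tau l \<beta> n q"
    using assms(1)
  proof (induction n)
    case (Suc n)
    let ?i = "tau l \<beta> n q"
    have IH: "tau l \<beta> n (2 * q) = ?i" "tau l \<beta> n (Suc (2 * q)) = ?i" using Suc by auto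
    have "1 \<le> ?i" "?i < 2 ^ Suc n" using tau_in_nodes[of l \<beta> n q] nodes_ge1 by (auto simp: nodes_def)
    then have li: "l ?i < j" using Suc.prems assms(2) by force
    have hs: "hs L (2 * q) = hs L q" "hs L (Suc (2 * q)) = hs L q" if "L \<in> nodes (l ?i)" for L
    proof -
      have "q \<noteq> L" using depth_nodes[OF that] depth_nodes[OF assms(3)] li by auto
      then show "hs L (2 * q) = hs L q" "hs L (Suc (2 * q)) = hs L q"
        using nodes_ge1[OF assms(3)] by (simp_all add: hs_child)
    qed
    then have "bval l \<beta> ?i (2 * q) = bval l \<beta> ?i q" "bval l \<beta> ?i (Suc (2 * q)) = bval l \<beta> ?i q"
      unfolding bval_def by (auto intro: sum.cong)
    then show ?case using IH by simp
  qed simp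
  then show "tau l \<beta> n (2 * q) = tau l \<beta> n q" "tau l \<beta> n (Suc (2 * q)) = tau l \<beta> n q" by auto
qed

context faithful
begin

text \<open>The means of \<open>g\<close> over the supports of the blocks form a martingale with increments \<open>\<delta>\<close>.\<close>

lemma support_mean:
  fixes g :: "nat \<Rightarrow> real"
  assumes g: "\<And>k. 1 \<le> k \<Longrightarrow> g k = g (2 * k) + g (2 * k + 1)" and k: "k \<in> nodes n"
  defines "\<delta> \<equiv> \<lambda>i. 2 ^ depth i * (\<Sum>L\<in>nodes (l i). \<beta> i L * (g (2 * L) - g (2 * L + 1)))"
  shows "2 ^ n * (\<Sum>L\<in>nodes (l k). if \<tau> n L = k then g L else 0) = g 1 + (\<Sum>i\<in>{1..<k}. \<delta> i * hs i k)"
proof -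
  obtain m where m: "deep (Suc n) m" using deep_exists by blast
  \<comment> \<open>Measured first at a level finer than all blocks involved, by induction from a
    block to its parent; at the end the support is measured at its own level
    \<open>l k\<close>.\<close>
  have fib: "2 ^ n * (\<Sum>p\<in>nodes m. if \<tau> n p = k then g p else 0) = g 1 + (\<Sum>i\<in>{1..<k}. \<delta> i * hs i k)"
    using deep_Suc[OF m] k
  proof (induction n arbitrary: k)
    case 0
    have "(\<Sum>p\<in>nodes m. if True then g p else 0) = (\<Sum>p\<in>nodes 0. if True then g p else 0)"
      by (rule sum_nodes_additive[OF g]) auto
    then show ?case using 0 by simp
  next
    case (Suc n)
    let ?j = "k div 2"
    have j: "?j \<in> nodes n" by (rule nodes_Suc_div[OF Suc.prems(2)])
    have kj: "k = 2 * ?j \<or> k = 2 * ?j + 1" by presburger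
    have j1: "1 \<le> ?j" by (rule nodes_ge1[OF j])
    have lj: "l ?j < m" using deepD[OF Suc.prems(1), of ?j] j j1 by (auto simp: nodes_def)
    define sg where "sg = (if even k then 1 else -1 :: real)"
    have conv: "(\<Sum>p\<in>nodes m. if Q p then g p else 0) = (\<Sum>p | p \<in> nodes m \<and> Q p. g p)" for Q
      by (simp add: sum.If_cases Int_def)
    have split: "2 * (\<Sum>p\<in>nodes m. if \<tau> (Suc n) p = k then g p else 0)
        = (\<Sum>p\<in>nodes m. if \<tau> n p = ?j then g p else 0) + sg * (\<Sum>p\<in>nodes m. bv ?j p * g p)"
      unfolding conv
    proof (cases "even k")
      case True
      then have "2 * ?j = k" by simp
      then show "2 * (\<Sum>p | p \<in> nodes m \<and> \<tau> (Suc n) p = k. g p)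
        = (\<Sum>p | p \<in> nodes m \<and> \<tau> n p = ?j. g p) + sg * (\<Sum>p\<in>nodes m. bv ?j p * g p)"
        using fiber_sum_split(1)[OF Suc.prems(1) j, of g] True by (simp del: tau.simps add: sg_def)
    next
      case False
      then have "2 * ?j + 1 = k" using kj by (metis dvd_triv_left)
      then show "2 * (\<Sum>p | p \<in> nodes m \<and> \<tau> (Suc n) p = k. g p)
        = (\<Sum>p | p \<in> nodes m \<and> \<tau> n p = ?j. g p) + sg * (\<Sum>p\<in>nodes m. bv ?j p * g p)"
        using fiber_sum_split(2)[OF Suc.prems(1) j, of g] False by (simp del: tau.simps add: sg_def)
    qed
    have "(\<Sum>p\<in>nodes m. bv ?j p * g p) = (\<Sum>L\<in>nodes (l ?j). \<beta> ?j L * (g (2 * L) - g (2 * L + 1)))"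
      unfolding sum_bv_mult by (rule sum.cong) (use sum_hs_additive[OF g _ lj] in auto)
    then have d: "2 ^ n * (\<Sum>p\<in>nodes m. bv ?j p * g p) = \<delta> ?j" by (simp add: \<delta>_def depth_nodes[OF j])
    have "2 ^ Suc n * (\<Sum>p\<in>nodes m. if \<tau> (Suc n) p = k then g p else 0)
        = 2 ^ n * (2 * (\<Sum>p\<in>nodes m. if \<tau> (Suc n) p = k then g p else 0))" by (simp only: power_Suc mult_ac)
    also have "\<dots> = 2 ^ n * (\<Sum>p\<in>nodes m. if \<tau> n p = ?j then g p else 0) + sg * \<delta> ?j"
      unfolding split d[symmetric] by (simp only: distrib_left mult.left_commute)
    also have "\<dots> = g 1 + ((\<Sum>i\<in>{1..<?j}. \<delta> i * hs i ?j) + sg * \<delta> ?j)"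
      using Suc.IH[OF deep_Suc[OF Suc.prems(1)] j] by simp
    also have "(\<Sum>i\<in>{1..<?j}. \<delta> i * hs i ?j) + sg * \<delta> ?j = (\<Sum>i\<in>{1..<k}. \<delta> i * hs i k)"
    proof -
      have hsk: "hs i k = (if ?j = i then sg else hs i ?j)" for i
        using nodes_ge1[OF Suc.prems(2)] j1 by (subst hs.simps) (auto simp: sg_def)
      have "(\<Sum>i\<in>{1..<k}. \<delta> i * hs i k) = (\<Sum>i\<in>{1..<Suc ?j}. \<delta> i * hs i k)"
      proof (rule sum.mono_neutral_right)
        show "{1..<Suc ?j} \<subseteq> {1..<k}" using kj j1 by auto
        show "\<forall>i\<in>{1..<k} - {1..<Suc ?j}. \<delta> i * hs i k = 0"
        proof
          fix i assume "i \<in> {1..<k} - {1..<Suc ?j}"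
          then have "\<not> 2 * i \<le> k" by auto
          then show "\<delta> i * hs i k = 0" using hs_nonzero_le by (metis mult_zero_right)
        qed
      qed simp
      also have "\<dots> = (\<Sum>i\<in>{1..<?j}. \<delta> i * hs i k) + \<delta> ?j * hs ?j k" using j1 by simp
      also have "(\<Sum>i\<in>{1..<?j}. \<delta> i * hs i k) = (\<Sum>i\<in>{1..<?j}. \<delta> i * hs i ?j)"
        by (rule sum.cong) (auto simp: hsk)
      finally show ?thesis by (simp add: hsk mult.commute)
    qed
    finally show ?case .
  qed
  have "l k < m" using deepD[OF m, of k] k nodes_ge1[OF k] by (auto simp: nodes_def)
  then have "(\<Sum>p\<in>nodes m. if \<tau> n p = k then g p else 0) = (\<Sum>L\<in>nodes (l k). if \<tau> n L = k then g L else 0)"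
    using tau_child[OF deep_level[OF k]] by (intro sum_nodes_additive[OF g]) auto
  then show ?thesis using fib by simp
qed

end

section \<open>Encoded blocks and summation weights\<close>

context haar_space
begin

text \<open>Coefficients are at most \<open>k * norm y\<close>, so the weights \<open>k\<close> turn
  values on the basis into a norm bound.\<close>

lemma functional_bound:
  fixes F :: "'y \<Rightarrow>\<^sub>L real"
  assumes a: "\<And>k. 1 \<le> k \<Longrightarrow> \<bar>blinfun_apply F (h k)\<bar> * k \<le> a k" and s: "summable a" and nn: "\<And>k. 0 \<le> a k"
  shows "\<bar>blinfun_apply F y\<bar> \<le> suminf a * norm y"
proof (rule le_dense[of "\<lambda>y. \<bar>blinfun_apply F y\<bar>" "\<lambda>y. suminf a * norm y"])
  fix m and c :: "nat \<Rightarrow> real"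
  have "\<bar>blinfun_apply F (comb m c)\<bar> \<le> (\<Sum>k\<in>{1..<2 ^ m}. \<bar>c k * blinfun_apply F (h k)\<bar>)"
    unfolding comb_def by (simp add: blinfun.sum_right blinfun.scaleR_right sum_abs)
  also have "\<dots> \<le> (\<Sum>k\<in>{1..<2 ^ m}. a k * norm (comb m c))"
  proof (rule sum_mono)
    fix k :: nat assume k: "k \<in> {1..<2 ^ m}"
    then have "\<bar>c k\<bar> \<le> k * norm (comb m c)" using phi_abs_le'[of k "comb m c"] phi_comb[of k m c] by simp
    then have "\<bar>c k\<bar> * \<bar>blinfun_apply F (h k)\<bar> \<le> k * norm (comb m c) * \<bar>blinfun_apply F (h k)\<bar>"
      by (rule mult_right_mono) simp
    also have "\<dots> = \<bar>blinfun_apply F (h k)\<bar> * k * norm (comb m c)" by simp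
    also have "\<dots> \<le> a k * norm (comb m c)" by (rule mult_right_mono[OF a]) (use k in auto)
    finally show "\<bar>c k * blinfun_apply F (h k)\<bar> \<le> a k * norm (comb m c)" by (simp add: abs_mult)
  qed
  also have "\<dots> = (\<Sum>k\<in>{1..<2 ^ m}. a k) * norm (comb m c)" by (simp add: sum_distrib_right)
  also have "\<dots> \<le> suminf a * norm (comb m c)"
    by (intro mult_right_mono sum_le_suminf s) (auto simp: nn)
  finally show "\<bar>blinfun_apply F (comb m c)\<bar> \<le> suminf a * norm (comb m c)" .
qed (auto intro!: continuous_intros)

definition xvec :: "nat \<times> (nat \<Rightarrow> real) \<Rightarrow> 'y" where
  "xvec r = (\<Sum>L\<in>nodes (fst r). snd r L *\<^sub>R h L)"

text \<open>Integration against the block. The factor \<open>2 ^ depth k\<close> of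
  \<open>psi\<close> is left out because a pair of a level and signs does not contain the index of
  the block.\<close>

definition xfun :: "nat \<times> (nat \<Rightarrow> real) \<Rightarrow> 'y \<Rightarrow>\<^sub>L real" where
  "xfun r = (1 / 2 ^ fst r) *\<^sub>R (\<Sum>L\<in>nodes (fst r). snd r L *\<^sub>R phi L)"

lemma xfun_apply: "blinfun_apply (xfun r) y = (\<Sum>L\<in>nodes (fst r). snd r L * blinfun_apply (phi L) y) / 2 ^ fst r"
  by (simp add: xfun_def blinfun.scaleR_left blinfun.sum_left)

end

lemma prod_encode_less: "k < k' \<Longrightarrow> prod_encode (j, k) < prod_encode (j, k')"
proof -
  have "triangle m < triangle n" if "m < n" for m n
    using that by (induction n rule: less_Suc_induct) auto
  then show "k < k' \<Longrightarrow> prod_encode (j, k) < prod_encode (j, k')" by (simp add: prod_encode_def)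
qed

lemma prod_encode_ge: "j + k \<le> prod_encode (j, k)"
proof -
  have "n \<le> triangle n" for n by (induction n) auto
  from this[of "j + k"] show ?thesis by (simp add: prod_encode_def)
qed

text \<open>The factors \<open>q\<close> and \<open>q'\<close> will come from
  \<open>2 ^ depth k\<close> and from the growth of coefficients. As \<open>8 ^ m\<close> is
  \<open>2 ^ m * 2 ^ m * 2 ^ m\<close>, one factor absorbs them and the other two leave decay in
  each index separately.\<close>

lemma weight_bound:
  fixes q q' :: nat
  shows "real q * (1 / 8 ^ max q q') * real q' \<le> 2 * ((1 / 2) ^ q * (1 / 2) ^ q')"
proof -
  let ?m = "max q q'"
  have sq: "n * n \<le> 2 * 2 ^ n" for n :: nat
  proof (cases "3 \<le> n")
    case True
    then show ?thesis
    proof (induction n rule: dec_induct)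
      case (step n)
      have "3 * n \<le> n * n" using step.hyps(1) by (intro mult_le_mono1)
      moreover have "Suc n * Suc n = n * n + 2 * n + 1" by simp
      ultimately have "Suc n * Suc n \<le> 2 * (n * n)" using step.hyps(1) by linarith
      then show ?case using step.IH by simp
    qed simp
  next
    case False
    then have "n = 0 \<or> n = 1 \<or> n = 2" by linarith
    then show ?thesis by auto
  qed
  have "real q * real q' \<le> real ?m * real ?m" by (intro mult_mono) auto
  also have "\<dots> \<le> 2 * 2 ^ ?m" using sq[of ?m] by (metis of_nat_le_iff of_nat_mult of_nat_numeral of_nat_power)
  finally have "real q * real q' * (1 / 8 ^ ?m) \<le> 2 * 2 ^ ?m * (1 / 8 ^ ?m)" by (rule mult_right_mono) simp
  also have "2 * 2 ^ ?m * (1 / 8 ^ ?m) = 2 * ((1 / 2) ^ ?m * (1 / 2) ^ ?m :: real)"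
  proof -
    have "(8::real) ^ ?m = 2 ^ ?m * (2 ^ ?m * 2 ^ ?m)" by (simp flip: power_mult_distrib)
    then show ?thesis by (simp add: power_one_over)
  qed
  also have "\<dots> \<le> 2 * ((1 / 2) ^ q * (1 / 2) ^ q')"
    by (intro mult_left_mono mult_mono power_decreasing) auto
  finally show ?thesis by (simp add: mult_ac)
qed

context haar_space_wn
begin

text \<open>Stage \<open>prod_encode (j, k)\<close> chooses block \<open>k\<close> of coordinate
  \<open>j\<close>. An interaction of two blocks is controlled at the later of their two stages,
  whence the tolerance at the maximum.\<close>

lemma blocks_exist:
  fixes M :: "nat \<Rightarrow> nat \<Rightarrow> 'y \<Rightarrow>\<^sub>L 'y"
  assumes g: "\<And>j. diag_lim (M j j) (g j)" and \<eta>: "\<And>q. 0 < \<eta> q"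
  obtains f :: "nat \<Rightarrow> nat \<times> (nat \<Rightarrow> real)" where
    "\<And>j. faithful (\<lambda>k. fst (f (prod_encode (j, k)))) (\<lambda>k. snd (f (prod_encode (j, k))))"
    "\<And>j k j' k'. 1 \<le> k \<Longrightarrow> 1 \<le> k' \<Longrightarrow> (j, k) \<noteq> (j', k') \<Longrightarrow>
      \<bar>blinfun_apply (xfun (f (prod_encode (j, k)))) (blinfun_apply (M j j') (xvec (f (prod_encode (j', k')))))\<bar>
        < \<eta> (max (prod_encode (j, k)) (prod_encode (j', k')))"
    "\<And>j k. 1 \<le> k \<Longrightarrow>
      \<bar>blinfun_apply (xfun (f (prod_encode (j, k)))) (blinfun_apply (M j j) (xvec (f (prod_encode (j, k)))))
        - (\<Sum>L\<in>nodes (fst (f (prod_encode (j, k)))).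
            if tau (\<lambda>k. fst (f (prod_encode (j, k)))) (\<lambda>k. snd (f (prod_encode (j, k)))) (depth k) L = k
            then g j L else 0)\<bar> < \<eta> (prod_encode (j, k))"
    "\<And>j k. 1 \<le> k \<Longrightarrow>
      \<bar>\<Sum>L\<in>nodes (fst (f (prod_encode (j, k)))). snd (f (prod_encode (j, k))) L * (g j (2 * L) - g j (2 * L + 1))\<bar>
        < \<eta> (prod_encode (j, k))"
proof -
  define tt where "tt f j k = tau (\<lambda>k. fst (f (prod_encode (j, k)))) (\<lambda>k. snd (f (prod_encode (j, k)))) (depth k)"
    for f :: "nat \<Rightarrow> nat \<times> (nat \<Rightarrow> real)" and j k
  \<comment> \<open>Stages with \<open>k = 0\<close> carry no condition, as blocks are numbered from
    1. Interactions with earlier stages are listed in both orders, since the new block may occur as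
    functional or as vector.\<close>
  define P where "P f q r \<longleftrightarrow> (case prod_decode q of (j, k) \<Rightarrow> 1 \<le> k \<longrightarrow>
      (\<forall>q'<q. fst (f q') < fst r) \<and>
      (\<forall>K. snd r K \<in> (if K \<in> nodes (fst r) \<and> tt f j k K = k then {1, -1} else {0})) \<and>
      (\<forall>q'<q. \<bar>blinfun_apply (xfun r) (blinfun_apply (M j (fst (prod_decode q'))) (xvec (f q')))\<bar> < \<eta> q
        \<and> \<bar>blinfun_apply (xfun (f q')) (blinfun_apply (M (fst (prod_decode q')) j) (xvec r))\<bar> < \<eta> q) \<and>
      \<bar>blinfun_apply (xfun r) (blinfun_apply (M j j) (xvec r))
        - (\<Sum>L\<in>nodes (fst r). if tt f j k L = k then g j L else 0)\<bar> < \<eta> q \<and>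
      \<bar>\<Sum>L\<in>nodes (fst r). snd r L * (g j (2 * L) - g j (2 * L + 1))\<bar> < \<eta> q)"
    for f :: "nat \<Rightarrow> nat \<times> (nat \<Rightarrow> real)" and q and r :: "nat \<times> (nat \<Rightarrow> real)"
  \<comment> \<open>All blocks that \<open>tt f j k\<close> depends on were chosen before, because
    \<open>prod_encode\<close> increases in its second argument.\<close>
  have code: "prod_encode (j, i) < q" if "prod_decode q = (j, k)" "i < 2 ^ depth k" "1 \<le> k" for i j k q
  proof -
    have "i < k" using that(2) in_nodes_depth[OF that(3)] by (simp add: nodes_def)
    then have "prod_encode (j, i) < prod_encode (j, k)" by (rule prod_encode_less)
    also have "prod_encode (j, k) = q" using prod_decode_inverse[of q] that(1) by simp
    finally show ?thesis .
  qed
  have "\<exists>f. \<forall>q. P f q (f q)"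
  proof (rule dependent_wellorder_choice)
    fix r :: "nat \<times> (nat \<Rightarrow> real)" and f f' :: "nat \<Rightarrow> nat \<times> (nat \<Rightarrow> real)" and q
    assume eq: "\<And>y. y < q \<Longrightarrow> f y = f' y"
    obtain j k where jk: "prod_decode q = (j, k)" by fastforce
    have "tt f j k = tt f' j k" if "1 \<le> k"
    proof
      fix K show "tt f j k K = tt f' j k K"
        unfolding tt_def by (rule tau_cong) (use eq code[OF jk _ that] in auto)
    qed
    then show "P f q r = P f' q r" using eq unfolding P_def jk prod.case by (cases "1 \<le> k") auto
  next
    fix q and f :: "nat \<Rightarrow> nat \<times> (nat \<Rightarrow> real)"
    assume "\<And>y. y < q \<Longrightarrow> P f y (f y)"
    obtain j k where jk: "prod_decode q = (j, k)" by fastforce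
    show "\<exists>r. P f q r"
    proof (cases "1 \<le> k")
      case k: True
      define l0 where "l0 = Suc (\<Sum>q'<q. fst (f q'))"
      have l0: "fst (f q') < l0" if "q' < q" for q'
        unfolding l0_def less_Suc_eq_le using that by (intro member_le_sum) auto
      let ?Fs = "(\<lambda>q'. xfun (f q') o\<^sub>L M (fst (prod_decode q')) j) ` {..<q}"
      let ?Ys = "(\<lambda>q'. blinfun_apply (M j (fst (prod_decode q'))) (xvec (f q'))) ` {..<q}"
      have D: "(tt f j k (2 * p) = k) = (tt f j k p = k) \<and> (tt f j k (2 * p + 1) = k) = (tt f j k p = k)"
        if "l0 \<le> i" "p \<in> nodes i" for i p
      proof -
        have "fst (f (prod_encode (j, k'))) < l0" if "k' < 2 ^ depth k" for k' using l0[OF code[OF jk that k]] .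
        then have "tt f j k (2 * p) = tt f j k p" "tt f j k (Suc (2 * p)) = tt f j k p"
          unfolding tt_def by (intro tau_children[OF _ that]; blast)+
        then show ?thesis by simp
      qed
      obtain l b where lb: "l0 < l" "\<And>K. b K \<in> (if K \<in> nodes l \<and> tt f j k K = k then {1, -1} else {0})"
        "\<And>F. F \<in> ?Fs \<Longrightarrow> \<bar>blinfun_apply F (\<Sum>L\<in>nodes l. b L *\<^sub>R h L)\<bar> < \<eta> q"
        "\<And>y. y \<in> ?Ys \<Longrightarrow> \<bar>(\<Sum>L\<in>nodes l. b L * blinfun_apply (phi L) y) / 2 ^ l\<bar> < \<eta> q"
        "\<bar>(\<Sum>L\<in>nodes l. b L * blinfun_apply (phi L) (blinfun_apply (M j j) (\<Sum>L\<in>nodes l. b L *\<^sub>R h L))) / 2 ^ l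
          - (\<Sum>L\<in>nodes l. if tt f j k L = k then g j L else 0)\<bar> < \<eta> q"
        "\<bar>\<Sum>L\<in>nodes l. b L * (g j (2 * L) - g j (2 * L + 1))\<bar> < \<eta> q"
        by (rule block_exists[OF g[of j], of ?Fs ?Ys "\<eta> q" l0 "\<lambda>K. tt f j k K = k"]) (use D \<eta> in auto)
      have "P f q (l, b)"
        unfolding P_def jk prod.case fst_conv snd_conv xfun_apply[of "(l, b)"] xvec_def[of "(l, b)"]
      proof (intro impI conjI allI)
        fix q' assume "q' < q"
        then show "fst (f q') < l" using l0 lb(1) less_trans by blast
      next
        fix q' assume "q' < q"
        then show "\<bar>(\<Sum>L\<in>nodes l. b L * blinfun_apply (phi L) (blinfun_apply (M j (fst (prod_decode q'))) (xvec (f q')))) / 2 ^ l\<bar> < \<eta> q"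
          by (intro lb(4)) auto
      next
        fix q' assume "q' < q"
        then show "\<bar>blinfun_apply (xfun (f q')) (blinfun_apply (M (fst (prod_decode q')) j) (\<Sum>L\<in>nodes l. b L *\<^sub>R h L))\<bar> < \<eta> q"
          using lb(3)[of "xfun (f q') o\<^sub>L M (fst (prod_decode q')) j"] by auto
      qed (use lb in blast)+
      then show ?thesis by blast
    qed (auto simp: P_def jk)
  qed
  then obtain f where f: "\<And>q. P f q (f q)" by blast
  note P = f[of "prod_encode (j, k)" for j k, unfolded P_def prod_encode_inverse prod.case, rule_format]
  show ?thesis
  proof
    fix j
    show "faithful (\<lambda>k. fst (f (prod_encode (j, k)))) (\<lambda>k. snd (f (prod_encode (j, k))))"
    proof
      fix n i k :: nat assume ik: "1 \<le> i" "i < 2 ^ n" "k \<in> nodes n"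
      then have "i < k" "1 \<le> k" by (auto simp: nodes_def)
      then show "fst (f (prod_encode (j, i))) < fst (f (prod_encode (j, k)))"
        using P[of k j] prod_encode_less by blast
    next
      fix n k K :: nat assume k: "k \<in> nodes n"
      have "1 \<le> k" "depth k = n" using nodes_ge1[OF k] depth_nodes[OF k] by auto
      then show "snd (f (prod_encode (j, k))) K
        \<in> (if K \<in> nodes (fst (f (prod_encode (j, k)))) \<and>
             tau (\<lambda>k. fst (f (prod_encode (j, k)))) (\<lambda>k. snd (f (prod_encode (j, k)))) n K = k
           then {1, - 1} else {0})"
        using P[of k j] unfolding tt_def by blast
    qed
  next
    fix j k j' k' :: nat assume k: "1 \<le> k" "1 \<le> k'" "(j, k) \<noteq> (j', k')"
    let ?q = "prod_encode (j, k)" and ?q' = "prod_encode (j', k')"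
    have "?q \<noteq> ?q'" using k(3) by simp
    then consider "?q' < ?q" | "?q < ?q'" by linarith
    then show "\<bar>blinfun_apply (xfun (f ?q)) (blinfun_apply (M j j') (xvec (f ?q')))\<bar> < \<eta> (max ?q ?q')"
    proof cases
      case 1
      then show ?thesis using P[OF k(1), of j] by (auto simp: max_def)
    next
      case 2
      then show ?thesis using P[OF k(2), of j'] by (auto simp: max_def)
    qed
  next
    fix j k :: nat assume k: "1 \<le> k"
    show "\<bar>blinfun_apply (xfun (f (prod_encode (j, k)))) (blinfun_apply (M j j) (xvec (f (prod_encode (j, k)))))
        - (\<Sum>L\<in>nodes (fst (f (prod_encode (j, k)))).
            if tau (\<lambda>k. fst (f (prod_encode (j, k)))) (\<lambda>k. snd (f (prod_encode (j, k)))) (depth k) L = k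
            then g j L else 0)\<bar> < \<eta> (prod_encode (j, k))"
      using P[OF k, of j] unfolding tt_def by blast
    show "\<bar>\<Sum>L\<in>nodes (fst (f (prod_encode (j, k)))). snd (f (prod_encode (j, k))) L * (g j (2 * L) - g j (2 * L + 1))\<bar>
        < \<eta> (prod_encode (j, k))"
      using P[OF k, of j] by blast
  qed
qed

end

section \<open>Sequence spaces over a Banach space\<close>

lemma blinfun_compose_assoc: "(A o\<^sub>L B) o\<^sub>L C = A o\<^sub>L (B o\<^sub>L C)"
  by (rule blinfun_eqI) simp

text \<open>The solution x of x + Q x = y is the fixed point of the contraction x -> y - Q x, and
  its norm is at most that of y plus half its own.\<close>

lemma left_inverse_perturbed_id:
  fixes Q :: "'e::banach \<Rightarrow>\<^sub>L 'e"
  assumes "norm Q \<le> 1 / 2"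
  obtains M where "M o\<^sub>L (id_blinfun + Q) = id_blinfun" "norm M \<le> 2"
proof -
  have Q: "norm (blinfun_apply Q x) \<le> norm x / 2" for x
    using norm_blinfun[of Q x] mult_right_mono[OF assms norm_ge_zero[of x]] by simp
  have ex: "\<exists>!x. y - blinfun_apply Q x = x" for y
  proof -
    show ?thesis
    proof (rule banach_fix_type[where c = "1 / 2"])
      have "dist (y - blinfun_apply Q a) (y - blinfun_apply Q b) \<le> 1 / 2 * dist a b" for a b
      proof -
        have "dist (y - blinfun_apply Q a) (y - blinfun_apply Q b) = norm (blinfun_apply Q (b - a))"
          by (simp add: dist_norm blinfun.diff_right)
        also have "\<dots> \<le> norm (b - a) / 2" by (rule Q)
        finally show ?thesis by (simp add: dist_norm norm_minus_commute)
      qed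
      then show "\<forall>a b. dist (y - blinfun_apply Q a) (y - blinfun_apply Q b) \<le> 1 / 2 * dist a b" by blast
    qed simp_all
  qed
  define M where "M y = (THE x. y - blinfun_apply Q x = x)" for y
  have M: "M y + blinfun_apply Q (M y) = y" for y
    using theI'[OF ex[of y]] unfolding M_def[symmetric] by (metis diff_add_cancel add.commute)
  have uniq: "x = M y" if "x + blinfun_apply Q x = y" for x y
  proof -
    have "y - blinfun_apply Q x = x" using that by auto
    moreover have "y - blinfun_apply Q (M y) = M y" using M[of y] by (metis add_diff_cancel_right')
    ultimately show ?thesis using ex[of y] by blast
  qed
  have bound: "norm (M y) \<le> norm y * 2" for y
  proof -
    have "norm (M y) \<le> norm y + norm (blinfun_apply Q (M y))"
      using norm_triangle_ineq4[of y "blinfun_apply Q (M y)"] M[of y] by (metis add_diff_cancel_right')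
    then show ?thesis using Q[of "M y"] by simp
  qed
  have bl: "bounded_linear M"
  proof (rule bounded_linear_intro[OF _ _ bound])
    fix x y and a :: real
    have "(M x + M y) + blinfun_apply Q (M x + M y) = x + y"
      using M[of x] M[of y] by (simp add: blinfun.add_right) (metis add.assoc add.left_commute)
    then show "M (x + y) = M x + M y" using uniq by metis
    have "a *\<^sub>R M x + blinfun_apply Q (a *\<^sub>R M x) = a *\<^sub>R x"
      using M[of x] by (metis blinfun.scaleR_right scaleR_right_distrib)
    then show "M (a *\<^sub>R x) = a *\<^sub>R M x" using uniq by metis
  qed
  show ?thesis
  proof
    show "Blinfun M o\<^sub>L (id_blinfun + Q) = id_blinfun"
    proof (rule blinfun_eqI)
      fix x
      show "blinfun_apply (Blinfun M o\<^sub>L (id_blinfun + Q)) x = blinfun_apply id_blinfun x"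
        using uniq[of x "x + blinfun_apply Q x"] bl
        by (simp add: bounded_linear_Blinfun_apply blinfun.add_left)
    qed
    show "norm (Blinfun M) \<le> 2"
      by (rule norm_blinfun_bound) (use bound bl in \<open>auto simp: bounded_linear_Blinfun_apply mult.commute\<close>)
  qed
qed

text \<open>
  \<open>Idx\<close> is the set of coordinates that actually occur (a single one for the space itself, all for
  sequence spaces), and \<open>G\<close> is a set of maps along which coordinates may be selected.
\<close>

locale coord_space =
  fixes Phi :: "'e::banach \<Rightarrow> nat \<Rightarrow> 'y::banach" and P :: "(nat \<Rightarrow> real) \<Rightarrow> bool"
    and rho :: "(nat \<Rightarrow> real) \<Rightarrow> real" and Idx :: "nat set" and G :: "(nat \<Rightarrow> nat) set"
  assumes Phi_linear: "\<And>n. linear (\<lambda>v. Phi v n)"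
    and Phi_range: "range Phi = {y. P (\<lambda>n. norm (y n))}"
    and Phi_norm: "\<And>v. norm v = rho (\<lambda>n. norm (Phi v n))"
    and P_mono: "\<And>a b. P a \<Longrightarrow> (\<And>n. 0 \<le> b n) \<Longrightarrow> (\<And>n. b n \<le> a n) \<Longrightarrow> P b"
    and rho_mono: "\<And>a b. P a \<Longrightarrow> (\<And>n. 0 \<le> b n) \<Longrightarrow> (\<And>n. b n \<le> a n) \<Longrightarrow> rho b \<le> rho a"
    and P_scale: "\<And>a c. P a \<Longrightarrow> (\<And>n. 0 \<le> a n) \<Longrightarrow> 0 \<le> c \<Longrightarrow> P (\<lambda>n. c * a n)"
    and rho_scale: "\<And>a c. P a \<Longrightarrow> (\<And>n. 0 \<le> a n) \<Longrightarrow> 0 \<le> c \<Longrightarrow> rho (\<lambda>n. c * a n) \<le> c * rho a"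
    and rho_coord: "\<And>a n. P a \<Longrightarrow> (\<And>n. 0 \<le> a n) \<Longrightarrow> a n \<le> rho a"
    and P_summable: "\<And>a. (\<And>n. 0 \<le> a n) \<Longrightarrow> summable a \<Longrightarrow> (\<And>n. n \<notin> Idx \<Longrightarrow> a n = 0) \<Longrightarrow> P a"
    and rho_summable: "\<And>a. (\<And>n. 0 \<le> a n) \<Longrightarrow> summable a \<Longrightarrow> (\<And>n. n \<notin> Idx \<Longrightarrow> a n = 0) \<Longrightarrow> rho a \<le> suminf a"
    and P_zero: "\<And>a n. P a \<Longrightarrow> (\<And>n. 0 \<le> a n) \<Longrightarrow> n \<notin> Idx \<Longrightarrow> a n = 0"
    and G_inj: "\<And>\<gamma>. \<gamma> \<in> G \<Longrightarrow> inj \<gamma>"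
    and G_Idx: "\<And>\<gamma> n. \<gamma> \<in> G \<Longrightarrow> \<gamma> n \<in> Idx \<longleftrightarrow> n \<in> Idx"
    and G_select: "\<And>\<gamma> a. \<gamma> \<in> G \<Longrightarrow> P a \<Longrightarrow> (\<And>n. 0 \<le> a n) \<Longrightarrow> P (\<lambda>n. a (\<gamma> n)) \<and> rho (\<lambda>n. a (\<gamma> n)) \<le> rho a"
    and G_spread: "\<And>\<gamma> a. \<gamma> \<in> G \<Longrightarrow> P a \<Longrightarrow> (\<And>n. 0 \<le> a n) \<Longrightarrow>
      P (\<lambda>n. if n \<in> range \<gamma> then a (inv_into UNIV \<gamma> n) else 0) \<and> rho (\<lambda>n. if n \<in> range \<gamma> then a (inv_into UNIV \<gamma> n) else 0) \<le> rho a"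
    and G_dichotomy: "\<And>Q. \<exists>\<gamma>\<in>G. (\<forall>n\<in>Idx. Q (\<gamma> n)) \<or> (\<forall>n\<in>Idx. \<not> Q (\<gamma> n))"
begin

lemma Phi_P: "P (\<lambda>n. norm (Phi v n))"
  using Phi_range by blast

lemma Phi_add: "Phi (v + w) n = Phi v n + Phi w n"
  using linear_add[OF Phi_linear[of n]] .

lemma Phi_scale: "Phi (c *\<^sub>R v) n = c *\<^sub>R Phi v n"
  using linear_scale[OF Phi_linear[of n]] .

lemma Phi_diff: "Phi (v - w) n = Phi v n - Phi w n"
  using linear_diff[OF Phi_linear[of n]] .

lemma Phi_eqI: "(\<And>n. Phi v n = Phi w n) \<Longrightarrow> v = w"
proof -
  assume eq: "\<And>n. Phi v n = Phi w n"
  have "norm (v - w) = rho (\<lambda>n. 0 * norm (Phi v n))" unfolding Phi_norm by (simp add: Phi_diff eq)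
  also have "\<dots> \<le> 0" using rho_scale[OF Phi_P[of v], of 0] by simp
  finally show ?thesis by simp
qed

lemma Phi_surj: "P (\<lambda>n. norm (y n)) \<Longrightarrow> \<exists>v. Phi v = y"
  using Phi_range by (metis (mono_tags, lifting) mem_Collect_eq rangeE)

lemma Phi_outside: "n \<notin> Idx \<Longrightarrow> Phi v n = 0"
  using P_zero[OF Phi_P[of v], of n] by simp

lemma norm_Phi_le: "norm (Phi v n) \<le> norm v"
  unfolding Phi_norm[of v] by (rule rho_coord[OF Phi_P]) simp

lemma norm_le_suminf_coord:
  assumes "\<And>n. norm (Phi v n) \<le> a n" "summable a"
  shows "norm v \<le> suminf a"
proof -
  have s: "summable (\<lambda>n. norm (Phi v n))"
    by (rule summable_comparison_test'[OF assms(2), of 0]) (use assms(1) in simp)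
  have "norm v \<le> (\<Sum>n. norm (Phi v n))"
    unfolding Phi_norm by (rule rho_summable[OF _ s]) (auto simp: Phi_outside)
  also have "\<dots> \<le> suminf a" by (rule suminf_le[OF assms(1) s assms(2)])
  finally show ?thesis .
qed

section \<open>Operators that act on coordinates\<close>

lemma operator_exists:
  fixes F :: "'e \<Rightarrow> nat \<Rightarrow> 'y"
  assumes add: "\<And>v w n. F (v + w) n = F v n + F w n"
    and scale: "\<And>c v n. F (c *\<^sub>R v) n = c *\<^sub>R F v n"
    and bd: "\<And>v. P (\<lambda>n. norm (F v n)) \<and> rho (\<lambda>n. norm (F v n)) \<le> C * norm v"
    and "0 \<le> C"
  obtains L :: "'e \<Rightarrow>\<^sub>L 'e" where "\<And>v. Phi (blinfun_apply L v) = F v" "norm L \<le> C"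
proof -
  have "\<exists>w. Phi w = F v" for v using bd Phi_surj by blast
  then obtain L where L: "\<And>v. Phi (L v) = F v" by metis
  have bound: "norm (L v) \<le> norm v * C" for v
    using bd[of v] unfolding Phi_norm[of "L v"] L by (simp add: mult.commute)
  have "bounded_linear L"
    by (rule bounded_linear_intro[OF _ _ bound]; rule Phi_eqI) (simp_all add: Phi_add Phi_scale L add scale)
  then show ?thesis
    using that[of "Blinfun L"] L bound \<open>0 \<le> C\<close>
    by (simp add: bounded_linear_Blinfun_apply norm_blinfun_bound mult.commute)
qed

lemma diagonal_operator:
  fixes S :: "nat \<Rightarrow> 'y \<Rightarrow>\<^sub>L 'y"
  assumes "\<And>n. norm (S n) \<le> C"
  obtains D :: "'e \<Rightarrow>\<^sub>L 'e" where "\<And>v n. Phi (blinfun_apply D v) n = blinfun_apply (S n) (Phi v n)" "norm D \<le> C"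
proof -
  have C: "0 \<le> C" using assms[of 0] norm_ge_zero order_trans by blast
  have le: "norm (blinfun_apply (S n) y) \<le> C * norm y" for n y
    using norm_blinfun[of "S n" y] mult_right_mono[OF assms norm_ge_zero[of y]] order_trans by blast
  obtain D where "\<And>v. Phi (blinfun_apply D v) = (\<lambda>n. blinfun_apply (S n) (Phi v n))" "norm D \<le> C"
  proof (rule operator_exists[of "\<lambda>v n. blinfun_apply (S n) (Phi v n)" C])
    fix v
    have p: "P (\<lambda>n. C * norm (Phi v n))" by (rule P_scale[OF Phi_P _ C]) simp
    show "P (\<lambda>n. norm (blinfun_apply (S n) (Phi v n))) \<and> rho (\<lambda>n. norm (blinfun_apply (S n) (Phi v n))) \<le> C * norm v"
    proof
      show "P (\<lambda>n. norm (blinfun_apply (S n) (Phi v n)))"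
        by (rule P_mono[OF p]) (use le in auto)
      have "rho (\<lambda>n. norm (blinfun_apply (S n) (Phi v n))) \<le> rho (\<lambda>n. C * norm (Phi v n))"
        by (rule rho_mono[OF p]) (use le in auto)
      also have "\<dots> \<le> C * norm v" unfolding Phi_norm[of v] by (rule rho_scale[OF Phi_P _ C]) simp
      finally show "rho (\<lambda>n. norm (blinfun_apply (S n) (Phi v n))) \<le> C * norm v" .
    qed
  qed (use C in \<open>auto simp: Phi_add Phi_scale blinfun.add_right blinfun.scaleR_right\<close>)
  then show ?thesis using that by metis
qed

definition Phib :: "nat \<Rightarrow> 'e \<Rightarrow>\<^sub>L 'y" where
  "Phib n = Blinfun (\<lambda>v. Phi v n)"

lemma Phib_apply [simp]: "blinfun_apply (Phib n) v = Phi v n"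
  unfolding Phib_def
  by (rule bounded_linear_Blinfun_apply[THEN fun_cong])
     (rule bounded_linear_intro[where K = 1], auto simp: Phi_add Phi_scale norm_Phi_le)

lemma eb_exists: "\<exists>L :: 'y \<Rightarrow>\<^sub>L 'e. \<forall>y n. Phi (blinfun_apply L y) n = (if n = j \<and> j \<in> Idx then y else 0)"
proof -
  let ?F = "\<lambda>y n. if n = j \<and> j \<in> Idx then y else (0::'y)"
  have sums: "(\<lambda>n. norm (?F y n)) sums (if j \<in> Idx then norm y else 0)" for y
    using sums_If_finite_set[of "{j}" "\<lambda>n. if j \<in> Idx then norm y else 0"]
    by (simp add: if_distrib[of norm] cong: if_cong) (smt (verit) sums_cong)
  have "\<exists>w. Phi w = ?F y" for y
    by (rule Phi_surj, rule P_summable[OF _ sums_summable[OF sums]]) auto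
  then obtain L where L: "\<And>y. Phi (L y) = ?F y" by metis
  have "norm (L y) \<le> norm y * 1" for y
  proof -
    have "norm (L y) \<le> (\<Sum>n. norm (?F y n))"
      by (rule norm_le_suminf_coord[OF _ sums_summable[OF sums]]) (simp add: L)
    then show ?thesis using sums_unique[OF sums[of y]] by (simp split: if_splits)
  qed
  then have "bounded_linear L"
    by (intro bounded_linear_intro[where K = 1] Phi_eqI) (auto simp: L Phi_add Phi_scale)
  then show ?thesis using L by (intro exI[of _ "Blinfun L"]) (simp add: bounded_linear_Blinfun_apply)
qed

text \<open>The embedding of the \<open>j\<close>-th coordinate; it is 0 for \<open>j\<close>
  outside \<open>Idx\<close>, where every vector has coordinate 0.\<close>

definition eb :: "nat \<Rightarrow> 'y \<Rightarrow>\<^sub>L 'e" where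
  "eb j = (SOME L. \<forall>y n. Phi (blinfun_apply L y) n = (if n = j \<and> j \<in> Idx then y else 0))"

lemma Phi_eb: "Phi (blinfun_apply (eb j) y) n = (if n = j \<and> j \<in> Idx then y else 0)"
  using someI_ex[OF eb_exists[of j]] unfolding eb_def by blast

definition trunc :: "nat \<Rightarrow> 'e \<Rightarrow> 'e" where
  "trunc p x = (\<Sum>i<p. blinfun_apply (eb i) (Phi x i))"

lemma Phi_sum: "Phi (\<Sum>i\<in>A. f i) n = (\<Sum>i\<in>A. Phi (f i) n)"
  using linear_sum[OF Phi_linear[of n]] .

lemma Phi_trunc: "Phi (trunc p x) n = (if n < p then Phi x n else 0)"
proof -
  have "Phi (trunc p x) n = (\<Sum>i<p. if i = n then Phi x n else 0)"
    unfolding trunc_def Phi_sum by (rule sum.cong) (auto simp: Phi_eb Phi_outside)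
  then show ?thesis by simp
qed

definition is_spread :: "(nat \<Rightarrow> nat) \<Rightarrow> ('e \<Rightarrow>\<^sub>L 'e) \<Rightarrow> bool" where
  "is_spread \<gamma> U \<longleftrightarrow> (\<forall>v n. Phi (blinfun_apply U v) (\<gamma> n) = Phi v n)
     \<and> (\<forall>v m. m \<notin> range \<gamma> \<longrightarrow> Phi (blinfun_apply U v) m = 0)"

lemma spread_exists:
  assumes "\<gamma> \<in> G"
  obtains U V where "is_spread \<gamma> U" "norm U \<le> 1"
    "\<And>v n. Phi (blinfun_apply V v) n = Phi v (\<gamma> n)" "norm V \<le> 1"
proof -
  obtain U where U: "\<And>v. Phi (blinfun_apply U v) = (\<lambda>n. if n \<in> range \<gamma> then Phi v (inv_into UNIV \<gamma> n) else 0)" "norm U \<le> 1"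
  proof (rule operator_exists[of "\<lambda>v n. if n \<in> range \<gamma> then Phi v (inv_into UNIV \<gamma> n) else 0" 1])
    fix v
    from G_spread[OF assms Phi_P[of v]]
    show "P (\<lambda>n. norm (if n \<in> range \<gamma> then Phi v (inv_into UNIV \<gamma> n) else 0))
      \<and> rho (\<lambda>n. norm (if n \<in> range \<gamma> then Phi v (inv_into UNIV \<gamma> n) else 0)) \<le> 1 * norm v"
      unfolding Phi_norm[of v] by (simp add: if_distrib[of norm] cong: if_cong)
  qed (auto simp: Phi_add Phi_scale)
  obtain V where V: "\<And>v. Phi (blinfun_apply V v) = (\<lambda>n. Phi v (\<gamma> n))" "norm V \<le> 1"
  proof (rule operator_exists[of "\<lambda>v n. Phi v (\<gamma> n)" 1])
    fix v
    from G_select[OF assms Phi_P[of v]]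
    show "P (\<lambda>n. norm (Phi v (\<gamma> n))) \<and> rho (\<lambda>n. norm (Phi v (\<gamma> n))) \<le> 1 * norm v"
      unfolding Phi_norm[of v] by simp
  qed (auto simp: Phi_add Phi_scale)
  have "is_spread \<gamma> U" unfolding is_spread_def U(1) using G_inj[OF assms] by (auto simp: inv_f_f)
  then show ?thesis by (rule that[OF _ U(2) _ V(2)]) (simp add: V(1))
qed

text \<open>
  After a selection of coordinates, countably many functionals are determined by their values on
  vectors with finitely many nonzero coordinates.
\<close>

definition determined :: bool where
  "determined \<longleftrightarrow> (\<forall>F :: nat \<Rightarrow> 'e \<Rightarrow>\<^sub>L real. \<exists>\<gamma>\<in>G. \<forall>U. is_spread \<gamma> U \<longrightarrow>
     (\<forall>l x. (\<lambda>p. blinfun_apply (F l) (blinfun_apply U (trunc p x))) \<longlonglongrightarrow> blinfun_apply (F l) (blinfun_apply U x)))"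

lemma spread_eb:
  assumes "is_spread \<gamma> U" "\<gamma> \<in> G" "i \<in> Idx"
  shows "blinfun_apply U (blinfun_apply (eb i) y) = blinfun_apply (eb (\<gamma> i)) y"
proof (rule Phi_eqI)
  fix m
  show "Phi (blinfun_apply U (blinfun_apply (eb i) y)) m = Phi (blinfun_apply (eb (\<gamma> i)) y) m"
  proof (cases "m \<in> range \<gamma>")
    case True
    then obtain n where n: "m = \<gamma> n" by blast
    then show ?thesis
      using assms G_Idx[OF assms(2), of i] G_inj[OF assms(2)] by (auto simp: is_spread_def Phi_eb inj_eq)
  next
    case False
    then show ?thesis using assms by (auto simp: is_spread_def Phi_eb)
  qed
qed

end

section \<open>Factorization of the identity\<close>

lemma geometric_half: "(\<lambda>k. c * (1 / 2) ^ k) sums (2 * c :: real)"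
  using sums_mult[OF geometric_sums[of "1 / 2 :: real"], of c] by (simp add: mult.commute)

locale hardy_sequence_space = haar_space_wn Nn ind h + coord_space Phi P rho Idx G
  for Nn ind and h :: "nat \<Rightarrow> 'y::banach" and Phi :: "'e::banach \<Rightarrow> nat \<Rightarrow> 'y" and P rho Idx G
begin

definition entry :: "('e \<Rightarrow>\<^sub>L 'e) \<Rightarrow> nat \<Rightarrow> nat \<Rightarrow> 'y \<Rightarrow>\<^sub>L 'y" where
  "entry T j i = Phib j o\<^sub>L T o\<^sub>L eb i"

lemma entry_apply: "blinfun_apply (entry T j i) y = Phi (blinfun_apply T (blinfun_apply (eb i) y)) j"
  by (simp add: entry_def)

text \<open>\<open>B\<close> embeds every coordinate through its own faithful copy. \<open>A\<close>
  projects back, divides by the limit \<open>g j 1\<close>, and inverts the resulting perturbation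
  of the identity. \<open>det\<close> permits summation over coordinates even where finitely
  supported vectors are not dense.\<close>

lemma factor_large_diagonal:
  fixes T :: "'e \<Rightarrow>\<^sub>L 'e"
  assumes lim: "\<And>j. j \<in> Idx \<Longrightarrow> \<exists>g. diag_lim (entry T j j) g \<and> 1 / 2 \<le> \<bar>g 1\<bar>"
    and det: "\<And>j K x. 1 \<le> K \<Longrightarrow> (\<lambda>p. blinfun_apply (phi K) (Phi (blinfun_apply T (trunc p x)) j))
      \<longlonglongrightarrow> blinfun_apply (phi K) (Phi (blinfun_apply T x) j)"
  obtains A B :: "'e \<Rightarrow>\<^sub>L 'e" where "A o\<^sub>L T o\<^sub>L B = id_blinfun" "norm A \<le> 4" "norm B \<le> 1"
proof -
  have "\<exists>g. diag_lim (entry T j j) g \<and> (j \<in> Idx \<longrightarrow> 1 / 2 \<le> \<bar>g 1\<bar>)" for j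
    using lim diag_lim_exists by blast
  then obtain g where g: "\<And>j. diag_lim (entry T j j) (g j)" "\<And>j. j \<in> Idx \<Longrightarrow> 1 / 2 \<le> \<bar>g j 1\<bar>" by metis
  \<comment> \<open>Chosen so that 80 e = 1/2: the multipliers will contribute 16 e and the
    remaining entries 64 e.\<close>
  define e :: real where "e = 1 / 160"
  have e0: "0 < e" by (simp add: e_def)
  define \<eta> where "\<eta> q = e / 8 ^ q" for q :: nat
  have \<eta>0: "0 < \<eta> q" for q by (simp add: \<eta>_def e_def)
  obtain f where fa: "\<And>j. faithful (\<lambda>k. fst (f (prod_encode (j, k)))) (\<lambda>k. snd (f (prod_encode (j, k))))"
    and off: "\<And>j k j' k'. 1 \<le> k \<Longrightarrow> 1 \<le> k' \<Longrightarrow> (j, k) \<noteq> (j', k') \<Longrightarrow>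
      \<bar>blinfun_apply (xfun (f (prod_encode (j, k)))) (blinfun_apply (entry T j j') (xvec (f (prod_encode (j', k')))))\<bar>
        < \<eta> (max (prod_encode (j, k)) (prod_encode (j', k')))"
    and dia: "\<And>j k. 1 \<le> k \<Longrightarrow>
      \<bar>blinfun_apply (xfun (f (prod_encode (j, k)))) (blinfun_apply (entry T j j) (xvec (f (prod_encode (j, k)))))
        - (\<Sum>L\<in>nodes (fst (f (prod_encode (j, k)))).
            if tau (\<lambda>k. fst (f (prod_encode (j, k)))) (\<lambda>k. snd (f (prod_encode (j, k)))) (depth k) L = k
            then g j L else 0)\<bar> < \<eta> (prod_encode (j, k))"
    and bal: "\<And>j k. 1 \<le> k \<Longrightarrow>
      \<bar>\<Sum>L\<in>nodes (fst (f (prod_encode (j, k)))). snd (f (prod_encode (j, k))) L * (g j (2 * L) - g j (2 * L + 1))\<bar>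
        < \<eta> (prod_encode (j, k))"
    by (rule blocks_exist[of "entry T" g \<eta>]) (use g(1) \<eta>0 in auto)
  define l where "l j k = fst (f (prod_encode (j, k)))" for j k
  define \<beta> where "\<beta> j k = snd (f (prod_encode (j, k)))" for j k
  have fai: "faithful (l j) (\<beta> j)" for j using fa[of j] unfolding l_def[abs_def] \<beta>_def[abs_def] .
  have xb: "xvec (f (prod_encode (j, k))) = blk (l j) (\<beta> j) k" for j k
    by (simp add: xvec_def blk_def l_def \<beta>_def)
  have xp: "blinfun_apply (psi (l j) (\<beta> j) k) y = 2 ^ depth k * blinfun_apply (xfun (f (prod_encode (j, k)))) y" for j k y
    by (simp add: xfun_apply psi_apply l_def \<beta>_def)
  have d_le: "(2::real) ^ depth k \<le> real k" if "1 \<le> k" for k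
  proof -
    have "2 ^ depth k \<le> k" using in_nodes_depth[OF that] by (simp add: nodes_def)
    then show ?thesis by (metis of_nat_le_iff of_nat_numeral of_nat_power)
  qed
  \<comment> \<open>\<open>2 ^ depth k\<close> normalizes the functional of the row, and
    \<open>k'\<close> bounds the coefficient of the column. The outcome is a product of geometric
    terms, so the sums over \<open>k'\<close>, \<open>i\<close>, \<open>k\<close> and
    \<open>j\<close> can be taken one after the other.\<close>
  have weight: "2 ^ depth k * \<eta> (max (prod_encode (j, k)) (prod_encode (i, k'))) * real k'
      \<le> 2 * e * (1 / 2) ^ (j + k + i) * (1 / 2) ^ k'" if "1 \<le> k" for j k i k'
  proof -
    let ?q = "prod_encode (j, k)" and ?q' = "prod_encode (i, k')"
    have q: "j + k \<le> ?q" "i + k' \<le> ?q'" by (rule prod_encode_ge)+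
    have "2 ^ depth k * \<eta> (max ?q ?q') * real k' \<le> real ?q * \<eta> (max ?q ?q') * real ?q'"
      using d_le[OF that] q \<eta>0 by (intro mult_mono mult_nonneg_nonneg) (auto simp: less_imp_le intro: order_trans)
    also have "\<dots> = e * (real ?q * (1 / 8 ^ max ?q ?q') * real ?q')" by (simp add: \<eta>_def)
    also have "\<dots> \<le> e * (2 * ((1 / 2) ^ ?q * (1 / 2) ^ ?q'))" by (intro mult_left_mono weight_bound) (use e0 in simp)
    also have "\<dots> \<le> e * (2 * ((1 / 2) ^ (j + k) * (1 / 2) ^ (i + k')))"
      using q e0 by (intro mult_left_mono mult_mono power_decreasing) auto
    also have "\<dots> = 2 * e * (1 / 2) ^ (j + k + i) * (1 / 2) ^ k'" by (simp add: power_add)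
    finally show ?thesis .
  qed
  define \<delta> where "\<delta> j i = 2 ^ depth i * (\<Sum>L\<in>nodes (l j i). \<beta> j i L * (g j (2 * L) - g j (2 * L + 1)))" for j i
  \<comment> \<open>\<open>bal\<close> says nothing about index 0, whereas the multiplier is built
    from bounds for all indices.\<close>
  define \<delta>' where "\<delta>' j i = (if 1 \<le> i then \<delta> j i else 0)" for j i
  define mu where "mu j k = g j 1 + (\<Sum>i\<in>{1..<k}. \<delta> j i * hs i k)" for j k
  have \<delta>: "\<bar>\<delta>' j i\<bar> \<le> 2 * e * (1 / 2) ^ i" for j i
  proof (cases "1 \<le> i")
    case True
    have "\<bar>\<delta> j i\<bar> \<le> 2 ^ depth i * \<eta> (prod_encode (j, i))"
      using bal[OF True, of j] by (simp add: \<delta>_def l_def \<beta>_def abs_mult)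
    also have "\<dots> \<le> 2 ^ depth i * \<eta> (max (prod_encode (j, i)) (prod_encode (j, i))) * real i"
      using True mult_left_mono[of 1 "real i" "2 ^ depth i * \<eta> (prod_encode (j, i))"] \<eta>0[of "prod_encode (j, i)"]
      by (simp add: less_imp_le)
    also have "\<dots> \<le> 2 * e * (1 / 2) ^ (j + i + j) * (1 / 2) ^ i" by (rule weight[OF True])
    also have "\<dots> \<le> 2 * e * 1 * (1 / 2) ^ i"
      using e0 by (intro mult_right_mono mult_left_mono power_le_one) auto
    finally show ?thesis using True by (simp add: \<delta>'_def)
  qed (use e0 in \<open>simp add: \<delta>'_def\<close>)
  have mu: "2 ^ depth k * (\<Sum>L\<in>nodes (l j k). if tau (l j) (\<beta> j) (depth k) L = k then g j L else 0) = mu j k"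
    if "1 \<le> k" for j k
    using faithful.support_mean[OF fai[of j] diag_lim_additive[OF g(1)[of j]] in_nodes_depth[OF that]]
    by (simp add: mu_def \<delta>_def)
  have "\<exists>D. (\<forall>k\<ge>1. blinfun_apply D (h k) = (\<Sum>i\<in>{1..<k}. \<delta>' j i * hs i k) *\<^sub>R h k) \<and> norm D \<le> 8 * e" for j
  proof -
    have s: "summable (\<lambda>i. 2 * e * (1 / 2) ^ i)" "suminf (\<lambda>i. 2 * e * (1 / 2) ^ i) = 4 * e"
      using geometric_half[of "2 * e"] by (auto simp: sums_iff)
    obtain D where "\<And>k. 1 \<le> k \<Longrightarrow> blinfun_apply D (h k) = (\<Sum>i\<in>{1..<k}. \<delta>' j i * hs i k) *\<^sub>R h k"
      "norm D \<le> 2 * suminf (\<lambda>i. 2 * e * (1 / 2) ^ i)"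
    proof (rule multiplier_operator[OF s(1) _ \<delta>[of j]])
      show "0 \<le> 2 * e * (1 / 2) ^ i" for i using e0 by simp
    qed blast
    then show ?thesis using s(2) by auto
  qed
  then obtain D where D: "\<And>j k. 1 \<le> k \<Longrightarrow> blinfun_apply (D j) (h k) = (\<Sum>i\<in>{1..<k}. \<delta>' j i * hs i k) *\<^sub>R h k"
    "\<And>j. norm (D j) \<le> 8 * e" by metis
  \<comment> \<open>\<open>g j 1\<close> times the identity plus \<open>D j\<close> is the
    multiplier with entries \<open>mu j k\<close>, the normalized means of \<open>g j\<close> over
    the supports of the blocks.\<close>
  have phiD: "g j 1 * blinfun_apply (phi k) y + blinfun_apply (phi k) (blinfun_apply (D j) y) = mu j k * blinfun_apply (phi k) y"
    if k: "1 \<le> k" for j k y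
  proof -
    have "phi k o\<^sub>L D j = (mu j k - g j 1) *\<^sub>R phi k"
    proof (rule blinfun_eq_dense)
      fix i :: nat assume i: "1 \<le> i"
      have "(\<Sum>i'\<in>{1..<k}. \<delta>' j i' * hs i' k) = mu j k - g j 1" unfolding mu_def by (simp add: \<delta>'_def)
      then show "blinfun_apply (phi k o\<^sub>L D j) (h i) = blinfun_apply ((mu j k - g j 1) *\<^sub>R phi k) (h i)"
        using phi_h[OF k i] D(1)[OF i, of j] by (simp add: blinfun.scaleR_right blinfun.scaleR_left)
    qed
    then have "blinfun_apply (phi k) (blinfun_apply (D j) y) = (mu j k - g j 1) * blinfun_apply (phi k) y"
      by (metis blinfun_apply_blinfun_compose blinfun.scaleR_left real_scaleR_def)
    then show ?thesis by (simp add: algebra_simps)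
  qed
  have "\<exists>A. (\<forall>k\<ge>1. \<forall>y. blinfun_apply (phi k) (blinfun_apply A y) = blinfun_apply (psi (l j) (\<beta> j) k) y) \<and> norm A \<le> 1" for j
    by (rule projection_operator[OF fai[of j]]) blast
  then obtain A where A: "\<And>j k y. 1 \<le> k \<Longrightarrow> blinfun_apply (phi k) (blinfun_apply (A j) y) = blinfun_apply (psi (l j) (\<beta> j) k) y"
    "\<And>j. norm (A j) \<le> 1" by metis
  have "\<exists>B. (\<forall>k\<ge>1. blinfun_apply B (h k) = blk (l j) (\<beta> j) k) \<and> norm B \<le> 1" for j
    by (rule embedding_operator[OF fai[of j]]) blast
  then obtain B where B: "\<And>j k. 1 \<le> k \<Longrightarrow> blinfun_apply (B j) (h k) = blk (l j) (\<beta> j) k" "\<And>j. norm (B j) \<le> 1" by metis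
  obtain BB :: "'e \<Rightarrow>\<^sub>L 'e" where BB: "\<And>v n. Phi (blinfun_apply BB v) n = blinfun_apply (B n) (Phi v n)" "norm BB \<le> 1"
    using diagonal_operator[of B 1] B(2) by blast
  \<comment> \<open>Row \<open>(j, k)\<close> and column \<open>i\<close> of the compressed
    operator, minus the multiplier on the diagonal. Its values on the basis are bounded by the
    tolerances times \<open>2 ^ depth k\<close>.\<close>
  define F where "F j k i = (psi (l j) (\<beta> j) k o\<^sub>L entry T j i o\<^sub>L B i) - (if i = j then mu j k *\<^sub>R phi k else 0)" for j k i
  have F: "\<bar>blinfun_apply (F j k i) y\<bar> \<le> 4 * e * (1 / 2) ^ (j + k + i) * norm y" if k: "1 \<le> k" for j k i y
  proof -
    define a where "a k' = 2 * e * (1 / 2) ^ (j + k + i) * (1 / 2) ^ k'" for k' :: nat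
    have a: "a sums (2 * (2 * e * (1 / 2) ^ (j + k + i)))" unfolding a_def by (rule geometric_half)
    have "\<bar>blinfun_apply (F j k i) y\<bar> \<le> suminf a * norm y"
    proof (rule functional_bound)
      fix k' :: nat assume k': "1 \<le> k'"
      let ?x = "blinfun_apply (xfun (f (prod_encode (j, k)))) (blinfun_apply (entry T j i) (xvec (f (prod_encode (i, k')))))"
      have Fh: "blinfun_apply (F j k i) (h k') = 2 ^ depth k * ?x - (if i = j \<and> k' = k then mu j k else 0)"
        using phi_h[OF k k'] phi_h[OF k k] B(1)[OF k'] by (simp add: F_def blinfun.diff_left blinfun.scaleR_left xp xb)
      have "\<bar>blinfun_apply (F j k i) (h k')\<bar> \<le> 2 ^ depth k * \<eta> (max (prod_encode (j, k)) (prod_encode (i, k')))"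
      proof (cases "(j, k) = (i, k')")
        case False
        then show ?thesis using off[OF k k' False] unfolding Fh by (auto simp: abs_mult)
      next
        case True
        have "\<bar>2 ^ depth k * ?x - mu j k\<bar> = 2 ^ depth k * \<bar>?x - (\<Sum>L\<in>nodes (l j k). if tau (l j) (\<beta> j) (depth k) L = k then g j L else 0)\<bar>"
          unfolding mu[OF k, symmetric] right_diff_distrib[symmetric] abs_mult by simp
        also have "\<dots> \<le> 2 ^ depth k * \<eta> (prod_encode (j, k))"
          using dia[OF k, of j] True unfolding l_def[symmetric] \<beta>_def[symmetric] l_def[abs_def, symmetric] \<beta>_def[abs_def, symmetric]
          by (intro mult_left_mono) auto
        finally show ?thesis using True unfolding Fh by simp
      qed
      then have "\<bar>blinfun_apply (F j k i) (h k')\<bar> * real k'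
          \<le> 2 ^ depth k * \<eta> (max (prod_encode (j, k)) (prod_encode (i, k'))) * real k'" by (rule mult_right_mono) simp
      then show "\<bar>blinfun_apply (F j k i) (h k')\<bar> * real k' \<le> a k'"
        using weight[OF k, of j i k'] unfolding a_def by linarith
    next
      show "summable a" using a by (rule sums_summable)
      show "0 \<le> a k'" for k' using e0 by (simp add: a_def)
    qed
    then show ?thesis unfolding sums_unique[OF a, symmetric] by (simp add: mult_ac)
  qed
  define R where "R j x = blinfun_apply (A j) (Phi (blinfun_apply T (blinfun_apply BB x)) j)
      - g j 1 *\<^sub>R Phi x j - blinfun_apply (D j) (Phi x j)" for j x
  have phiR: "\<bar>blinfun_apply (phi k) (R j x)\<bar> \<le> 8 * e * (1 / 2) ^ j * norm x * (1 / 2) ^ k" if k: "1 \<le> k" for j k x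
  proof -
    have nn: "0 \<le> 4 * e * (1 / 2) ^ (j + k) * norm x" using e0 by simp
    \<comment> \<open>Here \<open>det\<close> enters: the coefficient is a limit over truncations,
      so the estimates for single columns can be added up.\<close>
    have "(\<lambda>p. blinfun_apply (psi (l j) (\<beta> j) k) (Phi (blinfun_apply T (trunc p (blinfun_apply BB x))) j))
        \<longlonglongrightarrow> blinfun_apply (psi (l j) (\<beta> j) k) (Phi (blinfun_apply T (blinfun_apply BB x)) j)"
      unfolding psi_apply by (intro tendsto_intros det nodes_ge1)
    moreover have "blinfun_apply (psi (l j) (\<beta> j) k) (Phi (blinfun_apply T (trunc p (blinfun_apply BB x))) j)
        = (\<Sum>i<p. blinfun_apply (psi (l j) (\<beta> j) k) (blinfun_apply (entry T j i) (blinfun_apply (B i) (Phi x i))))" for p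
      by (simp add: trunc_def blinfun.sum_right Phi_sum entry_apply BB)
    ultimately have lim: "(\<lambda>p. (\<Sum>i<p. blinfun_apply (psi (l j) (\<beta> j) k) (blinfun_apply (entry T j i) (blinfun_apply (B i) (Phi x i))))
          - mu j k * blinfun_apply (phi k) (Phi x j))
        \<longlonglongrightarrow> blinfun_apply (psi (l j) (\<beta> j) k) (Phi (blinfun_apply T (blinfun_apply BB x)) j) - mu j k * blinfun_apply (phi k) (Phi x j)"
      by (intro tendsto_diff tendsto_const) simp
    have bd: "\<bar>(\<Sum>i<p. blinfun_apply (psi (l j) (\<beta> j) k) (blinfun_apply (entry T j i) (blinfun_apply (B i) (Phi x i))))
          - mu j k * blinfun_apply (phi k) (Phi x j)\<bar> \<le> 8 * e * (1 / 2) ^ j * norm x * (1 / 2) ^ k" if p: "j < p" for p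
    proof -
      have "(\<Sum>i<p. blinfun_apply (psi (l j) (\<beta> j) k) (blinfun_apply (entry T j i) (blinfun_apply (B i) (Phi x i))))
          - mu j k * blinfun_apply (phi k) (Phi x j)
        = (\<Sum>i<p. blinfun_apply (psi (l j) (\<beta> j) k) (blinfun_apply (entry T j i) (blinfun_apply (B i) (Phi x i)))
            - (if i = j then mu j k * blinfun_apply (phi k) (Phi x j) else 0))"
        using p by (simp add: sum_subtractf)
      also have "\<dots> = (\<Sum>i<p. blinfun_apply (F j k i) (Phi x i))"
        by (rule sum.cong) (auto simp: F_def blinfun.diff_left blinfun.scaleR_left)
      also have "\<bar>\<dots>\<bar> \<le> (\<Sum>i<p. 4 * e * (1 / 2) ^ (j + k) * norm x * (1 / 2) ^ i)"
      proof (rule order_trans[OF sum_abs sum_mono])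
        fix i
        have "\<bar>blinfun_apply (F j k i) (Phi x i)\<bar> \<le> 4 * e * (1 / 2) ^ (j + k + i) * norm (Phi x i)" by (rule F[OF k])
        also have "\<dots> \<le> 4 * e * (1 / 2) ^ (j + k + i) * norm x"
          using e0 by (intro mult_left_mono norm_Phi_le) auto
        finally show "\<bar>blinfun_apply (F j k i) (Phi x i)\<bar> \<le> 4 * e * (1 / 2) ^ (j + k) * norm x * (1 / 2) ^ i"
          by (simp add: power_add mult_ac)
      qed
      also have "\<dots> \<le> 2 * (4 * e * (1 / 2) ^ (j + k) * norm x)"
        using sum_le_suminf[OF sums_summable[OF geometric_half[of "4 * e * (1 / 2) ^ (j + k) * norm x"]], of "{..<p}"]
          sums_unique[OF geometric_half[of "4 * e * (1 / 2) ^ (j + k) * norm x"]] nn by simp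
      finally show ?thesis by (simp add: power_add mult_ac)
    qed
    have "\<bar>blinfun_apply (psi (l j) (\<beta> j) k) (Phi (blinfun_apply T (blinfun_apply BB x)) j) - mu j k * blinfun_apply (phi k) (Phi x j)\<bar>
        \<le> 8 * e * (1 / 2) ^ j * norm x * (1 / 2) ^ k"
      by (rule LIMSEQ_le_const2[OF tendsto_rabs[OF lim]]) (use bd in \<open>auto intro!: exI[of _ "Suc j"]\<close>)
    moreover have "blinfun_apply (phi k) (R j x)
      = blinfun_apply (psi (l j) (\<beta> j) k) (Phi (blinfun_apply T (blinfun_apply BB x)) j) - mu j k * blinfun_apply (phi k) (Phi x j)"
      unfolding phiD[OF k, of j "Phi x j", symmetric] R_def
      by (simp add: blinfun.diff_right blinfun.scaleR_right A(1)[OF k])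
    ultimately show ?thesis by simp
  qed
  have R: "norm (R j x) \<le> 16 * e * norm x * (1 / 2) ^ j" for j x
  proof -
    have s: "(\<lambda>k. 8 * e * (1 / 2) ^ j * norm x * (1 / 2) ^ k) sums (2 * (8 * e * (1 / 2) ^ j * norm x))"
      by (rule geometric_half)
    have "norm (R j x) \<le> (\<Sum>k. 8 * e * (1 / 2) ^ j * norm x * (1 / 2) ^ k)"
      by (rule norm_le_suminf_phi[OF phiR sums_summable[OF s]]) (use e0 in auto)
    then show ?thesis using sums_unique[OF s] by (simp add: mult_ac)
  qed
  \<comment> \<open>A limit of absolute value at least 1/2 has an inverse of absolute value at most
    2. Off \<open>Idx\<close> all coordinates vanish, and 0 keeps the bound.\<close>
  define c where "c j = (if j \<in> Idx then 1 / g j 1 else 0)" for j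
  have c: "\<bar>c j\<bar> \<le> 2" for j
    using g(2)[of j] by (auto simp: c_def divide_le_eq abs_divide)
  have nW: "norm (c j *\<^sub>R A j) \<le> 2" for j
    using mult_mono[OF c[of j] A(2)[of j]] by simp
  obtain WW :: "'e \<Rightarrow>\<^sub>L 'e" where WW: "\<And>v n. Phi (blinfun_apply WW v) n = blinfun_apply (c n *\<^sub>R A n) (Phi v n)" "norm WW \<le> 2"
    using diagonal_operator[of "\<lambda>n. c n *\<^sub>R A n" 2] nW by blast
  have nD: "norm (c j *\<^sub>R D j) \<le> 2 * (8 * e)" for j
    unfolding norm_scaleR by (intro mult_mono c D) auto
  obtain Q1 :: "'e \<Rightarrow>\<^sub>L 'e" where Q1: "\<And>v n. Phi (blinfun_apply Q1 v) n = blinfun_apply (c n *\<^sub>R D n) (Phi v n)" "norm Q1 \<le> 2 * (8 * e)"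
    using diagonal_operator[of "\<lambda>n. c n *\<^sub>R D n" "2 * (8 * e)"] nD by blast
  define Q where "Q = (WW o\<^sub>L T o\<^sub>L BB) - id_blinfun"
  have "norm (blinfun_apply (Q - Q1) x) \<le> 64 * e * norm x" for x
  proof -
    have s: "(\<lambda>j. 32 * e * norm x * (1 / 2) ^ j) sums (2 * (32 * e * norm x))" by (rule geometric_half)
    have "norm (blinfun_apply (Q - Q1) x) \<le> (\<Sum>j. 32 * e * norm x * (1 / 2) ^ j)"
    proof (rule norm_le_suminf_coord[OF _ sums_summable[OF s]])
      fix j
      have "Phi (blinfun_apply (Q - Q1) x) j = c j *\<^sub>R R j x"
      proof (cases "j \<in> Idx")
        case True
        then have "c j *\<^sub>R (g j 1 *\<^sub>R Phi x j) = Phi x j" using g(2)[OF True] by (auto simp: c_def)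
        then show ?thesis
          by (simp add: Q_def R_def blinfun.diff_left Phi_diff WW Q1 blinfun.scaleR_left scaleR_diff_right)
      next
        case False
        then show ?thesis using Phi_outside[OF False] by (simp add: c_def)
      qed
      then have "norm (Phi (blinfun_apply (Q - Q1) x) j) = \<bar>c j\<bar> * norm (R j x)" by simp
      also have "\<dots> \<le> 2 * (16 * e * norm x * (1 / 2) ^ j)" by (intro mult_mono c R) auto
      finally show "norm (Phi (blinfun_apply (Q - Q1) x) j) \<le> 32 * e * norm x * (1 / 2) ^ j" by simp
    qed
    then show ?thesis using sums_unique[OF s] by simp
  qed
  then have "norm (Q - Q1) \<le> 64 * e" by (intro norm_blinfun_bound) (use e0 in auto)
  then have "norm Q \<le> 80 * e" using Q1(2) norm_triangle_ineq[of "Q - Q1" Q1] by simp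
  then have "norm Q \<le> 1 / 2" by (simp add: e_def)
  then obtain M where M: "M o\<^sub>L (id_blinfun + Q) = id_blinfun" "norm M \<le> 2" by (rule left_inverse_perturbed_id)
  have "(M o\<^sub>L WW) o\<^sub>L T o\<^sub>L BB = M o\<^sub>L (id_blinfun + Q)"
    by (simp add: Q_def blinfun_compose_assoc)
  then have "(M o\<^sub>L WW) o\<^sub>L T o\<^sub>L BB = id_blinfun" using M(1) by simp
  moreover have "norm (M o\<^sub>L WW) \<le> 4"
    using norm_blinfun_compose[of M WW] mult_mono[OF M(2) WW(2)] by simp
  ultimately show ?thesis using BB(2) that by blast
qed

text \<open>Two selections of coordinates are composed. The first makes the large limits belong to
  the same operator on all of \<open>Idx\<close>; the second makes the countably many coefficient
  functionals of the compressed operator determined by finite supports. Compression along a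
  selection only renumbers the diagonal entries.\<close>

theorem primary_factorization:
  assumes "determined"
  shows "primary_factorization_property 4 TYPE('e)"
  unfolding primary_factorization_property_def
proof
  fix T :: "'e \<Rightarrow>\<^sub>L 'e"
  have sel: "factors_through id_blinfun T' 4"
    if \<gamma>: "\<gamma>\<^sub>1 \<in> G" and lim: "\<And>j. j \<in> Idx \<Longrightarrow> \<exists>g. diag_lim (entry T' (\<gamma>\<^sub>1 j) (\<gamma>\<^sub>1 j)) g \<and> 1 / 2 \<le> \<bar>g 1\<bar>"
    for T' :: "'e \<Rightarrow>\<^sub>L 'e" and \<gamma>\<^sub>1
  proof -
    obtain U1 V1 where 1: "is_spread \<gamma>\<^sub>1 U1" "norm U1 \<le> 1"
      "\<And>v n. Phi (blinfun_apply V1 v) n = Phi v (\<gamma>\<^sub>1 n)" "norm V1 \<le> 1"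
      using spread_exists[OF \<gamma>] by blast
    define T1 where "T1 = V1 o\<^sub>L T' o\<^sub>L U1"
    define F where "F q = (case prod_decode q of (j, K) \<Rightarrow> phi K o\<^sub>L Phib j o\<^sub>L T1)" for q
    obtain \<gamma>\<^sub>2 where \<gamma>2: "\<gamma>\<^sub>2 \<in> G" "\<And>U l x. is_spread \<gamma>\<^sub>2 U \<Longrightarrow>
      (\<lambda>p. blinfun_apply (F l) (blinfun_apply U (trunc p x))) \<longlonglongrightarrow> blinfun_apply (F l) (blinfun_apply U x)"
      using assms unfolding determined_def by metis
    obtain U2 V2 where 2: "is_spread \<gamma>\<^sub>2 U2" "norm U2 \<le> 1"
      "\<And>v n. Phi (blinfun_apply V2 v) n = Phi v (\<gamma>\<^sub>2 n)" "norm V2 \<le> 1"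
      using spread_exists[OF \<gamma>2(1)] by blast
    define T2 where "T2 = V2 o\<^sub>L T1 o\<^sub>L U2"
    have lim2: "\<exists>g. diag_lim (entry T2 j j) g \<and> 1 / 2 \<le> \<bar>g 1\<bar>" if j: "j \<in> Idx" for j
    proof -
      have j2: "\<gamma>\<^sub>2 j \<in> Idx" using G_Idx[OF \<gamma>2(1)] j by simp
      have "entry T2 j j = entry T' (\<gamma>\<^sub>1 (\<gamma>\<^sub>2 j)) (\<gamma>\<^sub>1 (\<gamma>\<^sub>2 j))"
        by (rule blinfun_eqI)
           (simp add: entry_apply T2_def T1_def 1 2 spread_eb[OF 2(1) \<gamma>2(1) j] spread_eb[OF 1(1) \<gamma> j2])
      then show ?thesis using lim[OF j2] by simp
    qed
    have det2: "(\<lambda>p. blinfun_apply (phi K) (Phi (blinfun_apply T2 (trunc p x)) j))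
        \<longlonglongrightarrow> blinfun_apply (phi K) (Phi (blinfun_apply T2 x) j)" for j K :: nat and x
      using \<gamma>2(2)[OF 2(1), of "prod_encode (\<gamma>\<^sub>2 j, K)" x] by (simp add: F_def T2_def 2)
    obtain A B :: "'e \<Rightarrow>\<^sub>L 'e" where AB: "A o\<^sub>L T2 o\<^sub>L B = id_blinfun" "norm A \<le> 4" "norm B \<le> 1"
      by (rule factor_large_diagonal[OF lim2 det2])
    let ?A = "A o\<^sub>L V2 o\<^sub>L V1" and ?B = "U1 o\<^sub>L U2 o\<^sub>L B"
    have comp: "norm (X o\<^sub>L Y) \<le> a * 1" if "norm X \<le> a" "norm Y \<le> 1" for X Y :: "'e \<Rightarrow>\<^sub>L 'e" and a
      using norm_blinfun_compose[of X Y] mult_mono[OF that] norm_ge_zero[of X] that(1) by force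
    have "norm ?A \<le> 4" using comp[OF comp[OF AB(2) 2(4)] 1(4)] by simp
    moreover have "norm ?B \<le> 1" using comp[OF comp[OF 1(2) 2(2)] AB(3)] by simp
    ultimately have "norm ?A * norm ?B \<le> 4 * 1" by (intro mult_mono) auto
    moreover have "id_blinfun = ?A o\<^sub>L T' o\<^sub>L ?B"
      using AB(1) by (simp add: T2_def T1_def blinfun_compose_assoc)
    ultimately show ?thesis unfolding factors_through_def by (intro exI[of _ ?A] exI[of _ ?B]) auto
  qed
  have plus: "factors_through_plus id_blinfun T' 4" if "factors_through id_blinfun T' 4" for T' :: "'e \<Rightarrow>\<^sub>L 'e"
    using that unfolding factors_through_plus_def factors_through_def by (meson add_increasing2 less_imp_le order_trans order_refl)
  have "\<exists>g. diag_lim (entry T j j) g" for j by (rule diag_lim_exists)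
  then obtain g where g: "\<And>j. diag_lim (entry T j j) (g j)" by metis
  obtain \<gamma> where \<gamma>: "\<gamma> \<in> G" "(\<forall>n\<in>Idx. 1 / 2 \<le> \<bar>g (\<gamma> n) 1\<bar>) \<or> (\<forall>n\<in>Idx. \<not> 1 / 2 \<le> \<bar>g (\<gamma> n) 1\<bar>)"
    using G_dichotomy[of "\<lambda>n. 1 / 2 \<le> \<bar>g n 1\<bar>"] by blast
  from \<gamma>(2) show "factors_through_plus id_blinfun T 4 \<or> factors_through_plus id_blinfun (id_blinfun - T) 4"
  proof
    assume "\<forall>n\<in>Idx. 1 / 2 \<le> \<bar>g (\<gamma> n) 1\<bar>"
    then have "factors_through id_blinfun T 4" using g by (intro sel[OF \<gamma>(1)]) blast
    then show ?thesis using plus by blast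
  next
    assume small: "\<forall>n\<in>Idx. \<not> 1 / 2 \<le> \<bar>g (\<gamma> n) 1\<bar>"
    have "factors_through id_blinfun (id_blinfun - T) 4"
    proof (rule sel[OF \<gamma>(1)])
      fix j assume j: "j \<in> Idx"
      have j': "\<gamma> j \<in> Idx" using G_Idx[OF \<gamma>(1)] j by simp
      have "entry (id_blinfun - T) (\<gamma> j) (\<gamma> j) = id_blinfun - entry T (\<gamma> j) (\<gamma> j)"
        by (rule blinfun_eqI) (simp add: entry_apply blinfun.diff_left Phi_diff Phi_eb j')
      then have "diag_lim (entry (id_blinfun - T) (\<gamma> j) (\<gamma> j)) (\<lambda>k. 1 / 2 ^ depth k - g (\<gamma> j) k)"
        using diag_lim_complement[OF g[of "\<gamma> j"]] by simp
      moreover have "1 / 2 \<le> \<bar>1 / 2 ^ depth 1 - g (\<gamma> j) 1\<bar>" using small j by (auto simp: not_le abs_less_iff)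
      ultimately show "\<exists>g. diag_lim (entry (id_blinfun - T) (\<gamma> j) (\<gamma> j)) g \<and> 1 / 2 \<le> \<bar>g 1\<bar>" by blast
    qed
    then show ?thesis using plus by blast
  qed
qed

end

section \<open>Step functions and the Haar system\<close>

definition node :: "nat \<Rightarrow> real \<Rightarrow> nat" where
  "node m s = 2 ^ m + nat \<lfloor>2 ^ m * s\<rfloor>"

text \<open>The inverse of \<open>iota\<close> on the dyadic intervals.\<close>

definition iv :: "nat \<Rightarrow> real set" where
  "iv k = {real (k - 2 ^ depth k) / 2 ^ depth k ..< real (k - 2 ^ depth k + 1) / 2 ^ depth k}"

definition stp :: "nat \<Rightarrow> (nat \<Rightarrow> real) \<Rightarrow> real \<Rightarrow> real" where
  "stp m v s = (if s \<in> {0..<1} then v (node m s) else 0)"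

lemma floor_pow_bounds:
  assumes "s \<in> {0..<1::real}"
  shows "0 \<le> \<lfloor>2 ^ m * s\<rfloor>" "\<lfloor>2 ^ m * s\<rfloor> < 2 ^ m"
proof -
  show "0 \<le> \<lfloor>2 ^ m * s\<rfloor>" using assms by simp
  have "2 ^ m * s < 2 ^ m" using assms by simp
  then show "\<lfloor>2 ^ m * s\<rfloor> < 2 ^ m" by (simp add: floor_less_iff)
qed

lemma node_in: "s \<in> {0..<1} \<Longrightarrow> node m s \<in> nodes m"
  using floor_pow_bounds[of s m] by (auto simp: node_def nodes_def nat_less_iff)

lemma node_Suc_div:
  assumes "s \<in> {0..<1}"
  shows "node (Suc m) s div 2 = node m s"
proof -
  have "\<lfloor>2 ^ Suc m * s\<rfloor> div 2 = \<lfloor>2 ^ m * s\<rfloor>"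
    using floor_divide_real_eq_div[of 2 "2 ^ Suc m * s"] by simp
  then have "nat \<lfloor>2 ^ Suc m * s\<rfloor> div 2 = nat \<lfloor>2 ^ m * s\<rfloor>"
    using floor_pow_bounds[OF assms, of "Suc m"] by (metis nat_div_distrib nat_numeral)
  then show ?thesis by (simp add: node_def)
qed

lemma node_eq_iff:
  assumes "s \<in> {0..<1}" "i < 2 ^ m"
  shows "node m s = 2 ^ m + i \<longleftrightarrow> s \<in> {real i / 2 ^ m ..< real (i + 1) / 2 ^ m}"
proof -
  have "node m s = 2 ^ m + i \<longleftrightarrow> \<lfloor>2 ^ m * s\<rfloor> = int i"
    using floor_pow_bounds(1)[OF assms(1), of m] by (auto simp: node_def)
  also have "\<dots> \<longleftrightarrow> real i \<le> 2 ^ m * s \<and> 2 ^ m * s < real i + 1"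
    by (simp add: floor_eq_iff)
  also have "\<dots> \<longleftrightarrow> s \<in> {real i / 2 ^ m ..< real (i + 1) / 2 ^ m}"
    by (auto simp: field_simps)
  finally show ?thesis .
qed

lemma depth_pow: "1 \<le> k \<Longrightarrow> 2 ^ depth k + (k - 2 ^ depth k) = k" "1 \<le> k \<Longrightarrow> k - 2 ^ depth k < 2 ^ depth k"
  using in_nodes_depth[of k] by (auto simp: nodes_def)

lemma in_iv_iff: "s \<in> {0..<1} \<Longrightarrow> 1 \<le> k \<Longrightarrow> s \<in> iv k \<longleftrightarrow> node (depth k) s = k"
  using node_eq_iff[OF _ depth_pow(2)[of k]] depth_pow(1)[of k] by (simp add: iv_def)

lemma iv_subset: "1 \<le> k \<Longrightarrow> iv k \<subseteq> {0..<1}"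
proof -
  assume k: "1 \<le> k"
  have "real (k - 2 ^ depth k + 1) \<le> 2 ^ depth k"
    using depth_pow(2)[OF k] by (metis Suc_eq_plus1 Suc_leI of_nat_le_iff of_nat_numeral of_nat_power)
  then have "real (k - 2 ^ depth k + 1) / 2 ^ depth k \<le> 1" by simp
  then show ?thesis unfolding iv_def by (auto intro: order_trans[rotated] less_le_trans)
qed

lemma left_iv: "1 \<le> k \<Longrightarrow> real (k - 2 ^ depth k) / 2 ^ depth k \<in> iv k"
  by (simp add: iv_def divide_strict_right_mono)

lemma iv_nonempty: "1 \<le> k \<Longrightarrow> iv k \<noteq> {}"
  using left_iv by blast

text \<open>One level below \<open>k\<close>, the parity of the node tells which half contains the
  point; from there on, both sides are constant on subintervals.\<close>

lemma haar_iv: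
  assumes "1 \<le> k" "depth k < m"
  shows "haar (iv k) s = (if s \<in> {0..<1} then hs k (node m s) else 0)"
proof (cases "s \<in> {0..<1}")
  case False
  then have "s \<notin> iv k" using iv_subset[OF assms(1)] by blast
  then have "s \<notin> left_half (iv k)" "s \<notin> right_half (iv k)" by (auto simp: left_half_def right_half_def)
  then have "haar (iv k) s = 0" using iv_nonempty[OF assms(1)] by (simp add: haar_def)
  then show ?thesis using False by (simp only: if_False)
next
  case s: True
  let ?d = "depth k" and ?i = "k - 2 ^ depth k"
  have lt: "real ?i / 2 ^ ?d < real (?i + 1) / 2 ^ ?d" by (simp add: divide_strict_right_mono)
  have mid: "(Inf (iv k) + Sup (iv k)) / 2 = (2 * real ?i + 1) / 2 ^ Suc ?d"
    unfolding iv_def using lt by (simp add: field_simps)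
  have base: "haar (iv k) s = hs k (node (Suc ?d) s)"
  proof (cases "s \<in> iv k")
    case True
    have nd: "node (Suc ?d) s div 2 = k" using node_Suc_div[OF s] in_iv_iff[OF s assms(1)] True by simp
    have "node (Suc ?d) s = 2 * k \<longleftrightarrow> s < (2 * real ?i + 1) / 2 ^ Suc ?d"
    proof -
      have eq: "2 * k = 2 ^ Suc ?d + 2 * ?i" using depth_pow(1)[OF assms(1)] by (metis distrib_left_numeral power_Suc)
      have "2 * ?i < 2 ^ Suc ?d" using depth_pow(2)[OF assms(1)] by simp
      from node_eq_iff[OF s this] have "node (Suc ?d) s = 2 * k \<longleftrightarrow>
          real (2 * ?i) / 2 ^ Suc ?d \<le> s \<and> s < real (2 * ?i + 1) / 2 ^ Suc ?d" unfolding eq by simp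
      moreover have "real (2 * ?i) / 2 ^ Suc ?d \<le> s" using True by (simp add: iv_def)
      ultimately show ?thesis by (simp add: add.commute)
    qed
    moreover have "node (Suc ?d) s = 2 * k \<longleftrightarrow> even (node (Suc ?d) s)" using nd by presburger
    moreover have "\<not> node (Suc ?d) s \<le> 1" using nd assms(1) by auto
    ultimately show ?thesis
      using True iv_nonempty[OF assms(1)] nd
      by (subst hs.simps) (auto simp: haar_def left_half_def right_half_def mid)
  next
    case False
    have n0: "node ?d s \<noteq> k" using in_iv_iff[OF s assms(1)] False by simp
    have "hs k (node ?d s) = 0" by (rule hs_eq_0[OF in_nodes_depth[OF assms(1)] node_in[OF s]]) simp
    then have "hs k (node (Suc ?d) s) = 0" using n0 node_Suc_div[OF s, of ?d] by (subst hs.simps) auto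
    then show ?thesis using False iv_nonempty[OF assms(1)] by (simp add: haar_def left_half_def right_half_def)
  qed
  have "hs k (node m s) = hs k (node (Suc ?d) s)" if "Suc ?d \<le> m"
    using that
  proof (induction m rule: dec_induct)
    case (step m)
    have "node m s \<noteq> k" using depth_nodes[OF node_in[OF s], of m] step.hyps(1) by auto
    moreover have "\<not> node (Suc m) s \<le> 1"
      using depth_nodes[OF node_in[OF s], of "Suc m"] by (auto simp: depth.simps)
    ultimately have "hs k (node (Suc m) s) = hs k (node m s)"
      using node_Suc_div[OF s, of m] by (subst hs.simps) auto
    then show ?case using step.IH by simp
  qed simp
  then show ?thesis using base s assms(2) by simp
qed

lemma iv_Pair: "i < 2 ^ j \<Longrightarrow> iv (2 ^ j + i) = {real i / 2 ^ j ..< real (i + 1) / 2 ^ j}"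
proof -
  assume "i < 2 ^ j"
  then have "2 ^ j + i \<in> nodes j" by (simp add: nodes_def)
  then show ?thesis by (simp add: iv_def depth_nodes)
qed

lemma dyadic_level_iv: "dyadic_level n = iv ` nodes n"
proof
  show "dyadic_level n \<subseteq> iv ` nodes n"
  proof
    fix I assume "I \<in> dyadic_level n"
    then obtain i where i: "i < 2 ^ n" "I = {real i / 2 ^ n ..< real (i + 1) / 2 ^ n}" by (auto simp: dyadic_level_def)
    then show "I \<in> iv ` nodes n" using iv_Pair[OF i(1)] by (auto simp: nodes_def intro!: image_eqI[of _ _ "2 ^ n + i"])
  qed
  show "iv ` nodes n \<subseteq> dyadic_level n"
  proof
    fix I assume "I \<in> iv ` nodes n"
    then obtain k where k: "k \<in> nodes n" "I = iv k" by blast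
    have "k - 2 ^ n < 2 ^ n" using k(1) by (auto simp: nodes_def)
    moreover have "I = {real (k - 2 ^ n) / 2 ^ n ..< real (k - 2 ^ n + 1) / 2 ^ n}"
      using k depth_nodes[OF k(1)] by (simp add: iv_def)
    ultimately show "I \<in> dyadic_level n" unfolding dyadic_level_def by blast
  qed
qed

lemma dyadic_iv: "dyadic = iv ` {1..}"
proof -
  have "(\<Union>n. nodes n) = {1..}" using in_nodes_depth nodes_ge1 by fastforce
  then show ?thesis unfolding dyadic_def dyadic_level_iv by (metis image_UN)
qed

lemma iv_inj: "1 \<le> k \<Longrightarrow> 1 \<le> k' \<Longrightarrow> iv k = iv k' \<Longrightarrow> k = k'"
proof -
  assume k: "1 \<le> k" "1 \<le> k'" and eq: "iv k = iv k'"
  have len: "Sup (iv k) - Inf (iv k) = 1 / 2 ^ depth k" for k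
  proof -
    have "real (k - 2 ^ depth k) / 2 ^ depth k < real (k - 2 ^ depth k + 1) / 2 ^ depth k"
      by (simp add: divide_strict_right_mono)
    then show ?thesis unfolding iv_def by (simp add: field_simps)
  qed
  then have "(2::real) ^ depth k = 2 ^ depth k'" using eq len[of k] len[of k'] by simp
  then have d: "depth k = depth k'" by simp
  have l: "real (k - 2 ^ depth k) / 2 ^ depth k \<in> {0..<1}" using left_iv[OF k(1)] iv_subset[OF k(1)] by blast
  have "node (depth k) (real (k - 2 ^ depth k) / 2 ^ depth k) = k"
    by (rule iffD1[OF in_iv_iff[OF l k(1)] left_iv[OF k(1)]])
  moreover have "node (depth k') (real (k - 2 ^ depth k) / 2 ^ depth k) = k'"
    by (rule iffD1[OF in_iv_iff[OF l k(2)] left_iv[OF k(1), unfolded eq]])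
  ultimately show "k = k'" unfolding d by (rule trans[OF sym])
qed

lemma inj_on_iv: "A \<subseteq> {1..} \<Longrightarrow> inj_on iv A"
proof (rule inj_onI)
  fix x y assume A: "A \<subseteq> {1..}" "x \<in> A" "y \<in> A" and eq: "iv x = iv y"
  have "1 \<le> x" "1 \<le> y" using A by auto
  then show "x = y" using eq by (rule iv_inj)
qed

lemma iota_iv: "1 \<le> k \<Longrightarrow> iota (iv k) = k"
proof -
  assume k: "1 \<le> k"
  have "(THE m. \<exists>j i. i < 2 ^ j \<and> iv k = {real i / 2 ^ j ..< real (i + 1) / 2 ^ j} \<and> m = 2 ^ j + i) = k"
  proof (rule the_equality)
    show "\<exists>j i. i < 2 ^ j \<and> iv k = {real i / 2 ^ j ..< real (i + 1) / 2 ^ j} \<and> k = 2 ^ j + i"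
      using depth_pow[OF k] iv_def by metis
    fix m assume "\<exists>j i. i < 2 ^ j \<and> iv k = {real i / 2 ^ j ..< real (i + 1) / 2 ^ j} \<and> m = 2 ^ j + i"
    then obtain j i where ji: "i < 2 ^ j" "iv k = {real i / 2 ^ j ..< real (i + 1) / 2 ^ j}" "m = 2 ^ j + i" by blast
    have "iv k = iv m" using iv_Pair[OF ji(1)] ji by simp
    moreover have "1 \<le> m" using ji(3) one_le_power[of "2::nat" j] by linarith
    ultimately show "m = k" using iv_inj[OF k] by metis
  qed
  then show ?thesis using iv_nonempty[OF k] by (simp add: iota_def)
qed

lemma haar_span_add:
  assumes "x \<in> haar_span A" "y \<in> haar_span A"
  shows "(\<lambda>s. x s + y s) \<in> haar_span A"
proof -
  obtain F a where F: "finite F" "F \<subseteq> A" "x = haar_sum F a" using assms(1) unfolding haar_span_def by blast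
  obtain F' b where F': "finite F'" "F' \<subseteq> A" "y = haar_sum F' b" using assms(2) unfolding haar_span_def by blast
  let ?c = "\<lambda>I. (if I \<in> F then a I else 0) + (if I \<in> F' then b I else 0)"
  have "x s + y s = haar_sum (F \<union> F') ?c s" for s
  proof -
    have "haar_sum (F \<union> F') ?c s = (\<Sum>I\<in>F \<union> F'. (if I \<in> F then a I else 0) * haar I s)
        + (\<Sum>I\<in>F \<union> F'. (if I \<in> F' then b I else 0) * haar I s)"
      by (simp add: haar_sum_def distrib_right sum.distrib)
    also have "(\<Sum>I\<in>F \<union> F'. (if I \<in> F then a I else 0) * haar I s) = (\<Sum>I\<in>F. a I * haar I s)"
      by (rule sum.mono_neutral_cong_right) (use F F' in auto)
    also have "(\<Sum>I\<in>F \<union> F'. (if I \<in> F' then b I else 0) * haar I s) = (\<Sum>I\<in>F'. b I * haar I s)"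
      by (rule sum.mono_neutral_cong_right) (use F F' in auto)
    finally show ?thesis using F(3) F'(3) by (simp add: haar_sum_def)
  qed
  then have "(\<lambda>s. x s + y s) = haar_sum (F \<union> F') ?c" by (rule ext)
  moreover have "finite (F \<union> F')" "F \<union> F' \<subseteq> A" using F F' by auto
  ultimately show ?thesis unfolding haar_span_def by blast
qed

lemma haar_sum_in: "finite F \<Longrightarrow> F \<subseteq> A \<Longrightarrow> haar_sum F a \<in> haar_span A"
  by (auto simp: haar_span_def)

lemma haar_scaled_in: "I \<in> A \<Longrightarrow> (\<lambda>s. c * haar I s) \<in> haar_span A"
  using haar_sum_in[of "{I}" A "\<lambda>_. c"] by (simp add: haar_sum_def[abs_def])

lemma haar_in: "I \<in> A \<Longrightarrow> haar I \<in> haar_span A"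
  using haar_scaled_in[of I A 1] by simp

lemma haar_span_sum: "finite X \<Longrightarrow> (\<And>x. x \<in> X \<Longrightarrow> f x \<in> haar_span A) \<Longrightarrow> (\<lambda>s. \<Sum>x\<in>X. f x s) \<in> haar_span A"
proof (induction X rule: finite_induct)
  case empty
  have "haar_sum {} (\<lambda>_. 0) \<in> haar_span A" by (rule haar_sum_in) auto
  then show ?case by (simp add: haar_sum_def[abs_def])
next
  case (insert x X)
  have "(\<lambda>s. f x s + (\<Sum>x\<in>X. f x s)) \<in> haar_span A" by (rule haar_span_add) (use insert in auto)
  then show ?case using insert.hyps by simp
qed

lemma iv_dyadic: "1 \<le> k \<Longrightarrow> iv k \<in> dyadic" "1 \<le> k \<Longrightarrow> iv k \<in> dyadic_plus"
  by (auto simp: dyadic_iv dyadic_plus_def)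

lemma iv_image_dyadic: "A \<subseteq> {1..} \<Longrightarrow> iv ` A \<subseteq> dyadic" "A \<subseteq> {1..} \<Longrightarrow> iv ` A \<subseteq> dyadic_plus"
  unfolding dyadic_plus_def dyadic_iv by (auto dest: subsetD)

lemma nodes_subset_ge1: "nodes n \<subseteq> {1..}"
  using nodes_ge1 by auto

text \<open>A function on level m + 1 is its average over siblings, a function on level m, plus half
  their differences times Haar functions of level m. Membership is required because the axioms of a
  Haar system norm speak only about \<open>H_plus\<close>.\<close>

lemma stp_in_H: "stp m v \<in> H_plus"
proof (induction m arbitrary: v)
  case 0
  have "stp 0 v = (\<lambda>s. v 1 * haar {} s)"
    by (rule ext) (auto simp: stp_def node_def haar_def indicator_def)
  then show ?case using haar_scaled_in[of "{}" dyadic_plus "v 1"] by (simp add: dyadic_plus_def)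
next
  case (Suc m)
  define u where "u q = (v (2 * q) + v (2 * q + 1)) / 2" for q
  define w where "w q = (v (2 * q) - v (2 * q + 1)) / 2" for q
  have "stp (Suc m) v s = stp m u s + (\<Sum>q\<in>nodes m. w q * haar (iv q) s)" for s
  proof (cases "s \<in> {0..<1}")
    case True
    let ?p = "node (Suc m) s"
    have p: "?p \<in> nodes (Suc m)" "?p div 2 = node m s" using node_in[OF True] node_Suc_div[OF True] by auto
    have "(\<Sum>q\<in>nodes m. w q * haar (iv q) s) = (\<Sum>q\<in>nodes m. w q * hs q ?p)"
      by (rule sum.cong) (use True haar_iv[of _ "Suc m" s] in \<open>auto simp: nodes_iff_depth\<close>)
    also have "\<dots> = w (node m s) * hs (node m s) ?p"
      using sum_nodes_hs[OF p(1), of m w] p(2) by simp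
    also have "hs (node m s) ?p = (if even ?p then 1 else -1)"
      using p depth_nodes[OF p(1)] by (subst hs.simps) (auto simp: depth.simps)
    finally show ?thesis
    proof (cases "even ?p")
      case e: True
      assume "(\<Sum>q\<in>nodes m. w q * haar (iv q) s) = w (node m s) * (if even ?p then 1 else -1)"
      moreover have "2 * node m s = ?p" using e p(2) by auto
      ultimately show ?thesis using True e by (simp add: stp_def u_def w_def field_simps)
    next
      case e: False
      assume "(\<Sum>q\<in>nodes m. w q * haar (iv q) s) = w (node m s) * (if even ?p then 1 else -1)"
      moreover have "Suc (2 * node m s) = ?p" using e p(2) by presburger
      ultimately show ?thesis using True e by (simp add: stp_def u_def w_def field_simps)
    qed
  next
    case False
    have "haar (iv q) s = 0" if "q \<in> nodes m" for q
    proof -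
      have "depth q < Suc m" using depth_nodes[OF that] by simp
      from haar_iv[OF nodes_ge1[OF that] this, of s] show ?thesis using False by (simp only: if_False)
    qed
    then have "(\<Sum>q\<in>nodes m. w q * haar (iv q) s) = 0" by simp
    then show ?thesis using False by (simp only: stp_def if_False add_0)
  qed
  then have "stp (Suc m) v = (\<lambda>s. stp m u s + (\<Sum>q\<in>nodes m. w q * haar (iv q) s))" by (rule ext)
  moreover have "(\<lambda>s. \<Sum>q\<in>nodes m. w q * haar (iv q) s) \<in> H_plus"
    by (rule haar_span_sum) (auto intro: haar_scaled_in iv_dyadic nodes_ge1)
  ultimately show ?case using haar_span_add[OF Suc.IH[of u]] by simp
qed

definition cell :: "nat \<Rightarrow> nat \<Rightarrow> real set" where
  "cell m p = {s \<in> {0..<1}. node m s = p}"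

lemma cell_eq: "p \<in> nodes m \<Longrightarrow> cell m p = iv p"
  using in_iv_iff[OF _ nodes_ge1, of _ p m] iv_subset[OF nodes_ge1, of p m] depth_nodes[of p m]
  unfolding cell_def by auto

lemma emeasure_cell: "p \<in> nodes m \<Longrightarrow> emeasure lborel (cell m p) = ennreal (1 / 2 ^ m)"
  unfolding cell_eq iv_def by (subst emeasure_lborel_Ico) (auto simp: depth_nodes divide_right_mono field_simps)

lemma cell_measurable: "p \<in> nodes m \<Longrightarrow> cell m p \<in> sets borel"
  by (simp add: cell_eq iv_def)

lemma stp_sum: "stp m v s = (\<Sum>p\<in>nodes m. v p * indicator (cell m p) s)"
proof (cases "s \<in> {0..<1}")
  case True
  have "(\<Sum>p\<in>nodes m. v p * indicator (cell m p) s) = (\<Sum>p\<in>nodes m. if node m s = p then v p else 0)"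
    by (rule sum.cong) (use True in \<open>auto simp: cell_def indicator_def\<close>)
  then show ?thesis using True node_in[OF True] by (simp add: stp_def)
next
  case False
  then show ?thesis by (auto simp: stp_def cell_def indicator_def)
qed

lemma stp_measurable: "stp m v \<in> borel_measurable borel"
  unfolding stp_sum[abs_def] using cell_measurable by (intro borel_measurable_sum borel_measurable_times) auto

lemma integral_stp: "(LINT u:{0..<1}|lborel. stp m v u) = (\<Sum>p\<in>nodes m. v p) / 2 ^ m"
proof -
  have m: "measure lborel (cell m p) = 1 / 2 ^ m" if "p \<in> nodes m" for p
    using emeasure_cell[OF that] by (simp add: measure_def)
  have i: "integrable lborel (\<lambda>u. v p * indicator (cell m p) u :: real)" if "p \<in> nodes m" for p
    using cell_measurable[OF that] emeasure_cell[OF that] by (intro integrable_mult_right) (auto simp: integrable_indicator_iff)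
  have "indicat_real {0..<1} u *\<^sub>R stp m v u = (\<Sum>p\<in>nodes m. v p * indicator (cell m p) u)" for u
    unfolding stp_sum[symmetric] by (simp add: stp_def indicator_def)
  then have "(LINT u:{0..<1}|lborel. stp m v u) = (LINT u|lborel. (\<Sum>p\<in>nodes m. v p * indicator (cell m p) u))"
    by (simp add: set_lebesgue_integral_def)
  also have "\<dots> = (\<Sum>p\<in>nodes m. (LINT u|lborel. v p * indicator (cell m p) u))" by (rule Bochner_Integration.integral_sum) (rule i)
  also have "\<dots> = (\<Sum>p\<in>nodes m. v p * (1 / 2 ^ m))"
    by (rule sum.cong) (use m cell_measurable in auto)
  finally show ?thesis by (simp add: sum_divide_distrib)
qed

text \<open>Preimages are unions of cells of measure \<open>1 / 2 ^ m\<close>, so distributions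
  reduce to counting.\<close>

lemma distr_stp:
  assumes "\<And>S. 2 ^ n * card {p \<in> nodes m. \<bar>v p\<bar> \<in> S} = 2 ^ m * card {p \<in> nodes n. \<bar>w p\<bar> \<in> S}"
  shows "distr (restrict_space lborel {0..<1}) borel (\<lambda>s. \<bar>stp m v s\<bar>)
    = distr (restrict_space lborel {0..<1}) borel (\<lambda>s. \<bar>stp n w s\<bar>)"
proof (rule measure_eqI)
  fix A :: "real set" assume "A \<in> sets (distr (restrict_space lborel {0..<1}) borel (\<lambda>s. \<bar>stp m v s\<bar>))"
  then have A: "A \<in> sets borel" by simp
  have meas: "(\<lambda>s. \<bar>stp m v s\<bar>) \<in> measurable (restrict_space lborel {0..<1}) borel" for m v
    using stp_measurable by (intro measurable_restrict_space1) simp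
  have em: "emeasure (distr (restrict_space lborel {0..<1}) borel (\<lambda>s. \<bar>stp m v s\<bar>)) A
      = ennreal (card {p \<in> nodes m. \<bar>v p\<bar> \<in> A} / 2 ^ m)" for m v
  proof -
    let ?X = "{p \<in> nodes m. \<bar>v p\<bar> \<in> A}"
    have eq: "(\<lambda>s. \<bar>stp m v s\<bar>) -` A \<inter> {0..<1} = (\<Union>p\<in>?X. cell m p)"
      using node_in by (auto simp: stp_def cell_def)
    have "emeasure (distr (restrict_space lborel {0..<1}) borel (\<lambda>s. \<bar>stp m v s\<bar>)) A
        = emeasure (restrict_space lborel {0..<1}) ((\<lambda>s. \<bar>stp m v s\<bar>) -` A \<inter> {0..<1})"
      by (subst emeasure_distr[OF meas A]) (simp add: space_restrict_space)
    also have "\<dots> = emeasure lborel (\<Union>p\<in>?X. cell m p)"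
      unfolding eq by (subst emeasure_restrict_space) (auto simp: cell_def)
    also have "\<dots> = (\<Sum>p\<in>?X. emeasure lborel (cell m p))"
    proof (rule sum_emeasure[symmetric])
      show "cell m ` ?X \<subseteq> sets lborel" using cell_measurable by auto
      show "disjoint_family_on (cell m) ?X" by (auto simp: disjoint_family_on_def cell_def)
    qed simp
    also have "\<dots> = (\<Sum>p\<in>?X. ennreal (1 / 2 ^ m))" by (rule sum.cong) (auto simp: emeasure_cell)
    also have "\<dots> = ennreal (card ?X / 2 ^ m)" by (simp add: ennreal_of_nat_eq_real_of_nat ennreal_mult[symmetric])
    finally show ?thesis .
  qed
  have "real (card {p \<in> nodes m. \<bar>v p\<bar> \<in> A}) / 2 ^ m = real (card {p \<in> nodes n. \<bar>w p\<bar> \<in> A}) / 2 ^ n"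
    using arg_cong[OF assms[of A], of real] by (simp add: field_simps)
  then show "emeasure (distr (restrict_space lborel {0..<1}) borel (\<lambda>s. \<bar>stp m v s\<bar>)) A
    = emeasure (distr (restrict_space lborel {0..<1}) borel (\<lambda>s. \<bar>stp n w s\<bar>)) A"
    unfolding em by simp
qed simp

lemma step_norm_haar:
  assumes "haar_system_norm N"
  shows "step_norm (\<lambda>m v. N (stp m v))"
proof
  note N = assms[unfolded haar_system_norm_def]
  note N1 = N[THEN conjunct1, THEN bspec, OF stp_in_H]
  note N2 = N[THEN conjunct2, THEN conjunct1, THEN spec, THEN bspec, OF stp_in_H]
  note N3 = N[THEN conjunct2, THEN conjunct2, THEN conjunct1, THEN bspec, THEN bspec, OF stp_in_H stp_in_H]
  note N4 = N[THEN conjunct2, THEN conjunct2, THEN conjunct2, THEN conjunct1, THEN bspec, THEN bspec, THEN mp,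
      OF stp_in_H stp_in_H]
  note N5 = N[THEN conjunct2, THEN conjunct2, THEN conjunct2, THEN conjunct2]
  show "N (stp m (\<lambda>p. v p + w p)) \<le> N (stp m v) + N (stp m w)" for m v w
  proof -
    have "stp m (\<lambda>p. v p + w p) = (\<lambda>s. stp m v s + stp m w s)" by (auto simp: stp_def)
    then show ?thesis using N3[of m v m w] by (simp only:)
  qed
  show "N (stp m (\<lambda>p. c * v p)) = \<bar>c\<bar> * N (stp m v)" for m c v
  proof -
    have "stp m (\<lambda>p. c * v p) = (\<lambda>s. c * stp m v s)" by (auto simp: stp_def)
    then show ?thesis using N2[of c m v] by (simp only:)
  qed
  show "N (stp m v) = N (stp n w)"
    if "\<And>S. 2 ^ n * card {p \<in> nodes m. \<bar>v p\<bar> \<in> S} = 2 ^ m * card {p \<in> nodes n. \<bar>w p\<bar> \<in> S}" for m n v w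
    by (rule N4[OF distr_stp[OF that]])
  show "0 \<le> N (stp m v)" for m v by (rule N1[THEN conjunct1])
  show "v p = 0" if N0: "N (stp m v) = 0" and p: "p \<in> nodes m" for m v p
  proof -
    have z: "stp m v = (\<lambda>s. 0)" by (rule iffD1[OF N1[THEN conjunct2] N0])
    obtain s where s: "s \<in> cell m p" using cell_eq[OF p] iv_nonempty[OF nodes_ge1[OF p]] by blast
    then have "stp m v s = v p" unfolding stp_def cell_def by simp
    then show ?thesis unfolding z by simp
  qed
  have "stp 0 (\<lambda>_. 1) = indicat_real {0..<1}" by (auto simp: stp_def indicator_def)
  then show "N (stp 0 (\<lambda>_. 1)) = 1" using N5 by (simp only:)
qed

section \<open>Averages over Rademacher functions\<close>

definition rad :: "nat \<Rightarrow> nat \<Rightarrow> real" where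
  "rad k p = (\<Sum>L\<in>nodes k. hs L p)"

lemma sum_dyadic_level: "(\<Sum>I\<in>dyadic_level n. f I) = (\<Sum>k\<in>nodes n. f (iv k))"
  unfolding dyadic_level_iv by (rule sum.reindex_cong[where l = iv]) (auto intro!: inj_onI iv_inj nodes_ge1)

lemma rademacher_node: "s \<in> {0..<1} \<Longrightarrow> k < m \<Longrightarrow> rademacher k s = rad k (node m s)"
  unfolding rademacher_def rad_def sum_dyadic_level
  by (rule sum.cong) (use haar_iv[of _ m s] in \<open>auto simp: nodes_iff_depth\<close>)

lemma rad_child:
  assumes "q \<in> nodes m"
  shows "k < m \<Longrightarrow> rad k (2 * q) = rad k q" "k < m \<Longrightarrow> rad k (Suc (2 * q)) = rad k q"
    "rad m (2 * q) = 1" "rad m (Suc (2 * q)) = -1"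
proof -
  have q: "1 \<le> q" by (rule nodes_ge1[OF assms])
  { assume "k < m"
    then have "q \<noteq> L" if "L \<in> nodes k" for L using depth_nodes[OF that] depth_nodes[OF assms] by auto
    then show "rad k (2 * q) = rad k q" "rad k (Suc (2 * q)) = rad k q"
      unfolding rad_def using q by (auto simp: hs_child intro!: sum.cong) }
  have z: "hs L q = 0" if "L \<in> nodes m" for L by (rule hs_eq_0[OF that assms order_refl])
  have "rad m (2 * q) = (\<Sum>L\<in>nodes m. if q = L then 1 else 0)"
    unfolding rad_def by (rule sum.cong) (use q z in \<open>auto simp: hs_child\<close>)
  then show "rad m (2 * q) = 1" using assms by simp
  have "rad m (Suc (2 * q)) = (\<Sum>L\<in>nodes m. if q = L then -1 else 0)"
    unfolding rad_def by (rule sum.cong) (use q z in \<open>auto simp: hs_child\<close>)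
  then show "rad m (Suc (2 * q)) = -1" using assms by simp
qed

lemma rad_abs:
  assumes "p \<in> nodes m" "k < m"
  shows "\<bar>rad k p\<bar> = 1"
  using sum_nodes_hs[OF assms, of "\<lambda>_. 1"] hs_ancestor[OF assms] by (auto simp: rad_def)

text \<open>On the intervals of level \<open>M\<close>, the first \<open>M\<close> Rademacher
  functions run through every pattern of signs exactly once; the two halves of an interval supply
  the new sign.\<close>

lemma sum_rad_signs:
  fixes f :: "real \<Rightarrow> real"
  shows "(\<Sum>p\<in>nodes M. f (\<Sum>k<M. rad k p * x k)) = (\<Sum>Z\<in>Pow {..<M}. f (\<Sum>k<M. sgn_of Z k * x k))"
proof (induction M arbitrary: f)
  case (Suc M)
  have nin: "M \<notin> {..<M}" by simp
  have "(\<Sum>p\<in>nodes (Suc M). f (\<Sum>k<Suc M. rad k p * x k))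
      = (\<Sum>q\<in>nodes M. (\<lambda>t. f (t + x M) + f (t - x M)) (\<Sum>k<M. rad k q * x k))"
    unfolding sum_nodes_Suc by (rule sum.cong) (auto simp: rad_child)
  also have "\<dots> = (\<Sum>Z\<in>Pow {..<M}. (\<lambda>t. f (t + x M) + f (t - x M)) (\<Sum>k<M. sgn_of Z k * x k))"
    by (rule Suc.IH)
  also have "\<dots> = (\<Sum>Z\<in>Pow (insert M {..<M}). f (\<Sum>k<Suc M. sgn_of Z k * x k))"
    unfolding sum_Pow_insert[OF finite_lessThan nin]
  proof (rule sum.cong)
    fix Z assume Z: "Z \<in> Pow {..<M}"
    then have "M \<notin> Z" "Z \<subseteq> {..<M}" by auto
    then show "f ((\<Sum>k<M. sgn_of Z k * x k) + x M) + f ((\<Sum>k<M. sgn_of Z k * x k) - x M)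
      = f (\<Sum>k<Suc M. sgn_of Z k * x k) + f (\<Sum>k<Suc M. sgn_of (insert M Z) k * x k)"
      by (simp add: sgn_of_insert) (simp add: sgn_of_def)
  qed simp
  also have "insert M {..<M} = {..<Suc M}" by auto
  finally show ?case .
qed simp

text \<open>The integrand is a step function in \<open>u\<close>. Independent signs are handled by
  \<open>sum_rad_signs\<close>; a common factor r_0 has modulus 1 on [0,1) and drops out.\<close>

lemma integral_rademacher:
  assumes "finite F" "\<And>k. k \<in> F \<Longrightarrow> r k = (if ind then rademacher k else rademacher 0)"
  shows "(LINT u:{0..<1}|lborel. \<bar>\<Sum>k\<in>F. r k u * x k\<bar>) = W ind F x"
proof -
  obtain M where M: "F \<subseteq> {..<M}" "0 < M"
  proof -
    obtain M where "F \<subseteq> {..<M}" using finite_nat_bounded[OF assms(1)] by blast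
    then show ?thesis by (intro that[of "Suc M"]) auto
  qed
  let ?x = "\<lambda>k. if k \<in> F then x k else 0"
  define v where "v p = (if ind then \<bar>\<Sum>k<M. rad k p * ?x k\<bar> else \<bar>\<Sum>k\<in>F. x k\<bar>)" for p
  have "(LINT u:{0..<1}|lborel. \<bar>\<Sum>k\<in>F. r k u * x k\<bar>) = (LINT u:{0..<1}|lborel. stp M v u)"
  proof (rule set_lebesgue_integral_cong)
    show "\<forall>u. u \<in> {0..<1} \<longrightarrow> \<bar>\<Sum>k\<in>F. r k u * x k\<bar> = stp M v u"
    proof (intro allI impI)
      fix u :: real assume u: "u \<in> {0..<1}"
      show "\<bar>\<Sum>k\<in>F. r k u * x k\<bar> = stp M v u"
      proof (cases ind)
        case True
        have "(\<Sum>k\<in>F. r k u * x k) = (\<Sum>k<M. rad k (node M u) * ?x k)"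
          by (rule sum.mono_neutral_cong_left) (use M True assms rademacher_node[OF u] in auto)
        then show ?thesis using True u by (simp add: stp_def v_def)
      next
        case False
        have "(\<Sum>k\<in>F. r k u * x k) = rademacher 0 u * (\<Sum>k\<in>F. x k)"
          unfolding sum_distrib_left by (rule sum.cong) (use False assms in auto)
        then show ?thesis using False u rad_abs[OF node_in[OF u] M(2)] rademacher_node[OF u M(2)]
          by (simp add: stp_def v_def abs_mult)
      qed
    qed
  qed simp
  also have "\<dots> = (\<Sum>p\<in>nodes M. v p) / 2 ^ M" by (rule integral_stp)
  also have "\<dots> = W ind F x"
  proof (cases ind)
    case True
    have "W ind F x = W ind F ?x" by (rule W_cong) simp
    also have "\<dots> = W ind {..<M} ?x" by (rule W_superset[symmetric]) (use M in auto)
    also have "\<dots> = (\<Sum>p\<in>nodes M. v p) / 2 ^ M"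
      using True sum_rad_signs[where M = M and f = abs and x = ?x] by (simp add: W_True v_def)
    finally show ?thesis by simp
  next
    case False
    then show ?thesis by (simp add: v_def W_False)
  qed
  finally show ?thesis .
qed

section \<open>Haar system Hardy spaces\<close>

text \<open>The passage from the given completion to the axioms used so far. Norms are computed
  through the isometries \<open>inc\<close> and \<open>J\<close>; at a point of the interval
  \<open>p\<close> the inner integral is \<open>W\<close> of the values on \<open>p\<close>.\<close>

lemma haar_hardy_space:
  fixes J :: "(real \<Rightarrow> real) \<Rightarrow> 'x::banach" and inc :: "'y::banach \<Rightarrow> 'x"
  assumes N: "haar_system_norm N" and r: "r \<in> rademacher_choices"
    and J: "hardy_completion N r J" and inc: "hardy_zero J inc"
    and wn: "weakly_null (\<lambda>n. in_zero J inc (rademacher n))"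
  shows "\<exists>ind. haar_space_wn (\<lambda>m v. N (stp m v)) ind (\<lambda>k. in_zero J inc (haar (iv k)))"
proof -
  let ?h = "\<lambda>k. in_zero J inc (haar (iv k))"
  have J_add: "\<And>x y. x \<in> H_plus \<Longrightarrow> y \<in> H_plus \<Longrightarrow> J (\<lambda>s. x s + y s) = J x + J y"
    and J_scale: "\<And>c x. x \<in> H_plus \<Longrightarrow> J (\<lambda>s. c * x s) = c *\<^sub>R J x"
    and J_norm: "\<And>F a. finite F \<Longrightarrow> F \<subseteq> dyadic_plus \<Longrightarrow> norm (J (haar_sum F a)) =
        N (\<lambda>s. LINT u:{0..<1}|lborel. \<bar>\<Sum>I\<in>F. r I u * a I * haar I s\<bar>)"
    by (rule J[unfolded hardy_completion_def, THEN conjunct1, THEN bspec, THEN bspec]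
        J[unfolded hardy_completion_def, THEN conjunct2, THEN conjunct1, THEN spec, THEN bspec]
        J[unfolded hardy_completion_def, THEN conjunct2, THEN conjunct2, THEN conjunct1, THEN spec, THEN spec,
          THEN mp, OF conjI]; assumption)+
  have inc_lin: "linear inc" and inc_norm: "\<And>y. norm (inc y) = norm y" and inc_range: "range inc = closure (J ` H_zero)"
    by (rule inc[unfolded hardy_zero_def, THEN conjunct1]
        inc[unfolded hardy_zero_def, THEN conjunct2, THEN conjunct1, THEN spec]
        inc[unfolded hardy_zero_def, THEN conjunct2, THEN conjunct2])+
  have inc_inj: "x = y" if "inc x = inc y" for x y
  proof -
    have "norm (x - y) = norm (inc x - inc y)" unfolding linear_diff[OF inc_lin, symmetric] by (rule inc_norm[symmetric])
    then show ?thesis unfolding that by simp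
  qed
  have inc_zero: "inc (in_zero J inc x) = J x" if "x \<in> H_zero" for x
  proof -
    have "J x \<in> range inc" unfolding inc_range by (rule subsetD[OF closure_subset imageI[OF that]])
    then show ?thesis unfolding in_zero_def by (rule f_inv_into_f)
  qed
  have J_sum: "J (haar_sum F a) = (\<Sum>I\<in>F. a I *\<^sub>R J (haar I))" if "finite F" "F \<subseteq> dyadic_plus" for F a
    using that
  proof (induction F rule: finite_induct)
    case empty
    have "J (\<lambda>s. 0 * haar {} s) = 0 *\<^sub>R J (haar {})" by (rule J_scale) (auto intro: haar_in simp: dyadic_plus_def)
    then show ?case by (simp add: haar_sum_def[abs_def])
  next
    case (insert I F)
    have "haar_sum (insert I F) a = (\<lambda>s. a I * haar I s + haar_sum F a s)"
      using insert.hyps by (auto simp: haar_sum_def)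
    then have "J (haar_sum (insert I F) a) = J (\<lambda>s. a I * haar I s) + J (haar_sum F a)"
      using J_add[OF haar_scaled_in haar_sum_in, of I F "a I" a] insert by simp
    then show ?case using J_scale[OF haar_in, of I "a I"] insert by simp
  qed
  have h_span: "haar (iv k) \<in> H_zero" if "1 \<le> k" for k by (rule haar_in[OF iv_dyadic(1)[OF that]])
  have inc_h: "inc (?h k) = J (haar (iv k))" if "1 \<le> k" for k by (rule inc_zero[OF h_span[OF that]])
  have inc_sum: "inc (\<Sum>k\<in>A. c k *\<^sub>R ?h k) = J (haar_sum (iv ` A) (\<lambda>I. c (iota I)))" if A: "finite A" "A \<subseteq> {1..}" for A c
  proof -
    have inj: "inj_on iv A" using A(2) by (rule inj_on_iv)
    have "J (haar_sum (iv ` A) (\<lambda>I. c (iota I))) = (\<Sum>I\<in>iv ` A. c (iota I) *\<^sub>R J (haar I))"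
      by (rule J_sum[OF finite_imageI[OF A(1)] iv_image_dyadic(2)[OF A(2)]])
    also have "\<dots> = (\<Sum>k\<in>A. c k *\<^sub>R J (haar (iv k)))"
      unfolding sum.reindex[OF inj] comp_def by (rule sum.cong) (use subsetD[OF A(2)] iota_iv in auto)
    also have "\<dots> = (\<Sum>k\<in>A. inc (c k *\<^sub>R ?h k))"
      by (rule sum.cong) (use subsetD[OF A(2)] inc_h linear_scale[OF inc_lin] in auto)
    finally show ?thesis by (simp add: linear_sum[OF inc_lin])
  qed
  \<comment> \<open>On the dyadic intervals the two admissible sequences of signs differ by one
    bit.\<close>
  obtain ind where ind: "\<And>k. 1 \<le> k \<Longrightarrow> r (iv k) = (if ind then rademacher k else rademacher 0)"
  proof -
    from r consider "r = (\<lambda>I. rademacher (iota I))" | "r = (\<lambda>I. rademacher 0)"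
      unfolding rademacher_choices_def by blast
    then show ?thesis
    proof cases
      case 1
      then show ?thesis using that[of True] iota_iv by simp
    next
      case 2
      then show ?thesis using that[of False] by simp
    qed
  qed
  interpret step_norm "\<lambda>m v. N (stp m v)" by (rule step_norm_haar[OF N])
  have norm_comb: "norm (\<Sum>k\<in>{1..<2 ^ m}. c k *\<^sub>R ?h k) = N (stp m (\<lambda>p. W ind {1..<2 ^ m} (\<lambda>k. c k * hs k p)))" for m c
  proof -
    let ?A = "{1..<2 ^ m} :: nat set"
    have inj: "inj_on iv ?A" by (rule inj_on_iv) auto
    have "norm (\<Sum>k\<in>?A. c k *\<^sub>R ?h k) = norm (J (haar_sum (iv ` ?A) (\<lambda>I. c (iota I))))"
      unfolding inc_norm[symmetric] by (subst inc_sum) auto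
    also have "\<dots> = N (\<lambda>s. LINT u:{0..<1}|lborel. \<bar>\<Sum>I\<in>iv ` ?A. r I u * c (iota I) * haar I s\<bar>)"
      by (rule J_norm[OF finite_imageI iv_image_dyadic(2)]) auto
    also have "(\<lambda>s. LINT u:{0..<1}|lborel. \<bar>\<Sum>I\<in>iv ` ?A. r I u * c (iota I) * haar I s\<bar>)
        = stp m (\<lambda>p. W ind ?A (\<lambda>k. c k * hs k p))"
    proof
      fix s
      have "(\<Sum>I\<in>iv ` ?A. r I u * c (iota I) * haar I s) = (\<Sum>k\<in>?A. r (iv k) u * (c k * haar (iv k) s))" for u
        unfolding sum.reindex[OF inj] comp_def by (rule sum.cong) (use iota_iv in auto)
      then have "(LINT u:{0..<1}|lborel. \<bar>\<Sum>I\<in>iv ` ?A. r I u * c (iota I) * haar I s\<bar>)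
          = W ind ?A (\<lambda>k. c k * haar (iv k) s)"
        using integral_rademacher[of ?A "\<lambda>k. r (iv k)" ind "\<lambda>k. c k * haar (iv k) s"] ind by simp
      also have "\<dots> = stp m (\<lambda>p. W ind ?A (\<lambda>k. c k * hs k p)) s"
      proof (cases "s \<in> {0..<1}")
        case True
        have "W ind ?A (\<lambda>k. c k * haar (iv k) s) = W ind ?A (\<lambda>k. c k * hs k (node m s))"
          by (rule W_cong) (use True haar_iv[of _ m s] less_pow_iff in auto)
        then show ?thesis using True by (simp add: stp_def)
      next
        case False
        have "W ind ?A (\<lambda>k. c k * haar (iv k) s) = W ind ?A (\<lambda>k. 0 * 0)"
          by (rule W_cong) (use False haar_iv[of _ m s] less_pow_iff in auto)
        then show ?thesis using False by (simp only: W_scale stp_def if_False)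
      qed
      finally show "(LINT u:{0..<1}|lborel. \<bar>\<Sum>I\<in>iv ` ?A. r I u * c (iota I) * haar I s\<bar>)
        = stp m (\<lambda>p. W ind ?A (\<lambda>k. c k * hs k p)) s" .
    qed
    finally show ?thesis .
  qed
  have dense: "closure (span (?h ` {1..})) = UNIV"
  proof -
    have "y \<in> closure (span (?h ` {1..}))" for y
    proof (rule closure_approachable[THEN iffD2], intro allI impI)
      fix e :: real assume "0 < e"
      have "inc y \<in> closure (J ` H_zero)" using inc_range by blast
      then obtain x where x: "x \<in> H_zero" "dist (J x) (inc y) < e" using \<open>0 < e\<close> unfolding closure_approachable by blast
      obtain F a where F: "finite F" "F \<subseteq> dyadic" "x = haar_sum F a" using x(1) unfolding haar_span_def by blast
      obtain A where A: "A \<subseteq> {1..}" "finite A" "F = iv ` A" using F(1,2) unfolding dyadic_iv by (meson finite_subset_image)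
      let ?z = "\<Sum>k\<in>A. a (iv k) *\<^sub>R ?h k"
      have "inc ?z = J (haar_sum F (\<lambda>I. a (iv (iota I))))" using inc_sum[OF A(2,1), of "\<lambda>k. a (iv k)"] A(3) by simp
      also have "haar_sum F (\<lambda>I. a (iv (iota I))) = x"
        unfolding F(3) haar_sum_def[abs_def] A(3) using A(1) iota_iv by (intro ext sum.cong) auto
      finally have "dist (inc ?z) (inc y) < e" using x(2) by simp
      then have "dist ?z y < e" using inc_norm[of "?z - y"] linear_diff[OF inc_lin, of ?z y] by (simp add: dist_norm)
      moreover have "?z \<in> span (?h ` {1..})" using A(1) by (intro span_sum span_scale span_base) auto
      ultimately show "\<exists>z\<in>span (?h ` {1..}). dist z y < e" by blast
    qed
    then show ?thesis by blast
  qed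
  have rad: "in_zero J inc (rademacher n) = (\<Sum>k\<in>nodes n. ?h k)" for n
  proof (rule inc_inj)
    have eq: "rademacher n = haar_sum (iv ` nodes n) (\<lambda>I. 1)"
      by (rule ext) (simp add: rademacher_def haar_sum_def dyadic_level_iv)
    have "rademacher n \<in> H_zero" unfolding eq by (rule haar_sum_in[OF finite_imageI[OF finite_nodes] iv_image_dyadic(1)[OF nodes_subset_ge1]])
    then have "inc (in_zero J inc (rademacher n)) = J (rademacher n)" by (rule inc_zero)
    also have "\<dots> = inc (\<Sum>k\<in>nodes n. 1 *\<^sub>R ?h k)"
      unfolding eq by (rule inc_sum[OF finite_nodes nodes_subset_ge1, symmetric])
    finally show "inc (in_zero J inc (rademacher n)) = inc (\<Sum>k\<in>nodes n. ?h k)" by simp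
  qed
  have "haar_space_wn (\<lambda>m v. N (stp m v)) ind ?h"
  proof
    show "norm (\<Sum>k\<in>{1..<2 ^ m}. c k *\<^sub>R ?h k) = N (stp m (\<lambda>p. W ind {1..<2 ^ m} (\<lambda>k. c k * hs k p)))" for m c
      by (rule norm_comb)
    show "closure (span (?h ` {1..})) = UNIV" by (rule dense)
    show "(\<lambda>n. blinfun_apply f (\<Sum>k\<in>nodes n. ?h k)) \<longlonglongrightarrow> 0" for f :: "'y \<Rightarrow>\<^sub>L real"
      using wn unfolding weakly_null_def rad by blast
  qed
  then show ?thesis by blast
qed

section \<open>Determination by finitely supported vectors\<close>

context coord_space
begin

lemma trunc_diff: "Phi (x - trunc p x) n = (if n < p then 0 else Phi x n)"
  by (simp add: Phi_diff Phi_trunc)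

text \<open>Truncations converge in norm, so the identity is a selection that serves all
  functionals.\<close>

lemma determined_by_tails:
  assumes "id \<in> G"
    and tails: "\<And>a. P a \<Longrightarrow> (\<And>n. 0 \<le> a n) \<Longrightarrow> (\<lambda>p. rho (\<lambda>n. if n < p then 0 else a n)) \<longlonglongrightarrow> 0"
  shows determined
  unfolding determined_def
proof (intro allI bexI[OF _ assms(1)] impI)
  fix F :: "nat \<Rightarrow> 'e \<Rightarrow>\<^sub>L real" and U and l :: nat and x
  have "norm (x - trunc p x) = rho (\<lambda>n. if n < p then 0 else norm (Phi x n))" for p
    unfolding Phi_norm trunc_diff by (simp add: if_distrib[of norm] cong: if_cong)
  moreover have "(\<lambda>p. rho (\<lambda>n. if n < p then 0 else norm (Phi x n))) \<longlonglongrightarrow> 0"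
    by (rule tails[OF Phi_P]) simp
  ultimately have "(\<lambda>p. norm (x - trunc p x)) \<longlonglongrightarrow> 0" by simp
  then have "(\<lambda>p. norm (trunc p x - x)) \<longlonglongrightarrow> 0" by (simp add: norm_minus_commute)
  then have "(\<lambda>p. trunc p x - x) \<longlonglongrightarrow> 0" by (rule tendsto_norm_zero_cancel)
  then have "(\<lambda>p. trunc p x) \<longlonglongrightarrow> x" by (rule LIM_zero_cancel)
  then show "(\<lambda>p. blinfun_apply (F l) (blinfun_apply U (trunc p x))) \<longlonglongrightarrow> blinfun_apply (F l) (blinfun_apply U x)"
    by (intro blinfun.tendsto tendsto_const)
qed

text \<open>
  Disjointly supported vectors of norm at most 1 add up to a vector of norm at most 1, so a functional
  cannot be large on infinitely many disjoint sets of coordinates.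
\<close>

lemma functional_small_on_subset:
  fixes F :: "'e \<Rightarrow>\<^sub>L real"
  assumes disj: "\<And>v w. (\<And>n. Phi v n = 0 \<or> Phi w n = 0) \<Longrightarrow> norm (v + w) \<le> max (norm v) (norm w)"
    and "infinite \<Lambda>" "0 < e"
  shows "\<exists>\<Gamma>\<subseteq>\<Lambda>. infinite \<Gamma> \<and> (\<forall>x. (\<forall>n. n \<notin> \<Gamma> \<longrightarrow> Phi x n = 0) \<longrightarrow> \<bar>blinfun_apply F x\<bar> \<le> e * norm x)"
proof (rule ccontr)
  assume neg: "\<not> ?thesis"
  obtain r :: "nat \<Rightarrow> nat" where r: "strict_mono r" "\<And>n. r n \<in> \<Lambda>" using infinite_enumerate[OF assms(2)] by blast
  \<comment> \<open>The residue classes modulo \<open>N\<close> split the enumerated set into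
    \<open>N\<close> disjoint infinite sets. If the functional were large on each of them, suitable
    vectors of norm at most 1 would add up to one of norm at most 1 with value at least
    \<open>N * e\<close>, above \<open>norm F\<close>.\<close>
  obtain N :: nat where N: "norm F < N * e" using reals_Archimedean3[OF \<open>0 < e\<close>] by blast
  define \<Gamma> where "\<Gamma> k = range (\<lambda>i. r (i * N + k))" for k
  have inj: "inj (\<lambda>i. r (i * N + k))" if "0 < N" for k
    using that strict_mono_eq[OF r(1)] by (auto simp: inj_def)
  have ex: "\<exists>y. (\<forall>n. n \<notin> \<Gamma> k \<longrightarrow> Phi y n = 0) \<and> norm y \<le> 1 \<and> e < blinfun_apply F y" if k: "k < N" for k
  proof -
    have "infinite (\<Gamma> k)" unfolding \<Gamma>_def by (rule range_inj_infinite[OF inj]) (use k in simp)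
    moreover have "\<Gamma> k \<subseteq> \<Lambda>" using r(2) by (auto simp: \<Gamma>_def)
    ultimately obtain x where x: "\<And>n. n \<notin> \<Gamma> k \<Longrightarrow> Phi x n = 0" "e * norm x < \<bar>blinfun_apply F x\<bar>"
      using neg by (meson not_le)
    have x0: "x \<noteq> 0" using x(2) by auto
    define y where "y = (sgn (blinfun_apply F x) / norm x) *\<^sub>R x"
    have "Phi y n = 0" if "n \<notin> \<Gamma> k" for n using x(1)[OF that] by (simp add: y_def Phi_scale)
    moreover have "norm y \<le> 1" using x0 by (simp add: y_def abs_sgn_eq)
    moreover have "blinfun_apply F y = \<bar>blinfun_apply F x\<bar> / norm x"
      by (simp add: y_def blinfun.scaleR_right abs_sgn mult.commute)
    moreover have "e < \<bar>blinfun_apply F x\<bar> / norm x" using x(2) x0 by (simp add: field_simps)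
    ultimately show ?thesis by (intro exI[of _ y]) simp
  qed
  then obtain y where y: "\<And>k n. k < N \<Longrightarrow> n \<notin> \<Gamma> k \<Longrightarrow> Phi (y k) n = 0" "\<And>k. k < N \<Longrightarrow> norm (y k) \<le> 1"
    "\<And>k. k < N \<Longrightarrow> e < blinfun_apply F (y k)" by metis
  have "norm (\<Sum>k<m. y k) \<le> 1" if "m \<le> N" for m
    using that
  proof (induction m)
    case (Suc m)
    have "Phi (\<Sum>k<m. y k) n = 0 \<or> Phi (y m) n = 0" for n
    proof (cases "n \<in> \<Gamma> m")
      case True
      then obtain i where i: "n = r (i * N + m)" by (auto simp: \<Gamma>_def)
      have "Phi (y k) n = 0" if k: "k < m" for k
      proof (rule y(1))
        show "n \<notin> \<Gamma> k"
        proof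
          assume "n \<in> \<Gamma> k"
          then obtain j where "r (i * N + m) = r (j * N + k)" using i by (auto simp: \<Gamma>_def)
          then have "i * N + m = j * N + k" using strict_mono_eq[OF r(1)] by simp
          then have "(i * N + m) mod N = (j * N + k) mod N" by simp
          then show False using k Suc.prems by simp
        qed
      qed (use k Suc.prems in simp)
      then have "Phi (\<Sum>k<m. y k) n = 0" by (simp add: Phi_sum)
      then show ?thesis ..
    next
      case False
      then show ?thesis using y(1)[of m n] Suc.prems by simp
    qed
    then have "norm ((\<Sum>k<m. y k) + y m) \<le> max (norm (\<Sum>k<m. y k)) (norm (y m))" by (rule disj)
    then show ?case using Suc y(2)[of m] by simp
  qed simp
  from this[of N] have "norm (\<Sum>k<N. y k) \<le> 1" by simp
  then have "blinfun_apply F (\<Sum>k<N. y k) \<le> norm F"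
    using norm_blinfun[of F "\<Sum>k<N. y k"] mult_left_mono[of "norm (\<Sum>k<N. y k)" 1 "norm F"] by (simp add: abs_le_iff)
  moreover have "(\<Sum>k<N. e) \<le> (\<Sum>k<N. blinfun_apply F (y k))" by (rule sum_mono) (use y(3) in force)
  ultimately show False using N by (simp add: blinfun.sum_right)
qed

text \<open>Nested infinite sets of coordinates are chosen, each making one functional small, and
  \<open>\<gamma>\<close> takes one coordinate from each. The tail of a vector spread along
  \<open>\<gamma>\<close> lives on a late set, where the functional is small.\<close>

lemma determined_by_disjointness:
  assumes disj: "\<And>v w. (\<And>n. Phi v n = 0 \<or> Phi w n = 0) \<Longrightarrow> norm (v + w) \<le> max (norm v) (norm w)"
    and G: "\<And>\<gamma>. strict_mono \<gamma> \<Longrightarrow> \<gamma> \<in> G"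
  shows determined
  unfolding determined_def
proof (intro allI)
  fix F :: "nat \<Rightarrow> 'e \<Rightarrow>\<^sub>L real"
  \<comment> \<open>\<open>fst (prod_decode n)\<close> repeats every index infinitely often, so each
    functional meets arbitrarily small tolerances.\<close>
  define small where "small n \<Gamma> \<longleftrightarrow> (\<forall>x. (\<forall>i. i \<notin> \<Gamma> \<longrightarrow> Phi x i = 0) \<longrightarrow>
      \<bar>blinfun_apply (F (fst (prod_decode n))) x\<bar> \<le> 1 / real (Suc n) * norm x)" for n \<Gamma>
  have "\<exists>\<Gamma>. \<forall>n. infinite (\<Gamma> n) \<and> (\<Gamma> (Suc n) \<subseteq> \<Gamma> n \<and> small n (\<Gamma> (Suc n)))"
  proof (rule dependent_nat_choice)
    show "\<exists>x::nat set. infinite x" using infinite_UNIV_nat by blast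
    fix \<Lambda> :: "nat set" and n :: nat assume "infinite \<Lambda>"
    from functional_small_on_subset[OF disj this, of "1 / real (Suc n)" "F (fst (prod_decode n))"]
    show "\<exists>\<Gamma>. infinite \<Gamma> \<and> \<Gamma> \<subseteq> \<Lambda> \<and> small n \<Gamma>" unfolding small_def by auto
  qed
  then obtain \<Gamma> where \<Gamma>: "\<And>n. infinite (\<Gamma> n)" "\<And>n. \<Gamma> (Suc n) \<subseteq> \<Gamma> n" "\<And>n. small n (\<Gamma> (Suc n))" by blast
  have anti: "\<Gamma> n \<subseteq> \<Gamma> m" if "m \<le> n" for m n by (rule lift_Suc_antimono_le[of \<Gamma>, OF \<Gamma>(2) that])
  have "\<exists>\<gamma>. \<forall>n. \<gamma> n \<in> \<Gamma> n \<and> \<gamma> n < \<gamma> (Suc n)"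
  proof (rule dependent_nat_choice)
    show "\<exists>x. x \<in> \<Gamma> 0" using \<Gamma>(1)[of 0] by (metis finite.emptyI ex_in_conv)
    fix x n show "\<exists>y. y \<in> \<Gamma> (Suc n) \<and> x < y" using \<Gamma>(1)[of "Suc n"] by (auto simp: infinite_nat_iff_unbounded)
  qed
  then obtain \<gamma> where \<gamma>: "\<And>n. \<gamma> n \<in> \<Gamma> n" "\<And>n. \<gamma> n < \<gamma> (Suc n)" by blast
  have sm: "strict_mono \<gamma>" using \<gamma>(2) by (simp add: strict_mono_Suc_iff)
  show "\<exists>\<gamma>\<in>G. \<forall>U. is_spread \<gamma> U \<longrightarrow>
     (\<forall>l x. (\<lambda>p. blinfun_apply (F l) (blinfun_apply U (trunc p x))) \<longlonglongrightarrow> blinfun_apply (F l) (blinfun_apply U x))"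
  proof (rule bexI[OF _ G[OF sm]], intro allI impI)
    fix U and l :: nat and x assume U: "is_spread \<gamma> U"
    show "(\<lambda>p. blinfun_apply (F l) (blinfun_apply U (trunc p x))) \<longlonglongrightarrow> blinfun_apply (F l) (blinfun_apply U x)"
    proof (rule LIMSEQ_I)
      fix e :: real assume "0 < e"
      let ?C = "norm U * norm x"
      obtain m :: nat where m: "?C < m * e" using reals_Archimedean3[OF \<open>0 < e\<close>] by blast
      \<comment> \<open>A stage that treats functional \<open>l\<close> with a tolerance of at most
        \<open>1 / real (Suc m)\<close>.\<close>
      define q where "q = prod_encode (l, m)"
      have qm: "m \<le> q" using prod_encode_ge[of l m] by (simp add: q_def)
      have "norm (blinfun_apply (F l) (blinfun_apply U (trunc p x)) - blinfun_apply (F l) (blinfun_apply U x)) < e"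
        if p: "Suc q \<le> p" for p
      proof -
        let ?w = "blinfun_apply U (x - trunc p x)"
        have supp: "Phi ?w i = 0" if i: "i \<notin> \<Gamma> (Suc q)" for i
        proof (cases "i \<in> range \<gamma>")
          case True
          then obtain n where n: "i = \<gamma> n" by blast
          have "n < p"
          proof (rule ccontr)
            assume "\<not> n < p"
            then have "\<gamma> n \<in> \<Gamma> (Suc q)" using \<gamma>(1)[of n] anti[of "Suc q" n] p by auto
            then show False using i n by simp
          qed
          then show ?thesis using U n by (simp add: is_spread_def trunc_diff)
        next
          case False
          then show ?thesis using U by (simp add: is_spread_def)
        qed
        have "norm (x - trunc p x) \<le> norm x"
          unfolding Phi_norm by (rule rho_mono[OF Phi_P]) (auto simp: trunc_diff)
        then have "norm ?w \<le> ?C" using norm_blinfun[of U "x - trunc p x"] mult_left_mono order_trans norm_ge_zero by metis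
        have "\<bar>blinfun_apply (F l) ?w\<bar> \<le> 1 / real (Suc q) * norm ?w"
          using \<Gamma>(3)[of q] supp unfolding small_def q_def by simp
        also have "\<dots> \<le> 1 / real (Suc q) * ?C" using \<open>norm ?w \<le> ?C\<close> by (intro mult_left_mono) auto
        also have "\<dots> < e"
        proof -
          have "real m * e \<le> real (Suc q) * e" using qm \<open>0 < e\<close> by (intro mult_right_mono) auto
          then have "?C < real (Suc q) * e" using m by linarith
          then show ?thesis by (simp add: field_simps)
        qed
        finally show ?thesis by (simp add: blinfun.diff_right norm_minus_commute abs_minus_commute)
      qed
      then show "\<exists>N. \<forall>p\<ge>N. norm (blinfun_apply (F l) (blinfun_apply U (trunc p x)) - blinfun_apply (F l) (blinfun_apply U x)) < e"
        by blast
    qed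
  qed
qed

text \<open>
  Holds when the space is the space of the same kind over itself, the \<open>k\<close>-th term of \<open>a\<close> being the
  row \<open>i \<mapsto> a (prod_encode (k, i))\<close>. It allows an operator to be applied to all rows at once.
\<close>

definition row_bounded :: bool where
  "row_bounded \<longleftrightarrow> (\<forall>a b C. P a \<longrightarrow> (\<forall>n. 0 \<le> a n) \<longrightarrow> (\<forall>n. 0 \<le> b n) \<longrightarrow> 0 \<le> C \<longrightarrow>
     (\<forall>k. P (\<lambda>i. b (prod_encode (k, i))) \<and> rho (\<lambda>i. b (prod_encode (k, i))) \<le> C * rho (\<lambda>i. a (prod_encode (k, i)))) \<longrightarrow>
     P b \<and> rho b \<le> C * rho a)"

end

section \<open>The three kinds of spaces\<close>

text \<open>The space itself, viewed as sequences supported at index 0. As \<open>Idx\<close> is a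
  single point, the trivial selection already decides every dichotomy.\<close>

lemma coord_space_single:
  fixes \<Phi> :: "'e::banach \<Rightarrow> 'y::banach"
  assumes "linear \<Phi>" "\<And>v. norm (\<Phi> v) = norm v" "range \<Phi> = UNIV"
  shows "coord_space (\<lambda>v n. if n = 0 then \<Phi> v else 0) (\<lambda>a. \<forall>n>0. a n = 0) (\<lambda>a. a 0) {0} {id}"
proof (rule coord_space.intro)
  show "linear (\<lambda>v. if n = 0 then \<Phi> v else 0)" for n :: nat
    using assms(1) by (cases "n = 0") (auto simp: linear_zero)
  show "range (\<lambda>v n. if n = 0 then \<Phi> v else 0) = {y. \<forall>n>(0 :: nat). norm (y n :: 'y) = 0}"
  proof (intro equalityI subsetI)
    fix y :: "nat \<Rightarrow> 'y" assume y: "y \<in> {y. \<forall>n>0. norm (y n) = 0}"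
    obtain v where "\<Phi> v = y 0" using assms(3) by (metis rangeE UNIV_I)
    then have "y = (\<lambda>n. if n = 0 then \<Phi> v else 0)" using y by auto
    then show "y \<in> range (\<lambda>v n. if n = 0 then \<Phi> v else 0)" by blast
  qed auto
  show "a 0 \<le> suminf a" if "\<And>n. 0 \<le> a n" "summable a" for a :: "nat \<Rightarrow> real"
    using sum_le_suminf[OF that(2), of "{0}"] that by simp
  show "\<forall>n>0. b n = 0" if "\<forall>n>0. a n = 0" "\<And>n. 0 \<le> b n" "\<And>n. b n \<le> a n" for a b :: "nat \<Rightarrow> real"
  proof (intro allI impI)
    fix n :: nat assume "0 < n"
    then show "b n = 0" using that(1) that(2)[of n] that(3)[of n] by simp
  qed
  show "a n \<le> a 0" if "\<forall>n>0. a n = 0" "\<And>n. 0 \<le> a n" for a :: "nat \<Rightarrow> real" and n :: nat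
    using that(1) that(2)[of 0] by (cases "n = 0") auto
qed (use assms(2) in \<open>auto simp: less_imp_neq\<close>)

lemma strict_mono_dichotomy:
  "\<exists>\<gamma>\<in>{\<gamma> :: nat \<Rightarrow> nat. strict_mono \<gamma>}. (\<forall>n\<in>UNIV. Q (\<gamma> n)) \<or> (\<forall>n\<in>UNIV. \<not> Q (\<gamma> n))"
proof (cases "infinite {n. Q n}")
  case True
  then show ?thesis using infinite_enumerate[OF True] by auto
next
  case False
  then have "infinite (- {n. Q n})" by (simp add: finite_compl)
  then show ?thesis using infinite_enumerate by fastforce
qed

lemma powr_summable_select:
  fixes a :: "nat \<Rightarrow> real"
  assumes "strict_mono \<gamma>" "summable (\<lambda>n. a n powr p)"
  shows "summable (\<lambda>n. a (\<gamma> n) powr p)" "(\<Sum>n. a (\<gamma> n) powr p) \<le> (\<Sum>n. a n powr p)"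
proof -
  let ?f = "\<lambda>n. if n \<in> range \<gamma> then a n powr p else 0"
  have s: "summable ?f" by (rule summable_comparison_test'[OF assms(2), of 0]) auto
  have z: "?f n = 0" if "n \<notin> range \<gamma>" for n using that by simp
  show "summable (\<lambda>n. a (\<gamma> n) powr p)" using summable_mono_reindex[of \<gamma> ?f, OF assms(1) z] s by simp
  have "(\<Sum>n. a (\<gamma> n) powr p) = suminf ?f" using suminf_mono_reindex[of \<gamma> ?f, OF assms(1) z] by simp
  also have "\<dots> \<le> (\<Sum>n. a n powr p)" by (rule suminf_le[OF _ s assms(2)]) auto
  finally show "(\<Sum>n. a (\<gamma> n) powr p) \<le> (\<Sum>n. a n powr p)" .
qed

lemma powr_summable_spread:
  fixes a :: "nat \<Rightarrow> real"
  assumes "strict_mono \<gamma>" "summable (\<lambda>n. a n powr p)"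
  defines "b \<equiv> \<lambda>n. if n \<in> range \<gamma> then a (inv_into UNIV \<gamma> n) else 0"
  shows "summable (\<lambda>n. b n powr p)" "(\<Sum>n. b n powr p) = (\<Sum>n. a n powr p)"
proof -
  have z: "b n powr p = 0" if "n \<notin> range \<gamma>" for n using that by (simp add: b_def)
  have b: "b (\<gamma> n) = a n" for n using strict_mono_imp_inj_on[OF assms(1), of UNIV] by (simp add: b_def inv_f_f)
  show "summable (\<lambda>n. b n powr p)"
    using summable_mono_reindex[of \<gamma> "\<lambda>n. b n powr p", OF assms(1) z] assms(2) by (simp add: b)
  show "(\<Sum>n. b n powr p) = (\<Sum>n. a n powr p)"
    using suminf_mono_reindex[of \<gamma> "\<lambda>n. b n powr p", OF assms(1) z] by (simp add: b)
qed

text \<open>Each term is at most the sum \<open>?S\<close>, so \<open>a n powr p\<close> is at most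
  \<open>a n * ?S powr (p - 1)\<close>.\<close>

lemma powr_le_sum:
  fixes a :: "nat \<Rightarrow> real"
  assumes p: "1 \<le> p" and nn: "\<And>n. 0 \<le> a n" and s: "summable a"
  shows "summable (\<lambda>n. a n powr p)" "(\<Sum>n. a n powr p) powr (1 / p) \<le> suminf a"
proof -
  let ?S = "suminf a"
  have S0: "0 \<le> ?S" by (rule suminf_nonneg[OF s nn])
  have le: "a n powr p \<le> a n * ?S powr (p - 1)" for n
  proof (cases "a n = 0")
    case False
    have "a n \<le> ?S" using sum_le_suminf[OF s, of "{n}"] nn by simp
    then have "a n powr (p - 1) \<le> ?S powr (p - 1)" using nn p by (intro powr_mono2) auto
    then have "a n * a n powr (p - 1) \<le> a n * ?S powr (p - 1)" by (intro mult_left_mono nn)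
    moreover have "a n * a n powr (p - 1) = a n powr p" using False nn[of n] powr_mult_base[of "a n" "p - 1"] by simp
    ultimately show ?thesis by simp
  qed (use p in simp)
  have s2: "summable (\<lambda>n. a n * ?S powr (p - 1))" by (rule summable_mult2[OF s])
  show sp: "summable (\<lambda>n. a n powr p)" by (rule summable_comparison_test'[OF s2, of 0]) (use le in simp)
  have "(\<Sum>n. a n powr p) \<le> ?S * ?S powr (p - 1)" using suminf_le[OF le sp s2] suminf_mult2[OF s] by simp
  also have "\<dots> = ?S powr p" using S0 powr_mult_base[of ?S "p - 1"] p by (cases "?S = 0") auto
  finally have "(\<Sum>n. a n powr p) powr (1 / p) \<le> (?S powr p) powr (1 / p)"
    using p by (intro powr_mono2) (auto intro: suminf_nonneg[OF sp])
  also have "\<dots> = ?S" using S0 p by (simp add: powr_powr)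
  finally show "(\<Sum>n. a n powr p) powr (1 / p) \<le> ?S" .
qed

lemma coord_space_lp:
  fixes \<Phi> :: "'e::banach \<Rightarrow> nat \<Rightarrow> 'y::banach"
  assumes p: "1 \<le> p" and "\<And>n. linear (\<lambda>v. \<Phi> v n)" "range \<Phi> = {y. summable (\<lambda>n. norm (y n) powr p)}"
    "\<And>v. norm v = (\<Sum>n. norm (\<Phi> v n) powr p) powr (1 / p)"
  shows "coord_space \<Phi> (\<lambda>a. summable (\<lambda>n. a n powr p)) (\<lambda>a. (\<Sum>n. a n powr p) powr (1 / p)) UNIV {\<gamma>. strict_mono \<gamma>}"
proof (rule coord_space.intro)
  have mono: "summable (\<lambda>n. b n powr p) \<and> (\<Sum>n. b n powr p) powr (1 / p) \<le> (\<Sum>n. a n powr p) powr (1 / p)"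
    if s: "summable (\<lambda>n. a n powr p)" and b: "\<And>n. 0 \<le> b n" "\<And>n. b n \<le> a n" for a b :: "nat \<Rightarrow> real"
  proof -
    have le: "b n powr p \<le> a n powr p" for n using b p by (intro powr_mono2) auto
    have sb: "summable (\<lambda>n. b n powr p)" by (rule summable_comparison_test'[OF s, of 0]) (use le in simp)
    have "(\<Sum>n. b n powr p) \<le> (\<Sum>n. a n powr p)" by (rule suminf_le[OF le sb s])
    then show ?thesis using sb p by (auto intro!: powr_mono2 suminf_nonneg)
  qed
  show "summable (\<lambda>n. b n powr p)" if "summable (\<lambda>n. a n powr p)" "\<And>n. 0 \<le> b n" "\<And>n. b n \<le> a n" for a b :: "nat \<Rightarrow> real"
    using mono[OF that] by blast
  show "(\<Sum>n. b n powr p) powr (1 / p) \<le> (\<Sum>n. a n powr p) powr (1 / p)"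
    if "summable (\<lambda>n. a n powr p)" "\<And>n. 0 \<le> b n" "\<And>n. b n \<le> a n" for a b :: "nat \<Rightarrow> real"
    using mono[OF that] by blast
  show "summable (\<lambda>n. (c * a n) powr p)" if "summable (\<lambda>n. a n powr p)" "\<And>n. 0 \<le> a n" "0 \<le> c" for a :: "nat \<Rightarrow> real" and c :: real
    using that by (simp add: powr_mult summable_mult)
  show "(\<Sum>n. (c * a n) powr p) powr (1 / p) \<le> c * (\<Sum>n. a n powr p) powr (1 / p)"
    if "summable (\<lambda>n. a n powr p)" "\<And>n. 0 \<le> a n" "0 \<le> c" for a :: "nat \<Rightarrow> real" and c :: real
  proof -
    have "(\<Sum>n. (c * a n) powr p) = c powr p * (\<Sum>n. a n powr p)" using that by (simp add: powr_mult suminf_mult)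
    then have "(\<Sum>n. (c * a n) powr p) powr (1 / p) = (c powr p) powr (1 / p) * (\<Sum>n. a n powr p) powr (1 / p)"
      using suminf_nonneg[OF that(1)] by (simp add: powr_mult)
    then show ?thesis using that(3) p by (simp add: powr_powr)
  qed
  show "a n \<le> (\<Sum>n. a n powr p) powr (1 / p)" if "summable (\<lambda>n. a n powr p)" "\<And>n. 0 \<le> a n" for a :: "nat \<Rightarrow> real" and n :: nat
  proof -
    have "a n = (a n powr p) powr (1 / p)" using that p by (simp add: powr_powr)
    also have "\<dots> \<le> (\<Sum>n. a n powr p) powr (1 / p)"
      using sum_le_suminf[OF that(1), of "{n}"] p by (intro powr_mono2) auto
    finally show ?thesis .
  qed
  show "summable (\<lambda>n. a n powr p)" if "\<And>n. 0 \<le> a n" "summable a" for a :: "nat \<Rightarrow> real" by (rule powr_le_sum(1)[OF p that])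
  show "(\<Sum>n. a n powr p) powr (1 / p) \<le> suminf a" if "\<And>n. 0 \<le> a n" "summable a" for a :: "nat \<Rightarrow> real" by (rule powr_le_sum(2)[OF p that])
  show "inj \<gamma>" if "\<gamma> \<in> {\<gamma>. strict_mono \<gamma>}" for \<gamma> :: "nat \<Rightarrow> nat" using that strict_mono_imp_inj_on by blast
  show "summable (\<lambda>n. a (\<gamma> n) powr p) \<and> (\<Sum>n. a (\<gamma> n) powr p) powr (1 / p) \<le> (\<Sum>n. a n powr p) powr (1 / p)"
    if "\<gamma> \<in> {\<gamma>. strict_mono \<gamma>}" "summable (\<lambda>n. a n powr p)" for \<gamma> :: "nat \<Rightarrow> nat" and a :: "nat \<Rightarrow> real"
    using powr_summable_select[of \<gamma> a p] that p by (auto intro!: powr_mono2 suminf_nonneg)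
  show "summable (\<lambda>n. (if n \<in> range \<gamma> then a (inv_into UNIV \<gamma> n) else 0) powr p) \<and>
     (\<Sum>n. (if n \<in> range \<gamma> then a (inv_into UNIV \<gamma> n) else 0) powr p) powr (1 / p) \<le> (\<Sum>n. a n powr p) powr (1 / p)"
    if "\<gamma> \<in> {\<gamma>. strict_mono \<gamma>}" "summable (\<lambda>n. a n powr p)" for \<gamma> :: "nat \<Rightarrow> nat" and a :: "nat \<Rightarrow> real"
    using powr_summable_spread[of \<gamma> a p] that by simp
  show "\<exists>\<gamma>\<in>{\<gamma> :: nat \<Rightarrow> nat. strict_mono \<gamma>}. (\<forall>n\<in>UNIV. Q (\<gamma> n)) \<or> (\<forall>n\<in>UNIV. \<not> Q (\<gamma> n))" for Q :: "nat \<Rightarrow> bool"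
    by (rule strict_mono_dichotomy)
qed (use assms in auto)

lemma powr_tails:
  fixes a :: "nat \<Rightarrow> real"
  assumes "1 \<le> p" and s: "summable (\<lambda>n. a n powr p)"
  shows "(\<lambda>m. (\<Sum>n. (if n < m then 0 else a n) powr p) powr (1 / p)) \<longlonglongrightarrow> 0"
proof -
  have eq: "(\<Sum>n. (if n < m then 0 else a n) powr p) = (\<Sum>n. a n powr p) - (\<Sum>n<m. a n powr p)" for m
  proof -
    have "(\<lambda>n. if n < m then a n powr p else 0) sums (\<Sum>n<m. a n powr p)"
      using sums_If_finite_set[of "{..<m}" "\<lambda>n. a n powr p"] by simp
    from sums_diff[OF summable_sums[OF s] this]
    have "(\<lambda>n. a n powr p - (if n < m then a n powr p else 0)) sums ((\<Sum>n. a n powr p) - (\<Sum>n<m. a n powr p))" .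
    moreover have "(\<lambda>n. a n powr p - (if n < m then a n powr p else 0)) = (\<lambda>n. (if n < m then 0 else a n) powr p)" by auto
    ultimately show ?thesis using sums_unique by metis
  qed
  have "(\<lambda>m. (\<Sum>n. a n powr p) - (\<Sum>n<m. a n powr p)) \<longlonglongrightarrow> (\<Sum>n. a n powr p) - (\<Sum>n. a n powr p)"
    by (intro tendsto_diff tendsto_const summable_LIMSEQ s)
  then have lim: "(\<lambda>m. \<Sum>n. (if n < m then 0 else a n) powr p) \<longlonglongrightarrow> 0" unfolding eq by simp
  have nn: "0 \<le> (\<Sum>n. (if n < m then 0 else a n) powr p)" for m
    unfolding eq using sum_le_suminf[OF s, of "{..<m}"] by simp
  show ?thesis
    by (rule tendsto_zero_powrI[OF lim tendsto_const]) (use nn assms(1) in auto)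
qed

lemma coord_space_linf:
  fixes \<Phi> :: "'e::banach \<Rightarrow> nat \<Rightarrow> 'y::banach"
  assumes "\<And>n. linear (\<lambda>v. \<Phi> v n)" "range \<Phi> = {y. bounded (range y)}" "\<And>v. norm v = (SUP n. norm (\<Phi> v n))"
  shows "coord_space \<Phi> (\<lambda>a. bdd_above (range (\<lambda>n. \<bar>a n\<bar>))) (\<lambda>a. SUP n. a n) UNIV {\<gamma>. strict_mono \<gamma>}"
proof (rule coord_space.intro)
  have bd: "bdd_above (range a)" if "bdd_above (range (\<lambda>n. \<bar>a n\<bar>))" for a :: "nat \<Rightarrow> real"
  proof -
    from that obtain M where "\<And>n. \<bar>a n\<bar> \<le> M" by (auto simp: bdd_above_def)
    then have "a n \<le> M" for n using abs_le_D1 by blast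
    then show ?thesis by (auto intro!: bdd_aboveI[of _ M])
  qed
  have bdI: "bdd_above (range (\<lambda>n. \<bar>a n\<bar>))" if "\<And>n. 0 \<le> a n" "\<And>n. a n \<le> M" for a :: "nat \<Rightarrow> real" and M
    using that by (auto intro!: bdd_aboveI[of _ M])
  have up: "a n \<le> (SUP n. a n)" if "bdd_above (range (\<lambda>n. \<bar>a n\<bar>))" for a :: "nat \<Rightarrow> real" and n
    by (rule cSUP_upper[OF _ bd[OF that]]) simp
  show "range \<Phi> = {y. bdd_above (range (\<lambda>n. \<bar>norm (y n)\<bar>))}"
    unfolding assms(2) by (auto simp: bounded_iff bdd_above_def)
  show "bdd_above (range (\<lambda>n. \<bar>b n\<bar>))" if "bdd_above (range (\<lambda>n. \<bar>a n\<bar>))" "\<And>n. 0 \<le> b n" "\<And>n. b n \<le> a n" for a b :: "nat \<Rightarrow> real"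
    using bdI[of b] that(2,3) up[OF that(1)] order_trans by metis
  show "(SUP n. b n) \<le> (SUP n. a n)" if "bdd_above (range (\<lambda>n. \<bar>a n\<bar>))" "\<And>n. 0 \<le> b n" "\<And>n. b n \<le> a n" for a b :: "nat \<Rightarrow> real"
    by (rule cSUP_least) (auto intro: order_trans[OF that(3) up[OF that(1)]])
  show "bdd_above (range (\<lambda>n. \<bar>c * a n\<bar>))" if "bdd_above (range (\<lambda>n. \<bar>a n\<bar>))" "\<And>n. 0 \<le> a n" "0 \<le> c" for a :: "nat \<Rightarrow> real" and c :: real
    by (rule bdI[of _ "c * (SUP n. a n)"]) (use that up[OF that(1)] in \<open>auto intro: mult_left_mono\<close>)
  show "(SUP n. c * a n) \<le> c * (SUP n. a n)" if "bdd_above (range (\<lambda>n. \<bar>a n\<bar>))" "\<And>n. 0 \<le> a n" "0 \<le> c" for a :: "nat \<Rightarrow> real" and c :: real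
    by (rule cSUP_least) (use that up[OF that(1)] in \<open>auto intro: mult_left_mono\<close>)
  show "a n \<le> (SUP n. a n)" if "bdd_above (range (\<lambda>n. \<bar>a n\<bar>))" "\<And>n. 0 \<le> a n" for a :: "nat \<Rightarrow> real" and n :: nat by (rule up[OF that(1)])
  have le: "a n \<le> suminf a" if "\<And>n. 0 \<le> a n" "summable a" for a :: "nat \<Rightarrow> real" and n :: nat
    using sum_le_suminf[OF that(2), of "{n}"] that(1) by simp
  show "bdd_above (range (\<lambda>n. \<bar>a n\<bar>))" if "\<And>n. 0 \<le> a n" "summable a" for a :: "nat \<Rightarrow> real" by (rule bdI[OF that(1) le[OF that]])
  show "(SUP n. a n) \<le> suminf a" if "\<And>n. 0 \<le> a n" "summable a" for a :: "nat \<Rightarrow> real" by (rule cSUP_least) (use le[OF that] in auto)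
  show "inj \<gamma>" if "\<gamma> \<in> {\<gamma>. strict_mono \<gamma>}" for \<gamma> :: "nat \<Rightarrow> nat" using that strict_mono_imp_inj_on by blast
  show "bdd_above (range (\<lambda>n. \<bar>a (\<gamma> n)\<bar>)) \<and> (SUP n. a (\<gamma> n)) \<le> (SUP n. a n)"
    if "bdd_above (range (\<lambda>n. \<bar>a n\<bar>))" "\<And>n. 0 \<le> a n" for \<gamma> :: "nat \<Rightarrow> nat" and a :: "nat \<Rightarrow> real"
  proof
    show "bdd_above (range (\<lambda>n. \<bar>a (\<gamma> n)\<bar>))" by (rule bdI[OF that(2) up[OF that(1)]])
    show "(SUP n. a (\<gamma> n)) \<le> (SUP n. a n)" by (rule cSUP_least) (use up[OF that(1)] in auto)
  qed
  show "bdd_above (range (\<lambda>n. \<bar>if n \<in> range \<gamma> then a (inv_into UNIV \<gamma> n) else 0\<bar>)) \<and>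
     (SUP n. if n \<in> range \<gamma> then a (inv_into UNIV \<gamma> n) else 0) \<le> (SUP n. a n)"
    if "bdd_above (range (\<lambda>n. \<bar>a n\<bar>))" "\<And>n. 0 \<le> a n" for \<gamma> :: "nat \<Rightarrow> nat" and a :: "nat \<Rightarrow> real"
  proof
    have "(if n \<in> range \<gamma> then a (inv_into UNIV \<gamma> n) else 0) \<le> (SUP n. a n)" for n
      using up[OF that(1)] that(2)[of 0] order_trans[OF that(2)[of 0] up[OF that(1)]] by simp
    then show "bdd_above (range (\<lambda>n. \<bar>if n \<in> range \<gamma> then a (inv_into UNIV \<gamma> n) else 0\<bar>))"
      "(SUP n. if n \<in> range \<gamma> then a (inv_into UNIV \<gamma> n) else 0) \<le> (SUP n. a n)"
      by (intro bdI[of _ "SUP n. a n"] cSUP_least; use that(2) in simp)+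
  qed
  show "\<exists>\<gamma>\<in>{\<gamma> :: nat \<Rightarrow> nat. strict_mono \<gamma>}. (\<forall>n\<in>UNIV. Q (\<gamma> n)) \<or> (\<forall>n\<in>UNIV. \<not> Q (\<gamma> n))" for Q :: "nat \<Rightarrow> bool"
    by (rule strict_mono_dichotomy)
qed (use assms in auto)

section \<open>The ideal of operators that do not factor the identity\<close>

lemma operator_ring_ring: "ring (operator_ring E)"
proof (rule ringI)
  show "abelian_group (operator_ring E)"
  proof (rule abelian_groupI)
    fix x assume "x \<in> carrier (operator_ring E)"
    show "\<exists>y\<in>carrier (operator_ring E). y \<oplus>\<^bsub>operator_ring E\<^esub> x = \<zero>\<^bsub>operator_ring E\<^esub>"
      by (rule bexI[of _ "- x"]) (auto simp: operator_ring_def)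
  qed (auto simp: operator_ring_def)
  show "monoid (operator_ring E)"
    by (rule monoidI) (auto simp: operator_ring_def blinfun_compose_assoc intro!: blinfun_eqI)
qed (auto simp: operator_ring_def blinfun.add_left blinfun.add_right intro!: blinfun_eqI)

lemma M_set_compose:
  fixes E :: "'e::real_normed_vector itself" and A B :: "'e \<Rightarrow>\<^sub>L 'e"
  assumes "T \<in> M_set E"
  shows "A o\<^sub>L T o\<^sub>L B \<in> M_set E"
  unfolding M_set_def
proof (intro CollectI allI notI)
  fix A' B' :: "'e \<Rightarrow>\<^sub>L 'e" assume "id_blinfun = A' o\<^sub>L (A o\<^sub>L T o\<^sub>L B) o\<^sub>L B'"
  then have "id_blinfun = (A' o\<^sub>L A) o\<^sub>L T o\<^sub>L (B o\<^sub>L B')" by (simp add: blinfun_compose_assoc)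
  then show False using assms unfolding M_set_def by blast
qed

text \<open>If A (S + T) B is the identity, then A T B is the identity minus A S B, and the
  factorization property makes one of the two factor the identity.\<close>

lemma M_set_add:
  fixes E :: "'e::real_normed_vector itself"
  assumes pf: "primary_factorization_property C E" and S: "S \<in> M_set E" and T: "T \<in> M_set E"
  shows "S + T \<in> M_set E"
  unfolding M_set_def
proof (intro CollectI allI notI)
  fix A B :: "'e \<Rightarrow>\<^sub>L 'e" assume eq: "id_blinfun = A o\<^sub>L (S + T) o\<^sub>L B"
  have "id_blinfun - (A o\<^sub>L S o\<^sub>L B) = A o\<^sub>L T o\<^sub>L B"
    unfolding eq by (rule blinfun_eqI) (simp add: blinfun.diff_left blinfun.add_left blinfun.add_right)
  moreover have "factors_through_plus id_blinfun (A o\<^sub>L S o\<^sub>L B) C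
      \<or> factors_through_plus id_blinfun (id_blinfun - (A o\<^sub>L S o\<^sub>L B)) C"
    using pf unfolding primary_factorization_property_def by blast
  moreover have "\<not> factors_through_plus id_blinfun U C" if "U \<in> M_set E" for U :: "'e \<Rightarrow>\<^sub>L 'e"
    using that unfolding factors_through_plus_def factors_through_def M_set_def by (auto intro!: exI[of _ 1])
  ultimately show False using M_set_compose[OF S, of A B] M_set_compose[OF T, of A B] by metis
qed

lemma M_set_ideal:
  fixes E :: "'e::real_normed_vector itself"
  assumes pf: "primary_factorization_property C E" and nz: "(id_blinfun :: 'e \<Rightarrow>\<^sub>L 'e) \<noteq> 0"
  shows "ideal (M_set E) (operator_ring E)"
proof (rule idealI[OF operator_ring_ring])
  have zero: "0 \<in> M_set E"
  proof -
    have "A o\<^sub>L 0 o\<^sub>L B = 0" for A B :: "'e \<Rightarrow>\<^sub>L 'e" by (rule blinfun_eqI) simp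
    then show ?thesis using nz unfolding M_set_def by auto
  qed
  have neg: "- T \<in> M_set E" if "T \<in> M_set E" for T
  proof -
    have "- T = (- id_blinfun) o\<^sub>L T o\<^sub>L id_blinfun" by (rule blinfun_eqI) (simp add: blinfun.minus_left)
    then show ?thesis using M_set_compose[OF that] by metis
  qed
  interpret ring "operator_ring E" by (rule operator_ring_ring)
  show "subgroup (M_set E) (add_monoid (operator_ring E))"
  proof (rule add.subgroupI)
    show "M_set E \<noteq> {}" using zero by blast
    fix T assume T: "T \<in> M_set E"
    have "- T = \<ominus>\<^bsub>operator_ring E\<^esub> T"
      by (rule minus_equality[symmetric]) (auto simp: operator_ring_def)
    then show "\<ominus>\<^bsub>operator_ring E\<^esub> T \<in> M_set E" using neg[OF T] by simp
    fix S assume S: "S \<in> M_set E"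
    show "T \<oplus>\<^bsub>operator_ring E\<^esub> S \<in> M_set E"
      using M_set_add[OF pf T S] by (simp add: operator_ring_def)
  qed (auto simp: operator_ring_def)
next
  fix T X assume T: "T \<in> M_set E"
  have "X o\<^sub>L T = X o\<^sub>L T o\<^sub>L id_blinfun" "T o\<^sub>L X = id_blinfun o\<^sub>L T o\<^sub>L X" by (rule blinfun_eqI, simp)+
  then have "X o\<^sub>L T \<in> M_set E" "T o\<^sub>L X \<in> M_set E" using M_set_compose[OF T] by metis+
  then show "X \<otimes>\<^bsub>operator_ring E\<^esub> T \<in> M_set E" "T \<otimes>\<^bsub>operator_ring E\<^esub> X \<in> M_set E"
    by (simp_all add: operator_ring_def)
qed

text \<open>An ideal that contains an operator outside \<open>M_set\<close> contains the
  identity.\<close>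

lemma proper_ideal_subset_M_set:
  fixes E :: "'e::real_normed_vector itself"
  assumes "ideal J (operator_ring E)" "J \<noteq> carrier (operator_ring E)"
  shows "J \<subseteq> M_set E"
proof (rule subsetI, rule ccontr)
  fix T assume T: "T \<in> J" "T \<notin> M_set E"
  interpret ideal J "operator_ring E" by fact
  obtain A B :: "'e \<Rightarrow>\<^sub>L 'e" where AB: "id_blinfun = A o\<^sub>L T o\<^sub>L B" using T(2) unfolding M_set_def by auto
  have "A \<otimes>\<^bsub>operator_ring E\<^esub> T \<in> J" by (rule I_l_closed[OF T(1)]) (simp add: operator_ring_def)
  then have "(A \<otimes>\<^bsub>operator_ring E\<^esub> T) \<otimes>\<^bsub>operator_ring E\<^esub> B \<in> J" by (rule I_r_closed) (simp add: operator_ring_def)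
  then have "\<one>\<^bsub>operator_ring E\<^esub> \<in> J" using AB by (simp add: operator_ring_def)
  then show False using one_imp_carrier assms(2) by blast
qed

lemma M_set_unique_maximal:
  fixes E :: "'e::real_normed_vector itself"
  assumes pf: "primary_factorization_property C E" and nz: "(id_blinfun :: 'e \<Rightarrow>\<^sub>L 'e) \<noteq> 0"
  shows "maximalideal (M_set E) (operator_ring E) \<and> (\<forall>M. maximalideal M (operator_ring E) \<longrightarrow> M = M_set E)"
proof -
  have "id_blinfun \<notin> M_set E"
  proof -
    have "(id_blinfun :: 'e \<Rightarrow>\<^sub>L 'e) = id_blinfun o\<^sub>L id_blinfun o\<^sub>L id_blinfun" by (rule blinfun_eqI) simp
    then show ?thesis unfolding M_set_def by blast
  qed
  then have proper: "carrier (operator_ring E) \<noteq> M_set E" by (auto simp: operator_ring_def)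
  note id = M_set_ideal[OF pf nz]
  have max: "maximalideal (M_set E) (operator_ring E)"
  proof (rule maximalidealI[OF id proper])
    fix J assume "ideal J (operator_ring E)" "M_set E \<subseteq> J"
    then show "J = M_set E \<or> J = carrier (operator_ring E)" using proper_ideal_subset_M_set by blast
  qed
  moreover have "M = M_set E" if M: "maximalideal M (operator_ring E)" for M
  proof -
    interpret m: maximalideal M "operator_ring E" by fact
    have "M \<subseteq> M_set E" by (rule proper_ideal_subset_M_set[OF m.is_ideal]) (use m.I_notcarr in simp)
    moreover have "M_set E \<subseteq> carrier (operator_ring E)" by (simp add: operator_ring_def)
    ultimately show ?thesis using m.I_maximal[OF id] proper by blast
  qed
  ultimately show ?thesis by blast
qed

section \<open>Complemented subspaces\<close>

text \<open>As for the open mapping theorem, boundedness follows from Baire's theorem and successive approximation.\<close>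

lemma closed_complement_projection:
  fixes F G :: "'e::banach set"
  assumes F: "subspace F" "closed F" and G: "subspace G" "closed G"
    and FG: "F \<inter> G = {0}" "{u + v | u v. u \<in> F \<and> v \<in> G} = UNIV"
  obtains P :: "'e \<Rightarrow>\<^sub>L 'e" where "\<And>x. blinfun_apply P x \<in> F" "\<And>x. x - blinfun_apply P x \<in> G"
    "\<And>x. x \<in> F \<Longrightarrow> blinfun_apply P x = x" "\<And>x. x \<in> G \<Longrightarrow> blinfun_apply P x = 0"
proof -
  have ex: "\<exists>u. u \<in> F \<and> x - u \<in> G" for x
  proof -
    have "x \<in> {u + v | u v. u \<in> F \<and> v \<in> G}" using FG(2) by blast
    then obtain u v where "x = u + v" "u \<in> F" "v \<in> G" by blast
    then show ?thesis by (intro exI[of _ u]) simp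
  qed
  have uniq: "u = u'" if "u \<in> F" "x - u \<in> G" "u' \<in> F" "x - u' \<in> G" for u u' x
  proof -
    have "u - u' \<in> F" using that F(1) subspace_diff by blast
    moreover have "(x - u') - (x - u) \<in> G" using that G(1) subspace_diff by blast
    ultimately have "u - u' \<in> F \<inter> G" by simp
    then show ?thesis using FG(1) by simp
  qed
  obtain pr where pr: "\<And>x. pr x \<in> F" "\<And>x. x - pr x \<in> G" using ex by metis
  have prI: "pr x = u" if "u \<in> F" "x - u \<in> G" for x u using uniq[OF pr(1) pr(2) that] .
  have pr_add: "pr (x + y) = pr x + pr y" for x y
  proof (rule prI)
    show "pr x + pr y \<in> F" using pr F(1) subspace_add by blast
    have "(x - pr x) + (y - pr y) \<in> G" using pr G(1) subspace_add by blast
    then show "x + y - (pr x + pr y) \<in> G" by (simp add: algebra_simps)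
  qed
  have pr_scale: "pr (c *\<^sub>R x) = c *\<^sub>R pr x" for c x
  proof (rule prI)
    show "c *\<^sub>R pr x \<in> F" using pr F(1) subspace_scale by blast
    have "c *\<^sub>R (x - pr x) \<in> G" using pr G(1) subspace_scale by blast
    then show "c *\<^sub>R x - c *\<^sub>R pr x \<in> G" by (simp add: scaleR_diff_right)
  qed
  have pr_diff: "pr (x - y) = pr x - pr y" for x y
    using pr_add[of x "(-1) *\<^sub>R y"] pr_scale[of "-1" y] by simp
  \<comment> \<open>The sets on which the algebraic projection is bounded by \<open>n\<close>; they
    are convex, symmetric and cover the space.\<close>
  define S where "S n = {x. norm (pr x) \<le> real n}" for n
  have "\<exists>n. interior (closure (S n)) \<noteq> {}"
  proof (rule ccontr)
    assume neg: "\<not> ?thesis"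
    have "euclidean interior_of \<Union> (range (\<lambda>n. closure (S n))) = {}"
    proof (rule Baire_category_alt)
      show "completely_metrizable_space (euclidean :: 'e topology) \<or> locally_compact_space (euclidean :: 'e topology) \<and> regular_space (euclidean :: 'e topology)"
        using completely_metrizable_space_euclidean by blast
    qed (use neg in auto)
    moreover have "\<Union> (range (\<lambda>n. closure (S n))) = UNIV"
    proof -
      have "\<exists>n. x \<in> closure (S n)" for x
      proof -
        obtain n :: nat where "norm (pr x) \<le> n" using real_arch_simple by blast
        then have "x \<in> S n" by (simp add: S_def)
        then show ?thesis using closure_subset[of "S n"] by blast
      qed
      then show ?thesis by blast
    qed
    ultimately show False by simp
  qed
  then obtain n x0 where "x0 \<in> interior (closure (S n))" by blast
  then obtain r where r: "0 < r" "ball x0 r \<subseteq> closure (S n)" using mem_interior by blast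
  \<comment> \<open>Half the difference of points near x0 + y and x0 - y moves the ball to the
    origin without increasing the bound \<open>n\<close>.\<close>
  have near: "\<exists>z. norm (pr z) \<le> n \<and> norm (y - z) < e" if y: "norm y < r" and e: "0 < e" for y e
  proof -
    have "x0 + y \<in> closure (S n)" "x0 - y \<in> closure (S n)" using r(2) y by (auto simp: subset_iff dist_norm)
    then obtain a b where a: "a \<in> S n" "dist a (x0 + y) < e" and b: "b \<in> S n" "dist b (x0 - y) < e"
      using e unfolding closure_approachable by blast
    let ?z = "(1 / 2) *\<^sub>R (a - b)"
    have "norm (pr ?z) \<le> 1 / 2 * (norm (pr a) + norm (pr b))"
      unfolding pr_scale pr_diff using norm_triangle_ineq4[of "pr a" "pr b"] by simp
    then have "norm (pr ?z) \<le> n" using a(1) b(1) by (simp add: S_def)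
    moreover have "y - ?z = (1 / 2) *\<^sub>R ((b - (x0 - y)) - (a - (x0 + y)))"
      using scaleR_half_double[of y] by (simp add: algebra_simps)
    then have "norm (y - ?z) \<le> 1 / 2 * (norm (b - (x0 - y)) + norm (a - (x0 + y)))"
      using norm_triangle_ineq4[of "b - (x0 - y)" "a - (x0 + y)"] by simp
    ultimately show ?thesis using a(2) b(2) by (intro exI[of _ ?z]) (simp add: dist_norm)
  qed
  \<comment> \<open>A nonzero vector is scaled to norm r / 2, where \<open>near\<close> gives the
    bound \<open>n\<close>.\<close>
  define K where "K = 2 * real n / r"
  have "\<exists>z. norm (pr z) \<le> K * norm x \<and> norm (x - z) \<le> norm x / 2" for x
  proof (cases "x = 0")
    case True
    have "pr 0 = 0" using pr_scale[of 0 0] by simp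
    then show ?thesis using True by (intro exI[of _ 0]) simp
  next
    case False
    define t where "t = r / (2 * norm x)"
    have t: "0 < t" using r(1) False by (simp add: t_def)
    have "norm (t *\<^sub>R x) < r" using r(1) False by (simp add: t_def)
    then obtain z where z: "norm (pr z) \<le> n" "norm (t *\<^sub>R x - z) < t * norm x / 2"
      using near[of "t *\<^sub>R x" "t * norm x / 2"] t False by auto
    have "norm (pr ((1 / t) *\<^sub>R z)) \<le> K * norm x"
      using z(1) t r(1) False unfolding pr_scale by (simp add: K_def t_def field_simps)
    moreover have "norm (x - (1 / t) *\<^sub>R z) \<le> norm x / 2"
    proof -
      have "x - (1 / t) *\<^sub>R z = (1 / t) *\<^sub>R (t *\<^sub>R x - z)" using t by (simp add: scaleR_diff_right)
      then have "norm (x - (1 / t) *\<^sub>R z) = norm (t *\<^sub>R x - z) / t" using t by simp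
      also have "\<dots> \<le> t * norm x / 2 / t" using z(2) t by (intro divide_right_mono) auto
      also have "\<dots> = norm x / 2" using t by simp
      finally show ?thesis .
    qed
    ultimately show ?thesis by blast
  qed
  then obtain w where w: "\<And>x. norm (pr (w x)) \<le> K * norm x" "\<And>x. norm (x - w x) \<le> norm x / 2" by metis
  have K0: "0 \<le> K" using r(1) by (simp add: K_def)
  have bound: "norm (pr x) \<le> norm x * (2 * K)" for x
  proof -
    \<comment> \<open>The remainders of the successive approximation. The approximants and their
      projections both converge, and closedness of \<open>F\<close> and \<open>G\<close> identifies
      the limit of the projections as the projection of \<open>x\<close>.\<close>
    define X where "X k = ((\<lambda>x. x - w x) ^^ k) x" for k
    have X0: "X 0 = x" and XS: "X (Suc k) = X k - w (X k)" for k by (simp_all add: X_def)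
    have nX: "norm (X k) \<le> norm x * (1 / 2) ^ k" for k
    proof (induction k)
      case (Suc k)
      then show ?case using w(2)[of "X k"] XS[of k] by simp
    qed (simp add: X0)
    have sum_w: "(\<Sum>k<m. w (X k)) = x - X m" for m by (induction m) (simp_all add: X0 XS)
    have le: "norm (pr (w (X k))) \<le> K * norm x * (1 / 2) ^ k" for k
      using w(1)[of "X k"] mult_left_mono[OF nX[of k] K0] by (simp add: mult.assoc)
    have gs: "(\<lambda>k. K * norm x * (1 / 2) ^ k) sums (2 * (K * norm x))" by (rule geometric_half)
    have sn: "summable (\<lambda>k. norm (pr (w (X k))))"
      by (rule summable_comparison_test'[OF sums_summable[OF gs], of 0]) (use le in simp)
    define u where "u = (\<Sum>k. pr (w (X k)))"
    have lim_u: "(\<lambda>m. \<Sum>k<m. pr (w (X k))) \<longlonglongrightarrow> u"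
      unfolding u_def by (rule summable_LIMSEQ[OF summable_norm_cancel[OF sn]])
    have "(\<lambda>k. norm x * (1 / 2) ^ k) \<longlonglongrightarrow> norm x * 0" by (intro tendsto_mult tendsto_const LIMSEQ_power_zero) simp
    then have "(\<lambda>k. norm x * (1 / 2) ^ k) \<longlonglongrightarrow> 0" by simp
    then have "X \<longlonglongrightarrow> 0" by (rule Lim_null_comparison[OF always_eventually, rotated]) (use nX in blast)
    then have lim_x: "(\<lambda>m. \<Sum>k<m. w (X k)) \<longlonglongrightarrow> x" unfolding sum_w using tendsto_diff[OF tendsto_const] by fastforce
    have uF: "u \<in> F"
      by (rule closed_sequentially[OF F(2) _ lim_u]) (use pr(1) F(1) in \<open>auto intro: subspace_sum\<close>)
    have "(\<lambda>m. (\<Sum>k<m. w (X k)) - (\<Sum>k<m. pr (w (X k)))) \<longlonglongrightarrow> x - u" by (intro tendsto_diff lim_x lim_u)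
    then have "(\<lambda>m. \<Sum>k<m. (w (X k) - pr (w (X k)))) \<longlonglongrightarrow> x - u" by (simp add: sum_subtractf)
    then have uG: "x - u \<in> G"
      by (rule closed_sequentially[OF G(2), rotated]) (use pr(2) G(1) in \<open>auto intro: subspace_sum\<close>)
    have "norm u \<le> (\<Sum>k. norm (pr (w (X k))))" unfolding u_def by (rule summable_norm[OF sn])
    also have "\<dots> \<le> 2 * (K * norm x)"
      using suminf_le[OF le sn sums_summable[OF gs]] sums_unique[OF gs] by simp
    finally show ?thesis using prI[OF uF uG] by (simp add: mult_ac)
  qed
  have bl: "bounded_linear pr" by (rule bounded_linear_intro[OF pr_add pr_scale bound])
  have app: "blinfun_apply (Blinfun pr) = pr" using bl by (rule bounded_linear_Blinfun_apply)
  show ?thesis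
  proof (rule that[of "Blinfun pr"])
    show "blinfun_apply (Blinfun pr) x = x" if "x \<in> F" for x
      unfolding app by (rule prI[OF that]) (use G(1) in \<open>simp add: subspace_0\<close>)
    show "blinfun_apply (Blinfun pr) x = 0" if "x \<in> G" for x
      unfolding app by (rule prI) (use F(1) that in \<open>simp_all add: subspace_0\<close>)
  qed (simp_all add: app pr)
qed

section \<open>The decomposition method\<close>

text \<open>\<open>prod_encode\<close> orders pairs by their sum and then by the first component.
  Adding 1 to the first component respects this order, so the shift of rows is an admissible
  selection.\<close>

lemma row_shift_strict_mono:
  "strict_mono (\<lambda>n. prod_encode (Suc (fst (prod_decode n)), snd (prod_decode n)))"
proof -
  have step: "prod_encode (k, Suc i) + 1 = prod_encode (Suc k, i)" "prod_encode (k, 0) + 1 = prod_encode (0, Suc k)" for k i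
    by (simp_all add: prod_encode_def)
  have "prod_encode (Suc (fst (prod_decode n)), snd (prod_decode n))
      < prod_encode (Suc (fst (prod_decode (Suc n))), snd (prod_decode (Suc n)))" for n
  proof -
    obtain k i where ki: "prod_decode n = (k, i)" by fastforce
    then have n: "n = prod_encode (k, i)" using prod_decode_inverse[of n] by simp
    show ?thesis
    proof (cases i)
      case 0
      have "Suc n = prod_encode (0, Suc k)" using step(2)[of k] n 0 by simp
      then have "prod_decode (Suc n) = (0, Suc k)" by simp
      moreover have "prod_encode (Suc k, 0) < prod_encode (1, Suc k)"
        using step(2)[of "Suc k"] step(1)[of 0 "Suc k"] by simp
      ultimately show ?thesis using ki 0 by simp
    next
      case (Suc j)
      have "Suc n = prod_encode (Suc k, j)" using step(1)[of k j] n Suc by simp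
      then have "prod_decode (Suc n) = (Suc k, j)" by simp
      moreover have "prod_encode (Suc k, Suc j) < prod_encode (Suc (Suc k), j)" using step(1)[of "Suc k" j] by simp
      ultimately show ?thesis using ki Suc by simp
    qed
  qed
  then show ?thesis by (simp add: strict_mono_Suc_iff)
qed

context coord_space
begin

text \<open>Pelczynski's decomposition method with explicit maps. Let F be the range of
  \<open>T\<close>. The map \<open>\<alpha>\<close> embeds E into F with left inverse
  \<open>\<rho>\<close>, so F is the direct sum of a copy of E and the kernel W of
  \<open>\<rho>\<close> in F. By means of rows, E is isomorphic to F + E and to E + E. Hence E, F +
  E, E + W + E, E + W and F are isomorphic in turn.\<close>

lemma complemented_isomorphic:
  fixes A B T :: "'e \<Rightarrow>\<^sub>L 'e"
  assumes rows: row_bounded and G: "\<And>\<gamma>. strict_mono \<gamma> \<Longrightarrow> \<gamma> \<in> G"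
    and T: "T o\<^sub>L T = T" and fact: "id_blinfun = A o\<^sub>L T o\<^sub>L B"
  shows "isomorphic_to_subspace TYPE('e) {x. blinfun_apply T x = x}"
proof -
  have "strict_mono (\<lambda>i. prod_encode (k, i))" for k by (simp add: strict_mono_def prod_encode_less)
  then have "\<exists>R. (\<forall>v i. Phi (blinfun_apply R v) i = Phi v (prod_encode (k, i))) \<and> norm R \<le> 1" for k
    using spread_exists[OF G] by metis
  then obtain R where R: "\<And>k v i. Phi (blinfun_apply (R k) v) i = Phi v (prod_encode (k, i))" "\<And>k. norm (R k) \<le> 1" by metis
  have row_eqI: "v = w" if "\<And>k. blinfun_apply (R k) v = blinfun_apply (R k) w" for v w
  proof (rule Phi_eqI)
    fix n
    have "Phi (blinfun_apply (R (fst (prod_decode n))) v) (snd (prod_decode n))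
        = Phi (blinfun_apply (R (fst (prod_decode n))) w) (snd (prod_decode n))" using that by simp
    then show "Phi v n = Phi w n" by (simp add: R)
  qed
  obtain U0 where U0: "is_spread (\<lambda>i. prod_encode (0, i)) U0"
  proof -
    have "strict_mono (\<lambda>i. prod_encode (0, i))" by (simp add: strict_mono_def prod_encode_less)
    from spread_exists[OF G[OF this]] that show ?thesis by metis
  qed
  \<comment> \<open>The shift of rows: \<open>U\<close> moves all rows one step down and leaves row
    0 empty, \<open>V\<close> undoes this, and \<open>U0\<close> writes a vector into row 0.\<close>
  define \<sigma> where "\<sigma> n = prod_encode (Suc (fst (prod_decode n)), snd (prod_decode n))" for n
  have "strict_mono \<sigma>" unfolding \<sigma>_def by (rule row_shift_strict_mono)
  then obtain U V where U: "is_spread \<sigma> U" and V: "\<And>v n. Phi (blinfun_apply V v) n = Phi v (\<sigma> n)"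
    using spread_exists[OF G] by metis
  have RU0: "blinfun_apply (R 0) (blinfun_apply U0 v) = v" "blinfun_apply (R (Suc k)) (blinfun_apply U0 v) = 0" for v k
  proof -
    show "blinfun_apply (R 0) (blinfun_apply U0 v) = v" by (rule Phi_eqI) (use U0 in \<open>simp add: R is_spread_def\<close>)
    show "blinfun_apply (R (Suc k)) (blinfun_apply U0 v) = 0"
    proof (rule Phi_eqI)
      fix i
      have "prod_encode (Suc k, i) \<notin> range (\<lambda>i. prod_encode (0, i))" by auto
      then show "Phi (blinfun_apply (R (Suc k)) (blinfun_apply U0 v)) i = Phi 0 i"
        using U0 Phi_scale[of 0 0 i] by (simp add: R is_spread_def)
    qed
  qed
  have RU: "blinfun_apply (R 0) (blinfun_apply U v) = 0" "blinfun_apply (R (Suc k)) (blinfun_apply U v) = blinfun_apply (R k) v" for v k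
  proof -
    show "blinfun_apply (R 0) (blinfun_apply U v) = 0"
    proof (rule Phi_eqI)
      fix i
      have "prod_encode (0, i) \<notin> range \<sigma>" by (auto simp: \<sigma>_def)
      then show "Phi (blinfun_apply (R 0) (blinfun_apply U v)) i = Phi 0 i"
        using U Phi_scale[of 0 0 i] by (simp add: R is_spread_def)
    qed
    show "blinfun_apply (R (Suc k)) (blinfun_apply U v) = blinfun_apply (R k) v"
    proof (rule Phi_eqI)
      fix i
      have "prod_encode (Suc k, i) = \<sigma> (prod_encode (k, i))" by (simp add: \<sigma>_def)
      then show "Phi (blinfun_apply (R (Suc k)) (blinfun_apply U v)) i = Phi (blinfun_apply (R k) v) i"
        using U by (simp add: R is_spread_def)
    qed
  qed
  have RV: "blinfun_apply (R k) (blinfun_apply V v) = blinfun_apply (R (Suc k)) v" for v k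
    by (rule Phi_eqI) (simp add: R V \<sigma>_def)
  have VU0: "blinfun_apply V (blinfun_apply U0 v) = 0" and VU: "blinfun_apply V (blinfun_apply U v) = v" for v
    by (rule row_eqI, simp add: RV RU0 RU)+
  have U0R: "blinfun_apply U0 (blinfun_apply (R 0) v) + blinfun_apply U (blinfun_apply V v) = v" for v
  proof (rule row_eqI)
    fix k show "blinfun_apply (R k) (blinfun_apply U0 (blinfun_apply (R 0) v) + blinfun_apply U (blinfun_apply V v)) = blinfun_apply (R k) v"
      by (cases k) (simp_all add: blinfun.add_right RU0 RU RV)
  qed
  \<comment> \<open>Application of \<open>S\<close> to every row; \<open>row_bounded\<close> ensures
    that the result is again a vector of the space.\<close>
  have "\<exists>S'. \<forall>k v. blinfun_apply (R k) (blinfun_apply S' v) = blinfun_apply S (blinfun_apply (R k) v)" for S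
  proof -
    obtain S' :: "'e \<Rightarrow>\<^sub>L 'e" where S': "\<And>v. Phi (blinfun_apply S' v)
        = (\<lambda>n. Phi (blinfun_apply S (blinfun_apply (R (fst (prod_decode n))) v)) (snd (prod_decode n)))"
    proof (rule operator_exists[of "\<lambda>v n. Phi (blinfun_apply S (blinfun_apply (R (fst (prod_decode n))) v)) (snd (prod_decode n))" "norm S"])
      fix v
      let ?b = "\<lambda>n. norm (Phi (blinfun_apply S (blinfun_apply (R (fst (prod_decode n))) v)) (snd (prod_decode n)))"
      have "P (\<lambda>i. ?b (prod_encode (k, i))) \<and> rho (\<lambda>i. ?b (prod_encode (k, i))) \<le> norm S * rho (\<lambda>i. norm (Phi v (prod_encode (k, i))))" for k
        using Phi_P[of "blinfun_apply S (blinfun_apply (R k) v)"] norm_blinfun[of S "blinfun_apply (R k) v"]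
        by (simp add: Phi_norm[of "blinfun_apply S (blinfun_apply (R k) v)"] Phi_norm[of "blinfun_apply (R k) v"] R)
      then show "P ?b \<and> rho ?b \<le> norm S * norm v"
        using rows[unfolded row_bounded_def, rule_format, of "\<lambda>n. norm (Phi v n)" ?b "norm S"] Phi_P[of v]
        unfolding Phi_norm[of v] by simp
    next
      fix L :: "'e \<Rightarrow>\<^sub>L 'e"
      assume "\<And>v. Phi (blinfun_apply L v)
        = (\<lambda>n. Phi (blinfun_apply S (blinfun_apply (R (fst (prod_decode n))) v)) (snd (prod_decode n)))"
      then show thesis by (rule that)
    qed (simp_all add: blinfun.add_right blinfun.scaleR_right Phi_add Phi_scale)
    show ?thesis by (rule exI[of _ S'], intro allI Phi_eqI) (simp add: R S')
  qed
  then obtain amp where amp: "\<And>S k v. blinfun_apply (R k) (blinfun_apply (amp S) v) = blinfun_apply S (blinfun_apply (R k) v)"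
    by metis
  define Q where "Q = id_blinfun - T"
  have TT: "blinfun_apply T (blinfun_apply T x) = blinfun_apply T x" for x
    using T by (metis blinfun_apply_blinfun_compose)
  have Qx: "blinfun_apply Q x = x - blinfun_apply T x" for x by (simp add: Q_def blinfun.diff_left)
  define \<alpha> where "\<alpha> = T o\<^sub>L B"
  define \<rho> where "\<rho> = A"
  have T\<alpha>: "blinfun_apply T (blinfun_apply \<alpha> x) = blinfun_apply \<alpha> x" for x by (simp add: \<alpha>_def TT)
  have \<rho>\<alpha>: "blinfun_apply \<rho> (blinfun_apply \<alpha> x) = x" for x
    using arg_cong[OF fact, of "\<lambda>L. blinfun_apply L x"] by (simp add: \<alpha>_def \<rho>_def)
  \<comment> \<open>The component in E of the splitting of E into F + E: every row keeps its part in
    the kernel of \<open>T\<close> and receives the F-part of the next row. The component in F is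
    \<open>T\<close> of row 0.\<close>
  define X where "X = (amp T o\<^sub>L V) + amp Q"
  \<comment> \<open>With f the component in F, \<open>\<rho>\<close> of f is split off and leaves a
    rest in W. \<open>U0\<close> and \<open>U\<close> merge the component in E with
    \<open>\<rho>\<close> of f into one vector, which \<open>\<alpha>\<close> maps into F, and the
    rest is added. \<open>\<Theta>\<close> reverses these steps.\<close>
  define \<Omega> where "\<Omega> = (\<alpha> o\<^sub>L ((U0 o\<^sub>L X) + (U o\<^sub>L \<rho> o\<^sub>L T o\<^sub>L R 0))) + (T o\<^sub>L R 0) - (\<alpha> o\<^sub>L \<rho> o\<^sub>L T o\<^sub>L R 0)"
  define \<Theta> where "\<Theta> = (U0 o\<^sub>L ((\<alpha> o\<^sub>L V o\<^sub>L \<rho>) + id_blinfun - (\<alpha> o\<^sub>L \<rho>))) + (((U o\<^sub>L amp T) + amp Q) o\<^sub>L R 0 o\<^sub>L \<rho>)"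
  have RX: "blinfun_apply (R k) (blinfun_apply X v) = blinfun_apply T (blinfun_apply (R (Suc k)) v) + blinfun_apply Q (blinfun_apply (R k) v)" for k v
    by (simp add: X_def blinfun.add_left blinfun.add_right amp RV)
  have T\<Omega>: "blinfun_apply T (blinfun_apply \<Omega> z) = blinfun_apply \<Omega> z" for z
    by (simp add: \<Omega>_def blinfun.add_left blinfun.add_right blinfun.diff_left blinfun.diff_right TT T\<alpha>)
  have 1: "blinfun_apply \<Theta> (blinfun_apply \<Omega> z) = z" for z
  proof -
    define f where "f = blinfun_apply T (blinfun_apply (R 0) z)"
    define x where "x = blinfun_apply X z"
    have y: "blinfun_apply \<Omega> z = blinfun_apply \<alpha> (blinfun_apply U0 x + blinfun_apply U (blinfun_apply \<rho> f)) + f - blinfun_apply \<alpha> (blinfun_apply \<rho> f)"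
      by (simp add: \<Omega>_def f_def x_def blinfun.add_left blinfun.diff_left)
    have ry: "blinfun_apply \<rho> (blinfun_apply \<Omega> z) = blinfun_apply U0 x + blinfun_apply U (blinfun_apply \<rho> f)"
      unfolding y by (simp only: blinfun.add_right blinfun.diff_right \<rho>\<alpha>) simp
    have "blinfun_apply \<Theta> (blinfun_apply \<Omega> z) = blinfun_apply U0 (blinfun_apply \<alpha> (blinfun_apply V (blinfun_apply \<rho> (blinfun_apply \<Omega> z))) + blinfun_apply \<Omega> z
          - blinfun_apply \<alpha> (blinfun_apply \<rho> (blinfun_apply \<Omega> z)))
        + (blinfun_apply U (blinfun_apply (amp T) (blinfun_apply (R 0) (blinfun_apply \<rho> (blinfun_apply \<Omega> z))))
          + blinfun_apply (amp Q) (blinfun_apply (R 0) (blinfun_apply \<rho> (blinfun_apply \<Omega> z))))"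
      by (simp add: \<Theta>_def blinfun.add_left blinfun.diff_left)
    also have "\<dots> = blinfun_apply U0 f + (blinfun_apply U (blinfun_apply (amp T) x) + blinfun_apply (amp Q) x)"
      unfolding ry by (simp add: y blinfun.add_right VU0 VU RU0 RU)
    also have "\<dots> = z"
    proof (rule row_eqI)
      fix k
      show "blinfun_apply (R k) (blinfun_apply U0 f + (blinfun_apply U (blinfun_apply (amp T) x) + blinfun_apply (amp Q) x)) = blinfun_apply (R k) z"
        by (cases k) (simp_all add: blinfun.add_right blinfun.diff_right RU0 RU amp x_def f_def RX TT Qx)
    qed
    finally show ?thesis .
  qed
  have 2: "blinfun_apply \<Omega> (blinfun_apply \<Theta> y) = y" if y: "blinfun_apply T y = y" for y
  proof -
    define y' where "y' = blinfun_apply \<alpha> (blinfun_apply V (blinfun_apply \<rho> y)) + y - blinfun_apply \<alpha> (blinfun_apply \<rho> y)"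
    define e' where "e' = blinfun_apply (R 0) (blinfun_apply \<rho> y)"
    define z where "z = blinfun_apply \<Theta> y"
    have z: "z = blinfun_apply U0 y' + (blinfun_apply U (blinfun_apply (amp T) e') + blinfun_apply (amp Q) e')"
      by (simp add: z_def \<Theta>_def y'_def e'_def blinfun.add_left blinfun.diff_left)
    have Ty': "blinfun_apply T y' = y'" by (simp add: y'_def blinfun.add_right blinfun.diff_right T\<alpha> y)
    have ry': "blinfun_apply \<rho> y' = blinfun_apply V (blinfun_apply \<rho> y)"
      unfolding y'_def by (simp only: blinfun.add_right blinfun.diff_right \<rho>\<alpha>) simp
    have R0: "blinfun_apply (R 0) z = y' + blinfun_apply Q (blinfun_apply (R 0) e')"
      by (simp add: z blinfun.add_right RU0 RU amp)
    have RS: "blinfun_apply (R (Suc k)) z = blinfun_apply T (blinfun_apply (R k) e') + blinfun_apply Q (blinfun_apply (R (Suc k)) e')" for k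
      by (simp add: z blinfun.add_right RU0 RU amp)
    have f: "blinfun_apply T (blinfun_apply (R 0) z) = y'"
      unfolding R0 by (simp add: blinfun.add_right blinfun.diff_right Ty' Qx TT)
    have x: "blinfun_apply X z = e'"
    proof (rule row_eqI)
      fix k show "blinfun_apply (R k) (blinfun_apply X z) = blinfun_apply (R k) e'"
        by (cases k) (simp_all add: RX RS R0 blinfun.add_right blinfun.diff_right Qx TT Ty')
    qed
    have "blinfun_apply \<Omega> z = blinfun_apply \<alpha> (blinfun_apply U0 e' + blinfun_apply U (blinfun_apply V (blinfun_apply \<rho> y))) + y'
        - blinfun_apply \<alpha> (blinfun_apply V (blinfun_apply \<rho> y))"
      by (simp add: \<Omega>_def blinfun.add_left blinfun.diff_left f x ry')
    also have "\<dots> = y" unfolding e'_def U0R y'_def by simp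
    finally show ?thesis unfolding z_def .
  qed
  show ?thesis
    unfolding isomorphic_to_subspace_def
  proof (intro exI conjI)
    show "linear (blinfun_apply \<Omega>)" by (rule bounded_linear.linear[OF blinfun.bounded_linear_right])
    show "homeomorphism UNIV {x. blinfun_apply T x = x} (blinfun_apply \<Omega>) (blinfun_apply \<Theta>)"
    proof (rule homeomorphismI)
      show "continuous_on UNIV (blinfun_apply \<Omega>)" "continuous_on {x. blinfun_apply T x = x} (blinfun_apply \<Theta>)"
        by (intro continuous_intros)+
    qed (use 1 2 T\<Omega> in auto)
  qed
qed

lemma primary_space:
  assumes rows: row_bounded and G: "\<And>\<gamma>. strict_mono \<gamma> \<Longrightarrow> \<gamma> \<in> G"
    and pf: "primary_factorization_property C TYPE('e)"
  shows "primary TYPE('e)"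
  unfolding primary_def
proof (intro allI impI, elim conjE)
  fix F H :: "'e set"
  assume FH: "subspace F" "closed F" "subspace H" "closed H" "F \<inter> H = {0}" "{u + v | u v. u \<in> F \<and> v \<in> H} = UNIV"
  obtain T where T: "\<And>x. blinfun_apply T x \<in> F" "\<And>x. x - blinfun_apply T x \<in> H"
    "\<And>x. x \<in> F \<Longrightarrow> blinfun_apply T x = x" "\<And>x. x \<in> H \<Longrightarrow> blinfun_apply T x = 0"
    using closed_complement_projection[OF FH] by metis
  have F: "F = {x. blinfun_apply T x = x}" using T(1,3) by (metis (mono_tags, lifting) Collect_cong Collect_mem_eq)
  have H: "H = {x. blinfun_apply (id_blinfun - T) x = x}"
  proof -
    have "x \<in> H \<longleftrightarrow> blinfun_apply T x = 0" for x using T(2)[of x] T(4)[of x] by auto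
    then show ?thesis by (auto simp: blinfun.diff_left)
  qed
  have TT: "T o\<^sub>L T = T" by (rule blinfun_eqI) (simp add: T(1,3))
  have QQ: "(id_blinfun - T) o\<^sub>L (id_blinfun - T) = id_blinfun - T"
    by (rule blinfun_eqI) (simp add: blinfun.diff_left blinfun.diff_right T(1,3))
  have fac: "\<exists>A B :: 'e \<Rightarrow>\<^sub>L 'e. id_blinfun = A o\<^sub>L S o\<^sub>L B" if "factors_through_plus id_blinfun S C" for S :: "'e \<Rightarrow>\<^sub>L 'e"
    using that unfolding factors_through_plus_def factors_through_def by (meson zero_less_one)
  from pf have "factors_through_plus id_blinfun T C \<or> factors_through_plus id_blinfun (id_blinfun - T) C"
    unfolding primary_factorization_property_def by blast
  then show "isomorphic_to_subspace TYPE('e) F \<or> isomorphic_to_subspace TYPE('e) H"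
  proof
    assume "factors_through_plus id_blinfun T C"
    then show ?thesis using fac complemented_isomorphic[OF rows G TT] F by metis
  next
    assume "factors_through_plus id_blinfun (id_blinfun - T) C"
    then show ?thesis using fac complemented_isomorphic[OF rows G QQ] H by metis
  qed
qed

end

text \<open>For p-th powers the claim is that a double series of nonnegative terms may be summed by
  rows. Both inequalities are read off finite rectangles of pairs; an initial segment of codes lies
  in a square.\<close>

lemma row_bounded_lp:
  fixes \<Phi> :: "'e::banach \<Rightarrow> nat \<Rightarrow> 'y::banach"
  assumes p: "1 \<le> p"
    and cs: "coord_space \<Phi> (\<lambda>a. summable (\<lambda>n. a n powr p)) (\<lambda>a. (\<Sum>n. a n powr p) powr (1 / p)) UNIV {\<gamma>. strict_mono \<gamma>}"
  shows "coord_space.row_bounded (\<lambda>a. summable (\<lambda>n. a n powr p)) (\<lambda>a. (\<Sum>n. a n powr p) powr (1 / p))"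
  unfolding coord_space.row_bounded_def[OF cs]
proof (intro allI impI)
  fix a b :: "nat \<Rightarrow> real" and C :: real
  assume sa: "summable (\<lambda>n. a n powr p)" and a0: "\<forall>n. 0 \<le> a n" and b0: "\<forall>n. 0 \<le> b n" and C: "0 \<le> C"
    and rows: "\<forall>k. summable (\<lambda>i. b (prod_encode (k, i)) powr p)
      \<and> (\<Sum>i. b (prod_encode (k, i)) powr p) powr (1 / p) \<le> C * (\<Sum>i. a (prod_encode (k, i)) powr p) powr (1 / p)"
  define A where "A k = (\<Sum>i. a (prod_encode (k, i)) powr p)" for k
  define S where "S = (\<Sum>n. a n powr p)"
  have rs: "summable (\<lambda>i. a (prod_encode (k, i)) powr p)" for k
    by (rule powr_summable_select(1)[OF _ sa]) (simp add: strict_mono_def prod_encode_less)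
  have A0: "0 \<le> A k" for k unfolding A_def by (rule suminf_nonneg[OF rs]) simp
  have S0: "0 \<le> S" unfolding S_def by (rule suminf_nonneg[OF sa]) simp
  have row: "(\<Sum>i. b (prod_encode (k, i)) powr p) \<le> C powr p * A k" for k
  proof -
    let ?B = "\<Sum>i. b (prod_encode (k, i)) powr p"
    have B0: "0 \<le> ?B" by (rule suminf_nonneg) (use rows in auto)
    have "(?B powr (1 / p)) powr p \<le> (C * A k powr (1 / p)) powr p"
      using rows p unfolding A_def by (intro powr_mono2) auto
    moreover have "(?B powr (1 / p)) powr p = ?B" using B0 p by (simp add: powr_powr)
    moreover have "(C * A k powr (1 / p)) powr p = C powr p * A k" using C A0[of k] p by (simp add: powr_mult powr_powr)
    ultimately show ?thesis by simp
  qed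
  have sumA: "(\<Sum>k<m. A k) \<le> S" for m
  proof -
    have "(\<lambda>M. \<Sum>k<m. \<Sum>i<M. a (prod_encode (k, i)) powr p) \<longlonglongrightarrow> (\<Sum>k<m. A k)"
      unfolding A_def by (intro tendsto_sum summable_LIMSEQ rs)
    moreover have "(\<Sum>k<m. \<Sum>i<M. a (prod_encode (k, i)) powr p) \<le> S" for M
    proof -
      have "(\<Sum>k<m. \<Sum>i<M. a (prod_encode (k, i)) powr p) = (\<Sum>x\<in>{..<m} \<times> {..<M}. a (prod_encode x) powr p)"
        by (simp add: sum.cartesian_product)
      also have "\<dots> = (\<Sum>n\<in>prod_encode ` ({..<m} \<times> {..<M}). a n powr p)"
        by (rule sum.reindex[OF inj_prod_encode, unfolded comp_def, symmetric])
      also have "\<dots> \<le> S" unfolding S_def by (rule sum_le_suminf[OF sa]) auto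
      finally show ?thesis .
    qed
    ultimately show ?thesis by (intro LIMSEQ_le_const2) auto
  qed
  have part: "(\<Sum>n<m. b n powr p) \<le> C powr p * S" for m
  proof -
    have "{..<m} \<subseteq> prod_encode ` ({..<m} \<times> {..<m})"
    proof
      fix n assume n: "n \<in> {..<m}"
      obtain k i where ki: "prod_decode n = (k, i)" by fastforce
      then have "n = prod_encode (k, i)" using prod_decode_inverse[of n] by simp
      then show "n \<in> prod_encode ` ({..<m} \<times> {..<m})" using prod_encode_ge[of k i] n by auto
    qed
    then have "(\<Sum>n<m. b n powr p) \<le> (\<Sum>n\<in>prod_encode ` ({..<m} \<times> {..<m}). b n powr p)"
      by (intro sum_mono2) auto
    also have "\<dots> = (\<Sum>x\<in>{..<m} \<times> {..<m}. b (prod_encode x) powr p)"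
      by (rule sum.reindex[OF inj_prod_encode, unfolded comp_def])
    also have "\<dots> = (\<Sum>k<m. \<Sum>i<m. b (prod_encode (k, i)) powr p)" by (simp add: sum.cartesian_product)
    also have "\<dots> \<le> (\<Sum>k<m. C powr p * A k)"
    proof (rule sum_mono)
      fix k
      have "(\<Sum>i<m. b (prod_encode (k, i)) powr p) \<le> (\<Sum>i. b (prod_encode (k, i)) powr p)"
        by (rule sum_le_suminf) (use rows in auto)
      then show "(\<Sum>i<m. b (prod_encode (k, i)) powr p) \<le> C powr p * A k" using row[of k] by linarith
    qed
    also have "\<dots> = C powr p * (\<Sum>k<m. A k)" by (simp add: sum_distrib_left)
    also have "\<dots> \<le> C powr p * S" by (intro mult_left_mono sumA) auto
    finally show ?thesis .
  qed
  have sb: "summable (\<lambda>n. b n powr p)" by (rule summableI_nonneg_bounded[OF _ part]) simp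
  have "(\<Sum>n. b n powr p) \<le> C powr p * S" by (rule suminf_le_const[OF sb part])
  then have "(\<Sum>n. b n powr p) powr (1 / p) \<le> (C powr p * S) powr (1 / p)"
    using p by (intro powr_mono2) (auto intro: suminf_nonneg[OF sb])
  also have "\<dots> = C * S powr (1 / p)" using C S0 p by (simp add: powr_mult powr_powr)
  finally show "summable (\<lambda>n. b n powr p) \<and> (\<Sum>n. b n powr p) powr (1 / p) \<le> C * (\<Sum>n. a n powr p) powr (1 / p)"
    using sb by (simp add: S_def)
qed

lemma row_bounded_linf:
  fixes \<Phi> :: "'e::banach \<Rightarrow> nat \<Rightarrow> 'y::banach"
  assumes cs: "coord_space \<Phi> (\<lambda>a. bdd_above (range (\<lambda>n. \<bar>a n\<bar>))) (\<lambda>a. SUP n. a n) UNIV {\<gamma>. strict_mono \<gamma>}"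
  shows "coord_space.row_bounded (\<lambda>a. bdd_above (range (\<lambda>n. \<bar>a n\<bar>))) (\<lambda>a. SUP n :: nat. a n)"
  unfolding coord_space.row_bounded_def[OF cs]
proof (intro allI impI)
  fix a b :: "nat \<Rightarrow> real" and C :: real
  assume a: "bdd_above (range (\<lambda>n. \<bar>a n\<bar>))" and a0: "\<forall>n. 0 \<le> a n" and b0: "\<forall>n. 0 \<le> b n" and C: "0 \<le> C"
    and rows: "\<forall>k. bdd_above (range (\<lambda>i. \<bar>b (prod_encode (k, i))\<bar>))
      \<and> (SUP i. b (prod_encode (k, i))) \<le> C * (SUP i. a (prod_encode (k, i)))"
  have bd: "bdd_above (range a)" using a a0 by simp
  have le: "b n \<le> C * (SUP n. a n)" for n
  proof -
    obtain k i where ki: "prod_decode n = (k, i)" by fastforce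
    then have n: "n = prod_encode (k, i)" using prod_decode_inverse[of n] by simp
    have "bdd_above (range (\<lambda>i. b (prod_encode (k, i))))" using rows b0 by simp
    then have "b n \<le> (SUP i. b (prod_encode (k, i)))" unfolding n by (rule cSUP_upper[rotated]) simp
    also have "\<dots> \<le> C * (SUP i. a (prod_encode (k, i)))" using rows by blast
    also have "(SUP i. a (prod_encode (k, i))) \<le> (SUP n. a n)"
      by (rule cSUP_least) (auto intro: cSUP_upper[OF _ bd])
    finally show ?thesis using C by (simp add: mult_left_mono)
  qed
  show "bdd_above (range (\<lambda>n. \<bar>b n\<bar>)) \<and> (SUP n. b n) \<le> C * (SUP n. a n)"
    using le b0 by (auto intro!: bdd_aboveI[of _ "C * (SUP n. a n)"] cSUP_least)
qed

section \<open>Assembly of the three cases\<close>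

context hardy_sequence_space
begin

lemma id_blinfun_nonzero:
  assumes "i \<in> Idx"
  shows "(id_blinfun :: 'e \<Rightarrow>\<^sub>L 'e) \<noteq> 0"
proof
  assume "(id_blinfun :: 'e \<Rightarrow>\<^sub>L 'e) = 0"
  from arg_cong[OF this, of "\<lambda>L. Phi (blinfun_apply L (blinfun_apply (eb i) (h 1))) i"]
  have "Phi (blinfun_apply (eb i) (h 1)) i = 0" using Phi_scale[of 0 0 i] by simp
  then have "h 1 = 0" using assms by (simp add: Phi_eb)
  then show False using norm_h_pos[of 1] by simp
qed

lemma primary_factorization_unique_maximal:
  assumes determined "i \<in> Idx"
  shows "primary_factorization_property 4 TYPE('e)
    \<and> maximalideal (M_set TYPE('e)) (operator_ring TYPE('e))
    \<and> (\<forall>M. maximalideal M (operator_ring TYPE('e)) \<longrightarrow> M = M_set TYPE('e))"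
  using primary_factorization[OF assms(1)] M_set_unique_maximal[OF primary_factorization[OF assms(1)] id_blinfun_nonzero[OF assms(2)]]
  by (intro conjI) blast+

end

lemma space_primary_factorization:
  fixes h :: "nat \<Rightarrow> 'y::banach"
  assumes hs: "haar_space_wn Nn ind h" and sp: "is_space TYPE('e::banach) TYPE('y)"
  shows "primary_factorization_property 4 TYPE('e)
    \<and> maximalideal (M_set TYPE('e)) (operator_ring TYPE('e))
    \<and> (\<forall>M. maximalideal M (operator_ring TYPE('e)) \<longrightarrow> M = M_set TYPE('e))"
proof -
  obtain \<Phi> :: "'e \<Rightarrow> 'y" where \<Phi>: "linear \<Phi>" "\<And>v. norm (\<Phi> v) = norm v" "range \<Phi> = UNIV"
    using sp unfolding is_space_def by blast
  note cs = coord_space_single[OF \<Phi>]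
  interpret hardy_sequence_space Nn ind h "\<lambda>v n. if n = 0 then \<Phi> v else 0" "\<lambda>a. \<forall>n>0. a n = 0" "\<lambda>a. a 0" "{0}" "{id}"
    by (rule hardy_sequence_space.intro[OF hs cs])
  have determined
  proof (rule determined_by_tails)
    fix a :: "nat \<Rightarrow> real"
    have "eventually (\<lambda>p::nat. (if 0 < p then 0 else a 0) = 0) sequentially"
      using eventually_gt_at_top[of 0] by eventually_elim simp
    then show "(\<lambda>p::nat. if 0 < p then 0 else a 0) \<longlonglongrightarrow> 0" by (rule tendsto_eventually)
  qed simp
  then show ?thesis by (rule primary_factorization_unique_maximal[where i = 0]) simp
qed

lemma lp_space_primary_factorization:
  fixes h :: "nat \<Rightarrow> 'y::banach"
  assumes hs: "haar_space_wn Nn ind h" and p: "1 \<le> p" and sp: "is_lp_space p TYPE('e::banach) TYPE('y)"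
  shows "primary_factorization_property 4 TYPE('e)
    \<and> maximalideal (M_set TYPE('e)) (operator_ring TYPE('e))
    \<and> (\<forall>M. maximalideal M (operator_ring TYPE('e)) \<longrightarrow> M = M_set TYPE('e))"
    and "primary TYPE('e)"
proof -
  obtain \<Phi> :: "'e \<Rightarrow> nat \<Rightarrow> 'y" where \<Phi>: "\<And>n. linear (\<lambda>v. \<Phi> v n)" "range \<Phi> = {y. summable (\<lambda>n. norm (y n) powr p)}"
    "\<And>v. norm v = (\<Sum>n. norm (\<Phi> v n) powr p) powr (1 / p)"
    using sp unfolding is_lp_space_def by blast
  note cs = coord_space_lp[OF p \<Phi>]
  interpret hardy_sequence_space Nn ind h \<Phi> "\<lambda>a. summable (\<lambda>n. a n powr p)" "\<lambda>a. (\<Sum>n. a n powr p) powr (1 / p)"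
    UNIV "{\<gamma>. strict_mono \<gamma>}"
    by (rule hardy_sequence_space.intro[OF hs cs])
  have det: determined
    by (rule determined_by_tails) (use powr_tails[OF p] in \<open>auto simp: strict_mono_def\<close>)
  then show 1: "primary_factorization_property 4 TYPE('e)
    \<and> maximalideal (M_set TYPE('e)) (operator_ring TYPE('e))
    \<and> (\<forall>M. maximalideal M (operator_ring TYPE('e)) \<longrightarrow> M = M_set TYPE('e))"
    by (rule primary_factorization_unique_maximal[where i = 0]) simp
  show "primary TYPE('e)"
    by (rule primary_space[OF row_bounded_lp[OF p cs] _ primary_factorization[OF det]]) simp
qed

lemma linf_space_primary_factorization:
  fixes h :: "nat \<Rightarrow> 'y::banach"
  assumes hs: "haar_space_wn Nn ind h" and sp: "is_linf_space TYPE('e::banach) TYPE('y)"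
  shows "primary_factorization_property 4 TYPE('e)
    \<and> maximalideal (M_set TYPE('e)) (operator_ring TYPE('e))
    \<and> (\<forall>M. maximalideal M (operator_ring TYPE('e)) \<longrightarrow> M = M_set TYPE('e))"
    and "primary TYPE('e)"
proof -
  obtain \<Phi> :: "'e \<Rightarrow> nat \<Rightarrow> 'y" where \<Phi>: "\<And>n. linear (\<lambda>v. \<Phi> v n)" "range \<Phi> = {y. bounded (range y)}"
    "\<And>v. norm v = (SUP n. norm (\<Phi> v n))"
    using sp unfolding is_linf_space_def by blast
  note cs = coord_space_linf[OF \<Phi>]
  interpret hardy_sequence_space Nn ind h \<Phi> "\<lambda>a. bdd_above (range (\<lambda>n. \<bar>a n\<bar>))" "\<lambda>a. SUP n. a n"
    UNIV "{\<gamma>. strict_mono \<gamma>}"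
    by (rule hardy_sequence_space.intro[OF hs cs])
  have det: determined
  proof (rule determined_by_disjointness)
    fix v w :: 'e assume disj: "\<And>n. \<Phi> v n = 0 \<or> \<Phi> w n = 0"
    have le: "norm (\<Phi> x n) \<le> norm x" for x n using rho_coord[OF Phi_P[of x], of n] Phi_norm[of x] by simp
    have "norm (\<Phi> (v + w) n) \<le> max (norm v) (norm w)" for n
      using disj[of n] le[of v n] le[of w n] by (auto simp: Phi_add)
    then show "norm (v + w) \<le> max (norm v) (norm w)"
      unfolding \<Phi>(3)[of "v + w"] by (intro cSUP_least) auto
  qed simp
  then show "primary_factorization_property 4 TYPE('e)
    \<and> maximalideal (M_set TYPE('e)) (operator_ring TYPE('e))
    \<and> (\<forall>M. maximalideal M (operator_ring TYPE('e)) \<longrightarrow> M = M_set TYPE('e))"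
    by (rule primary_factorization_unique_maximal[where i = 0]) simp
  show "primary TYPE('e)"
    by (rule primary_space[OF row_bounded_linf[OF cs] _ primary_factorization[OF det]]) simp
qed

theorem theorem3p1:
  fixes N :: "(real \<Rightarrow> real) \<Rightarrow> real"
    and r :: "real set \<Rightarrow> real \<Rightarrow> real"
    and J :: "(real \<Rightarrow> real) \<Rightarrow> 'x::banach"
    and inc :: "'y::banach \<Rightarrow> 'x"
  assumes "haar_system_norm N"
    and "r \<in> rademacher_choices"
    and "hardy_completion N r J"
    and "hardy_zero J inc"
    and "weakly_null (\<lambda>n. in_zero J inc (rademacher n))"
    and "is_space TYPE('e::banach) TYPE('y)
       \<or> (\<exists>p\<ge>1. is_lp_space p TYPE('e) TYPE('y))
       \<or> (is_linf_space TYPE('e) TYPE('y) \<and> asymptotically_curved (haar_basis J inc))"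
  shows "primary_factorization_property 4 TYPE('e)
       \<and> maximalideal (M_set TYPE('e)) (operator_ring TYPE('e))
       \<and> (\<forall>M. maximalideal M (operator_ring TYPE('e)) \<longrightarrow> M = M_set TYPE('e))
       \<and> ((\<exists>p\<ge>1. is_lp_space p TYPE('e) TYPE('y))
           \<or> (is_linf_space TYPE('e) TYPE('y) \<and> asymptotically_curved (haar_basis J inc))
          \<longrightarrow> primary TYPE('e))"
proof -
  obtain ind where hs: "haar_space_wn (\<lambda>m v. N (stp m v)) ind (\<lambda>k. in_zero J inc (haar (iv k)))"
    using haar_hardy_space[OF assms(1-5)] by blast
  show ?thesis
    using assms(6) space_primary_factorization[OF hs, where 'e = 'e]
      lp_space_primary_factorization[OF hs, where 'e = 'e] linf_space_primary_factorization[OF hs, where 'e = 'e]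
    by blast
qed

end
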